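(* Let $X$ and $Y$ be Banach spaces over $\mathbb K\in\{\mathbb R,\mathbb C\}$ such that $X^*$ has the approximation property, and let $N\in\mathbb N$. (1) If $X\widehat\otimes_\varepsilon Y$ does not contain any isomorphic copy of $\ell_1$, then the set of projective norm-attaining elements is norm-dense in $X^*\widehat\otimes_\pi Y^*$. (2) If $\widehat\otimes_{\varepsilon,s,N}X$ does not contain any isomorphic copy of $\ell_1$, then the set of projective norm-attaining elements is norm-dense in $\widehat\otimes_{\pi,s,N}X^*$.
   Context: $X\widehat\otimes_\varepsilon Y$ is the completed injective tensor product, i.e. the completion of $X\otimes Y$ under $\|\sum_i x_i\otimes y_i\|_\varepsilon=\sup\{|\sum_i x^*(x_i)y^*(y_i)|:x^*\in B_{X^*},y^*\in B_{Y^*}\}$. For Banach spaces $E,F$, $E\widehat\otimes_\pi F$ is the completion of $E\otimes F$ under $\|z\|_\pi=\inf\{\sum_{i=1}^n\|x_i\|\|y_i\|:z=\sum_{i=1}^nx_i\otimes y_i\}$. An element $z\in E\widehat\otimes_\pi F$ is (projective) norm-attaining if there are sequences $(x_i)$ in $E$ and $(y_i)$ in $F$ with $z=\sum_{i=1}^\infty x_i\otimes y_i$ and $\|z\|_\pi=\sum_{i=1}^\infty\|x_i\|\|y_i\|$. For a Banach space $E$ write $x^N=x\otimes\cdots\otimes x$ ($N$ times), and let $\otimes_{s,N}E$ be the linear span of $\{x^N:x\in E\}$ in the $N$-fold algebraic tensor product. $\widehat\otimes_{\varepsilon,s,N}E$ is its completion under $\|\sum_j\lambda_jx_j^N\|=\sup_{x^*\in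 B_{E^*}}|\sum_j\lambda_jx^*(x_j)^N|$. $\widehat\otimes_{\pi,s,N}E$ is its completion under $\|z\|=\inf\{\sum_{j=1}^n|\lambda_j|\|x_j\|^N:z=\sum_{j=1}^n\lambda_jx_j^N\}$ (so its dual is isometrically the space of bounded $N$-homogeneous polynomials on $E$). An element $z\in\widehat\otimes_{\pi,s,N}E$ is norm-attaining if there are sequences $(\lambda_j)$ in $\mathbb K$ and $(x_j)$ in $E$ with $z=\sum_{j=1}^\infty\lambda_jx_j^N$ and $\|z\|=\sum_{j=1}^\infty|\lambda_j|\|x_j\|^N$. *)

theory Defs
  imports "HOL-Analysis.Analysis" "HOL-Library.Function_Algebras"
begin

section \<open>Scalars, Banach spaces and dual spaces\<close>

text \<open>The scalar field is a type isometrically isomorphic to the reals or to the complex numbers.\<close>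

class real_or_complex = real_normed_field +
  assumes real_or_complex:
    "(\<exists>\<phi> :: 'a \<Rightarrow> real. bij \<phi> \<and> (\<forall>x y. \<phi> (x + y) = \<phi> x + \<phi> y) \<and> (\<forall>x y. \<phi> (x * y) = \<phi> x * \<phi> y)
        \<and> (\<forall>r x. \<phi> (r *\<^sub>R x) = r *\<^sub>R \<phi> x) \<and> (\<forall>x. norm (\<phi> x) = norm x))
   \<or> (\<exists>\<phi> :: 'a \<Rightarrow> complex. bij \<phi> \<and> (\<forall>x y. \<phi> (x + y) = \<phi> x + \<phi> y) \<and> (\<forall>x y. \<phi> (x * y) = \<phi> x * \<phi> y)
        \<and> (\<forall>r x. \<phi> (r *\<^sub>R x) = r *\<^sub>R \<phi> x) \<and> (\<forall>x. norm (\<phi> x) = norm x))"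

instance real :: real_or_complex
  by standard (rule disjI1, rule exI[of _ id], simp)

instance complex :: real_or_complex
  by standard (rule disjI2, rule exI[of _ id], simp)

text \<open>The class \<open>banach\<close> supplies addition, norm and completeness; \<open>sc\<close> is the multiplication by
  scalars in \<open>'k\<close>, extending the real one.\<close>

locale banach_over = vector_space sc
  for sc :: "'k::real_or_complex \<Rightarrow> 'x::banach \<Rightarrow> 'x" +
  assumes scale_of_real: "sc (of_real r) x = r *\<^sub>R x"
    and norm_scale: "norm (sc c x) = norm c * norm x"

text \<open>The dual space consists of the \<open>'k\<close>-linear members of the (real) Banach space of real-linear
  bounded maps into \<open>'k\<close>, with the operator norm. It is a subset of a type, so the notions below that
  get applied to it take a carrier as well as a scalar multiplication.\<close>

definition dual :: "('k::real_or_complex \<Rightarrow> 'x::banach \<Rightarrow> 'x) \<Rightarrow> ('x \<Rightarrow>\<^sub>L 'k) set" where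
  "dual sc = {f. \<forall>c x. blinfun_apply f (sc c x) = c * blinfun_apply f x}"

definition dual_scale :: "'k::real_or_complex \<Rightarrow> ('x::banach \<Rightarrow>\<^sub>L 'k) \<Rightarrow> ('x \<Rightarrow>\<^sub>L 'k)" where
  "dual_scale c f = Blinfun (\<lambda>x. c * blinfun_apply f x)"

lemma dual_scale_apply [simp]: "blinfun_apply (dual_scale c f) x = c * blinfun_apply f x"
  unfolding dual_scale_def
  by (subst bounded_linear_Blinfun_apply)
     (auto intro: bounded_linear_const_mult blinfun.bounded_linear_right)

lemma vector_space_dual_scale: "vector_space dual_scale"
  by unfold_locales (auto intro!: blinfun_eqI simp: blinfun.add_left algebra_simps)

definition dual_ball :: "('k::real_or_complex \<Rightarrow> 'x::banach \<Rightarrow> 'x) \<Rightarrow> ('x \<Rightarrow>\<^sub>L 'k) set" where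
  "dual_ball sc = {f \<in> dual sc. norm f \<le> 1}"

definition finite_rank_operator ::
    "('k::real_or_complex \<Rightarrow> 'e::real_normed_vector \<Rightarrow> 'e) \<Rightarrow> 'e set \<Rightarrow> ('e \<Rightarrow> 'e) \<Rightarrow> bool" where
  "finite_rank_operator sc E T \<longleftrightarrow>
     (\<forall>x\<in>E. \<forall>y\<in>E. T (x + y) = T x + T y) \<and> (\<forall>c. \<forall>x\<in>E. T (sc c x) = sc c (T x)) \<and>
     (\<exists>C. \<forall>x\<in>E. norm (T x) \<le> C * norm x) \<and>
     T ` E \<subseteq> E \<and> (\<exists>B. finite B \<and> T ` E \<subseteq> module.span sc B)"

definition approximation_property ::
    "('k::real_or_complex \<Rightarrow> 'e::real_normed_vector \<Rightarrow> 'e) \<Rightarrow> 'e set \<Rightarrow> bool" where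
  "approximation_property sc E \<longleftrightarrow>
     (\<forall>K\<subseteq>E. compact K \<longrightarrow>
        (\<forall>\<epsilon>>0. \<exists>T. finite_rank_operator sc E T \<and> (\<forall>x\<in>K. norm (T x - x) \<le> \<epsilon>)))"

section \<open>Completions\<close>

record ('k, 'z) normed_structure =
  carrier :: "'z set"
  add :: "'z \<Rightarrow> 'z \<Rightarrow> 'z"
  smult :: "'k \<Rightarrow> 'z \<Rightarrow> 'z"
  vnorm :: "'z \<Rightarrow> real"

definition vdist :: "('k::real_or_complex, 'z) normed_structure \<Rightarrow> 'z \<Rightarrow> 'z \<Rightarrow> real" where
  "vdist Z z w = vnorm Z (add Z z (smult Z (- 1) w))"

definition Cauchy_seqs :: "'v::ab_group_add set \<Rightarrow> ('v \<Rightarrow> real) \<Rightarrow> (nat \<Rightarrow> 'v) set" where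
  "Cauchy_seqs V p =
     {s. range s \<subseteq> V \<and> (\<forall>\<epsilon>>0. \<exists>M. \<forall>m\<ge>M. \<forall>n\<ge>M. p (s m - s n) < \<epsilon>)}"

definition Cauchy_rel ::
    "'v::ab_group_add set \<Rightarrow> ('v \<Rightarrow> real) \<Rightarrow> ((nat \<Rightarrow> 'v) \<times> (nat \<Rightarrow> 'v)) set" where
  "Cauchy_rel V p =
     {(s, t). s \<in> Cauchy_seqs V p \<and> t \<in> Cauchy_seqs V p \<and> (\<lambda>n. p (s n - t n)) \<longlonglongrightarrow> 0}"

text \<open>The completion of the space \<open>V\<close> under the norm \<open>p\<close>: Cauchy sequences modulo null sequences.\<close>

definition completion ::
    "('k::real_or_complex \<Rightarrow> 'v::ab_group_add \<Rightarrow> 'v) \<Rightarrow> 'v set \<Rightarrow> ('v \<Rightarrow> real)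
      \<Rightarrow> ('k, (nat \<Rightarrow> 'v) set) normed_structure" where
  "completion sc V p =
     \<lparr> carrier = Cauchy_seqs V p // Cauchy_rel V p,
       add = (\<lambda>z w. \<Union>s\<in>z. \<Union>t\<in>w. Cauchy_rel V p `` {\<lambda>n. s n + t n}),
       smult = (\<lambda>c z. \<Union>s\<in>z. Cauchy_rel V p `` {\<lambda>n. sc c (s n)}),
       vnorm = (\<lambda>z. THE r. \<exists>s\<in>z. (\<lambda>n. p (s n)) \<longlonglongrightarrow> r) \<rparr>"

definition completion_embed :: "'v::ab_group_add set \<Rightarrow> ('v \<Rightarrow> real) \<Rightarrow> 'v \<Rightarrow> (nat \<Rightarrow> 'v) set" where
  "completion_embed V p v = Cauchy_rel V p `` {\<lambda>_. v}"

definition norm_dense :: "('k::real_or_complex, 'z) normed_structure \<Rightarrow> 'z set \<Rightarrow> bool" where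
  "norm_dense Z S \<longleftrightarrow> S \<subseteq> carrier Z \<and> (\<forall>z\<in>carrier Z. \<forall>\<epsilon>>0. \<exists>w\<in>S. vdist Z z w < \<epsilon>)"

definition l1 :: "(nat \<Rightarrow> 'k::real_or_complex) set" where
  "l1 = {a. summable (\<lambda>n. norm (a n))}"

definition l1_norm :: "(nat \<Rightarrow> 'k::real_or_complex) \<Rightarrow> real" where
  "l1_norm a = (\<Sum>n. norm (a n))"

definition contains_copy_of_l1 :: "('k::real_or_complex, 'z) normed_structure \<Rightarrow> bool" where
  "contains_copy_of_l1 Z \<longleftrightarrow>
     (\<exists>T :: (nat \<Rightarrow> 'k) \<Rightarrow> 'z.
        T ` l1 \<subseteq> carrier Z \<and>
        (\<forall>a\<in>l1. \<forall>b\<in>l1. T (\<lambda>n. a n + b n) = add Z (T a) (T b)) \<and>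
        (\<forall>c. \<forall>a\<in>l1. T (\<lambda>n. c * a n) = smult Z c (T a)) \<and>
        (\<exists>m>0. \<exists>M. \<forall>a\<in>l1. m * l1_norm a \<le> vnorm Z (T a) \<and> vnorm Z (T a) \<le> M * l1_norm a))"

section \<open>Tensor products of two spaces\<close>

text \<open>The elementary tensor of \<open>x\<close> and \<open>y\<close> is evaluation at \<open>(x, y)\<close> on the space of all (not
  necessarily bounded) bilinear forms on \<open>E \<times> F\<close>, and the algebraic tensor product is the linear span
  of the elementary tensors. Addition of tensors is the pointwise one of
  \<^theory>\<open>HOL-Library.Function_Algebras\<close>.\<close>

definition bilinear_form ::
    "('k::real_or_complex \<Rightarrow> 'e::ab_group_add \<Rightarrow> 'e) \<Rightarrow> 'e set
      \<Rightarrow> ('k \<Rightarrow> 'f::ab_group_add \<Rightarrow> 'f) \<Rightarrow> 'f set \<Rightarrow> ('e \<Rightarrow> 'f \<Rightarrow> 'k) \<Rightarrow> bool" where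
  "bilinear_form sE E sF F A \<longleftrightarrow>
     (\<forall>x\<in>E. \<forall>x'\<in>E. \<forall>y\<in>F. A (x + x') y = A x y + A x' y) \<and>
     (\<forall>c. \<forall>x\<in>E. \<forall>y\<in>F. A (sE c x) y = c * A x y) \<and>
     (\<forall>x\<in>E. \<forall>y\<in>F. \<forall>y'\<in>F. A x (y + y') = A x y + A x y') \<and>
     (\<forall>c. \<forall>x\<in>E. \<forall>y\<in>F. A x (sF c y) = c * A x y)"

definition tens ::
    "('k::real_or_complex \<Rightarrow> 'e::ab_group_add \<Rightarrow> 'e) \<Rightarrow> 'e set
      \<Rightarrow> ('k \<Rightarrow> 'f::ab_group_add \<Rightarrow> 'f) \<Rightarrow> 'f set \<Rightarrow> 'e \<Rightarrow> 'f \<Rightarrow> ('e \<Rightarrow> 'f \<Rightarrow> 'k) \<Rightarrow> 'k" where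
  "tens sE E sF F x y = (\<lambda>A. if bilinear_form sE E sF F A then A x y else 0)"

definition tscale :: "'k::real_or_complex \<Rightarrow> ('a \<Rightarrow> 'k) \<Rightarrow> ('a \<Rightarrow> 'k)" where
  "tscale c u = (\<lambda>A. c * u A)"

lemma vector_space_tscale: "vector_space (tscale :: 'k::real_or_complex \<Rightarrow> ('a \<Rightarrow> 'k) \<Rightarrow> ('a \<Rightarrow> 'k))"
  by unfold_locales (auto simp: tscale_def algebra_simps)

definition tensor_product ::
    "('k::real_or_complex \<Rightarrow> 'e::ab_group_add \<Rightarrow> 'e) \<Rightarrow> 'e set
      \<Rightarrow> ('k \<Rightarrow> 'f::ab_group_add \<Rightarrow> 'f) \<Rightarrow> 'f set \<Rightarrow> (('e \<Rightarrow> 'f \<Rightarrow> 'k) \<Rightarrow> 'k) set" where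
  "tensor_product sE E sF F = module.span tscale {tens sE E sF F x y |x y. x \<in> E \<and> y \<in> F}"

text \<open>If \<open>u\<close> is the sum of the tensors of \<open>x\<^sub>i\<close> and \<open>y\<^sub>i\<close>, then its value at the bilinear form
  \<open>\<lambda>x y. f x * g y\<close> is the sum of the \<open>f x\<^sub>i * g y\<^sub>i\<close>.\<close>

definition inj_norm ::
    "('k::real_or_complex \<Rightarrow> 'x::banach \<Rightarrow> 'x) \<Rightarrow> ('k \<Rightarrow> 'y::banach \<Rightarrow> 'y)
      \<Rightarrow> (('x \<Rightarrow> 'y \<Rightarrow> 'k) \<Rightarrow> 'k) \<Rightarrow> real" where
  "inj_norm sX sY u =
     Sup {norm (u (\<lambda>x y. blinfun_apply f x * blinfun_apply g y)) |f g. f \<in> dual_ball sX \<and> g \<in> dual_ball sY}"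

definition inj_tensor ::
    "('k::real_or_complex \<Rightarrow> 'x::banach \<Rightarrow> 'x) \<Rightarrow> ('k \<Rightarrow> 'y::banach \<Rightarrow> 'y)
      \<Rightarrow> ('k, (nat \<Rightarrow> ('x \<Rightarrow> 'y \<Rightarrow> 'k) \<Rightarrow> 'k) set) normed_structure" where
  "inj_tensor sX sY = completion tscale (tensor_product sX UNIV sY UNIV) (inj_norm sX sY)"

definition proj_norm ::
    "('k::real_or_complex \<Rightarrow> 'e::real_normed_vector \<Rightarrow> 'e) \<Rightarrow> 'e set
      \<Rightarrow> ('k \<Rightarrow> 'f::real_normed_vector \<Rightarrow> 'f) \<Rightarrow> 'f set \<Rightarrow> (('e \<Rightarrow> 'f \<Rightarrow> 'k) \<Rightarrow> 'k) \<Rightarrow> real" where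
  "proj_norm sE E sF F u =
     Inf {(\<Sum>i<n. norm (x i) * norm (y i)) |n x y.
            (\<forall>i<n. x i \<in> E \<and> y i \<in> F) \<and> u = (\<Sum>i<n::nat. tens sE E sF F (x i) (y i))}"

definition proj_tensor ::
    "('k::real_or_complex \<Rightarrow> 'e::real_normed_vector \<Rightarrow> 'e) \<Rightarrow> 'e set
      \<Rightarrow> ('k \<Rightarrow> 'f::real_normed_vector \<Rightarrow> 'f) \<Rightarrow> 'f set
      \<Rightarrow> ('k, (nat \<Rightarrow> ('e \<Rightarrow> 'f \<Rightarrow> 'k) \<Rightarrow> 'k) set) normed_structure" where
  "proj_tensor sE E sF F = completion tscale (tensor_product sE E sF F) (proj_norm sE E sF F)"

definition proj_norm_attaining ::
    "('k::real_or_complex \<Rightarrow> 'e::real_normed_vector \<Rightarrow> 'e) \<Rightarrow> 'e set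
      \<Rightarrow> ('k \<Rightarrow> 'f::real_normed_vector \<Rightarrow> 'f) \<Rightarrow> 'f set \<Rightarrow> (nat \<Rightarrow> ('e \<Rightarrow> 'f \<Rightarrow> 'k) \<Rightarrow> 'k) set set" where
  "proj_norm_attaining sE E sF F =
     {z \<in> carrier (proj_tensor sE E sF F).
        \<exists>x y. range x \<subseteq> E \<and> range y \<subseteq> F \<and>
          (\<lambda>n. vdist (proj_tensor sE E sF F) z
             (completion_embed (tensor_product sE E sF F) (proj_norm sE E sF F)
                (\<Sum>i<n. tens sE E sF F (x i) (y i)))) \<longlonglongrightarrow> 0 \<and>
          (\<lambda>i. norm (x i) * norm (y i)) sums vnorm (proj_tensor sE E sF F) z}"

section \<open>Symmetric tensor products\<close>

text \<open>As before, an \<open>N\<close>-fold elementary tensor is evaluation on \<open>N\<close>-linear forms. The arguments of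
  such a form are tuples in \<open>E\<^sup>N\<close>, coded as extensional functions on \<open>{..<N}\<close>.\<close>

definition multilinear_form ::
    "nat \<Rightarrow> ('k::real_or_complex \<Rightarrow> 'e::ab_group_add \<Rightarrow> 'e) \<Rightarrow> 'e set \<Rightarrow> ((nat \<Rightarrow> 'e) \<Rightarrow> 'k) \<Rightarrow> bool" where
  "multilinear_form N sE E A \<longleftrightarrow>
     (\<forall>v \<in> {..<N} \<rightarrow>\<^sub>E E. \<forall>i<N.
        (\<forall>x\<in>E. \<forall>y\<in>E. A (v(i := x + y)) = A (v(i := x)) + A (v(i := y))) \<and>
        (\<forall>c. \<forall>x\<in>E. A (v(i := sE c x)) = c * A (v(i := x))))"

definition tens_power ::
    "nat \<Rightarrow> ('k::real_or_complex \<Rightarrow> 'e::ab_group_add \<Rightarrow> 'e) \<Rightarrow> 'e set \<Rightarrow> 'e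
      \<Rightarrow> ((nat \<Rightarrow> 'e) \<Rightarrow> 'k) \<Rightarrow> 'k" where
  "tens_power N sE E x = (\<lambda>A. if multilinear_form N sE E A then A (\<lambda>i\<in>{..<N}. x) else 0)"

definition sym_tensor_product ::
    "nat \<Rightarrow> ('k::real_or_complex \<Rightarrow> 'e::ab_group_add \<Rightarrow> 'e) \<Rightarrow> 'e set
      \<Rightarrow> (((nat \<Rightarrow> 'e) \<Rightarrow> 'k) \<Rightarrow> 'k) set" where
  "sym_tensor_product N sE E = module.span tscale (tens_power N sE E ` E)"

text \<open>The value of \<open>u\<close>, the sum of the \<open>\<lambda>\<^sub>j x\<^sub>j\<^sup>N\<close>, at the form \<open>\<lambda>v. \<Prod>i<N. f (v i)\<close> is the sum of
  the \<open>\<lambda>\<^sub>j (f x\<^sub>j)\<^sup>N\<close>.\<close>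

definition sym_inj_norm ::
    "nat \<Rightarrow> ('k::real_or_complex \<Rightarrow> 'x::banach \<Rightarrow> 'x) \<Rightarrow> (((nat \<Rightarrow> 'x) \<Rightarrow> 'k) \<Rightarrow> 'k) \<Rightarrow> real" where
  "sym_inj_norm N sX u = Sup {norm (u (\<lambda>v. \<Prod>i<N. blinfun_apply f (v i))) |f. f \<in> dual_ball sX}"

definition sym_inj_tensor ::
    "nat \<Rightarrow> ('k::real_or_complex \<Rightarrow> 'x::banach \<Rightarrow> 'x)
      \<Rightarrow> ('k, (nat \<Rightarrow> ((nat \<Rightarrow> 'x) \<Rightarrow> 'k) \<Rightarrow> 'k) set) normed_structure" where
  "sym_inj_tensor N sX = completion tscale (sym_tensor_product N sX UNIV) (sym_inj_norm N sX)"

definition sym_proj_norm ::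
    "nat \<Rightarrow> ('k::real_or_complex \<Rightarrow> 'e::real_normed_vector \<Rightarrow> 'e) \<Rightarrow> 'e set
      \<Rightarrow> (((nat \<Rightarrow> 'e) \<Rightarrow> 'k) \<Rightarrow> 'k) \<Rightarrow> real" where
  "sym_proj_norm N sE E u =
     Inf {(\<Sum>j<n. norm (c j) * norm (x j) ^ N) |n c x.
            (\<forall>j<n. x j \<in> E) \<and> u = (\<Sum>j<n::nat. tscale (c j) (tens_power N sE E (x j)))}"

definition sym_proj_tensor ::
    "nat \<Rightarrow> ('k::real_or_complex \<Rightarrow> 'e::real_normed_vector \<Rightarrow> 'e) \<Rightarrow> 'e set
      \<Rightarrow> ('k, (nat \<Rightarrow> ((nat \<Rightarrow> 'e) \<Rightarrow> 'k) \<Rightarrow> 'k) set) normed_structure" where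
  "sym_proj_tensor N sE E =
     completion tscale (sym_tensor_product N sE E) (sym_proj_norm N sE E)"

definition sym_proj_norm_attaining ::
    "nat \<Rightarrow> ('k::real_or_complex \<Rightarrow> 'e::real_normed_vector \<Rightarrow> 'e) \<Rightarrow> 'e set
      \<Rightarrow> (nat \<Rightarrow> ((nat \<Rightarrow> 'e) \<Rightarrow> 'k) \<Rightarrow> 'k) set set" where
  "sym_proj_norm_attaining N sE E =
     {z \<in> carrier (sym_proj_tensor N sE E).
        \<exists>c x. range x \<subseteq> E \<and>
          (\<lambda>n. vdist (sym_proj_tensor N sE E) z
             (completion_embed (sym_tensor_product N sE E) (sym_proj_norm N sE E)
                (\<Sum>j<n. tscale (c j) (tens_power N sE E (x j))))) \<longlonglongrightarrow> 0 \<and>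
          (\<lambda>j. norm (c j) * norm (x j) ^ N) sums vnorm (sym_proj_tensor N sE E) z}"

end

theory Submission
  imports Defs
begin

text \<open>
  Both duals of tensor products are treated at once as spaces of nuclear functionals
  \<open>\<Sum>\<^sub>i c\<^sub>i \<delta>(k\<^sub>i)\<close> on a space of continuous functions on a compact set \<open>K\<close> (the product of the two dual
  balls, or the dual ball of \<open>X\<close>). Given a bounded functional \<open>f\<close>, an Ekeland-type perturbation of a minimiser
  of \<open>\<parallel>z\<parallel>\<^sup>2 / 2 - Re (f z)\<close> is a function \<open>u\<close> such that for every \<open>z\<close> some \<open>k\<close> with \<open>\<bar>u(k)\<bar> = \<parallel>u\<parallel>\<close> satisfies
  \<open>Re (f z) \<le> Re (cnj (u k) * z k) + \<epsilon> * \<parallel>z\<parallel>\<close>. If \<open>f\<close> were not close to a finite convex combination of these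
  functionals, then by minimax there would be a bounded convex set of functions whose real parts all reach a
  level \<open>\<alpha>\<close>, but which accumulates pointwise at a function with real part at most some \<open>\<beta> < \<alpha>\<close>; such a
  set contains an \<open>\<ell>\<^sub>1\<close>-sequence. Hence \<open>f\<close> is a norm limit of finite combinations of atoms, and each of
  them attains its nuclear norm because it attains its norm at \<open>u\<close>. Finally, the approximation property of
  \<open>X\<^sup>*\<close> shows that an element of the projective tensor product is determined by its values on the
  (symmetric) injective tensor product.
\<close>

section \<open>Minimax and finitely additive means\<close>

text \<open>At an exact minimiser the one-sided derivative of the squared sup norm lives on the
  points where the modulus of \<open>u\<close> peaks; this is the origin of the terms
  \<open>Re (cnj (u k) * z k)\<close>. Minimisers need not exist, hence the perturbation, and the
  space of functions is incomplete, hence a \<open>u\<close> in its uniform closure only. All atoms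
  sit at peaks of one function and carry the phase \<open>cnj (u k)\<close>, so every finite convex
  combination attains its norm at \<open>u\<close>: attainment is automatic, and the obstacle is
  finiteness. Separation alone gives a combination in the weak-star closure, such as a diffuse
  measure on the peak set, and not a norm approximation; excluding this is what the absence of
  \<open>\<ell>\<^sub>1\<close> is for. A second gap is that the approximation is in the norm of
  functionals on the injective product, while density is claimed in the projective norm. Repeating
  the approximation on the residuals produces an absolutely convergent series of atoms of almost the
  right total cost, and the approximation property identifies this series with the given
  element.\<close>

lemma net_cluster:
  fixes u :: "'i set \<Rightarrow> 'a \<Rightarrow> 'b::{real_normed_vector, heine_borel}"
  assumes b: "\<And>F a. norm (u F a) \<le> b a"
  shows "\<exists>\<phi>. \<forall>A F0 e. finite A \<longrightarrow> finite F0 \<longrightarrow> e > 0 \<longrightarrow>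
           (\<exists>F. finite F \<and> F0 \<subseteq> F \<and> (\<forall>a\<in>A. norm (u F a - \<phi> a) < e))"
proof -
  \<comment> \<open>By Tychonoff, the product of the closed balls of radius \<open>b a\<close> is
    compact for pointwise convergence.\<close>
  define P where "P = PiE UNIV (\<lambda>a. cball (0::'b) (b a))"
  have cP: "compact P"
    unfolding P_def using compactin_PiE[of "\<lambda>_. euclidean" UNIV "\<lambda>a. cball (0::'b) (b a)"]
    by (simp add: euclidean_product_topology)
  \<comment> \<open>The net over finite sets, directed by inclusion, is turned into a filter; a
    proper filter on a compact set has a cluster point.\<close>
  define G where "G = filtermap u (finite_subsets_at_top UNIV)"
  have "G \<le> principal P"
    unfolding G_def le_principal eventually_filtermap
    by (rule always_eventually) (auto simp: P_def b)
  moreover have "G \<noteq> bot"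
    unfolding G_def filtermap_bot_iff by (rule finite_subsets_at_top_neq_bot)
  ultimately obtain \<phi> where \<phi>: "inf (nhds \<phi>) G \<noteq> bot"
    using cP unfolding compact_filter le_principal by blast
  show ?thesis
  proof (intro exI[of _ \<phi>] allI impI)
    fix A :: "'a set" and F0 :: "'i set" and e :: real
    assume A: "finite A" and F0: "finite F0" and e: "e > 0"
    define O' where "O' = (\<Inter>a\<in>A. (\<lambda>g. g a) -` ball (\<phi> a) e)"
    have "open O'" unfolding O'_def using A
    proof (intro open_INT ballI)
      fix a
      show "open ((\<lambda>g. g a) -` ball (\<phi> a) e)"
        using continuous_on_product_coordinates[of a] by (rule open_vimage[OF open_ball])
    qed
    moreover have "\<phi> \<in> O'" using e by (auto simp: O'_def)
    ultimately have ev1: "eventually (\<lambda>g. g \<in> O') (nhds \<phi>)"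
      using eventually_nhds by blast
    have ev2: "eventually (\<lambda>g. \<exists>F. finite F \<and> F0 \<subseteq> F \<and> g = u F) G"
      unfolding G_def eventually_filtermap eventually_finite_subsets_at_top using F0 by auto
    have "eventually (\<lambda>g. g \<in> O' \<and> (\<exists>F. finite F \<and> F0 \<subseteq> F \<and> g = u F)) (inf (nhds \<phi>) G)"
      using ev1 ev2 unfolding eventually_inf by blast
    then obtain g where "g \<in> O'" "\<exists>F. finite F \<and> F0 \<subseteq> F \<and> g = u F"
      using \<phi> eventually_happens' by blast
    then show "\<exists>F. finite F \<and> F0 \<subseteq> F \<and> (\<forall>a\<in>A. norm (u F a - \<phi> a) < e)"
      by (auto simp: O'_def dist_norm norm_minus_commute)
  qed
qed

text \<open>The convex set misses the open quadrant above \<open>(c, c)\<close>, so a line separates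
  them. Since the quadrant is unbounded upwards, the normal has nonnegative coordinates, and
  dividing by their sum gives the weights.\<close>

lemma minimax_two:
  fixes Q :: "(real \<times> real) set"
  assumes "convex Q" and min: "\<And>x y. (x, y) \<in> Q \<Longrightarrow> x \<le> c \<or> y \<le> c"
  shows "\<exists>t. 0 \<le> t \<and> t \<le> 1 \<and> (\<forall>(x, y)\<in>Q. t * x + (1 - t) * y \<le> c)"
proof (cases "Q = {}")
  case False
  define R where "R = {c<..} \<times> {c<..}"
  have "convex R" unfolding R_def by (intro convex_Times convex_real_interval)
  moreover have "R \<noteq> {}" by (auto simp: R_def intro: exI[of _ "c + 1"])
  moreover have "Q \<inter> R = {}" using min by (fastforce simp: R_def)
  ultimately obtain a d where a: "a \<noteq> 0" "\<forall>x\<in>Q. a \<bullet> x \<le> d" "\<forall>x\<in>R. d \<le> a \<bullet> x"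
    using separating_hyperplane_sets[OF assms(1) \<open>convex R\<close> False] by blast
  obtain p q where pq: "a = (p, q)" by (cases a)
  have R: "d \<le> p * (c + s) + q * (c + t)" if "s > 0" "t > 0" for s t
    using a(3)[rule_format, of "(c + s, c + t)"] that by (auto simp: R_def pq)
  have lim: "d \<le> (p + q) * c"
  proof (rule field_le_epsilon)
    fix e :: real assume "e > 0"
    define s where "s = e / (\<bar>p\<bar> + \<bar>q\<bar> + 1)"
    have "s > 0" using \<open>e > 0\<close> by (auto simp: s_def intro!: divide_pos_pos)
    have "s * (p + q) \<le> s * (\<bar>p\<bar> + \<bar>q\<bar> + 1)" using \<open>s > 0\<close> by (intro mult_left_mono) auto
    also have "\<dots> = e" by (simp add: s_def add_nonneg_eq_0_iff)
    finally show "d \<le> (p + q) * c + e" using R[OF \<open>s > 0\<close> \<open>s > 0\<close>] by (simp add: algebra_simps)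
  qed
  have nonneg: "0 \<le> p'" if "\<And>s. s > 0 \<Longrightarrow> d \<le> p' * s + r" for p' r
  proof (rule ccontr)
    assume "\<not> 0 \<le> p'"
    \<comment> \<open>Chosen with \<open>p' * s = - (\<bar>r\<bar> + \<bar>d\<bar> + 1)\<close>,
      which pushes \<open>p' * s + r\<close> below \<open>d\<close>.\<close>
    define s where "s = (\<bar>r\<bar> + \<bar>d\<bar> + 1) / (- p')"
    have "s > 0" unfolding s_def by (rule divide_pos_pos) (use \<open>\<not> 0 \<le> p'\<close> in auto)
    moreover have "p' * s = - (\<bar>r\<bar> + \<bar>d\<bar> + 1)" using \<open>\<not> 0 \<le> p'\<close> by (simp add: s_def)
    ultimately show False using that[of s] by linarith
  qed
  have "p \<ge> 0"
    by (rule nonneg[of p "p * c + q * (c + 1)"]) (use R[of _ 1] in \<open>auto simp: algebra_simps\<close>)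
  have "q \<ge> 0"
    by (rule nonneg[of q "q * c + p * (c + 1)"]) (use R[of 1] in \<open>auto simp: algebra_simps\<close>)
  have pos: "p + q > 0" using a(1) \<open>p \<ge> 0\<close> \<open>q \<ge> 0\<close> by (auto simp: pq zero_prod_def)
  define t where "t = p / (p + q)"
  have t1: "1 - t = q / (p + q)" using pos by (auto simp: t_def field_simps)
  show ?thesis
  proof (intro exI[of _ t] conjI ballI)
    show "0 \<le> t" "t \<le> 1" using \<open>p \<ge> 0\<close> \<open>q \<ge> 0\<close> pos by (auto simp: t_def)
    fix z assume "z \<in> Q"
    then obtain x y where z: "z = (x, y)" "p * x + q * y \<le> d" using a(2) by (cases z) (auto simp: pq)
    then have "p * x + q * y \<le> (p + q) * c" using lim by simp
    then have "(p * x + q * y) / (p + q) \<le> c" using pos by (simp add: field_simps)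
    then show "case z of (x, y) \<Rightarrow> t * x + (1 - t) * y \<le> c"
      using t1 by (simp add: z t_def add_divide_distrib)
  qed
qed (auto intro: exI[of _ 0])

text \<open>Induction on the index set. The weights for \<open>I\<close> are found on the part of
  \<open>Q\<close> that exceeds \<open>c\<close> at the new index \<open>j\<close>; the planar case,
  applied to the value at \<open>j\<close> and the weighted mean over \<open>I\<close>, then mixes
  in \<open>j\<close>.\<close>

lemma minimax_finite:
  fixes Q :: "('i \<Rightarrow> real) set"
  assumes "finite I" "I \<noteq> {}"
    and cvx: "\<And>p q t. p \<in> Q \<Longrightarrow> q \<in> Q \<Longrightarrow> 0 \<le> t \<Longrightarrow> t \<le> 1 \<Longrightarrow> (\<lambda>i. t * p i + (1 - t) * q i) \<in> Q"
    and min: "\<And>q. q \<in> Q \<Longrightarrow> \<exists>i\<in>I. q i \<le> c"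
  shows "\<exists>w. (\<forall>i\<in>I. w i \<ge> 0) \<and> sum w I = 1 \<and> (\<forall>q\<in>Q. (\<Sum>i\<in>I. w i * q i) \<le> c)"
  using assms
proof (induction I arbitrary: Q rule: finite_ne_induct)
  case (singleton j)
  then show ?case by (intro exI[of _ "\<lambda>_. 1"]) auto
next
  case (insert j I)
  \<comment> \<open>Members of \<open>Q\<close> that are at most \<open>c\<close> at
    \<open>j\<close> put no constraint on \<open>I\<close>; all others must be at most
    \<open>c\<close> somewhere in \<open>I\<close>.\<close>
  define Q' where "Q' = {q \<in> Q. q j > c}"
  have *: "(\<lambda>i. t * p i + (1 - t) * q i) \<in> Q'" if "p \<in> Q'" "q \<in> Q'" "0 \<le> t" "t \<le> 1" for p q t
  proof -
    have "t * p j + (1 - t) * q j > c"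
      using that convex_bound_lt[of "- p j" "- c" "- q j" t "1 - t"] by (auto simp: Q'_def)
    then show ?thesis using that insert.prems(1) by (auto simp: Q'_def)
  qed
  have "\<exists>w. (\<forall>i\<in>I. w i \<ge> 0) \<and> sum w I = 1 \<and> (\<forall>q\<in>Q'. (\<Sum>i\<in>I. w i * q i) \<le> c)"
  proof (rule insert.IH[OF *])
    show "\<exists>i\<in>I. q i \<le> c" if "q \<in> Q'" for q
      using insert.prems(2)[of q] that by (auto simp: Q'_def)
  qed
  then obtain \<mu> where \<mu>: "\<forall>i\<in>I. \<mu> i \<ge> 0" "sum \<mu> I = 1" "\<forall>q\<in>Q'. (\<Sum>i\<in>I. \<mu> i * q i) \<le> c"
    by blast
  define R where "R = (\<lambda>q. (q j, \<Sum>i\<in>I. \<mu> i * q i)) ` Q"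
  have "convex R"
    unfolding convex_alt
  proof (intro ballI allI impI)
    fix x y and u :: real assume "x \<in> R" "y \<in> R" and u: "0 \<le> u \<and> u \<le> 1"
    then obtain p q where pq: "p \<in> Q" "q \<in> Q"
      "x = (p j, \<Sum>i\<in>I. \<mu> i * p i)" "y = (q j, \<Sum>i\<in>I. \<mu> i * q i)" by (auto simp: R_def)
    have "(1 - u) *\<^sub>R x + u *\<^sub>R y
        = (\<lambda>q. (q j, \<Sum>i\<in>I. \<mu> i * q i)) (\<lambda>i. u * q i + (1 - u) * p i)"
      by (simp add: pq sum_distrib_left sum.distrib[symmetric] algebra_simps)
    moreover have "(\<lambda>i. u * q i + (1 - u) * p i) \<in> Q"
      using insert.prems(1)[of q p u] pq u by auto
    ultimately show "(1 - u) *\<^sub>R x + u *\<^sub>R y \<in> R"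
      unfolding R_def by (rule image_eqI)
  qed
  moreover have "x \<le> c \<or> y \<le> c" if "(x, y) \<in> R" for x y
    using that \<mu>(3) by (auto simp: R_def Q'_def)
  ultimately obtain t where t: "0 \<le> t" "t \<le> 1" "\<forall>(x, y)\<in>R. t * x + (1 - t) * y \<le> c"
    using minimax_two by blast
  define w where "w i = (if i = j then t else (1 - t) * \<mu> i)" for i
  have eq: "(\<Sum>i\<in>I. w i * q i) = (1 - t) * (\<Sum>i\<in>I. \<mu> i * q i)" for q
    unfolding sum_distrib_left by (rule sum.cong) (use insert.hyps in \<open>auto simp: w_def\<close>)
  show ?case
  proof (intro exI[of _ w] conjI ballI)
    show "0 \<le> w i" if "i \<in> insert j I" for i using that t \<mu>(1) by (auto simp: w_def)
    show "sum w (insert j I) = 1"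
      using eq[of "\<lambda>_. 1"] insert.hyps \<mu>(2) by (simp add: w_def)
    fix q assume "q \<in> Q"
    then show "(\<Sum>i\<in>insert j I. w i * q i) \<le> c"
      using t(3) insert.hyps by (auto simp: eq R_def) (simp add: w_def)
  qed
qed

definition fconvex :: "('a \<Rightarrow> 'b::real_vector) set \<Rightarrow> bool" where
  "fconvex D \<longleftrightarrow> (\<forall>x\<in>D. \<forall>y\<in>D. \<forall>t. 0 \<le> t \<longrightarrow> t \<le> 1 \<longrightarrow> (\<lambda>k. t *\<^sub>R x k + (1 - t) *\<^sub>R y k) \<in> D)"

lemma fconvexD:
  "fconvex D \<Longrightarrow> x \<in> D \<Longrightarrow> y \<in> D \<Longrightarrow> 0 \<le> t \<Longrightarrow> t \<le> 1 \<Longrightarrow> (\<lambda>k. t *\<^sub>R x k + (1 - t) *\<^sub>R y k) \<in> D"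
  by (simp add: fconvex_def)

lemma fconvex_sum:
  fixes D :: "('a \<Rightarrow> 'b::real_vector) set"
  assumes D: "fconvex D" and "finite I" and "\<And>i. i \<in> I \<Longrightarrow> w i \<ge> 0" "sum w I = 1" "\<And>i. i \<in> I \<Longrightarrow> x i \<in> D"
  shows "(\<lambda>k. \<Sum>i\<in>I. w i *\<^sub>R x i k) \<in> D"
  using assms(2-)
proof (induction I arbitrary: w rule: finite_induct)
  case empty
  then show ?case by simp
next
  case (insert j I)
  have wj: "w j + sum w I = 1" using insert by simp
  have nn: "sum w I \<ge> 0" using insert.prems by (intro sum_nonneg) auto
  show ?case
  proof (cases "sum w I = 0")
    case True
    then have "\<forall>i\<in>I. w i = 0" using insert by (subst (asm) sum_nonneg_eq_0_iff) auto
    then have "(\<lambda>k. \<Sum>i\<in>insert j I. w i *\<^sub>R x i k) = x j"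
      using insert.hyps wj True by (auto simp: fun_eq_iff)
    then show ?thesis using insert.prems by simp
  next
    case False
    define s where "s = sum w I"
    have s: "s > 0" using False nn by (simp add: s_def)
    have "(\<lambda>k. \<Sum>i\<in>I. (w i / s) *\<^sub>R x i k) \<in> D"
      by (rule insert.IH) (use insert.prems s in \<open>auto simp: sum_divide_distrib[symmetric] s_def[symmetric]\<close>)
    from fconvexD[OF D insert.prems(3)[of j] this, of "w j"]
    have "(\<lambda>k. w j *\<^sub>R x j k + (1 - w j) *\<^sub>R (\<Sum>i\<in>I. (w i / s) *\<^sub>R x i k)) \<in> D"
      using insert.prems wj nn by auto
    moreover have "1 - w j = s" using wj by (simp add: s_def)
    ultimately show ?thesis using s insert.hyps by (simp add: scaleR_sum_right)
  qed
qed

section \<open>Bounded functions, positive functionals and means\<close>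

definition bdd_on :: "'a set \<Rightarrow> ('a \<Rightarrow> real) \<Rightarrow> bool" where
  "bdd_on L g \<longleftrightarrow> (\<exists>B. \<forall>k\<in>L. \<bar>g k\<bar> \<le> B)"

lemma bdd_onI: "(\<And>k. k \<in> L \<Longrightarrow> \<bar>g k\<bar> \<le> B) \<Longrightarrow> bdd_on L g"
  by (auto simp: bdd_on_def)

lemma bdd_on_const [simp]: "bdd_on L (\<lambda>_. r)"
  by (rule bdd_onI[of _ _ "\<bar>r\<bar>"]) auto

lemma bdd_on_add [intro]: "bdd_on L g \<Longrightarrow> bdd_on L h \<Longrightarrow> bdd_on L (\<lambda>k. g k + h k)"
proof -
  assume "bdd_on L g" "bdd_on L h"
  then obtain A B where "\<forall>k\<in>L. \<bar>g k\<bar> \<le> A" "\<forall>k\<in>L. \<bar>h k\<bar> \<le> B" by (auto simp: bdd_on_def)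
  then show ?thesis by (intro bdd_onI[of _ _ "A + B"]) (meson abs_triangle_ineq add_mono order_trans)
qed

lemma bdd_on_mult [intro]: "bdd_on L g \<Longrightarrow> bdd_on L h \<Longrightarrow> bdd_on L (\<lambda>k. g k * h k)"
proof -
  assume "bdd_on L g" "bdd_on L h"
  then obtain A B where "\<forall>k\<in>L. \<bar>g k\<bar> \<le> A" "\<forall>k\<in>L. \<bar>h k\<bar> \<le> B" by (auto simp: bdd_on_def)
  then show ?thesis by (intro bdd_onI[of _ _ "A * B"]) (auto simp: abs_mult intro!: mult_mono')
qed

lemma bdd_on_minus [intro]: "bdd_on L g \<Longrightarrow> bdd_on L (\<lambda>k. - g k)"
  unfolding bdd_on_def by simp

lemma bdd_on_diff [intro]: "bdd_on L g \<Longrightarrow> bdd_on L h \<Longrightarrow> bdd_on L (\<lambda>k. g k - h k)"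
  using bdd_on_add[of L g "\<lambda>k. - h k"] bdd_on_minus[of L h] by simp

lemma bdd_on_sum [intro]: "(\<And>i. i \<in> I \<Longrightarrow> bdd_on L (g i)) \<Longrightarrow> bdd_on L (\<lambda>k. \<Sum>i\<in>I. g i k)"
  by (induction I rule: infinite_finite_induct) auto

lemma bdd_on_continuous:
  assumes "compact L" "continuous_on L g" shows "bdd_on L g"
  using compact_imp_bounded[OF compact_continuous_image[OF assms(2,1)]]
  by (auto simp: bounded_iff bdd_on_def)

text \<open>Integration against a finitely additive positive measure on all subsets of
  \<open>L\<close>. The axioms speak of bounded functions only; \<open>m\<close> is a total function
  on all functions. Working with such functionals avoids any representation by countably additive
  measures.\<close>

locale positive_functional =
  fixes L :: "'a set" and m :: "('a \<Rightarrow> real) \<Rightarrow> real"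
  assumes add: "bdd_on L g \<Longrightarrow> bdd_on L h \<Longrightarrow> m (\<lambda>k. g k + h k) = m g + m h"
    and mult: "bdd_on L g \<Longrightarrow> m (\<lambda>k. r * g k) = r * m g"
    and nonneg: "bdd_on L g \<Longrightarrow> (\<And>k. k \<in> L \<Longrightarrow> g k \<ge> 0) \<Longrightarrow> m g \<ge> 0"
begin

lemma diff: "bdd_on L g \<Longrightarrow> bdd_on L h \<Longrightarrow> m (\<lambda>k. g k - h k) = m g - m h"
  using add[of g "\<lambda>k. (- 1) * h k"] mult[of h "- 1"] by auto

lemma mono: "bdd_on L g \<Longrightarrow> bdd_on L h \<Longrightarrow> (\<And>k. k \<in> L \<Longrightarrow> g k \<le> h k) \<Longrightarrow> m g \<le> m h"
  using nonneg[of "\<lambda>k. h k - g k"] diff[of h g] by auto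

lemma zero: "m (\<lambda>_. 0) = 0"
  using mult[of "\<lambda>_. 0" 0] by simp

lemma sum: "finite I \<Longrightarrow> (\<And>i. i \<in> I \<Longrightarrow> bdd_on L (g i)) \<Longrightarrow> m (\<lambda>k. \<Sum>i\<in>I. g i k) = (\<Sum>i\<in>I. m (g i))"
  by (induction I rule: finite_induct) (auto simp: zero add bdd_on_sum)

lemma abs_le: "bdd_on L g \<Longrightarrow> \<bar>m g\<bar> \<le> m (\<lambda>k. \<bar>g k\<bar>)"
proof -
  assume g: "bdd_on L g"
  then have g': "bdd_on L (\<lambda>k. \<bar>g k\<bar>)" by (simp add: bdd_on_def)
  have "m g \<le> m (\<lambda>k. \<bar>g k\<bar>)" by (intro mono g g') auto
  moreover have "m (\<lambda>k. (- 1) * g k) \<le> m (\<lambda>k. \<bar>g k\<bar>)" by (intro mono g') (use g in auto)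
  ultimately show ?thesis using mult[OF g, of "- 1"] by auto
qed

end

locale mean = positive_functional +
  assumes one: "m (\<lambda>_. 1) = 1"
begin

lemma const: "m (\<lambda>_. r) = r"
  using mult[of "\<lambda>_. 1" r] one by simp

text \<open>The Cauchy-Schwarz inequality against the constant 1, in the form that the variance is
  nonnegative.\<close>

lemma le_sqrt:
  assumes g: "bdd_on L g" shows "m g \<le> sqrt (m (\<lambda>k. (g k)\<^sup>2))"
proof -
  have g2: "bdd_on L (\<lambda>k. (g k)\<^sup>2)" using g by (auto simp: power2_eq_square)
  have "0 \<le> m (\<lambda>k. (g k - m g)\<^sup>2)"
    by (rule nonneg) (use g in \<open>auto simp: power2_eq_square intro!: bdd_on_mult bdd_on_diff\<close>)
  also have "(\<lambda>k. (g k - m g)\<^sup>2) = (\<lambda>k. ((g k)\<^sup>2 - (2 * m g) * g k) + (m g)\<^sup>2)"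
    by (auto simp: power2_diff algebra_simps)
  also have "m \<dots> = m (\<lambda>k. (g k)\<^sup>2) - 2 * m g * m g + (m g)\<^sup>2"
  proof -
    have "bdd_on L (\<lambda>k. 2 * m g * g k)" by (rule bdd_on_mult[OF bdd_on_const g])
    then show ?thesis
      using g2 mult[OF g, of "2 * m g"] by (subst add) (auto simp: const diff)
  qed
  finally have "(m g)\<^sup>2 \<le> m (\<lambda>k. (g k)\<^sup>2)" by (simp add: power2_eq_square)
  then show ?thesis by (rule real_le_rsqrt)
qed

end

text \<open>Minimax with the finitely many functions of \<open>F\<close> as coordinates: if no
  probability with finite support worked, some convex combination of \<open>F\<close> would have all
  its values at most \<open>c\<close>, although as a member of \<open>D\<close> it reaches
  \<open>\<alpha>\<close>.\<close>

lemma finite_mean_exists: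
  assumes L: "L \<noteq> {}" and D: "fconvex (D :: ('a \<Rightarrow> real) set)"
    and max: "\<And>z. z \<in> D \<Longrightarrow> \<exists>k\<in>L. z k \<ge> \<alpha>" and c: "c < \<alpha>" and F: "finite F" "F \<subseteq> D"
  shows "\<exists>A w. finite A \<and> A \<subseteq> L \<and> (\<forall>k. w k \<ge> 0) \<and> sum w A = (1::real) \<and> (\<forall>z\<in>F. c \<le> (\<Sum>k\<in>A. w k * z k))"
proof (rule ccontr)
  assume neg: "\<not> ?thesis"
  obtain k0 where k0: "k0 \<in> L" using L by blast
  have "F \<noteq> {}"
  proof
    assume "F = {}"
    then show False
      by (intro neg[THEN notE, of False] exI[of _ "{k0}"] exI[of _ "\<lambda>_. 1"]) (use k0 in auto)
  qed
  \<comment> \<open>The vectors of means over all probabilities of finite support. Requiring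
    \<open>w\<close> to vanish off \<open>A\<close> allows two supports to be merged in the proof of
    convexity.\<close>
  define Q where "Q = {q. \<exists>A w. finite A \<and> A \<subseteq> L \<and> (\<forall>k. w k \<ge> 0) \<and> (\<forall>k. k \<notin> A \<longrightarrow> w k = 0) \<and> sum w A = (1::real)
      \<and> q = (\<lambda>z. \<Sum>k\<in>A. w k * z k)}"
  have "\<exists>w. (\<forall>i\<in>F. w i \<ge> 0) \<and> sum w F = 1 \<and> (\<forall>q\<in>Q. (\<Sum>i\<in>F. w i * q i) \<le> c)"
  proof (rule minimax_finite[OF F(1) \<open>F \<noteq> {}\<close>])
    fix p q and t :: real assume "p \<in> Q" "q \<in> Q" and t: "0 \<le> t" "t \<le> 1"
    then obtain A w B v where
      A: "finite A" "A \<subseteq> L" "\<And>k. w k \<ge> 0" "\<And>k. k \<notin> A \<Longrightarrow> w k = 0" "sum w A = (1::real)" "p = (\<lambda>z. \<Sum>k\<in>A. w k * z k)" and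
      B: "finite B" "B \<subseteq> L" "\<And>k. v k \<ge> 0" "\<And>k. k \<notin> B \<Longrightarrow> v k = 0" "sum v B = (1::real)" "q = (\<lambda>z. \<Sum>k\<in>B. v k * z k)"
      unfolding Q_def by auto
    have exts: "sum w (A \<union> B) = 1" "sum v (A \<union> B) = 1"
      "(\<Sum>k\<in>A. w k * z k) = (\<Sum>k\<in>A \<union> B. w k * z k)" "(\<Sum>k\<in>B. v k * z k) = (\<Sum>k\<in>A \<union> B. v k * z k)" for z
    proof -
      show "sum w (A \<union> B) = 1" using A(1,4) B(1) by (subst A(5)[symmetric], intro sum.mono_neutral_right) auto
      show "sum v (A \<union> B) = 1" using A(1) B(1,4) by (subst B(5)[symmetric], intro sum.mono_neutral_right) auto
      show "(\<Sum>k\<in>A. w k * z k) = (\<Sum>k\<in>A \<union> B. w k * z k)"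
        using A(1,4) B(1) by (intro sum.mono_neutral_left) auto
      show "(\<Sum>k\<in>B. v k * z k) = (\<Sum>k\<in>A \<union> B. v k * z k)"
        using A(1) B(1,4) by (intro sum.mono_neutral_left) auto
    qed
    show "(\<lambda>i. t * p i + (1 - t) * q i) \<in> Q"
      unfolding Q_def
    proof (intro CollectI exI[of _ "A \<union> B"] exI[of _ "\<lambda>k. t * w k + (1 - t) * v k"] conjI allI impI)
      show "(\<Sum>k\<in>A \<union> B. t * w k + (1 - t) * v k) = 1"
        using exts by (simp add: sum.distrib flip: sum_distrib_left)
      show "(\<lambda>i. t * p i + (1 - t) * q i) = (\<lambda>z. \<Sum>k\<in>A \<union> B. (t * w k + (1 - t) * v k) * z k)"
        by (rule ext) (simp only: A(6) B(6) exts(3,4) sum_distrib_left sum.distrib distrib_right mult.assoc)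
    qed (use A B t in auto)
  next
    fix q assume "q \<in> Q"
    then obtain A w where
      A: "finite A" "A \<subseteq> L" "\<And>k. w k \<ge> 0" "sum w A = (1::real)" "q = (\<lambda>z. \<Sum>k\<in>A. w k * z k)"
      unfolding Q_def by auto
    show "\<exists>i\<in>F. q i \<le> c"
    proof (rule ccontr)
      assume "\<not> (\<exists>i\<in>F. q i \<le> c)"
      then have "\<forall>z\<in>F. c \<le> (\<Sum>k\<in>A. w k * z k)" using A(5) by force
      then show False using neg A by blast
    qed
  qed
  then obtain w where w: "\<forall>i\<in>F. w i \<ge> 0" "sum w F = 1" "\<forall>q\<in>Q. (\<Sum>i\<in>F. w i * q i) \<le> c" by blast
  have "(\<lambda>k. \<Sum>i\<in>F. w i *\<^sub>R i k) \<in> D"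
    using fconvex_sum[OF D F(1), of w "\<lambda>i. i"] w F(2) by auto
  then obtain k where k: "k \<in> L" "\<alpha> \<le> (\<Sum>i\<in>F. w i * i k)" using max by fastforce
  \<comment> \<open>The point mass at \<open>k\<close> is one of the competitors, and it violates
    the bound by \<open>c\<close>.\<close>
  have "(\<lambda>z. \<Sum>j\<in>{k}. (if j = k then 1 else 0) * z j) \<in> Q"
    unfolding Q_def
    by (intro CollectI exI[of _ "{k}"] exI[of _ "\<lambda>j. if j = k then 1 else 0"]) (use k in auto)
  then show False using w(3) k(2) c by fastforce
qed

text \<open>Each finite part of \<open>D\<close> has its own probability of finite support; a
  pointwise cluster point along the net of finite parts serves all of \<open>D\<close> at once,
  because linearity, positivity and the lower bounds involve finitely many functions each.\<close>

lemma mean_exists: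
  assumes L: "L \<noteq> {}" and D: "fconvex (D :: ('a \<Rightarrow> real) set)" and bD: "\<And>z. z \<in> D \<Longrightarrow> bdd_on L z"
    and max: "\<And>z. z \<in> D \<Longrightarrow> \<exists>k\<in>L. z k \<ge> \<alpha>" and c: "c < \<alpha>"
  shows "\<exists>m. mean L m \<and> (\<forall>z\<in>D. c \<le> m z)"
proof -
  have "\<forall>F. \<exists>A w. finite A \<and> A \<subseteq> L \<and> (\<forall>k. w k \<ge> 0) \<and> sum w A = (1::real)
      \<and> (finite F \<longrightarrow> (\<forall>z\<in>F \<inter> D. c \<le> (\<Sum>k\<in>A. w k * z k)))"
  proof
    fix F
    define F' where "F' = (if finite F then F \<inter> D else {})"
    have "finite F'" "F' \<subseteq> D" by (auto simp: F'_def)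
    then have "\<exists>A w. finite A \<and> A \<subseteq> L \<and> (\<forall>k. w k \<ge> 0) \<and> sum w A = (1::real) \<and> (\<forall>z\<in>F'. c \<le> (\<Sum>k\<in>A. w k * z k))"
      by (intro finite_mean_exists[OF L D max c])
    then obtain A w where "finite A" "A \<subseteq> L" "\<forall>k. w k \<ge> 0" "sum w A = (1::real)" "\<forall>z\<in>F'. c \<le> (\<Sum>k\<in>A. w k * z k)"
      by (elim exE conjE)
    then show "\<exists>A w. finite A \<and> A \<subseteq> L \<and> (\<forall>k. w k \<ge> 0) \<and> sum w A = (1::real)
      \<and> (finite F \<longrightarrow> (\<forall>z\<in>F \<inter> D. c \<le> (\<Sum>k\<in>A. w k * z k)))"
      by (intro exI[of _ A] exI[of _ w] conjI impI) (simp_all add: F'_def)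
  qed
  from choice[OF this] obtain A where A: "\<forall>F. \<exists>w. finite (A F) \<and> A F \<subseteq> L \<and> (\<forall>k. w k \<ge> 0) \<and> sum w (A F) = (1::real)
      \<and> (finite F \<longrightarrow> (\<forall>z\<in>F \<inter> D. c \<le> (\<Sum>k\<in>A F. w k * z k)))" ..
  from choice[OF this] obtain w where w: "\<forall>F. finite (A F) \<and> A F \<subseteq> L \<and> (\<forall>k. w F k \<ge> 0) \<and> sum (w F) (A F) = (1::real)
      \<and> (finite F \<longrightarrow> (\<forall>z\<in>F \<inter> D. c \<le> (\<Sum>k\<in>A F. w F k * z k)))" ..
  have Aw: "finite (A F)" "A F \<subseteq> L" "w F k \<ge> 0" "sum (w F) (A F) = (1::real)"
      "finite F \<Longrightarrow> z \<in> F \<Longrightarrow> z \<in> D \<Longrightarrow> c \<le> (\<Sum>k\<in>A F. w F k * z k)" for F k z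
    using w[rule_format, of F] by simp_all
  \<comment> \<open>A bound is selected for each bounded function, and unbounded functions get value
    0 in \<open>u\<close>; so the net is bounded at every function, as the cluster lemma
    demands.\<close>
  define b where "b g = (SOME B. \<forall>k\<in>L. \<bar>g k\<bar> \<le> B)" for g :: "'a \<Rightarrow> real"
  have b: "\<bar>g k\<bar> \<le> b g" if "bdd_on L g" "k \<in> L" for g k
    using someI_ex[of "\<lambda>B. \<forall>k\<in>L. \<bar>g k\<bar> \<le> B"] that unfolding b_def bdd_on_def by blast
  define u where "u F g = (if bdd_on L g then \<Sum>k\<in>A F. w F k * g k else 0)" for F g
  have "norm (u F g) \<le> \<bar>b g\<bar>" for F g
  proof (cases "bdd_on L g")
    case True
    have "\<bar>g k\<bar> \<le> \<bar>b g\<bar>" if "k \<in> A F" for k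
      using b[OF True, of k] Aw(2)[of F] that by force
    then have "(\<Sum>k\<in>A F. \<bar>w F k * g k\<bar>) \<le> (\<Sum>k\<in>A F. w F k * \<bar>b g\<bar>)"
      using Aw(3) by (intro sum_mono) (auto simp: abs_mult intro!: mult_left_mono)
    then have "\<bar>u F g\<bar> \<le> (\<Sum>k\<in>A F. w F k * \<bar>b g\<bar>)"
      unfolding u_def using True order_trans[OF sum_abs] by auto
    then show ?thesis using Aw(4)[of F] by (simp flip: sum_distrib_right)
  qed (auto simp: u_def)
  from net_cluster[of u, OF this] obtain m where
    m: "\<And>G F0 e. finite G \<Longrightarrow> finite F0 \<Longrightarrow> e > 0 \<Longrightarrow>
           \<exists>F. finite F \<and> F0 \<subseteq> F \<and> (\<forall>a\<in>G. norm (u F a - m a) < e)"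
    by metis
  have eq: "x = y" if "\<And>e. e > 0 \<Longrightarrow> \<bar>x - y\<bar> \<le> 3 * e" for x y :: real
  proof (rule ccontr)
    assume "x \<noteq> y"
    then show False using that[of "\<bar>x - y\<bar> / 4"] by auto
  qed
  have "mean L m"
  proof
    fix g h :: "'a \<Rightarrow> real" assume g: "bdd_on L g" and h: "bdd_on L h"
    show "m (\<lambda>k. g k + h k) = m g + m h"
    proof (rule eq)
      fix e :: real assume "e > 0"
      then obtain F where F: "\<forall>a\<in>{g, h, \<lambda>k. g k + h k}. norm (u F a - m a) < e"
        using m[of "{g, h, \<lambda>k. g k + h k}" "{}" e] by auto
      moreover have "u F (\<lambda>k. g k + h k) = u F g + u F h"
        using g h by (auto simp: u_def sum.distrib algebra_simps)
      ultimately show "\<bar>m (\<lambda>k. g k + h k) - (m g + m h)\<bar> \<le> 3 * e" by auto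
    qed
  next
    fix g :: "'a \<Rightarrow> real" and r assume g: "bdd_on L g"
    show "m (\<lambda>k. r * g k) = r * m g"
    proof (rule eq)
      fix e :: real assume "e > 0"
      define d where "d = e / (\<bar>r\<bar> + 1)"
      have "d > 0" using \<open>e > 0\<close> by (auto simp: d_def intro!: divide_pos_pos)
      then obtain F where F: "\<forall>a\<in>{g, \<lambda>k. r * g k}. norm (u F a - m a) < d"
        using m[of "{g, \<lambda>k. r * g k}" "{}" d] by auto
      have u: "u F (\<lambda>k. r * g k) = r * u F g"
        using g bdd_on_mult[OF bdd_on_const g, of r] by (auto simp: u_def sum_distrib_left algebra_simps)
      have "\<bar>m (\<lambda>k. r * g k) - r * m g\<bar> \<le> \<bar>r * u F g - m (\<lambda>k. r * g k)\<bar> + \<bar>r * (u F g - m g)\<bar>"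
        by (simp add: algebra_simps)
      also have "\<dots> \<le> d + \<bar>r\<bar> * d"
        using F u by (intro add_mono) (auto simp: abs_mult intro!: mult_left_mono)
      also have "\<dots> = e" unfolding d_def by (simp add: field_simps add_nonneg_eq_0_iff)
      finally show "\<bar>m (\<lambda>k. r * g k) - r * m g\<bar> \<le> 3 * e" using \<open>e > 0\<close> by simp
    qed
  next
    fix g :: "'a \<Rightarrow> real" assume g: "bdd_on L g" and nn: "\<And>k. k \<in> L \<Longrightarrow> g k \<ge> 0"
    show "m g \<ge> 0"
    proof (rule ccontr)
      assume "\<not> m g \<ge> 0"
      then obtain F where F: "norm (u F g - m g) < - m g"
        using m[of "{g}" "{}" "- m g"] by auto
      have "u F g \<ge> 0" using g nn Aw(2)[of F] Aw(3) by (auto simp: u_def subset_iff intro!: sum_nonneg mult_nonneg_nonneg)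
      then show False using F by auto
    qed
  next
    show "m (\<lambda>_. 1) = 1"
    proof (rule eq)
      fix e :: real assume "e > 0"
      then obtain F where F: "norm (u F (\<lambda>_. 1) - m (\<lambda>_. 1)) < e"
        using m[of "{\<lambda>_. 1}" "{}" e] by auto
      then show "\<bar>m (\<lambda>_. 1) - 1\<bar> \<le> 3 * e" using Aw(4)[of F] by (auto simp: u_def)
    qed
  qed
  moreover have "c \<le> m z" if "z \<in> D" for z
  proof (rule ccontr)
    assume "\<not> c \<le> m z"
    then obtain F where F: "finite F" "{z} \<subseteq> F" "norm (u F z - m z) < c - m z"
      using m[of "{z}" "{z}" "c - m z"] by auto
    have "c \<le> u F z" using Aw(5)[of F z] F that bD by (auto simp: u_def)
    then show False using F by auto
  qed
  ultimately show ?thesis by blast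
qed

section \<open>Extracting an \<open>\<ell>\<^sub>1\<close>-sequence from a convex set\<close>

text \<open>The support of the measure behind \<open>m\<close>, described by continuous test
  functions: every such nonnegative function that is positive at \<open>k\<close> has positive
  integral.\<close>

definition supp :: "'a::topological_space set \<Rightarrow> (('a \<Rightarrow> real) \<Rightarrow> real) \<Rightarrow> 'a set" where
  "supp L m = {k \<in> L. \<forall>g. continuous_on L g \<longrightarrow> (\<forall>x\<in>L. g x \<ge> 0) \<longrightarrow> g k > 0 \<longrightarrow> m g > 0}"

text \<open>If \<open>g\<close> vanished on the support, every point of the compact set where
  \<open>g \<ge> e\<close> would carry a null function positive there. Finitely many of them sum to
  a null function \<open>G\<close> bounded below on that set, so
  \<open>g \<le> e + (B / c) * G\<close> and the integral of \<open>g\<close> is at most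
  \<open>e * m (\<lambda>_. 1)\<close>, too small by the choice of \<open>e\<close>.\<close>

lemma supp_meets:
  fixes L :: "'a::topological_space set"
  assumes "positive_functional L m" and L: "compact L" and g: "continuous_on L g" "\<And>x. x \<in> L \<Longrightarrow> g x \<ge> 0" and pos: "m g > 0"
  shows "\<exists>k\<in>supp L m. g k > 0"
proof (rule ccontr)
  interpret positive_functional L m by fact
  assume none: "\<not> ?thesis"
  have bg: "bdd_on L g" by (rule bdd_on_continuous[OF L g(1)])
  then obtain B where B: "\<And>k. k \<in> L \<Longrightarrow> \<bar>g k\<bar> \<le> B" unfolding bdd_on_def by blast
  have m1: "m (\<lambda>_. 1) \<ge> 0" by (rule nonneg) auto
  \<comment> \<open>Half of \<open>m g\<close> spread over the total mass; the added 1 keeps the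
    denominator positive and the inequality below strict.\<close>
  define e where "e = m g / (2 * (m (\<lambda>_. 1) + 1))"
  have e: "e > 0" using pos m1 by (auto simp: e_def)
  have "e * m (\<lambda>_. 1) < m g"
  proof -
    have "e * m (\<lambda>_. 1) < e * (2 * (m (\<lambda>_. 1) + 1))" using e m1 by (intro mult_strict_left_mono) auto
    also have "\<dots> = m g" using m1 by (simp add: e_def)
    finally show ?thesis .
  qed
  define K where "K = {k \<in> L. g k \<ge> e}"
  have "K = L \<inter> g -` {e..}" by (auto simp: K_def)
  moreover have "closedin (top_of_set L) (L \<inter> g -` {e..})"
    by (rule continuous_closedin_preimage[OF g(1)]) simp
  ultimately have cK: "compact K" using closedin_compact[OF L] by simp
  have ex: "\<exists>h. continuous_on L h \<and> (\<forall>x\<in>L. h x \<ge> 0) \<and> h k > 0 \<and> m h = 0" if "k \<in> K" for k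
  proof -
    have "k \<in> L" "g k > 0" using that e by (auto simp: K_def)
    then have "k \<notin> supp L m" using none by auto
    then obtain h where h: "continuous_on L h" "\<forall>x\<in>L. h x \<ge> 0" "h k > 0" "\<not> m h > 0"
      using \<open>k \<in> L\<close> unfolding supp_def by blast
    moreover have "m h \<ge> 0" by (rule nonneg[OF bdd_on_continuous[OF L h(1)]]) (use h in auto)
    ultimately show ?thesis by (intro exI[of _ h]) auto
  qed
  then obtain H where H: "\<And>k. k \<in> K \<Longrightarrow> continuous_on L (H k)" "\<And>k x. k \<in> K \<Longrightarrow> x \<in> L \<Longrightarrow> H k x \<ge> 0"
    "\<And>k. k \<in> K \<Longrightarrow> H k k > 0" "\<And>k. k \<in> K \<Longrightarrow> m (H k) = 0" by metis
  have "\<forall>k\<in>K. \<exists>U. open U \<and> U \<inter> L = H k -` {0<..} \<inter> L"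
    using H(1) unfolding continuous_on_open_invariant by (metis open_greaterThan)
  then obtain U where U: "\<And>k. k \<in> K \<Longrightarrow> open (U k)" "\<And>k. k \<in> K \<Longrightarrow> U k \<inter> L = H k -` {0<..} \<inter> L" by metis
  have "K \<subseteq> (\<Union>k\<in>K. U k)"
  proof
    fix k assume "k \<in> K"
    then have "k \<in> H k -` {0<..} \<inter> L" using H(3) by (auto simp: K_def)
    then show "k \<in> (\<Union>k\<in>K. U k)" using U(2)[OF \<open>k \<in> K\<close>] \<open>k \<in> K\<close> by blast
  qed
  then obtain J where J: "J \<subseteq> K" "finite J" "K \<subseteq> (\<Union>k\<in>J. U k)"
    using compactE_image[OF cK, of K U] U(1) by blast
  define G where "G x = (\<Sum>k\<in>J. H k x)" for x
  have G: "continuous_on L G" unfolding G_def using J H(1) by (intro continuous_on_sum) auto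
  have G0: "G x \<ge> 0" if "x \<in> L" for x unfolding G_def using J H(2) that by (intro sum_nonneg) auto
  have GK: "G x > 0" if xK: "x \<in> K" for x
  proof -
    obtain k where k: "k \<in> J" "x \<in> U k" using J(3) xK by auto
    have "x \<in> L" using that by (auto simp: K_def)
    then have "H k x > 0" using U(2)[of k] k J(1) by auto
    then show ?thesis unfolding G_def using J H(2) k \<open>x \<in> L\<close> by (intro sum_pos2[of _ k]) auto
  qed
  have mG: "m G = 0"
  proof -
    have "m G = (\<Sum>k\<in>J. m (H k))" unfolding G_def
      by (rule sum) (use J H(1) bdd_on_continuous[OF L] in auto)
    then show ?thesis using H(4) J(1) by (auto intro!: sum.neutral)
  qed
  obtain c where c: "c > 0" "\<And>x. x \<in> K \<Longrightarrow> G x \<ge> c"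
  proof (cases "K = {}")
    case False
    have "continuous_on K G" using G by (rule continuous_on_subset) (auto simp: K_def)
    then obtain x where "x \<in> K" "\<forall>y\<in>K. G x \<le> G y" using continuous_attains_inf[OF cK False] by blast
    then show ?thesis using that[of "G x"] GK by auto
  qed (use that[of 1] in auto)
  have "B \<ge> 0 \<or> L = {}" using B by force
  have le: "g x \<le> e * 1 + (B / c) * G x" if x: "x \<in> L" for x
  proof (cases "x \<in> K")
    case True
    have "0 \<le> B" using B[OF x] by simp
    have "g x \<le> B" using B[OF x] by simp
    also have "\<dots> = (B / c) * c" using c by simp
    also have "\<dots> \<le> (B / c) * G x" using c(2)[OF True] c(1) \<open>0 \<le> B\<close> by (intro mult_left_mono) auto
    finally show ?thesis using e by simp
  next
    case False
    then have "g x \<le> e" using x by (auto simp: K_def)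
    moreover have "0 \<le> (B / c) * G x" using G0[OF x] c(1) B[OF x] by auto
    ultimately show ?thesis by simp
  qed
  have bG: "bdd_on L (\<lambda>x. (B / c) * G x)" by (rule bdd_on_mult[OF bdd_on_const bdd_on_continuous[OF L G]])
  have "m g \<le> m (\<lambda>x. e * 1 + (B / c) * G x)"
    by (rule mono[OF bg bdd_on_add[OF _ bG] le]) auto
  also have "\<dots> = m (\<lambda>x. e * 1) + m (\<lambda>x. (B / c) * G x)" by (rule add[OF _ bG]) auto
  also have "m (\<lambda>x. e * 1) = e * m (\<lambda>_. 1)" by (rule mult[OF bdd_on_const])
  also have "m (\<lambda>x. (B / c) * G x) = (B / c) * m G" by (rule mult[OF bdd_on_continuous[OF L G]])
  finally show False using \<open>e * m (\<lambda>_. 1) < m g\<close> mG by simp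
qed

text \<open>A Baire-type argument for a finite cover, needed because \<open>\<phi>\<close> is an
  arbitrary function: passing to a density \<open>g0\<close>, the points where \<open>\<phi>\<close>
  is near one fixed value \<open>d\<close> meet every piece of positive mass. Otherwise the discs
  around the members of \<open>D\<close> could be avoided one after the other without losing all
  mass.\<close>

lemma localize_value:
  fixes \<phi> :: "'a::topological_space \<Rightarrow> complex"
  assumes pf: "positive_functional L m" and L: "compact L" and m1: "m (\<lambda>_. 1) > 0" and "finite D"
    and net: "\<And>k. k \<in> L \<Longrightarrow> \<exists>d\<in>D. cmod (\<phi> k - d) < r"
  shows "\<exists>d\<in>D. \<exists>g0. continuous_on L g0 \<and> (\<forall>k\<in>L. g0 k \<ge> 0) \<and> m g0 > 0 \<and>
     (\<forall>g. continuous_on L g \<longrightarrow> (\<forall>k\<in>L. g k \<ge> 0) \<longrightarrow> m (\<lambda>k. g0 k * g k) > 0 \<longrightarrow>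
        (\<exists>k\<in>supp L m. g0 k * g k > 0 \<and> cmod (\<phi> k - d) < r))"
proof (rule ccontr)
  assume neg: "\<not> ?thesis"
  \<comment> \<open>For each disc the current density is multiplied by a further function of
    positive mass that avoids it on the support. At \<open>D' = D\<close> the remaining mass has no
    admissible value of \<open>\<phi>\<close>.\<close>
  have "\<exists>g. continuous_on L g \<and> (\<forall>k\<in>L. g k \<ge> 0) \<and> m g > 0 \<and>
          (\<forall>k\<in>supp L m. g k > 0 \<longrightarrow> (\<forall>d\<in>D'. cmod (\<phi> k - d) \<ge> r))" if "finite D'" "D' \<subseteq> D" for D'
    using that
  proof (induction D' rule: finite_induct)
    case empty
    show ?case by (intro exI[of _ "\<lambda>_. 1"]) (use m1 in auto)
  next
    case (insert d D')
    then obtain g0 where g0: "continuous_on L g0" "\<forall>k\<in>L. g0 k \<ge> 0" "m g0 > 0"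
      "\<forall>k\<in>supp L m. g0 k > 0 \<longrightarrow> (\<forall>d\<in>D'. cmod (\<phi> k - d) \<ge> r)" by auto
    have "\<not> (\<forall>g. continuous_on L g \<longrightarrow> (\<forall>k\<in>L. g k \<ge> 0) \<longrightarrow> m (\<lambda>k. g0 k * g k) > 0 \<longrightarrow>
        (\<exists>k\<in>supp L m. g0 k * g k > 0 \<and> cmod (\<phi> k - d) < r))"
    proof
      assume *: "\<forall>g. continuous_on L g \<longrightarrow> (\<forall>k\<in>L. g k \<ge> 0) \<longrightarrow> m (\<lambda>k. g0 k * g k) > 0 \<longrightarrow>
        (\<exists>k\<in>supp L m. g0 k * g k > 0 \<and> cmod (\<phi> k - d) < r)"
      show False
        by (rule neg[THEN notE], rule bexI[of _ d], intro exI[of _ g0] conjI)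
           (use * g0 insert.prems in simp_all)
    qed
    then obtain g where g: "continuous_on L g" "\<forall>k\<in>L. g k \<ge> 0" "m (\<lambda>k. g0 k * g k) > 0"
        "\<forall>k\<in>supp L m. g0 k * g k > 0 \<longrightarrow> \<not> cmod (\<phi> k - d) < r" by blast
    show ?case
    proof (intro exI[of _ "\<lambda>k. g0 k * g k"] conjI ballI impI)
      fix k d' assume k: "k \<in> supp L m" "g0 k * g k > 0" and d': "d' \<in> insert d D'"
      have "k \<in> L" using k by (auto simp: supp_def)
      then have "g0 k > 0" using g0(2) k(2) by (metis less_eq_real_def mult_zero_left order_less_irrefl)
      then show "cmod (\<phi> k - d') \<ge> r" using d' g0(4) g(4) k by fastforce
    qed (use g0 g in \<open>auto intro!: continuous_on_mult\<close>)
  qed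
  from this[OF \<open>finite D\<close>] obtain g where g: "continuous_on L g" "\<forall>k\<in>L. g k \<ge> 0" "m g > 0"
      "\<forall>k\<in>supp L m. g k > 0 \<longrightarrow> (\<forall>d\<in>D. cmod (\<phi> k - d) \<ge> r)" by blast
  obtain k where k: "k \<in> supp L m" "g k > 0" using supp_meets[OF pf L g(1) _ g(3)] g(2) by blast
  then have "k \<in> L" by (auto simp: supp_def)
  with net obtain d where "d \<in> D" "cmod (\<phi> k - d) < r" by blast
  then show False using g(4) k by force
qed

text \<open>A tent of radius and height \<open>r\<close> around \<open>d\<close>, the 1-Lipschitz
  substitute for the indicator of a disc.\<close>

definition bump :: "real \<Rightarrow> complex \<Rightarrow> complex \<Rightarrow> real" where
  "bump r d w = max 0 (r - cmod (w - d))"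

lemma bump_nonneg [simp]: "bump r d w \<ge> 0" by (simp add: bump_def)

lemma bump_pos_iff: "bump r d w > 0 \<longleftrightarrow> cmod (w - d) < r" by (auto simp: bump_def)

lemma bump_le: "r \<ge> 0 \<Longrightarrow> bump r d w \<le> r" by (auto simp: bump_def)

lemma bump_lipschitz: "\<bar>bump r d w - bump r d w'\<bar> \<le> cmod (w - w')"
proof -
  have "\<bar>cmod (w - d) - cmod (w' - d)\<bar> \<le> cmod (w - w')"
    using norm_triangle_ineq3[of "w - d" "w' - d"] by simp
  then show ?thesis by (auto simp: bump_def)
qed

lemma continuous_on_bump: "continuous_on L z \<Longrightarrow> continuous_on L (\<lambda>k. bump r d (z k))"
  unfolding bump_def by (intro continuous_intros)

lemma bdd_on_bump: "r \<ge> 0 \<Longrightarrow> bdd_on L (\<lambda>k. bump r d (z k))"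
  by (rule bdd_onI[of _ _ r]) (auto simp: bump_le)

lemma bdd_on_cmod_diff:
  "bdd_on L (\<lambda>k. cmod (z k)) \<Longrightarrow> bdd_on L (\<lambda>k. cmod (w k)) \<Longrightarrow> bdd_on L (\<lambda>k. cmod (z k - w k))"
  unfolding bdd_on_def by (metis abs_norm_cancel add_mono norm_triangle_ineq4 order_trans)

text \<open>The projection argument of Hilbert space along a downward directed family of convex
  sets: the least \<open>L\<^sup>2\<close> norms on the sets increase to a limit \<open>d\<close>,
  and by the parallelogram law members of a small set with norm close to \<open>d\<close> are close
  to one another. The conclusion is stated in \<open>L\<^sup>1\<close>.\<close>

lemma (in mean) near_minimizers:
  fixes \<G> :: "('a \<Rightarrow> complex) set set"
  assumes ne: "\<G> \<noteq> {}" and cvx: "\<And>G. G \<in> \<G> \<Longrightarrow> fconvex G" and nonempty: "\<And>G. G \<in> \<G> \<Longrightarrow> G \<noteq> {}"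
    and dir: "\<And>G H. G \<in> \<G> \<Longrightarrow> H \<in> \<G> \<Longrightarrow> \<exists>K\<in>\<G>. K \<subseteq> G \<inter> H"
    and M: "\<And>G z k. G \<in> \<G> \<Longrightarrow> z \<in> G \<Longrightarrow> k \<in> L \<Longrightarrow> cmod (z k) \<le> M"
  shows "\<exists>h. (\<forall>n::nat. h n \<in> \<Union>\<G>) \<and>
     (\<forall>e>0. \<forall>G\<in>\<G>. \<exists>z\<in>G. \<exists>N. \<forall>n\<ge>N. m (\<lambda>k. cmod (z k - h n k)) < e)"
proof -
  define nz where "nz z = m (\<lambda>k. (cmod (z k))\<^sup>2)" for z
  have bc: "bdd_on L (\<lambda>k. cmod (z k))" if "G \<in> \<G>" "z \<in> G" for z G
    by (rule bdd_onI[of _ _ M]) (use M that in auto)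
  have bc2: "bdd_on L (\<lambda>k. (cmod (z k))\<^sup>2)" if "G \<in> \<G>" "z \<in> G" for z G
    using bdd_on_mult[OF bc[OF that] bc[OF that]] by (simp add: power2_eq_square)
  have nz: "0 \<le> nz z" "nz z \<le> M\<^sup>2" if "G \<in> \<G>" "z \<in> G" for G z
  proof -
    show "0 \<le> nz z" unfolding nz_def by (rule nonneg[OF bc2[OF that]]) auto
    have "nz z \<le> m (\<lambda>_. M\<^sup>2)" unfolding nz_def
      by (rule mono[OF bc2[OF that]]) (use M that in \<open>auto intro!: power_mono\<close>)
    then show "nz z \<le> M\<^sup>2" by (simp add: const)
  qed
  define val where "val G = Inf (nz ` G)" for G
  have bb: "bdd_below (nz ` G)" if "G \<in> \<G>" for G using nz(1)[OF that] by (auto intro!: bdd_belowI[of _ 0])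
  have val_le: "val G \<le> nz z" if "G \<in> \<G>" "z \<in> G" for G z
    unfolding val_def by (rule cInf_lower) (use that bb in auto)
  have valM: "val G \<le> M\<^sup>2" if "G \<in> \<G>" for G
    using nonempty[OF that] nz(2)[OF that] val_le[OF that] by fastforce
  define d where "d = Sup (val ` \<G>)"
  have ba: "bdd_above (val ` \<G>)" using valM by (auto intro!: bdd_aboveI[of _ "M\<^sup>2"])
  have val_d: "val G \<le> d" if "G \<in> \<G>" for G
    unfolding d_def by (rule cSup_upper) (use that ba in auto)
  have small: "\<exists>z\<in>G. nz z < d + s" if "G \<in> \<G>" "s > 0" for G s
  proof -
    have "Inf (nz ` G) < d + s" using val_d[OF that(1)] that(2) by (simp add: val_def)
    then show ?thesis using cInf_lessD[of "nz ` G" "d + s"] nonempty[OF that(1)] by auto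
  qed
  have "\<exists>G\<in>\<G>. val G > d - s" if "s > 0" for s
    using less_cSupD[of "val ` \<G>" "d - s"] ne that by (auto simp: d_def)
  then have "\<forall>n::nat. \<exists>G. G \<in> \<G> \<and> val G > d - 1 / real (n + 1)" by (metis divide_pos_pos of_nat_0_less_iff zero_less_one add_gr_0)
  from choice[OF this] obtain Gs where Gs: "\<And>n::nat. Gs n \<in> \<G>" "\<And>n. val (Gs n) > d - 1 / real (n + 1)" by blast
  have "\<forall>n::nat. \<exists>z. z \<in> Gs n \<and> nz z < d + 1 / real (n + 1)" using small[OF Gs(1)] by (metis divide_pos_pos of_nat_0_less_iff zero_less_one add_gr_0)
  from choice[OF this] obtain h where h: "\<And>n. h n \<in> Gs n" "\<And>n. nz (h n) < d + 1 / real (n + 1)" by blast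
  \<comment> \<open>With \<open>t = 1 / (n + 1)\<close>, two norms below \<open>d + t\<close> and a
    midpoint norm above \<open>d - t\<close> leave
    \<open>2 * (d + t) + 2 * (d + t) - 4 * (d - t) = 8 * t\<close> in the parallelogram law.\<close>
  define s where "s n = sqrt (8 / real (n + 1))" for n :: nat
  have close: "m (\<lambda>k. cmod (z k - h n k)) \<le> s n" if z: "z \<in> Gs n" "nz z < d + 1 / real (n + 1)" for z n
  proof -
    let ?w = "\<lambda>k. (1/2) *\<^sub>R z k + (1 - 1/2) *\<^sub>R h n k"
    have w: "?w \<in> Gs n" by (rule fconvexD[OF cvx[OF Gs(1)]]) (use z h in auto)
    have par: "(cmod (z k - h n k))\<^sup>2 = (2 * (cmod (z k))\<^sup>2 + 2 * (cmod (h n k))\<^sup>2) - 4 * (cmod (?w k))\<^sup>2" for k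
    proof -
      have "?w k = (1/2) *\<^sub>R (z k + h n k)" by (simp add: scaleR_right_distrib)
      then have "4 * (cmod (?w k))\<^sup>2 = (cmod (z k + h n k))\<^sup>2" by (simp only: norm_scaleR) (simp add: power_divide)
      moreover have "(cmod (z k - h n k))\<^sup>2 + (cmod (z k + h n k))\<^sup>2 = 2 * (cmod (z k))\<^sup>2 + 2 * (cmod (h n k))\<^sup>2"
        unfolding cmod_power2 by (simp add: power2_eq_square algebra_simps)
      ultimately show ?thesis by linarith
    qed
    have b1: "bdd_on L (\<lambda>k. 2 * (cmod (z k))\<^sup>2)" by (rule bdd_on_mult[OF bdd_on_const bc2[OF Gs(1) z(1)]])
    have b2: "bdd_on L (\<lambda>k. 2 * (cmod (h n k))\<^sup>2)" by (rule bdd_on_mult[OF bdd_on_const bc2[OF Gs(1) h(1)]])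
    have b3: "bdd_on L (\<lambda>k. 4 * (cmod (?w k))\<^sup>2)" by (rule bdd_on_mult[OF bdd_on_const bc2[OF Gs(1) w]])
    have "m (\<lambda>k. (cmod (z k - h n k))\<^sup>2) = 2 * nz z + 2 * nz (h n) - 4 * nz ?w"
      unfolding par nz_def
      by (simp only: diff[OF bdd_on_add[OF b1 b2] b3] add[OF b1 b2] mult[OF bc2[OF Gs(1) z(1)]]
          mult[OF bc2[OF Gs(1) h(1)]] mult[OF bc2[OF Gs(1) w]])
    also have "\<dots> \<le> 8 / real (n + 1)"
    proof -
      define t where "t = 1 / real (n + 1)"
      have "8 / real (n + 1) = 8 * t" by (simp add: t_def)
      then show ?thesis
        using z(2) h(2)[of n] Gs(2)[of n] val_le[OF Gs(1) w] unfolding t_def[symmetric] by linarith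
    qed
    finally have "sqrt (m (\<lambda>k. (cmod (z k - h n k))\<^sup>2)) \<le> s n" by (simp add: s_def)
    moreover have "m (\<lambda>k. cmod (z k - h n k)) \<le> sqrt (m (\<lambda>k. (cmod (z k - h n k))\<^sup>2))"
      by (rule le_sqrt[OF bdd_on_cmod_diff[OF bc[OF Gs(1) z(1)] bc[OF Gs(1) h(1)]]])
    ultimately show ?thesis by simp
  qed
  have "\<exists>z\<in>G. \<exists>N. \<forall>n\<ge>N. m (\<lambda>k. cmod (z k - h n k)) < e" if "e > 0" and G: "G \<in> \<G>" for e G
  proof -
    have "s \<longlonglongrightarrow> 0" unfolding s_def
      using tendsto_real_sqrt[OF LIMSEQ_ignore_initial_segment[OF lim_const_over_n[of 8], of 1]] by simp
    then have "\<forall>\<^sub>F n in sequentially. s n < e / 3" using \<open>e > 0\<close> by (intro order_tendstoD) auto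
    then obtain N where N: "s N < e / 3" unfolding eventually_sequentially by blast
    obtain K where K: "K \<in> \<G>" "K \<subseteq> G \<inter> Gs N" using dir[OF G Gs(1)] by blast
    obtain z where z: "z \<in> K" "nz z < d + 1 / real (N + 1)" using small[OF K(1), of "1 / real (N + 1)"] by auto
    have "m (\<lambda>k. cmod (z k - h n k)) < e" if n: "n \<ge> N" for n
    proof -
      \<comment> \<open>\<open>h n\<close> and \<open>h N\<close> are near minimal in different
        sets, so they are compared through some \<open>y\<close> that is near minimal in a common
        refinement. Three distances of at most \<open>s N < e / 3\<close> add up.\<close>
      obtain K' where K': "K' \<in> \<G>" "K' \<subseteq> Gs n \<inter> Gs N" using dir[OF Gs(1) Gs(1)] by blast
      obtain y where y: "y \<in> K'" "nz y < d + 1 / real (n + 1)" using small[OF K'(1), of "1 / real (n + 1)"] by auto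
      have "1 / real (n + 1) \<le> 1 / real (N + 1)" using n by (simp add: frac_le)
      then have yN: "nz y < d + 1 / real (N + 1)" using y(2) by simp
      have sn: "s n \<le> s N" using n by (auto simp: s_def intro!: frac_le)
      have c1: "m (\<lambda>k. cmod (z k - h N k)) \<le> s N" by (rule close) (use z K in auto)
      have c2: "m (\<lambda>k. cmod (y k - h N k)) \<le> s N" by (rule close) (use y K' yN in auto)
      have c3: "m (\<lambda>k. cmod (y k - h n k)) \<le> s n" by (rule close) (use y K' in auto)
      have bz: "bdd_on L (\<lambda>k. cmod (z k))" and by': "bdd_on L (\<lambda>k. cmod (y k))"
        and bN: "bdd_on L (\<lambda>k. cmod (h N k))" and bn: "bdd_on L (\<lambda>k. cmod (h n k))"
        using bc[OF K(1) z(1)] bc[OF K'(1) y(1)] bc[OF Gs(1) h(1)] by auto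
      note b1 = bdd_on_cmod_diff[OF bz bN] and b2 = bdd_on_cmod_diff[OF by' bN] and b3 = bdd_on_cmod_diff[OF by' bn]
      have tri: "cmod (z k - h n k) \<le> (cmod (z k - h N k) + cmod (y k - h N k)) + cmod (y k - h n k)" for k
      proof -
        have "cmod (z k - h n k) = cmod (((z k - h N k) - (y k - h N k)) + (y k - h n k))" by simp
        also have "\<dots> \<le> cmod ((z k - h N k) - (y k - h N k)) + cmod (y k - h n k)" by (rule norm_triangle_ineq)
        also have "cmod ((z k - h N k) - (y k - h N k)) \<le> cmod (z k - h N k) + cmod (y k - h N k)" by (rule norm_triangle_ineq4)
        finally show ?thesis by simp
      qed
      have "m (\<lambda>k. cmod (z k - h n k)) \<le> m (\<lambda>k. (cmod (z k - h N k) + cmod (y k - h N k)) + cmod (y k - h n k))"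
        by (rule mono[OF bdd_on_cmod_diff[OF bz bn] bdd_on_add[OF bdd_on_add[OF b1 b2] b3] tri])
      also have "\<dots> = m (\<lambda>k. cmod (z k - h N k)) + m (\<lambda>k. cmod (y k - h N k)) + m (\<lambda>k. cmod (y k - h n k))"
        by (simp only: add[OF bdd_on_add[OF b1 b2] b3] add[OF b1 b2])
      finally show ?thesis using c1 c2 c3 sn N by linarith
    qed
    then show ?thesis using z(1) K(2) by blast
  qed
  then show ?thesis using h(1) Gs(1) by (intro exI[of _ h]) blast
qed

text \<open>The functional \<open>\<mu>\<close> is the mean weighted by the bump of the
  \<open>L\<^sup>1\<close>-limit of \<open>h\<close>. That limit need not exist as a function, but
  the weighted means converge because the bump is Lipschitz and \<open>h\<close> is Cauchy.\<close>

lemma (in mean) bump_limit: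
  fixes h :: "nat \<Rightarrow> 'a \<Rightarrow> complex"
  assumes r: "r \<ge> 0" and bh: "\<And>n. bdd_on L (\<lambda>k. cmod (h n k))"
    and Cauchy: "\<And>e. e > 0 \<Longrightarrow> \<exists>N. \<forall>n\<ge>N. \<forall>l\<ge>N. m (\<lambda>k. cmod (h n k - h l k)) < e"
  shows "\<exists>\<mu>. positive_functional L \<mu> \<and> (\<forall>g. bdd_on L g \<longrightarrow> (\<lambda>n. m (\<lambda>k. g k * bump r d (h n k))) \<longlonglongrightarrow> \<mu> g)"
proof -
  define \<mu> where "\<mu> g = lim (\<lambda>n. m (\<lambda>k. g k * bump r d (h n k)))" for g
  note bb = bdd_on_mult[OF _ bdd_on_bump[OF r]]
  have lim: "(\<lambda>n. m (\<lambda>k. g k * bump r d (h n k))) \<longlonglongrightarrow> \<mu> g" if g: "bdd_on L g" for g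
  proof -
    obtain B where B: "\<And>k. k \<in> L \<Longrightarrow> \<bar>g k\<bar> \<le> B" using g unfolding bdd_on_def by blast
    define B' where "B' = \<bar>B\<bar> + 1"
    have B': "B' > 0" "\<And>k. k \<in> L \<Longrightarrow> \<bar>g k\<bar> \<le> B'" using B by (force simp: B'_def)+
    have est: "\<bar>m (\<lambda>k. g k * bump r d (h n k)) - m (\<lambda>k. g k * bump r d (h l k))\<bar> \<le> B' * m (\<lambda>k. cmod (h n k - h l k))" for n l
    proof -
      have bd: "bdd_on L (\<lambda>k. g k * bump r d (h n k) - g k * bump r d (h l k))"
        by (intro bdd_on_diff bb g)
      have bd': "bdd_on L (\<lambda>k. \<bar>g k * bump r d (h n k) - g k * bump r d (h l k)\<bar>)"
        using bd by (simp add: bdd_on_def)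
      have "\<bar>m (\<lambda>k. g k * bump r d (h n k)) - m (\<lambda>k. g k * bump r d (h l k))\<bar>
          = \<bar>m (\<lambda>k. g k * bump r d (h n k) - g k * bump r d (h l k))\<bar>"
        by (subst diff[OF bb[OF g] bb[OF g]]) simp
      also have "\<dots> \<le> m (\<lambda>k. \<bar>g k * bump r d (h n k) - g k * bump r d (h l k)\<bar>)" by (rule abs_le[OF bd])
      also have "\<dots> \<le> m (\<lambda>k. B' * cmod (h n k - h l k))"
      proof (rule mono[OF bd' bdd_on_mult[OF bdd_on_const bdd_on_cmod_diff[OF bh bh]]])
        fix k assume "k \<in> L"
        have "\<bar>g k * bump r d (h n k) - g k * bump r d (h l k)\<bar> = \<bar>g k\<bar> * \<bar>bump r d (h n k) - bump r d (h l k)\<bar>"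
          by (simp add: abs_mult[symmetric] right_diff_distrib)
        also have "\<dots> \<le> B' * cmod (h n k - h l k)"
          by (rule mult_mono[OF B'(2)[OF \<open>k \<in> L\<close>] bump_lipschitz]) (use B' in auto)
        finally show "\<bar>g k * bump r d (h n k) - g k * bump r d (h l k)\<bar> \<le> B' * cmod (h n k - h l k)" .
      qed
      also have "\<dots> = B' * m (\<lambda>k. cmod (h n k - h l k))" by (rule mult[OF bdd_on_cmod_diff[OF bh bh]])
      finally show ?thesis .
    qed
    have "Cauchy (\<lambda>n. m (\<lambda>k. g k * bump r d (h n k)))"
    proof (rule CauchyI)
      fix e :: real assume "e > 0"
      then obtain N where N: "\<forall>n\<ge>N. \<forall>l\<ge>N. m (\<lambda>k. cmod (h n k - h l k)) < e / B'"
        using Cauchy[of "e / B'"] B'(1) by auto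
      have "norm (m (\<lambda>k. g k * bump r d (h n k)) - m (\<lambda>k. g k * bump r d (h l k))) < e" if "n \<ge> N" "l \<ge> N" for n l
        using est[of n l] N[rule_format, OF that] B'(1) by (simp add: field_simps)
      then show "\<exists>M. \<forall>n\<ge>M. \<forall>l\<ge>M. norm (m (\<lambda>k. g k * bump r d (h n k)) - m (\<lambda>k. g k * bump r d (h l k))) < e"
        by blast
    qed
    then show ?thesis unfolding \<mu>_def using Cauchy_convergent convergent_LIMSEQ_iff by blast
  qed
  have "positive_functional L \<mu>"
  proof
    fix g h' :: "'a \<Rightarrow> real" assume g: "bdd_on L g" and h': "bdd_on L h'"
    have "(\<lambda>n. m (\<lambda>k. (g k + h' k) * bump r d (h n k))) = (\<lambda>n. m (\<lambda>k. g k * bump r d (h n k)) + m (\<lambda>k. h' k * bump r d (h n k)))"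
      by (simp only: distrib_right add[OF bb[OF g] bb[OF h']])
    then show "\<mu> (\<lambda>k. g k + h' k) = \<mu> g + \<mu> h'"
      using LIMSEQ_unique[OF lim[OF bdd_on_add[OF g h']]] tendsto_add[OF lim[OF g] lim[OF h']] by simp
  next
    fix g :: "'a \<Rightarrow> real" and c assume g: "bdd_on L g"
    have "(\<lambda>n. m (\<lambda>k. (c * g k) * bump r d (h n k))) = (\<lambda>n. c * m (\<lambda>k. g k * bump r d (h n k)))"
      by (simp only: mult.assoc mult[OF bb[OF g]])
    then show "\<mu> (\<lambda>k. c * g k) = c * \<mu> g"
      using LIMSEQ_unique[OF lim[OF bdd_on_mult[OF bdd_on_const g]]] tendsto_mult_left[OF lim[OF g], of c] by simp
  next
    fix g :: "'a \<Rightarrow> real" assume g: "bdd_on L g" and "\<And>k. k \<in> L \<Longrightarrow> g k \<ge> 0"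
    then have "m (\<lambda>k. g k * bump r d (h n k)) \<ge> 0" for n by (intro nonneg[OF bb[OF g]]) auto
    then show "\<mu> g \<ge> 0" by (intro LIMSEQ_le_const[OF lim[OF g]]) auto
  qed
  then show ?thesis using lim by blast
qed

text \<open>A binary tree of densities, with \<open>P\<close> in the role of positive mass. One
  function must split all finitely many cells of a level at the same time; every path of length
  \<open>n\<close> then ends in a cell that satisfies \<open>P\<close>.\<close>

lemma independent_cells:
  fixes C :: "('a::topological_space \<Rightarrow> complex) set" and \<psi>0 \<psi>1 :: "complex \<Rightarrow> real" and P :: "('a \<Rightarrow> real) \<Rightarrow> bool"
  assumes base: "P (\<lambda>_. 1)"
    and step: "\<And>\<G>. finite \<G> \<Longrightarrow> (\<And>g. g \<in> \<G> \<Longrightarrow> P g) \<Longrightarrow>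
       \<exists>z\<in>C. \<forall>g\<in>\<G>. P (\<lambda>k. g k * \<psi>0 (z k)) \<and> P (\<lambda>k. g k * \<psi>1 (z k))"
  shows "\<exists>z :: nat \<Rightarrow> _. (\<forall>i. z i \<in> C) \<and>
     (\<forall>n \<sigma>. P (\<lambda>k. \<Prod>i<n. if \<sigma> i then \<psi>1 (z i k) else \<psi>0 (z i k)))"
proof -
  define next' where "next' \<G> z = (\<lambda>g k. g k * \<psi>0 (z k)) ` \<G> \<union> (\<lambda>g k. g k * \<psi>1 (z k)) ` \<G>"
    for \<G> :: "('a \<Rightarrow> real) set" and z :: "'a \<Rightarrow> complex"
  define good where "good \<G> \<longleftrightarrow> finite \<G> \<and> (\<forall>g\<in>\<G>. P g)" for \<G>
  have "\<exists>f. (\<forall>n::nat. good (f n)) \<and> f 0 = {\<lambda>_. 1} \<and> (\<forall>n. \<exists>z\<in>C. f (Suc n) = next' (f n) z)"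
  proof -
    have 0: "good {\<lambda>_. 1}" using base by (simp add: good_def)
    have 1: "\<exists>\<H>. good \<H> \<and> (\<exists>z\<in>C. \<H> = next' \<G> z)" if good: "good \<G>" for \<G>
    proof -
      have "\<exists>z\<in>C. \<forall>g\<in>\<G>. P (\<lambda>k. g k * \<psi>0 (z k)) \<and> P (\<lambda>k. g k * \<psi>1 (z k))"
        by (rule step) (use good in \<open>auto simp: good_def\<close>)
      then obtain z where z: "z \<in> C" "\<forall>g\<in>\<G>. P (\<lambda>k. g k * \<psi>0 (z k)) \<and> P (\<lambda>k. g k * \<psi>1 (z k))" ..
      then have "good (next' \<G> z)" using good by (auto simp: good_def next'_def)
      then show ?thesis using z(1) by blast
    qed
    have "\<exists>f. \<forall>n. (good (f n) \<and> (n = 0 \<longrightarrow> f n = {\<lambda>_. 1})) \<and> (\<exists>z\<in>C. f (Suc n) = next' (f n) z)"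
    proof (rule dependent_nat_choice[of "\<lambda>n \<G>. good \<G> \<and> (n = 0 \<longrightarrow> \<G> = {\<lambda>_. 1})" "\<lambda>_ \<G> \<H>. \<exists>z\<in>C. \<H> = next' \<G> z"])
      show "\<exists>\<G>. good \<G> \<and> (0 = 0 \<longrightarrow> \<G> = {\<lambda>_. 1})" using 0 by simp
      show "\<exists>\<H>. (good \<H> \<and> (Suc n = 0 \<longrightarrow> \<H> = {\<lambda>_. 1})) \<and> (\<exists>z\<in>C. \<H> = next' \<G> z)"
        if "good \<G> \<and> (n = 0 \<longrightarrow> \<G> = {\<lambda>_. 1})" for \<G> n using 1 that by simp
    qed
    then obtain f where "\<forall>n. (good (f n) \<and> (n = 0 \<longrightarrow> f n = {\<lambda>_. 1})) \<and> (\<exists>z\<in>C. f (Suc n) = next' (f n) z)" ..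
    then show ?thesis by (intro exI[of _ f]) simp
  qed
  then obtain f where f: "\<And>n. good (f n)" "f 0 = {\<lambda>_. 1}" "\<forall>n::nat. \<exists>z. z \<in> C \<and> f (Suc n) = next' (f n) z" unfolding Bex_def by auto
  from choice[OF f(3)] obtain z where z: "\<And>n. z n \<in> C" "\<And>n. f (Suc n) = next' (f n) (z n)" by blast
  have "(\<lambda>k. \<Prod>i<n. if \<sigma> i then \<psi>1 (z i k) else \<psi>0 (z i k)) \<in> f n" for n \<sigma>
  proof (induction n)
    case 0
    then show ?case by (simp add: f(2))
  next
    case (Suc n)
    then show ?case unfolding z(2) next'_def by (cases "\<sigma> n") (auto intro!: rev_image_eqI[OF Suc])
  qed
  then show ?thesis using z(1) f(1) unfolding good_def by (intro exI[of _ z]) blast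
qed

text \<open>Rosenthal's argument. Let \<open>e = d1 - d0\<close>. Choosing the value
  \<open>d1\<close> or \<open>d0\<close> by the sign of \<open>Re (u * (c i * e))\<close> at one
  point, and oppositely at another, makes the two values of the sum differ by at least the sum of
  \<open>\<bar>Re (u * (c i * e))\<bar>\<close> minus the errors
  \<open>2 * \<rho> * cmod (c i)\<close>; one of the two points carries half. Taking
  \<open>u\<close> as 1 or \<open>\<i>\<close> handles complex coefficients at the cost of another
  factor 2.\<close>

lemma independent_imp_l1:
  fixes z :: "nat \<Rightarrow> 'a \<Rightarrow> complex"
  assumes \<rho>: "4 * \<rho> < cmod (d1 - d0)"
    and ind: "\<And>n \<sigma>. \<exists>k\<in>L. \<forall>i<n. cmod (z i k - (if \<sigma> i then d1 else d0)) < \<rho>"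
  shows "\<exists>k\<in>L. (cmod (d1 - d0) / 2 - 2 * \<rho>) / 2 * (\<Sum>i<n. cmod (c i)) \<le> cmod (\<Sum>i<n. c i * z i k)"
proof -
  define e where "e = d1 - d0"
  have main: "\<exists>k\<in>L. (cmod e / 2 - 2 * \<rho>) / 2 * (\<Sum>i<n. cmod (c i)) \<le> cmod (\<Sum>i<n. c i * z i k)"
    if half: "(\<Sum>i<n. \<bar>Re (u * (c i * e))\<bar>) \<ge> cmod e / 2 * (\<Sum>i<n. cmod (c i))" and u: "cmod u = 1" for u
  proof -
    define \<sigma> where "\<sigma> i = (Re (u * (c i * e)) \<ge> 0)" for i
    obtain k where k: "k \<in> L" "\<forall>i<n. cmod (z i k - (if \<sigma> i then d1 else d0)) < \<rho>" using ind by blast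
    obtain k' where k': "k' \<in> L" "\<forall>i<n. cmod (z i k' - (if \<not> \<sigma> i then d1 else d0)) < \<rho>" using ind[of n "\<lambda>i. \<not> \<sigma> i"] by auto
    have tm: "\<bar>Re (u * (c i * e))\<bar> - 2 * \<rho> * cmod (c i) \<le> Re (u * (c i * z i k)) - Re (u * (c i * z i k'))" if "i < n" for i
    proof -
      define s :: complex where "s = (if \<sigma> i then 1 else - 1)"
      define x where "x = z i k - (if \<sigma> i then d1 else d0)"
      define y where "y = z i k' - (if \<not> \<sigma> i then d1 else d0)"
      have xy: "cmod x < \<rho>" "cmod y < \<rho>" using k(2) k'(2) that by (auto simp: x_def y_def)
      have eq: "z i k - z i k' = s * e + (x - y)" by (auto simp: s_def e_def x_def y_def)
      have "Re (u * (c i * z i k)) - Re (u * (c i * z i k')) = Re (u * (c i * (z i k - z i k')))"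
        by (simp add: algebra_simps)
      also have "\<dots> = Re (s * (u * (c i * e))) + Re (u * (c i * (x - y)))"
        unfolding eq by (simp add: algebra_simps)
      also have "Re (s * (u * (c i * e))) = \<bar>Re (u * (c i * e))\<bar>" by (auto simp: s_def \<sigma>_def)
      finally have 1: "Re (u * (c i * z i k)) - Re (u * (c i * z i k')) = \<bar>Re (u * (c i * e))\<bar> + Re (u * (c i * (x - y)))" .
      have "\<bar>Re (u * (c i * (x - y)))\<bar> \<le> cmod (u * (c i * (x - y)))" by (rule abs_Re_le_cmod)
      also have "\<dots> = cmod (c i) * cmod (x - y)" by (simp add: norm_mult u)
      also have "\<dots> \<le> cmod (c i) * (2 * \<rho>)"
        using norm_triangle_ineq4[of x y] xy by (intro mult_left_mono) auto
      finally show ?thesis using 1 by (simp add: algebra_simps)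
    qed
    define S where "S k = (\<Sum>i<n. c i * z i k)" for k
    have "(cmod e / 2 - 2 * \<rho>) * (\<Sum>i<n. cmod (c i)) \<le> (\<Sum>i<n. \<bar>Re (u * (c i * e))\<bar> - 2 * \<rho> * cmod (c i))"
      using half by (simp add: sum_subtractf sum_distrib_left left_diff_distrib)
    also have "\<dots> \<le> (\<Sum>i<n. Re (u * (c i * z i k)) - Re (u * (c i * z i k')))" by (rule sum_mono) (use tm in auto)
    also have "\<dots> = Re (u * S k) - Re (u * S k')"
      by (simp only: S_def sum_subtractf sum_distrib_left Re_sum)
    also have "\<dots> \<le> cmod (u * S k) + cmod (u * S k')"
      using complex_Re_le_cmod[of "u * S k"] abs_Re_le_cmod[of "u * S k'"] by linarith
    also have "\<dots> = cmod (S k) + cmod (S k')" by (simp add: norm_mult u)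
    finally have "(cmod e / 2 - 2 * \<rho>) / 2 * (\<Sum>i<n. cmod (c i)) \<le> cmod (S k) \<or>
        (cmod e / 2 - 2 * \<rho>) / 2 * (\<Sum>i<n. cmod (c i)) \<le> cmod (S k')" by linarith
    then show ?thesis using k k' unfolding S_def by blast
  qed
  have "cmod e * (\<Sum>i<n. cmod (c i)) \<le> (\<Sum>i<n. \<bar>Re (1 * (c i * e))\<bar> + \<bar>Re (\<i> * (c i * e))\<bar>)"
    unfolding sum_distrib_left
  proof (rule sum_mono)
    fix i
    have *: "cmod w \<le> \<bar>Re (1 * w)\<bar> + \<bar>Re (\<i> * w)\<bar>" for w using cmod_le[of w] by simp
    from *[of "c i * e"] show "cmod e * cmod (c i) \<le> \<bar>Re (1 * (c i * e))\<bar> + \<bar>Re (\<i> * (c i * e))\<bar>"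
      by (simp only: norm_mult mult.commute)
  qed
  then have "(\<Sum>i<n. \<bar>Re (1 * (c i * e))\<bar>) \<ge> cmod e / 2 * (\<Sum>i<n. cmod (c i))
      \<or> (\<Sum>i<n. \<bar>Re (\<i> * (c i * e))\<bar>) \<ge> cmod e / 2 * (\<Sum>i<n. cmod (c i))"
    unfolding sum.distrib by linarith
  then show ?thesis using main[of 1] main[of \<i>] unfolding e_def by auto
qed


lemma complex_net:
  assumes "r > 0" shows "\<exists>D. finite D \<and> (\<forall>w. cmod w \<le> M \<longrightarrow> (\<exists>d\<in>D. cmod (w - d) < r))"
proof -
  have "compact (cball (0::complex) M)" by simp
  then obtain D where D: "finite D" "cball (0::complex) M \<subseteq> (\<Union>d\<in>D. ball d r)"
    unfolding compact_eq_totally_bounded using assms by blast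
  have "\<exists>d\<in>D. cmod (w - d) < r" if "cmod w \<le> M" for w
  proof -
    have "w \<in> (\<Union>d\<in>D. ball d r)" using subsetD[OF D(2), of w] that by simp
    then show ?thesis by (auto simp: dist_norm norm_minus_commute)
  qed
  with D(1) show ?thesis by blast
qed

text \<open>A mean \<open>m\<close> is chosen for which the real parts of all members of \<open>C\<close> still have mean almost \<open>\<alpha>\<close>.
  Members of \<open>C\<close> close to \<open>\<phi>\<close> on large finite sets and almost minimal in \<open>L\<^sup>2(m)\<close> form a Cauchy sequence in
  \<open>L\<^sup>1(m)\<close>, whose limit is near some high value \<open>d1\<close> on a set of positive mass; let \<open>\<mu>\<close> be the mass there. On the support
  of \<open>\<mu>\<close> the function \<open>\<phi>\<close> is near a low value \<open>d0\<close>. A member close to \<open>\<phi>\<close> at finitely many points of the support and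
  to the limit in \<open>L\<^sup>1(m)\<close> therefore splits finitely many sets of positive mass between \<open>d0\<close> and \<open>d1\<close>;
  iterating yields an independent sequence in the sense of Rosenthal.\<close>

lemma l1_sequence_in_convex_set:
  fixes L :: "'a::topological_space set" and C :: "('a \<Rightarrow> complex) set" and \<phi> :: "'a \<Rightarrow> complex"
  assumes L: "compact L" "L \<noteq> {}" and C: "fconvex C" and cont: "\<And>z. z \<in> C \<Longrightarrow> continuous_on L z"
    and M: "\<And>z k. z \<in> C \<Longrightarrow> k \<in> L \<Longrightarrow> cmod (z k) \<le> M"
    and high: "\<And>z. z \<in> C \<Longrightarrow> \<exists>k\<in>L. Re (z k) \<ge> \<alpha>" and "\<beta> < \<alpha>"
    and low: "\<And>k. k \<in> L \<Longrightarrow> Re (\<phi> k) \<le> \<beta>"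
    and approx: "\<And>F e. finite F \<Longrightarrow> F \<subseteq> L \<Longrightarrow> e > 0 \<Longrightarrow> \<exists>z\<in>C. \<forall>k\<in>F. cmod (z k - \<phi> k) < e"
  shows "\<exists>z :: nat \<Rightarrow> _. \<exists>\<delta>>0. (\<forall>i. z i \<in> C) \<and>
     (\<forall>n c. \<exists>k\<in>L. \<delta> * (\<Sum>i<n. cmod (c i)) \<le> cmod (\<Sum>i<n. c i * z i k))"
proof -
  \<comment> \<open>The budget: \<open>Re d1\<close> will exceed \<open>\<alpha> - 3 * r\<close> and
    \<open>Re d0\<close> will be at most \<open>\<beta> + r\<close>, so the values are more than
    \<open>16 * r\<close> apart, whereas independence at radius \<open>2 * r\<close> needs a gap
    above \<open>8 * r\<close>.\<close>
  define r where "r = (\<alpha> - \<beta>) / 20"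
  have r: "r > 0" and r20: "\<alpha> = \<beta> + 20 * r" using \<open>\<beta> < \<alpha>\<close> by (simp_all add: r_def field_simps)
  have bC: "bdd_on L (\<lambda>k. cmod (z k))" if "z \<in> C" for z by (rule bdd_onI[of _ _ M]) (use M that in auto)
  define c where "c = \<alpha> - r"
  have bdd_Re: "bdd_on L (\<lambda>k. Re (z k))" if "z \<in> C" for z
    by (rule bdd_onI[of _ _ M]) (use M[OF that] abs_Re_le_cmod order_trans in blast)
  obtain m where "mean L m" and m_ge: "\<And>z. z \<in> C \<Longrightarrow> c \<le> m (\<lambda>k. Re (z k))"
  proof -
    define D where "D = (\<lambda>z k. Re (z k)) ` C"
    have "\<exists>m. mean L m \<and> (\<forall>z\<in>D. c \<le> m z)"
    proof (rule mean_exists[OF L(2)])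
      show "fconvex D"
        unfolding fconvex_def
      proof (intro ballI allI impI)
        fix x y and t :: real assume "x \<in> D" "y \<in> D" "0 \<le> t" "t \<le> 1"
        then obtain z w where zw: "z \<in> C" "w \<in> C" "x = (\<lambda>k. Re (z k))" "y = (\<lambda>k. Re (w k))" by (auto simp: D_def)
        show "(\<lambda>k. t *\<^sub>R x k + (1 - t) *\<^sub>R y k) \<in> D"
          unfolding D_def by (rule image_eqI[OF _ fconvexD[OF C zw(1,2) \<open>0 \<le> t\<close> \<open>t \<le> 1\<close>]]) (auto simp: zw)
      qed
      show "bdd_on L z" if "z \<in> D" for z using that bdd_Re by (auto simp: D_def)
      show "\<exists>k\<in>L. \<alpha> \<le> z k" if "z \<in> D" for z using that high by (auto simp: D_def)
      show "c < \<alpha>" using r by (simp add: c_def)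
    qed
    then show ?thesis using that unfolding D_def by blast
  qed
  interpret mean L m by fact
  \<comment> \<open>The traces on \<open>C\<close> of the basic neighbourhoods of
    \<open>\<phi>\<close> for pointwise convergence.\<close>
  define \<G> where "\<G> = {{z \<in> C. \<forall>k\<in>F. cmod (z k - \<phi> k) < e} | F e. finite F \<and> F \<subseteq> L \<and> e > 0}"
  have "\<exists>h. (\<forall>n::nat. h n \<in> \<Union>\<G>) \<and>
     (\<forall>e>0. \<forall>G\<in>\<G>. \<exists>z\<in>G. \<exists>N. \<forall>n\<ge>N. m (\<lambda>k. cmod (z k - h n k)) < e)"
  proof (rule near_minimizers)
    have "{z \<in> C. \<forall>k\<in>{}. cmod (z k - \<phi> k) < 1} \<in> \<G>"
      unfolding \<G>_def by (intro CollectI exI[of _ "{}"] exI[of _ "1::real"]) simp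
    then show "\<G> \<noteq> {}" by blast
    show "fconvex G" if GG: "G \<in> \<G>" for G
    proof -
      obtain F e where G: "G = {z \<in> C. \<forall>k\<in>F. cmod (z k - \<phi> k) < e}" using GG by (auto simp: \<G>_def)
      have "cmod (t *\<^sub>R x + (1 - t) *\<^sub>R y - p) < e" if "cmod (x - p) < e" "cmod (y - p) < e" "0 \<le> t" "t \<le> 1" for t x y p
        using convexD[OF convex_ball[of p e], of x y t "1 - t"] that
        by (simp add: dist_norm norm_minus_commute)
      then show ?thesis unfolding G fconvex_def using fconvexD[OF C] by auto
    qed
    show "G \<noteq> {}" if "G \<in> \<G>" for G using that approx by (fastforce simp: \<G>_def)
    show "\<exists>K\<in>\<G>. K \<subseteq> G \<inter> H" if GH: "G \<in> \<G>" "H \<in> \<G>" for G H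
    proof -
      obtain F e where G: "finite F" "F \<subseteq> L" "e > 0" "G = {z \<in> C. \<forall>k\<in>F. cmod (z k - \<phi> k) < e}"
        using GH(1) by (auto simp: \<G>_def)
      obtain F' e' where H: "finite F'" "F' \<subseteq> L" "e' > 0" "H = {z \<in> C. \<forall>k\<in>F'. cmod (z k - \<phi> k) < e'}"
        using GH(2) by (auto simp: \<G>_def)
      show ?thesis
        by (rule bexI[of _ "{z \<in> C. \<forall>k\<in>F \<union> F'. cmod (z k - \<phi> k) < min e e'}"])
          (use G H in \<open>auto simp: \<G>_def intro!: exI[of _ "F \<union> F'"] exI[of _ "min e e'"]\<close>)
    qed
    show "cmod (z k) \<le> M" if "G \<in> \<G>" "z \<in> G" "k \<in> L" for G z k using that M by (auto simp: \<G>_def)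
  qed
  then obtain h :: "nat \<Rightarrow> 'a \<Rightarrow> complex" where h': "\<And>n. h n \<in> \<Union>\<G>"
    and near: "\<And>e G. e > 0 \<Longrightarrow> G \<in> \<G> \<Longrightarrow> \<exists>z\<in>G. \<exists>N. \<forall>n\<ge>N. m (\<lambda>k. cmod (z k - h n k)) < e" by blast
  have h: "h n \<in> C" for n using h'[of n] by (auto simp: \<G>_def)
  have CG: "{z \<in> C. \<forall>k\<in>F. cmod (z k - \<phi> k) < e} \<in> \<G>" if "finite F" "F \<subseteq> L" "e > 0" for F e
    using that by (auto simp: \<G>_def)
  have Cauchy: "\<exists>N. \<forall>n\<ge>N. \<forall>l\<ge>N. m (\<lambda>k. cmod (h n k - h l k)) < e" if "e > 0" for e
  proof -
    obtain z N where z: "z \<in> C" "\<forall>n\<ge>N. m (\<lambda>k. cmod (z k - h n k)) < e / 2"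
      using near[OF _ CG[of "{}" 1], of "e / 2"] \<open>e > 0\<close> by auto
    have "m (\<lambda>k. cmod (h n k - h l k)) < e" if "n \<ge> N" "l \<ge> N" for n l
    proof -
      have b: "bdd_on L (\<lambda>k. cmod (z k - h n k))" for n by (rule bdd_on_cmod_diff[OF bC[OF z(1)] bC[OF h]])
      have "m (\<lambda>k. cmod (h n k - h l k)) \<le> m (\<lambda>k. cmod (z k - h n k) + cmod (z k - h l k))"
      proof (rule mono[OF bdd_on_cmod_diff[OF bC[OF h] bC[OF h]] bdd_on_add[OF b b]])
        fix k
        have "cmod (h n k - h l k) = cmod ((z k - h l k) - (z k - h n k))" by simp
        then show "cmod (h n k - h l k) \<le> cmod (z k - h n k) + cmod (z k - h l k)"
          using norm_triangle_ineq4[of "z k - h l k" "z k - h n k"] by simp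
      qed
      also have "\<dots> = m (\<lambda>k. cmod (z k - h n k)) + m (\<lambda>k. cmod (z k - h l k))" by (rule add[OF b b])
      also have "\<dots> < e" using z(2)[rule_format, OF that(1)] z(2)[rule_format, OF that(2)] by simp
      finally show ?thesis .
    qed
    then show ?thesis by blast
  qed
  have lims: "\<exists>\<mu>. positive_functional L \<mu> \<and> (\<forall>g. bdd_on L g \<longrightarrow> (\<lambda>n. m (\<lambda>k. g k * bump r d (h n k))) \<longlonglongrightarrow> \<mu> g)" for d
    by (rule bump_limit) (use r bC[OF h] Cauchy in auto)
  \<comment> \<open>The mesh is \<open>r / 2\<close> while the bumps have radius \<open>r\<close>,
    so at each point some bump is at least \<open>r / 2\<close>. The radius
    \<open>\<bar>M\<bar> + r\<close> also covers the values of \<open>\<phi>\<close>, which are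
    within \<open>r\<close> of values of members of \<open>C\<close>.\<close>
  obtain D where D: "finite D" "\<And>w. cmod w \<le> \<bar>M\<bar> + r \<Longrightarrow> \<exists>d\<in>D. cmod (w - d) < r / 2"
    using complex_net[of "r / 2" "\<bar>M\<bar> + r"] r by auto
  \<comment> \<open>If every bump at a centre of large real part lost its mass in the limit, the
    mean of \<open>Re (h n)\<close> would be at most \<open>c - 3 / 2 * r\<close> up to a null
    sequence, contrary to the choice of \<open>m\<close>.\<close>
  obtain d1 \<mu> where d1: "Re d1 > c - 2 * r" and \<mu>: "positive_functional L \<mu>"
    and \<mu>lim: "\<And>g. bdd_on L g \<Longrightarrow> (\<lambda>n. m (\<lambda>k. g k * bump r d1 (h n k))) \<longlonglongrightarrow> \<mu> g" and \<mu>1: "\<mu> (\<lambda>_. 1) > 0"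
  proof (rule ccontr)
    assume "\<not> thesis"
    then have *: "\<not> \<mu> (\<lambda>_. 1) > 0"
      if "Re d > c - 2 * r" "positive_functional L \<mu>"
        "\<And>g. bdd_on L g \<Longrightarrow> (\<lambda>n. m (\<lambda>k. g k * bump r d (h n k))) \<longlonglongrightarrow> \<mu> g" for d \<mu>
      using \<open>\<And>d1 \<mu>. \<lbrakk>c - 2 * r < Re d1; positive_functional L \<mu>;
        \<And>g. bdd_on L g \<Longrightarrow> (\<lambda>n. m (\<lambda>k. g k * bump r d1 (h n k))) \<longlonglongrightarrow> \<mu> g; 0 < \<mu> (\<lambda>_. 1)\<rbrakk> \<Longrightarrow> thesis\<close> that
      by blast
    have null: "(\<lambda>n. m (\<lambda>k. bump r d (h n k))) \<longlonglongrightarrow> 0" if d: "Re d > c - 2 * r" for d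
    proof -
      obtain \<mu> where \<mu>: "positive_functional L \<mu>" "\<And>g. bdd_on L g \<Longrightarrow> (\<lambda>n. m (\<lambda>k. g k * bump r d (h n k))) \<longlonglongrightarrow> \<mu> g"
        using lims[of d] by blast
      have "\<mu> (\<lambda>_. 1) \<ge> 0" by (rule positive_functional.nonneg[OF \<mu>(1)]) auto
      then have "\<mu> (\<lambda>_. 1) = 0" using *[OF d \<mu>] by simp
      then show ?thesis using \<mu>(2)[of "\<lambda>_. 1"] by simp
    qed
    define D' where "D' = {d \<in> D. Re d > c - 2 * r}"
    \<comment> \<open>Normalised by
      \<open>B * (r / 2) = \<bar>M\<bar> + \<bar>c\<bar> + 2 * r\<close>: one bump of size
      \<open>r / 2\<close> pays for the largest possible value of \<open>Re (h n k)\<close>.\<close>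
    define B where "B = (\<bar>M\<bar> + \<bar>c\<bar> + 2 * r) * (2 / r)"
    have B: "B \<ge> 0" using r by (simp add: B_def)
    have fD': "finite D'" using D(1) by (simp add: D'_def)
    have bb: "bdd_on L (\<lambda>k. \<Sum>d\<in>D'. bump r d (h n k))" for n
      by (intro bdd_on_sum bdd_on_bump) (use r in auto)
    have "c \<le> (c - 3 / 2 * r) + B * (\<Sum>d\<in>D'. m (\<lambda>k. bump r d (h n k)))" for n
    proof -
      have "m (\<lambda>k. Re (h n k)) \<le> m (\<lambda>k. (c - 3 / 2 * r) + B * (\<Sum>d\<in>D'. bump r d (h n k)))"
      proof (rule mono[OF bdd_Re[OF h] bdd_on_add[OF bdd_on_const bdd_on_mult[OF bdd_on_const bb]]])
        fix k assume "k \<in> L"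
        then have hM: "cmod (h n k) \<le> \<bar>M\<bar>" using M[OF h] by (meson abs_ge_self order_trans)
        then obtain d where d: "d \<in> D" "cmod (h n k - d) < r / 2" using D(2)[of "h n k"] r by auto
        show "Re (h n k) \<le> (c - 3 / 2 * r) + B * (\<Sum>d\<in>D'. bump r d (h n k))"
        proof (cases "d \<in> D'")
          case True
          have "r / 2 \<le> bump r d (h n k)" using d(2) r by (auto simp: bump_def)
          also have "\<dots> \<le> (\<Sum>d\<in>D'. bump r d (h n k))" by (rule member_le_sum) (use True fD' in auto)
          finally have "B * (r / 2) \<le> B * (\<Sum>d\<in>D'. bump r d (h n k))" using B by (intro mult_left_mono)
          moreover have "B * (r / 2) = \<bar>M\<bar> + \<bar>c\<bar> + 2 * r" using r by (simp add: B_def)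
          moreover have "Re (h n k) \<le> \<bar>M\<bar>" using complex_Re_le_cmod[of "h n k"] hM by simp
          ultimately show ?thesis using r by linarith
        next
          case False
          then have "Re d \<le> c - 2 * r" using d(1) by (auto simp: D'_def)
          moreover have "Re (h n k) - Re d \<le> r / 2" using complex_Re_le_cmod[of "h n k - d"] d(2) by simp
          moreover have "0 \<le> B * (\<Sum>d\<in>D'. bump r d (h n k))" using B by (simp add: sum_nonneg)
          ultimately show ?thesis by linarith
        qed
      qed
      also have "\<dots> = (c - 3 / 2 * r) + m (\<lambda>k. B * (\<Sum>d\<in>D'. bump r d (h n k)))"
        by (simp only: add[OF bdd_on_const bdd_on_mult[OF bdd_on_const bb]] const)
      also have "m (\<lambda>k. B * (\<Sum>d\<in>D'. bump r d (h n k))) = B * m (\<lambda>k. \<Sum>d\<in>D'. bump r d (h n k))" by (rule mult[OF bb])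
      also have "m (\<lambda>k. \<Sum>d\<in>D'. bump r d (h n k)) = (\<Sum>d\<in>D'. m (\<lambda>k. bump r d (h n k)))"
        by (rule sum[OF fD']) (use r in \<open>auto intro: bdd_on_bump\<close>)
      finally show ?thesis using m_ge[OF h[of n]] by simp
    qed
    moreover have "(\<lambda>n. (c - 3 / 2 * r) + B * (\<Sum>d\<in>D'. m (\<lambda>k. bump r d (h n k)))) \<longlonglongrightarrow> (c - 3 / 2 * r) + B * (\<Sum>d\<in>D'. 0)"
      by (intro tendsto_intros null) (auto simp: D'_def)
    ultimately have "c \<le> (c - 3 / 2 * r) + B * (\<Sum>d\<in>D'. 0)" by (intro LIMSEQ_le_const) auto
    then show False using r by simp
  qed
  interpret \<mu>: positive_functional L \<mu> by fact
  have net: "\<exists>d\<in>D. cmod (\<phi> k - d) < r" if k: "k \<in> L" for k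
  proof -
    obtain z where "z \<in> C" "cmod (z k - \<phi> k) < r" using approx[of "{k}" r] r k by auto
    then have "cmod (\<phi> k) \<le> \<bar>M\<bar> + r"
      using M[of z k] norm_triangle_ineq2[of "\<phi> k" "z k"] k by (auto simp: norm_minus_commute)
    then obtain d where "d \<in> D" "cmod (\<phi> k - d) < r / 2" using D(2) by blast
    then show ?thesis using r by (intro bexI[of _ d]) auto
  qed
  have "\<exists>d0\<in>D. \<exists>g0. continuous_on L g0 \<and> (\<forall>k\<in>L. g0 k \<ge> 0) \<and> \<mu> g0 > 0 \<and>
     (\<forall>g. continuous_on L g \<longrightarrow> (\<forall>k\<in>L. g k \<ge> 0) \<longrightarrow> \<mu> (\<lambda>k. g0 k * g k) > 0 \<longrightarrow>
        (\<exists>k\<in>supp L \<mu>. g0 k * g k > 0 \<and> cmod (\<phi> k - d0) < r))"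
    by (rule localize_value[OF \<mu> L(1) \<mu>1 D(1)]) (rule net)
  then obtain d0 g0 where dg: "continuous_on L g0 \<and> (\<forall>k\<in>L. g0 k \<ge> 0) \<and> \<mu> g0 > 0 \<and>
     (\<forall>g. continuous_on L g \<longrightarrow> (\<forall>k\<in>L. g k \<ge> 0) \<longrightarrow> \<mu> (\<lambda>k. g0 k * g k) > 0 \<longrightarrow>
        (\<exists>k\<in>supp L \<mu>. g0 k * g k > 0 \<and> cmod (\<phi> k - d0) < r))"
    by (elim bexE exE) (erule that)
  then have g0: "continuous_on L g0" "\<And>k. k \<in> L \<Longrightarrow> g0 k \<ge> 0" "\<mu> g0 > 0" by simp_all
  have d0: "\<exists>k\<in>supp L \<mu>. g0 k * g k > 0 \<and> cmod (\<phi> k - d0) < r"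
    if "continuous_on L g" "\<And>k. k \<in> L \<Longrightarrow> g k \<ge> 0" "\<mu> (\<lambda>k. g0 k * g k) > 0" for g
    using dg[THEN conjunct2, THEN conjunct2, THEN conjunct2, rule_format, of g] that by simp
  define P where "P g \<longleftrightarrow> continuous_on L g \<and> (\<forall>k\<in>L. g k \<ge> 0) \<and> \<mu> (\<lambda>k. g0 k * g k) > 0" for g
  have "\<exists>z :: nat \<Rightarrow> _. (\<forall>i. z i \<in> C) \<and>
     (\<forall>n \<sigma>. P (\<lambda>k. \<Prod>i<n. if \<sigma> i then bump (2 * r) d1 (z i k) else bump (2 * r) d0 (z i k)))"
  proof (rule independent_cells)
    show "P (\<lambda>_. 1)" using g0 by (auto simp: P_def)
  next
    fix \<H> assume fin: "finite \<H>" and PH: "\<And>g. g \<in> \<H> \<Longrightarrow> P g"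
    \<comment> \<open>One point of the support per cell is enough for the low value: a continuous
      function near \<open>d0\<close> at a support point is near \<open>d0\<close> on positive mass.
      This is why control of \<open>\<phi>\<close> at finitely many points suffices.\<close>
    have "\<forall>g\<in>\<H>. \<exists>k. k \<in> supp L \<mu> \<and> g0 k * g k > 0 \<and> cmod (\<phi> k - d0) < r"
      using PH d0 unfolding P_def by blast
    from bchoice[OF this] obtain k where k: "\<forall>g\<in>\<H>. k g \<in> supp L \<mu> \<and> g0 (k g) * g (k g) > 0 \<and> cmod (\<phi> (k g) - d0) < r" ..
    have "\<forall>g\<in>\<H>. \<exists>B>0. \<forall>k\<in>L. \<bar>g0 k * g k\<bar> \<le> B"
    proof
      fix g assume "g \<in> \<H>"
      then have "bdd_on L (\<lambda>k. g0 k * g k)"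
        using PH g0(1) by (intro bdd_on_continuous[OF L(1)] continuous_on_mult) (auto simp: P_def)
      then obtain B where "\<forall>k\<in>L. \<bar>g0 k * g k\<bar> \<le> B" by (auto simp: bdd_on_def)
      then show "\<exists>B>0. \<forall>k\<in>L. \<bar>g0 k * g k\<bar> \<le> B" by (intro exI[of _ "\<bar>B\<bar> + 1"]) force
    qed
    then have "\<forall>g\<in>\<H>. \<exists>B. B > 0 \<and> (\<forall>k\<in>L. \<bar>g0 k * g k\<bar> \<le> B)" by blast
    from bchoice[OF this] obtain B where B: "\<forall>g\<in>\<H>. B g > 0 \<and> (\<forall>k\<in>L. \<bar>g0 k * g k\<bar> \<le> B g)" ..
    \<comment> \<open>The \<open>L\<^sup>1\<close> distance to the tail of \<open>h\<close> has to
      be small against the mass of every one of the finitely many cells, relative to their bounds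
      \<open>B g\<close>.\<close>
    obtain \<eta> where \<eta>: "\<eta> > 0" "\<And>g. g \<in> \<H> \<Longrightarrow> B g * \<eta> < \<mu> (\<lambda>k. g0 k * g k)"
    proof -
      define \<eta> where "\<eta> = Min (insert 1 ((\<lambda>g. \<mu> (\<lambda>k. g0 k * g k) / (2 * B g)) ` \<H>))"
      have p: "\<mu> (\<lambda>k. g0 k * g k) > 0" "B g > 0" if "g \<in> \<H>" for g using PH[OF that] B that by (auto simp: P_def)
      have "\<eta> > 0" unfolding \<eta>_def using fin p by (subst Min_gr_iff) auto
      moreover have "B g * \<eta> < \<mu> (\<lambda>k. g0 k * g k)" if "g \<in> \<H>" for g
      proof -
        have "\<eta> \<le> \<mu> (\<lambda>k. g0 k * g k) / (2 * B g)" unfolding \<eta>_def using fin that by (intro Min_le) auto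
        then have "B g * \<eta> \<le> B g * (\<mu> (\<lambda>k. g0 k * g k) / (2 * B g))"
          using p[OF that] by (intro mult_left_mono) auto
        also have "\<dots> = \<mu> (\<lambda>k. g0 k * g k) / 2" using p(2)[OF that] by simp
        finally show ?thesis using p(1)[OF that] by linarith
      qed
      ultimately show ?thesis using that by blast
    qed
    have "finite (k ` \<H>)" "k ` \<H> \<subseteq> L" using fin k by (auto simp: supp_def)
    from near[OF \<eta>(1) CG[OF this r]] obtain z N where z: "z \<in> C" "\<And>g. g \<in> \<H> \<Longrightarrow> cmod (z (k g) - \<phi> (k g)) < r"
      "\<forall>n\<ge>N. m (\<lambda>k. cmod (z k - h n k)) < \<eta>" by auto
    show "\<exists>z\<in>C. \<forall>g\<in>\<H>. P (\<lambda>k. g k * bump (2 * r) d0 (z k)) \<and> P (\<lambda>k. g k * bump (2 * r) d1 (z k))"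
    proof (intro bexI[OF _ z(1)] ballI conjI)
      fix g assume g: "g \<in> \<H>"
      have Pg: "continuous_on L g" "\<forall>k\<in>L. g k \<ge> 0" using PH[OF g] by (auto simp: P_def)
      have cb: "continuous_on L (\<lambda>k. bump (2 * r) d (z k))" for d by (rule continuous_on_bump[OF cont[OF z(1)]])
      have "cmod (z (k g) - d0) < 2 * r"
        using z(2)[OF g] k g norm_triangle_ineq[of "z (k g) - \<phi> (k g)" "\<phi> (k g) - d0"] by force
      then have "bump (2 * r) d0 (z (k g)) > 0" by (simp add: bump_pos_iff)
      then have "g0 (k g) * (g (k g) * bump (2 * r) d0 (z (k g))) > 0" using k g by (simp add: mult.assoc[symmetric])
      moreover have "continuous_on L (\<lambda>x. g0 x * (g x * bump (2 * r) d0 (z x)))"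
        by (intro continuous_on_mult g0 Pg cb)
      moreover have "\<forall>x\<in>L. g0 x * (g x * bump (2 * r) d0 (z x)) \<ge> 0" using g0(2) Pg(2) by simp
      moreover have "k g \<in> supp L \<mu>" using k g by blast
      ultimately have "\<mu> (\<lambda>x. g0 x * (g x * bump (2 * r) d0 (z x))) > 0" unfolding supp_def by blast
      then show "P (\<lambda>k. g k * bump (2 * r) d0 (z k))"
        unfolding P_def using Pg cb by (auto intro!: continuous_on_mult)
      define G where "G k = g0 k * g k" for k
      have cG: "continuous_on L G" unfolding G_def by (intro continuous_on_mult g0 Pg)
      have bG: "bdd_on L G" by (rule bdd_on_continuous[OF L(1) cG])
      have G0: "G k \<ge> 0" if "k \<in> L" for k using g0(2) Pg(2) that by (simp add: G_def)
      have GB: "G k \<le> B g" if "k \<in> L" for k using B g that unfolding G_def by force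
      have Bg: "B g > 0" using B g by blast
      have bz: "bdd_on L (\<lambda>k. bump (2 * r) d1 (z k))" by (rule bdd_on_bump) (use r in simp)
      have bGz: "bdd_on L (\<lambda>k. G k * bump (2 * r) d1 (z k))" by (rule bdd_on_mult[OF bG bz])
      \<comment> \<open>Where \<open>h n\<close> is within \<open>r\<close> of \<open>d1\<close>,
        the bump of radius \<open>2 * r\<close> at \<open>z\<close> is at least
        \<open>r - cmod (z k - h n k)\<close>. Integrating this against the cell keeps most of its
        mass near \<open>d1\<close>.\<close>
      have ineq: "r * m (\<lambda>k. G k * bump r d1 (h n k)) - r * B g * \<eta> \<le> m (\<lambda>k. (G k * bump (2 * r) d1 (z k)) * bump r d1 (h n k))" if "n \<ge> N" for n
      proof -
        have bh: "bdd_on L (\<lambda>k. bump r d1 (h n k))" by (rule bdd_on_bump) (use r in simp)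
        have bzh: "bdd_on L (\<lambda>k. cmod (z k - h n k))" by (rule bdd_on_cmod_diff[OF bC[OF z(1)] bC[OF h]])
        note b1 = bdd_on_mult[OF bdd_on_const bdd_on_mult[OF bG bh], of r]
        note b2 = bdd_on_mult[OF bdd_on_const bzh, of "r * B g"]
        have "m (\<lambda>k. r * (G k * bump r d1 (h n k)) - (r * B g) * cmod (z k - h n k))
            \<le> m (\<lambda>k. (G k * bump (2 * r) d1 (z k)) * bump r d1 (h n k))"
        proof (rule mono[OF bdd_on_diff[OF b1 b2] bdd_on_mult[OF bGz bh]])
          fix k assume "k \<in> L"
          have "bump r d1 (h n k) * (r - cmod (z k - h n k)) \<le> bump r d1 (h n k) * bump (2 * r) d1 (z k)"
          proof (cases "bump r d1 (h n k) > 0")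
            case True
            then have "cmod (h n k - d1) < r" by (simp add: bump_pos_iff)
            then have "r - cmod (z k - h n k) \<le> bump (2 * r) d1 (z k)"
              using norm_triangle_ineq[of "z k - h n k" "h n k - d1"] by (auto simp: bump_def)
            then show ?thesis by (intro mult_left_mono) auto
          next
            case False
            then have "bump r d1 (h n k) = 0" using bump_nonneg[of r d1 "h n k"] by linarith
            then show ?thesis by simp
          qed
          then have 1: "G k * (bump r d1 (h n k) * (r - cmod (z k - h n k))) \<le> G k * (bump r d1 (h n k) * bump (2 * r) d1 (z k))"
            using G0[OF \<open>k \<in> L\<close>] by (rule mult_left_mono)
          have "(bump r d1 (h n k) * G k) * cmod (z k - h n k) \<le> (r * B g) * cmod (z k - h n k)"
            using bump_le[of r d1 "h n k"] r GB G0 \<open>k \<in> L\<close> by (intro mult_right_mono mult_mono) auto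
          with 1 show "r * (G k * bump r d1 (h n k)) - (r * B g) * cmod (z k - h n k)
              \<le> (G k * bump (2 * r) d1 (z k)) * bump r d1 (h n k)" by (simp add: algebra_simps)
        qed
        moreover have "m (\<lambda>k. r * (G k * bump r d1 (h n k)) - (r * B g) * cmod (z k - h n k))
            = r * m (\<lambda>k. G k * bump r d1 (h n k)) - (r * B g) * m (\<lambda>k. cmod (z k - h n k))"
          by (simp only: diff[OF b1 b2] mult[OF bdd_on_mult[OF bG bh]] mult[OF bzh])
        moreover have "(r * B g) * m (\<lambda>k. cmod (z k - h n k)) \<le> (r * B g) * \<eta>"
          using z(3)[rule_format, OF that] r Bg by (intro mult_left_mono) auto
        ultimately show ?thesis by linarith
      qed
      have "(\<lambda>n. r * m (\<lambda>k. G k * bump r d1 (h n k)) - r * B g * \<eta>) \<longlonglongrightarrow> r * \<mu> G - r * B g * \<eta>"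
        by (intro tendsto_intros \<mu>lim bG)
      from LIMSEQ_le[OF this \<mu>lim[OF bGz]] ineq
      have "r * \<mu> G - r * B g * \<eta> \<le> \<mu> (\<lambda>k. G k * bump (2 * r) d1 (z k))" by blast
      moreover have "r * (B g * \<eta>) < r * \<mu> G" using \<eta>(2)[OF g] r unfolding G_def by (intro mult_strict_left_mono)
      ultimately have "\<mu> (\<lambda>k. G k * bump (2 * r) d1 (z k)) > 0" by (simp add: mult.assoc)
      then show "P (\<lambda>k. g k * bump (2 * r) d1 (z k))"
        unfolding P_def using Pg cb by (auto intro!: continuous_on_mult simp: G_def mult.assoc)
    qed
  qed
  then obtain z :: "nat \<Rightarrow> 'a \<Rightarrow> complex" where z: "\<And>i. z i \<in> C"
    "\<And>n \<sigma>. P (\<lambda>k. \<Prod>i<n. if \<sigma> i then bump (2 * r) d1 (z i k) else bump (2 * r) d0 (z i k))" by blast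
  have ind: "\<exists>k\<in>L. \<forall>i<n. cmod (z i k - (if \<sigma> i then d1 else d0)) < 2 * r" for n \<sigma>
  proof -
    \<comment> \<open>The whole cell has positive mass, so it is positive at some point, and there
      none of the bump factors vanishes.\<close>
    obtain k where k: "k \<in> supp L \<mu>" "g0 k * (\<Prod>i<n. if \<sigma> i then bump (2 * r) d1 (z i k) else bump (2 * r) d0 (z i k)) > 0"
      using d0 z(2)[where n = n and \<sigma> = \<sigma>] unfolding P_def by blast
    then have "(\<Prod>i<n. if \<sigma> i then bump (2 * r) d1 (z i k) else bump (2 * r) d0 (z i k)) \<noteq> 0" by fastforce
    then have nz: "(if \<sigma> i then bump (2 * r) d1 (z i k) else bump (2 * r) d0 (z i k)) \<noteq> 0" if "i < n" for i
      using that by (subst (asm) prod_zero_iff) auto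
    have "bump (2 * r) (if \<sigma> i then d1 else d0) (z i k) > 0" if "i < n" for i
    proof -
      have "bump (2 * r) (if \<sigma> i then d1 else d0) (z i k) \<noteq> 0" using nz[OF that] by (cases "\<sigma> i") simp_all
      then show ?thesis using bump_nonneg[of "2 * r" "if \<sigma> i then d1 else d0" "z i k"] by linarith
    qed
    then show ?thesis using k(1) by (intro bexI[of _ k]) (auto simp: bump_pos_iff supp_def)
  qed
  have gap: "4 * (2 * r) < cmod (d1 - d0)"
  proof -
    obtain k where "k \<in> supp L \<mu>" "cmod (\<phi> k - d0) < r" using d0[of "\<lambda>_. 1"] g0(3) by auto
    then have "Re d0 \<le> \<beta> + r"
      using low[of k] complex_Re_le_cmod[of "d0 - \<phi> k"] by (auto simp: supp_def norm_minus_commute)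
    moreover have "Re d1 - Re d0 \<le> cmod (d1 - d0)" using complex_Re_le_cmod[of "d1 - d0"] by simp
    ultimately show ?thesis using d1 r r20 unfolding c_def by linarith
  qed
  define \<delta> where "\<delta> = (cmod (d1 - d0) / 2 - 2 * (2 * r)) / 2"
  have "\<delta> > 0" using gap by (simp add: \<delta>_def)
  moreover have "\<exists>k\<in>L. \<delta> * (\<Sum>i<n. cmod (c i)) \<le> cmod (\<Sum>i<n. c i * z i k)" for n c
    unfolding \<delta>_def by (rule independent_imp_l1[OF gap ind])
  ultimately show ?thesis using z(1) by blast
qed

section \<open>Support points of functionals on spaces of continuous functions\<close>

definition snorm :: "'a set \<Rightarrow> ('a \<Rightarrow> complex) \<Rightarrow> real" where
  "snorm K z = (SUP k\<in>K. cmod (z k))"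

lemma snorm_upper:
  assumes "compact K" "continuous_on K z" "k \<in> K" shows "cmod (z k) \<le> snorm K z"
proof -
  obtain B where "\<forall>k\<in>K. \<bar>cmod (z k)\<bar> \<le> B"
    using bdd_on_continuous[OF assms(1) continuous_on_norm[OF assms(2)]] by (auto simp: bdd_on_def)
  then show ?thesis unfolding snorm_def using assms(3) by (intro cSUP_upper) (auto intro!: bdd_aboveI[of _ B])
qed

lemma snorm_least: "K \<noteq> {} \<Longrightarrow> (\<And>k. k \<in> K \<Longrightarrow> cmod (z k) \<le> c) \<Longrightarrow> snorm K z \<le> c"
  unfolding snorm_def by (rule cSUP_least)

lemma snorm_attained:
  assumes "compact K" "K \<noteq> {}" "continuous_on K z" shows "\<exists>k\<in>K. cmod (z k) = snorm K z"
proof -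
  obtain k where "k \<in> K" "\<forall>y\<in>K. cmod (z y) \<le> cmod (z k)"
    using continuous_attains_sup[OF assms(1,2) continuous_on_norm[OF assms(3)]] by blast
  then show ?thesis using snorm_least[OF assms(2)] snorm_upper[OF assms(1,3)] by (intro bexI[of _ k] antisym) auto
qed

text \<open>Only real scalars are required of \<open>V\<close>, so function spaces over either field
  fit in after embedding the scalars into the complex numbers. Accordingly the functionals below are
  real, standing for real parts.\<close>

locale fun_space =
  fixes K :: "'a::topological_space set" and V :: "('a \<Rightarrow> complex) set"
  assumes K: "compact K" "K \<noteq> {}"
    and cont: "z \<in> V \<Longrightarrow> continuous_on K z"
    and zero: "(\<lambda>_. 0) \<in> V"
    and add: "z \<in> V \<Longrightarrow> w \<in> V \<Longrightarrow> (\<lambda>k. z k + w k) \<in> V"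
    and scale: "z \<in> V \<Longrightarrow> (\<lambda>k. r *\<^sub>R z k) \<in> V"
begin

lemma snorm_ge: "continuous_on K z \<Longrightarrow> k \<in> K \<Longrightarrow> cmod (z k) \<le> snorm K z"
  by (rule snorm_upper[OF K(1)])

lemma snorm_nonneg: "continuous_on K z \<Longrightarrow> snorm K z \<ge> 0"
  using snorm_ge K(2) norm_ge_zero order_trans by blast

lemma snorm_add:
  assumes "continuous_on K z" "continuous_on K w"
  shows "snorm K (\<lambda>k. z k + w k) \<le> snorm K z + snorm K w"
  by (rule snorm_least[OF K(2)]) (meson add_mono assms norm_triangle_ineq order_trans snorm_ge)

lemma snorm_scale:
  assumes "continuous_on K z" shows "snorm K (\<lambda>k. r *\<^sub>R z k) = \<bar>r\<bar> * snorm K z"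
proof -
  obtain k where k: "k \<in> K" "cmod (z k) = snorm K z" using snorm_attained[OF K assms] by blast
  have "snorm K (\<lambda>k. r *\<^sub>R z k) \<le> \<bar>r\<bar> * snorm K z"
    by (rule snorm_least[OF K(2)]) (auto intro!: mult_left_mono snorm_ge assms)
  moreover have "\<bar>r\<bar> * snorm K z \<le> snorm K (\<lambda>k. r *\<^sub>R z k)"
    using snorm_ge[OF continuous_on_scaleR[OF continuous_on_const assms] k(1), of r] k(2) by simp
  ultimately show ?thesis by simp
qed

lemma diff: "z \<in> V \<Longrightarrow> w \<in> V \<Longrightarrow> (\<lambda>k. z k - w k) \<in> V"
  using add[of z "\<lambda>k. (- 1) *\<^sub>R w k"] scale[of w "- 1"] by simp

lemma snorm_diff_le:
  assumes "continuous_on K z" "continuous_on K w"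
  shows "\<bar>snorm K z - snorm K w\<bar> \<le> snorm K (\<lambda>k. z k - w k)"
proof -
  have d: "continuous_on K (\<lambda>k. z k - w k)" "continuous_on K (\<lambda>k. w k - z k)"
    using assms by (auto intro!: continuous_intros)
  have "snorm K z \<le> snorm K (\<lambda>k. z k - w k) + snorm K w" using snorm_add[OF d(1) assms(2)] by simp
  moreover have "snorm K w \<le> snorm K (\<lambda>k. w k - z k) + snorm K z" using snorm_add[OF d(2) assms(1)] by simp
  moreover have "snorm K (\<lambda>k. w k - z k) = snorm K (\<lambda>k. z k - w k)" by (simp add: snorm_def norm_minus_commute)
  ultimately show ?thesis by linarith
qed

definition functional :: "(('a \<Rightarrow> complex) \<Rightarrow> real) \<Rightarrow> real \<Rightarrow> bool" where
  "functional f M \<longleftrightarrow> (\<forall>z\<in>V. \<forall>w\<in>V. f (\<lambda>k. z k + w k) = f z + f w) \<and>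
     (\<forall>r. \<forall>z\<in>V. f (\<lambda>k. r *\<^sub>R z k) = r * f z) \<and> (\<forall>z\<in>V. f z \<le> M * snorm K z)"

lemma
  assumes "functional f M" "z \<in> V"
  shows functional_add: "w \<in> V \<Longrightarrow> f (\<lambda>k. z k + w k) = f z + f w"
    and functional_scale: "f (\<lambda>k. r *\<^sub>R z k) = r * f z"
    and functional_le: "f z \<le> M * snorm K z"
  using assms by (simp_all add: functional_def)

lemma functional_abs:
  assumes "functional f M" "z \<in> V" shows "\<bar>f z\<bar> \<le> M * snorm K z"
proof -
  have "f (\<lambda>k. (- 1) *\<^sub>R z k) = (- 1) * f z" by (rule functional_scale[OF assms])
  moreover have "f (\<lambda>k. (- 1) *\<^sub>R z k) \<le> M * snorm K (\<lambda>k. (- 1) *\<^sub>R z k)"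
    by (rule functional_le[OF assms(1) scale[OF assms(2)]])
  moreover have "f z \<le> M * snorm K z" by (rule functional_le[OF assms])
  ultimately show ?thesis using snorm_scale[OF cont[OF assms(2)], of "- 1"] by auto
qed

text \<open>Membership in the uniform closure of \<open>V\<close>. The space \<open>V\<close>
  consists of algebraic tensors in the applications and is not complete.\<close>

definition ulimit :: "('a \<Rightarrow> complex) \<Rightarrow> bool" where
  "ulimit u \<longleftrightarrow> continuous_on K u \<and> (\<exists>z. (\<forall>n::nat. z n \<in> V) \<and> (\<lambda>n. snorm K (\<lambda>k. z n k - u k)) \<longlonglongrightarrow> 0)"

text \<open>Ekeland's variational principle for \<open>G z = (snorm K z)\<^sup>2 / 2 - f z\<close>,
  which is bounded below by \<open>- (M\<^sup>2 / 2)\<close> on completing the square. The iteration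
  stays in \<open>V\<close>, where \<open>f\<close> is defined, and only its limit leaves it; so the
  inequality compares \<open>u\<close> with its translates along \<open>V\<close>, and
  \<open>f u\<close> never occurs.\<close>

lemma almost_minimizer:
  assumes f: "functional f M" and \<epsilon>: "\<epsilon> > 0"
  shows "\<exists>u. ulimit u \<and> (\<forall>z\<in>V. \<forall>t>0. (snorm K u)\<^sup>2 / 2 - \<epsilon> * (t * snorm K z) \<le> (snorm K (\<lambda>k. u k + t *\<^sub>R z k))\<^sup>2 / 2 - t * f z)"
proof -
  define G where "G z = (snorm K z)\<^sup>2 / 2 - f z" for z
  have Gbelow: "G z \<ge> - (M\<^sup>2 / 2)" if "z \<in> V" for z
  proof -
    have "f z \<le> M * snorm K z" by (rule functional_le[OF f that])
    moreover have "0 \<le> (snorm K z - M)\<^sup>2" by simp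
    ultimately show ?thesis unfolding G_def power2_diff by (simp add: field_simps)
  qed
  \<comment> \<open>The Ekeland order: a move from \<open>z\<close> to \<open>y\<close> must lower
    \<open>G\<close> by \<open>\<epsilon>\<close> times the distance. Each iterate almost minimises
    \<open>G\<close> over the admissible moves.\<close>
  define S where "S z = {y \<in> V. G y \<le> G z - \<epsilon> * snorm K (\<lambda>k. y k - z k)}" for z
  have s0: "snorm K (\<lambda>_. 0) = 0" using snorm_scale[of "\<lambda>_. 0" 0] by simp
  have "\<exists>z. \<forall>n::nat. z n \<in> V \<and> (z (Suc n) \<in> S (z n) \<and> (\<forall>y\<in>S (z n). G (z (Suc n)) \<le> G y + (1/2)^n))"
  proof (rule dependent_nat_choice)
    show "\<exists>x. x \<in> V" using zero by blast
    fix x and n :: nat assume x: "x \<in> V"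
    have xS: "x \<in> S x" using x s0 by (simp add: S_def)
    have bb: "bdd_below (G ` S x)" using Gbelow by (intro bdd_belowI[of _ "- (M\<^sup>2 / 2)"]) (auto simp: S_def)
    have "Inf (G ` S x) < Inf (G ` S x) + (1/2)^n" by simp
    then obtain y where y: "y \<in> S x" "G y < Inf (G ` S x) + (1/2)^n"
      using cInf_lessD[of "G ` S x"] xS by blast
    have "G y \<le> G y' + (1/2)^n" if "y' \<in> S x" for y'
      using cInf_lower[OF imageI[OF that] bb] y(2) by linarith
    then show "\<exists>y. y \<in> V \<and> (y \<in> S x \<and> (\<forall>y'\<in>S x. G y \<le> G y' + (1/2)^n))"
      using y(1) by (intro exI[of _ y]) (auto simp: S_def)
  qed
  then obtain z where zV: "\<And>n::nat. z n \<in> V" and zS: "\<And>n. z (Suc n) \<in> S (z n)"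
    and zmin: "\<And>n y. y \<in> S (z n) \<Longrightarrow> G (z (Suc n)) \<le> G y + (1/2)^n" by blast
  have step: "\<epsilon> * snorm K (\<lambda>k. z (Suc n) k - z n k) \<le> G (z n) - G (z (Suc n))" for n
    using zS[of n] by (simp add: S_def)
  have dec: "decseq (\<lambda>n. G (z n))"
  proof (rule decseq_SucI)
    fix n show "G (z (Suc n)) \<le> G (z n)"
      using step[of n] mult_nonneg_nonneg[OF less_imp_le[OF \<epsilon>] snorm_nonneg[OF cont[OF diff[OF zV zV]]], of "Suc n" n] by linarith
  qed
  obtain g where g: "(\<lambda>n. G (z n)) \<longlonglongrightarrow> g"
    using decseq_convergent[OF dec, of "- (M\<^sup>2 / 2)"] Gbelow[OF zV] by blast
  have tele: "\<epsilon> * snorm K (\<lambda>k. z (n + p) k - z n k) \<le> G (z n) - G (z (n + p))" for n p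
  proof (induction p)
    case (Suc p)
    have "snorm K (\<lambda>k. z (n + Suc p) k - z n k)
        \<le> snorm K (\<lambda>k. z (Suc (n + p)) k - z (n + p) k) + snorm K (\<lambda>k. z (n + p) k - z n k)"
      using snorm_add[OF cont[OF diff[OF zV zV]] cont[OF diff[OF zV zV]], of "Suc (n + p)" "n + p" "n + p" n] by simp
    then have "\<epsilon> * snorm K (\<lambda>k. z (n + Suc p) k - z n k)
        \<le> \<epsilon> * snorm K (\<lambda>k. z (Suc (n + p)) k - z (n + p) k) + \<epsilon> * snorm K (\<lambda>k. z (n + p) k - z n k)"
      using \<epsilon> mult_left_mono[OF _ less_imp_le[OF \<epsilon>]] by (simp only: distrib_left[symmetric])
    then show ?case using step[of "n + p"] Suc by simp
  qed (use s0 in simp)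
  have close: "\<exists>N. \<forall>n\<ge>N. \<forall>p\<ge>N. snorm K (\<lambda>k. z p k - z n k) < e" if "e > 0" for e
  proof -
    have "Cauchy (\<lambda>n. G (z n))" using g by (rule LIMSEQ_imp_Cauchy)
    then obtain N where N: "\<And>m n. m \<ge> N \<Longrightarrow> n \<ge> N \<Longrightarrow> \<bar>G (z m) - G (z n)\<bar> < \<epsilon> * e"
      using CauchyD[of "\<lambda>n. G (z n)" "\<epsilon> * e"] \<epsilon> \<open>e > 0\<close> by auto
    have le: "snorm K (\<lambda>k. z p k - z n k) < e" if "n \<ge> N" "p \<ge> n" for n p
    proof -
      have "\<epsilon> * snorm K (\<lambda>k. z p k - z n k) < \<epsilon> * e" using tele[of n "p - n"] N[of n p] that by auto
      then show ?thesis using \<epsilon> by simp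
    qed
    have "snorm K (\<lambda>k. z p k - z n k) = snorm K (\<lambda>k. z n k - z p k)" for n p by (simp add: snorm_def norm_minus_commute)
    then have "snorm K (\<lambda>k. z p k - z n k) < e" if "n \<ge> N" "p \<ge> N" for n p
      using le[of n p] le[of p n] that by (cases "n \<le> p") simp_all
    then show ?thesis by blast
  qed
  have "uniformly_Cauchy_on K z"
    unfolding uniformly_Cauchy_on_def dist_norm
  proof (intro allI impI)
    fix e :: real assume "e > 0"
    from close[OF this] obtain N where N: "\<forall>n\<ge>N. \<forall>p\<ge>N. snorm K (\<lambda>k. z p k - z n k) < e" ..
    have "cmod (z p x - z n x) < e" if "x \<in> K" "n \<ge> N" "p \<ge> N" for x n p
      using snorm_ge[OF cont[OF diff[OF zV zV]] that(1), of p n] N[rule_format, OF that(2,3)] by simp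
    then show "\<exists>M. \<forall>x\<in>K. \<forall>m\<ge>M. \<forall>n\<ge>M. cmod (z m x - z n x) < e" by blast
  qed
  then obtain u where u: "uniform_limit K z u sequentially"
    using Cauchy_uniformly_convergent unfolding uniformly_convergent_on_def by blast
  have cu: "continuous_on K u"
    by (rule uniform_limit_theorem[OF _ u]) (auto intro: always_eventually cont zV)
  have lim: "(\<lambda>n. snorm K (\<lambda>k. z n k - u k)) \<longlonglongrightarrow> 0"
  proof (rule LIMSEQ_I)
    fix e :: real assume "e > 0"
    then have "\<forall>\<^sub>F n in sequentially. \<forall>x\<in>K. dist (z n x) (u x) < e / 2"
      using uniform_limitD[OF u, of "e / 2"] by simp
    then obtain N where N: "\<And>n x. n \<ge> N \<Longrightarrow> x \<in> K \<Longrightarrow> cmod (z n x - u x) \<le> e / 2"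
      unfolding eventually_sequentially dist_norm by (meson less_imp_le)
    have "norm (snorm K (\<lambda>k. z n k - u k) - 0) < e" if "n \<ge> N" for n
    proof -
      have "snorm K (\<lambda>k. z n k - u k) \<le> e / 2" by (rule snorm_least[OF K(2)]) (use N that in auto)
      moreover have "0 \<le> snorm K (\<lambda>k. z n k - u k)"
        by (rule snorm_nonneg) (intro continuous_intros cont zV cu)
      ultimately show ?thesis using \<open>e > 0\<close> by simp
    qed
    then show "\<exists>N. \<forall>n\<ge>N. norm (snorm K (\<lambda>k. z n k - u k) - 0) < e" by blast
  qed
  have limz: "(\<lambda>n. snorm K (\<lambda>k. z n k + t *\<^sub>R y k)) \<longlonglongrightarrow> snorm K (\<lambda>k. u k + t *\<^sub>R y k)" if "y \<in> V" for y t
  proof (rule LIM_zero_cancel, rule Lim_null_comparison[OF always_eventually lim], intro allI)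
    fix n
    show "norm (snorm K (\<lambda>k. z n k + t *\<^sub>R y k) - snorm K (\<lambda>k. u k + t *\<^sub>R y k)) \<le> snorm K (\<lambda>k. z n k - u k)"
      using snorm_diff_le[OF continuous_on_add[OF cont[OF zV] cont[OF scale[OF that]]]
          continuous_on_add[OF cu cont[OF scale[OF that]]], of n t t] by simp
  qed
  have limu: "(\<lambda>n. snorm K (z n)) \<longlonglongrightarrow> snorm K u" using limz[OF zero, of 0] by simp
  have "(snorm K u)\<^sup>2 / 2 - \<epsilon> * (t * snorm K y) \<le> (snorm K (\<lambda>k. u k + t *\<^sub>R y k))\<^sup>2 / 2 - t * f y"
    if y: "y \<in> V" and t: "t > 0" for y t
  proof (rule ccontr)
    assume neg: "\<not> ?thesis"
    define d where "d = ((snorm K (\<lambda>k. u k + t *\<^sub>R y k))\<^sup>2 / 2 - t * f y) - (snorm K u)\<^sup>2 / 2"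
    have d: "d < - (\<epsilon> * (t * snorm K y))" using neg by (simp add: d_def)
    have d0: "d < 0" using d mult_nonneg_nonneg[OF less_imp_le[OF \<epsilon>] mult_nonneg_nonneg[OF less_imp_le[OF t] snorm_nonneg[OF cont[OF y]]]] by linarith
    define y' where "y' n = (\<lambda>k. z n k + t *\<^sub>R y k)" for n
    have y'V: "y' n \<in> V" for n unfolding y'_def by (intro add scale zV y)
    have fy': "f (y' n) = f (z n) + t * f y" for n
      unfolding y'_def by (simp only: functional_add[OF f zV scale[OF y]] functional_scale[OF f y])
    have "(\<lambda>n. G (y' n) - G (z n)) \<longlonglongrightarrow> d"
    proof -
      have "(\<lambda>n. ((snorm K (y' n))\<^sup>2 / 2 - t * f y) - (snorm K (z n))\<^sup>2 / 2) \<longlonglongrightarrow> d"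
        unfolding d_def y'_def by (intro tendsto_intros limz y limu) auto
      then show ?thesis by (simp add: G_def fy' algebra_simps)
    qed
    note dlim = this
    then have "\<forall>\<^sub>F n in sequentially. G (y' n) - G (z n) < - (\<epsilon> * (t * snorm K y))" using d by (rule order_tendstoD)
    then have ev: "\<forall>\<^sub>F n in sequentially. G (z (Suc n)) \<le> G (z n) + (G (y' n) - G (z n)) + (1/2)^n"
    proof (rule eventually_mono)
      fix n assume a: "G (y' n) - G (z n) < - (\<epsilon> * (t * snorm K y))"
      have "snorm K (\<lambda>k. y' n k - z n k) = t * snorm K y"
        using snorm_scale[OF cont[OF y], of t] t by (simp add: y'_def)
      then have "y' n \<in> S (z n)" using a y'V by (simp add: S_def)
      then show "G (z (Suc n)) \<le> G (z n) + (G (y' n) - G (z n)) + (1/2)^n" using zmin by simp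
    qed
    have "(\<lambda>n. G (z n) + (G (y' n) - G (z n)) + (1/2)^n) \<longlonglongrightarrow> g + d + 0"
      by (intro tendsto_add g dlim LIMSEQ_power_zero) auto
    from tendsto_le[OF _ this LIMSEQ_Suc[OF g] ev] have "g \<le> g + d" by simp
    then show False using d0 by simp
  qed
  moreover have "ulimit u" unfolding ulimit_def using cu zV lim by blast
  ultimately show ?thesis by blast
qed

text \<open>The directional derivative of half the squared sup norm, with its maximum over peak
  points. For small \<open>t\<close> a maximum point of \<open>u + t * z\<close> almost peaks for
  \<open>u\<close> and almost satisfies the inequality; compactness of \<open>K\<close> turns almost
  into exactly.\<close>

lemma almost_support:
  assumes f: "functional f M" and \<epsilon>: "\<epsilon> > 0"
  shows "\<exists>u. ulimit u \<and> (\<forall>z\<in>V. \<exists>k\<in>K. cmod (u k) = snorm K u \<and> f z \<le> Re (cnj (u k) * z k) + \<epsilon> * snorm K z)"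
proof -
  obtain u where u: "ulimit u" and min: "\<And>z t. z \<in> V \<Longrightarrow> t > 0 \<Longrightarrow>
      (snorm K u)\<^sup>2 / 2 - \<epsilon> * (t * snorm K z) \<le> (snorm K (\<lambda>k. u k + t *\<^sub>R z k))\<^sup>2 / 2 - t * f z"
    using almost_minimizer[OF f \<epsilon>] by blast
  have cu: "continuous_on K u" using u by (simp add: ulimit_def)
  have "\<exists>k\<in>K. cmod (u k) = snorm K u \<and> f z \<le> Re (cnj (u k) * z k) + \<epsilon> * snorm K z" if z: "z \<in> V" for z
  proof (rule ccontr)
    assume neg: "\<not> ?thesis"
    have cz: "continuous_on K z" by (rule cont[OF z])
    have sz: "snorm K z \<ge> 0" by (rule snorm_nonneg[OF cz])
    \<comment> \<open>The larger of the two defects at \<open>k\<close>. If no point satisfies both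
      requirements, \<open>H\<close> is positive on \<open>K\<close> and has a positive minimum
      there.\<close>
    define H where "H k = max (snorm K u - cmod (u k)) (f z - \<epsilon> * snorm K z - Re (cnj (u k) * z k))" for k
    have "continuous_on K H" unfolding H_def using cu cz by (intro continuous_intros)
    then obtain k0 where k0: "k0 \<in> K" "\<forall>k\<in>K. H k0 \<le> H k" using continuous_attains_inf[OF K] by blast
    have "H k0 > 0"
    proof (cases "cmod (u k0) = snorm K u")
      case True
      then have "\<not> f z \<le> Re (cnj (u k0) * z k0) + \<epsilon> * snorm K z" using neg k0(1) by blast
      then show ?thesis unfolding H_def by (auto simp: less_max_iff_disj)
    next
      case False
      then show ?thesis using snorm_ge[OF cu k0(1)] by (simp add: H_def less_max_iff_disj)
    qed
    \<comment> \<open>\<open>D\<close> dominates the two error rates in \<open>t\<close>, namely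
      \<open>2 * snorm K z\<close> for the peak defect and \<open>(snorm K z)\<^sup>2 / 2\<close>
      for the inequality; the 1 keeps it positive.\<close>
    define D where "D = 2 * snorm K z + (snorm K z)\<^sup>2 + 1"
    have den: "D > 0" using sz by (simp add: D_def add_nonneg_pos)
    define t where "t = H k0 / (2 * D)"
    have t: "t > 0" using \<open>H k0 > 0\<close> den by (simp add: t_def)
    have "t * D = H k0 / 2" using den by (simp add: t_def)
    then have tH: "t * D < H k0" using \<open>H k0 > 0\<close> by linarith
    define y where "y k = u k + t *\<^sub>R z k" for k
    have cy: "continuous_on K y" unfolding y_def using cu cz by (intro continuous_intros)
    obtain k where k: "k \<in> K" "cmod (y k) = snorm K y" using snorm_attained[OF K cy] by blast
    have tz: "cmod (t *\<^sub>R z k) \<le> t * snorm K z" using snorm_ge[OF cz k(1)] t by (simp add: mult_left_mono)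
    have "snorm K u \<le> snorm K y + t * snorm K z"
    proof (rule snorm_least[OF K(2)])
      fix x assume "x \<in> K"
      have "u x = y x - t *\<^sub>R z x" by (simp add: y_def)
      then have "cmod (u x) \<le> cmod (y x) + t * cmod (z x)" using norm_triangle_ineq4[of "y x" "t *\<^sub>R z x"] t by simp
      also have "\<dots> \<le> snorm K y + t * snorm K z"
        using snorm_ge[OF cy \<open>x \<in> K\<close>] snorm_ge[OF cz \<open>x \<in> K\<close>] t by (intro add_mono mult_left_mono) auto
      finally show "cmod (u x) \<le> snorm K y + t * snorm K z" .
    qed
    moreover have "cmod (y k) \<le> cmod (u k) + t * snorm K z" using norm_triangle_ineq[of "u k" "t *\<^sub>R z k"] tz by (simp add: y_def)
    ultimately have "snorm K u - cmod (u k) \<le> t * (2 * snorm K z)" using k(2) by (simp add: algebra_simps)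
    also have "\<dots> \<le> t * D" unfolding D_def using t by (intro mult_left_mono) auto
    finally have 1: "snorm K u - cmod (u k) < H k0" using tH by simp
    have "(snorm K u)\<^sup>2 / 2 - \<epsilon> * (t * snorm K z) \<le> (snorm K y)\<^sup>2 / 2 - t * f z"
      using min[OF z t] unfolding y_def .
    moreover have "(snorm K y)\<^sup>2 = (cmod (u k))\<^sup>2 + 2 * (t * Re (cnj (u k) * z k)) + t\<^sup>2 * (cmod (z k))\<^sup>2"
      unfolding k(2)[symmetric] y_def cmod_power2 by (simp add: power2_eq_square algebra_simps)
    moreover have "(cmod (u k))\<^sup>2 \<le> (snorm K u)\<^sup>2" using snorm_ge[OF cu k(1)] by (intro power_mono) auto
    moreover have "t\<^sup>2 * (cmod (z k))\<^sup>2 \<le> t\<^sup>2 * (snorm K z)\<^sup>2" using snorm_ge[OF cz k(1)] by (intro mult_left_mono power_mono) auto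
    ultimately have "t * f z - \<epsilon> * (t * snorm K z) - t * Re (cnj (u k) * z k) \<le> t\<^sup>2 * (snorm K z)\<^sup>2 / 2" by linarith
    then have "t * (f z - \<epsilon> * snorm K z - Re (cnj (u k) * z k)) \<le> t * (t * (snorm K z)\<^sup>2 / 2)"
      by (simp add: algebra_simps power2_eq_square)
    then have "f z - \<epsilon> * snorm K z - Re (cnj (u k) * z k) \<le> t * ((snorm K z)\<^sup>2 / 2)" using t by simp
    also have "\<dots> \<le> t * D" unfolding D_def using t sz by (intro mult_left_mono) auto
    finally have 2: "f z - \<epsilon> * snorm K z - Re (cnj (u k) * z k) < H k0" using tH by simp
    have "H k < H k0" using 1 2 by (simp add: H_def[of k])
    then show False using k0(2) k(1) by force
  qed
  then show ?thesis using u by blast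
qed


definition l1_sequence :: bool where
  "l1_sequence \<longleftrightarrow> (\<exists>z :: nat \<Rightarrow> _. \<exists>\<delta>>0. (\<forall>i. z i \<in> V \<and> snorm K (z i) \<le> 1) \<and>
     (\<forall>n c. \<delta> * (\<Sum>i<n. cmod (c i)) \<le> snorm K (\<lambda>k. \<Sum>i<n. c i * z i k)))"

lemma continuous_on_sum_V: "(\<And>i. i \<in> I \<Longrightarrow> z i \<in> V) \<Longrightarrow> continuous_on K (\<lambda>k. \<Sum>i\<in>I. c i * z i k)"
  by (intro continuous_on_sum continuous_on_mult continuous_on_const cont)

text \<open>For each finite set of peak points take a \<open>z\<close> that defeats it and pass to a
  cluster point along the net of finite sets. The limit \<open>\<phi>\<close> of the functions
  \<open>cnj (u k) * z k\<close> stays \<open>\<epsilon>\<close> below the limit \<open>a\<close> of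
  the values of \<open>f\<close> at every peak point, whereas each single such function comes within
  \<open>\<epsilon> / 2\<close> of its value of \<open>f\<close> somewhere. This is the
  discontinuity from which an \<open>\<ell>\<^sub>1\<close>-sequence is extracted.\<close>

lemma separated_imp_l1_sequence:
  assumes f: "functional f M" and u: "continuous_on K u" and \<epsilon>: "\<epsilon> > 0" and upos: "snorm K u > 0"
    and Ku: "Ku = {k \<in> K. cmod (u k) = snorm K u}" "Ku \<noteq> {}"
    and sup: "\<And>z. z \<in> V \<Longrightarrow> \<exists>k\<in>Ku. f z \<le> Re (cnj (u k) * z k) + \<epsilon> / 2 * snorm K z"
    and ex: "\<And>F. finite F \<Longrightarrow> F \<subseteq> Ku \<Longrightarrow> \<exists>z\<in>V. snorm K z \<le> 1 \<and> (\<forall>k\<in>F. f z - Re (cnj (u k) * z k) > \<epsilon>)"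
  shows l1_sequence
proof -
  have KuK: "Ku \<subseteq> K" by (auto simp: Ku)
  have cKu: "compact Ku"
  proof -
    have "Ku = K \<inter> (\<lambda>k. cmod (u k)) -` {snorm K u}" by (auto simp: Ku)
    moreover have "closedin (top_of_set K) (K \<inter> (\<lambda>k. cmod (u k)) -` {snorm K u})"
      by (rule continuous_closedin_preimage[OF continuous_on_norm[OF u]]) simp
    ultimately show ?thesis using closedin_compact[OF K(1)] by simp
  qed
  have "\<forall>F. \<exists>z. z \<in> V \<and> snorm K z \<le> 1 \<and> (finite F \<longrightarrow> (\<forall>k\<in>F \<inter> Ku. f z - Re (cnj (u k) * z k) > \<epsilon>))"
  proof
    fix F
    define F' where "F' = (if finite F then F \<inter> Ku else {})"
    have "finite F'" "F' \<subseteq> Ku" by (auto simp: F'_def)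
    from ex[OF this] obtain z where "z \<in> V" "snorm K z \<le> 1" "\<forall>k\<in>F'. f z - Re (cnj (u k) * z k) > \<epsilon>" by blast
    then show "\<exists>z. z \<in> V \<and> snorm K z \<le> 1 \<and> (finite F \<longrightarrow> (\<forall>k\<in>F \<inter> Ku. f z - Re (cnj (u k) * z k) > \<epsilon>))"
      by (intro exI[of _ z]) (simp add: F'_def)
  qed
  from choice[OF this] obtain Z where Z: "\<forall>F. Z F \<in> V \<and> snorm K (Z F) \<le> 1 \<and>
      (finite F \<longrightarrow> (\<forall>k\<in>F \<inter> Ku. f (Z F) - Re (cnj (u k) * Z F k) > \<epsilon>))" ..
  have ZV: "Z F \<in> V" and Z1: "snorm K (Z F) \<le> 1" for F using Z by simp_all
  have Zsep: "f (Z F) - Re (cnj (u k) * Z F k) > \<epsilon>" if "finite F" "k \<in> F" "k \<in> Ku" for F k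
    using Z that by blast
  define M' where "M' = \<bar>M\<bar>"
  have fM: "\<bar>f z\<bar> \<le> M'" if "z \<in> V" "snorm K z \<le> 1" for z
  proof -
    have "M * snorm K z \<le> \<bar>M\<bar> * 1" using that(2) snorm_nonneg[OF cont[OF that(1)]] by (intro mult_mono) auto
    then show ?thesis using functional_abs[OF f that(1)] by (simp add: M'_def)
  qed
  have uz: "cmod (cnj (u k) * z k) \<le> snorm K u" if "z \<in> V" "snorm K z \<le> 1" "k \<in> K" for z k
    using mult_mono[OF snorm_ge[OF u that(3)] order_trans[OF snorm_ge[OF cont[OF that(1)] that(3)] that(2)]] upos
    by (simp add: norm_mult)
  \<comment> \<open>The value of \<open>f\<close> is stored at \<open>None\<close> and the values at
    points under \<open>Some\<close>, so that both converge along the same net.\<close>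
  define U where "U F a = (case a of None \<Rightarrow> complex_of_real (f (Z F))
      | Some k \<Rightarrow> if k \<in> K then cnj (u k) * Z F k else 0)" for F a
  have "norm (U F a) \<le> (case a of None \<Rightarrow> M' | Some k \<Rightarrow> snorm K u)" for F a
    using fM[OF ZV Z1] uz[OF ZV Z1] upos by (cases a) (auto simp: U_def)
  from net_cluster[of U, OF this] obtain \<phi>' where
    \<phi>': "\<And>A F0 e. finite A \<Longrightarrow> finite F0 \<Longrightarrow> e > 0 \<Longrightarrow> \<exists>F. finite F \<and> F0 \<subseteq> F \<and> (\<forall>a\<in>A. norm (U F a - \<phi>' a) < e)"
    by metis
  define \<phi> where "\<phi> k = \<phi>' (Some k)" for k
  define a where "a = Re (\<phi>' None)"
  have near: "\<exists>F. finite F \<and> F0 \<subseteq> F \<and> \<bar>f (Z F) - a\<bar> < e \<and> (\<forall>k\<in>A. cmod (cnj (u k) * Z F k - \<phi> k) < e)"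
    if A: "finite A" "A \<subseteq> K" and F0: "finite F0" and e: "e > 0" for A F0 e
  proof -
    obtain F where F: "finite F" "F0 \<subseteq> F" "\<forall>a\<in>insert None (Some ` A). norm (U F a - \<phi>' a) < e"
      using \<phi>'[of "insert None (Some ` A)" F0 e] A(1) F0 e by auto
    have "norm (U F None - \<phi>' None) < e" using F(3) by simp
    then have "\<bar>Re (U F None - \<phi>' None)\<bar> < e" using abs_Re_le_cmod le_less_trans by blast
    then have 1: "\<bar>f (Z F) - a\<bar> < e" by (simp add: U_def a_def)
    have 2: "cmod (cnj (u k) * Z F k - \<phi> k) < e" if "k \<in> A" for k
    proof -
      have "norm (U F (Some k) - \<phi>' (Some k)) < e" using F(3) that by blast
      then show ?thesis using A(2) that by (auto simp: U_def \<phi>_def)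
    qed
    show ?thesis using F(1,2) 1 2 by blast
  qed
  define C where "C = {z \<in> V. snorm K z \<le> 1 \<and> f z > a - \<epsilon> / 4}"
  define hat where "hat z = (\<lambda>k. cnj (u k) * z k)" for z :: "'a \<Rightarrow> complex"
  have "\<exists>y :: nat \<Rightarrow> _. \<exists>\<delta>>0. (\<forall>i. y i \<in> hat ` C) \<and>
     (\<forall>n c. \<exists>k\<in>Ku. \<delta> * (\<Sum>i<n. cmod (c i)) \<le> cmod (\<Sum>i<n. c i * y i k))"
  \<comment> \<open>Members of \<open>C\<close> have \<open>f z > a - \<epsilon> / 4\<close> and
    lose at most another \<open>\<epsilon> / 2\<close> at a suitable peak point, which leaves a gap
    of \<open>\<epsilon> / 4\<close> above \<open>a - \<epsilon>\<close>.\<close>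
  proof (rule l1_sequence_in_convex_set[OF cKu Ku(2), where \<phi> = \<phi> and M = "snorm K u" and \<alpha> = "a - \<epsilon> / 4 - \<epsilon> / 2" and \<beta> = "a - \<epsilon>"])
    show "fconvex (hat ` C)"
      unfolding fconvex_def
    proof (intro ballI allI impI)
      fix x y and t :: real assume "x \<in> hat ` C" "y \<in> hat ` C" and t: "0 \<le> t" "t \<le> 1"
      then obtain z w where zw: "x = hat z" "y = hat w" "z \<in> V" "w \<in> V" "snorm K z \<le> 1" "snorm K w \<le> 1"
        "f z > a - \<epsilon> / 4" "f w > a - \<epsilon> / 4" by (auto simp: C_def)
      define v where "v = (\<lambda>k. t *\<^sub>R z k + (1 - t) *\<^sub>R w k)"
      have v: "v \<in> V" unfolding v_def by (intro add scale zw)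
      have "snorm K v \<le> \<bar>t\<bar> * snorm K z + \<bar>1 - t\<bar> * snorm K w"
        using snorm_add[OF cont[OF scale[OF zw(3)]] cont[OF scale[OF zw(4)]], of t "1 - t"]
        unfolding v_def by (simp add: snorm_scale[OF cont[OF zw(3)]] snorm_scale[OF cont[OF zw(4)]])
      also have "\<dots> \<le> 1" using convex_bound_le[OF zw(5,6), of t "1 - t"] t by simp
      finally have "snorm K v \<le> 1" .
      moreover have "f v = t * f z + (1 - t) * f w"
        unfolding v_def by (simp only: functional_add[OF f scale[OF zw(3)] scale[OF zw(4)]] functional_scale[OF f zw(3)] functional_scale[OF f zw(4)])
      then have "f v > a - \<epsilon> / 4" using convex_bound_lt[of "- f z" "- (a - \<epsilon> / 4)" "- f w" t "1 - t"] zw(7,8) t by auto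
      ultimately have "v \<in> C" using v by (simp add: C_def)
      moreover have "(\<lambda>k. t *\<^sub>R x k + (1 - t) *\<^sub>R y k) = hat v"
        by (simp add: zw hat_def v_def algebra_simps scaleR_conv_of_real fun_eq_iff)
      ultimately show "(\<lambda>k. t *\<^sub>R x k + (1 - t) *\<^sub>R y k) \<in> hat ` C" by blast
    qed
  next
    fix z assume "z \<in> hat ` C"
    then obtain w where w: "z = hat w" "w \<in> V" "snorm K w \<le> 1" "f w > a - \<epsilon> / 4" by (auto simp: C_def)
    have "continuous_on K z" unfolding w(1) hat_def by (intro continuous_intros u cont w)
    then show "continuous_on Ku z" using KuK by (rule continuous_on_subset)
    show "cmod (z k) \<le> snorm K u" if "k \<in> Ku" for k using uz[OF w(2,3), of k] KuK that by (auto simp: w hat_def)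
    obtain k where k: "k \<in> Ku" "f w \<le> Re (cnj (u k) * w k) + \<epsilon> / 2 * snorm K w" using sup[OF w(2)] by blast
    have "\<epsilon> / 2 * snorm K w \<le> \<epsilon> / 2" using w(3) \<epsilon> by simp
    then show "\<exists>k\<in>Ku. a - \<epsilon> / 4 - \<epsilon> / 2 \<le> Re (z k)" using k w(4) by (intro bexI[of _ k]) (auto simp: w(1) hat_def)
  next
    show "a - \<epsilon> < a - \<epsilon> / 4 - \<epsilon> / 2" using \<epsilon> by simp
  next
    fix k assume k: "k \<in> Ku"
    show "Re (\<phi> k) \<le> a - \<epsilon>"
    proof (rule field_le_epsilon)
      fix e :: real assume "e > 0"
      obtain F where F: "finite F" "{k} \<subseteq> F" "\<bar>f (Z F) - a\<bar> < e / 2" "\<forall>k\<in>{k}. cmod (cnj (u k) * Z F k - \<phi> k) < e / 2"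
        using near[of "{k}" "{k}" "e / 2"] k KuK \<open>e > 0\<close> by auto
      have "\<bar>Re (cnj (u k) * Z F k - \<phi> k)\<bar> < e / 2" using F(4) abs_Re_le_cmod le_less_trans by blast
      then have "\<bar>Re (cnj (u k) * Z F k) - Re (\<phi> k)\<bar> < e / 2" by (simp only: minus_complex.sel)
      moreover have "f (Z F) - Re (cnj (u k) * Z F k) > \<epsilon>" using Zsep[OF F(1) _ k] F(2) by blast
      ultimately show "Re (\<phi> k) \<le> a - \<epsilon> + e" using F(3) by linarith
    qed
  next
    fix F :: "'a set" and e :: real assume F: "finite F" "F \<subseteq> Ku" and e: "e > 0"
    have FK: "F \<subseteq> K" using F KuK by blast
    obtain F1 where F1: "\<bar>f (Z F1) - a\<bar> < min e (\<epsilon> / 4)" "\<forall>k\<in>F. cmod (cnj (u k) * Z F1 k - \<phi> k) < min e (\<epsilon> / 4)"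
      using near[OF F(1) FK finite.emptyI, of "min e (\<epsilon> / 4)"] e \<epsilon> by auto
    have "f (Z F1) > a - \<epsilon> / 4" using F1(1) by linarith
    then have "Z F1 \<in> C" using ZV Z1 by (simp add: C_def)
    then show "\<exists>z\<in>hat ` C. \<forall>k\<in>F. cmod (z k - \<phi> k) < e" using F1(2) by (intro bexI[of _ "hat (Z F1)"]) (auto simp: hat_def)
  qed
  then obtain y :: "nat \<Rightarrow> 'a \<Rightarrow> complex" and \<delta> where y: "\<delta> > 0" "\<forall>i. y i \<in> hat ` C"
    "\<forall>n c. \<exists>k\<in>Ku. \<delta> * (\<Sum>i<n. cmod (c i)) \<le> cmod (\<Sum>i<n. c i * y i k)"
    by (elim exE conjE) (erule that)
  have "\<forall>i. \<exists>z. z \<in> C \<and> y i = hat z" using y(2) by blast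
  from choice[OF this] obtain z where z: "\<And>i. z i \<in> C" "\<And>i. y i = hat (z i)" by blast
  have zV: "z i \<in> V" for i using z(1)[of i] by (simp add: C_def)
  \<comment> \<open>On \<open>Ku\<close> the factor \<open>cnj (u k)\<close> has constant modulus
    \<open>snorm K u\<close>, so it can be divided out of the lower estimate.\<close>
  have "\<delta> / snorm K u * (\<Sum>i<n. cmod (c i)) \<le> snorm K (\<lambda>k. \<Sum>i<n. c i * z i k)" for n c
  proof -
    obtain k where k: "k \<in> Ku" "\<delta> * (\<Sum>i<n. cmod (c i)) \<le> cmod (\<Sum>i<n. c i * y i k)" using y(3) by blast
    have "(\<Sum>i<n. c i * y i k) = cnj (u k) * (\<Sum>i<n. c i * z i k)"
      by (simp add: z(2) hat_def sum_distrib_left mult.left_commute)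
    then have "cmod (\<Sum>i<n. c i * y i k) = snorm K u * cmod (\<Sum>i<n. c i * z i k)"
      using k(1) by (simp add: norm_mult Ku)
    also have "\<dots> \<le> snorm K u * snorm K (\<lambda>k. \<Sum>i<n. c i * z i k)"
      using upos k(1) KuK by (intro mult_left_mono snorm_ge continuous_on_sum_V zV) auto
    finally show ?thesis using k(2) upos by (simp add: field_simps)
  qed
  moreover have "\<forall>i. z i \<in> V \<and> snorm K (z i) \<le> 1" using z(1) by (simp add: C_def)
  moreover have "\<delta> / snorm K u > 0" using y(1) upos by simp
  ultimately show ?thesis unfolding l1_sequence_def by (intro exI[of _ z] exI[of _ "\<delta> / snorm K u"]) simp
qed

text \<open>Absence of an \<open>\<ell>\<^sub>1\<close>-sequence gives a finite set of peak points
  of which one always works up to \<open>\<epsilon>\<close> on the unit ball; minimax replaces the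
  choice depending on \<open>z\<close> by fixed convex weights. The one-sided bound becomes
  two-sided since the unit ball is symmetric.\<close>

theorem finite_approximation:
  assumes f: "functional f M" and \<epsilon>: "\<epsilon> > 0" and no: "\<not> l1_sequence"
  shows "\<exists>u F w. ulimit u \<and> finite F \<and> F \<subseteq> K \<and> (\<forall>k\<in>F. w k \<ge> 0 \<and> cmod (u k) = snorm K u) \<and> sum w F = (1::real) \<and>
     (\<forall>z\<in>V. \<bar>f z - (\<Sum>k\<in>F. w k * Re (cnj (u k) * z k))\<bar> \<le> \<epsilon> * snorm K z)"
proof -
  have "\<epsilon> / 2 > 0" using \<epsilon> by simp
  from almost_support[OF f this] obtain u where u: "ulimit u" and
    sup': "\<And>z. z \<in> V \<Longrightarrow> \<exists>k\<in>K. cmod (u k) = snorm K u \<and> f z \<le> Re (cnj (u k) * z k) + \<epsilon> / 2 * snorm K z" by blast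
  have cu: "continuous_on K u" using u by (simp add: ulimit_def)
  define Ku where "Ku = {k \<in> K. cmod (u k) = snorm K u}"
  have sup: "\<exists>k\<in>Ku. f z \<le> Re (cnj (u k) * z k) + \<epsilon> / 2 * snorm K z" if "z \<in> V" for z
    using sup'[OF that] by (auto simp: Ku_def)
  obtain k0 where k0: "k0 \<in> Ku" using sup[OF zero] by blast
  have "\<exists>F w. finite F \<and> F \<subseteq> Ku \<and> (\<forall>k\<in>F. w k \<ge> 0) \<and> sum w F = (1::real) \<and>
     (\<forall>z\<in>V. snorm K z \<le> 1 \<longrightarrow> f z - (\<Sum>k\<in>F. w k * Re (cnj (u k) * z k)) \<le> \<epsilon>)"
  \<comment> \<open>If \<open>u\<close> vanishes, so do all its atoms, and \<open>f\<close> is at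
    most \<open>\<epsilon> / 2\<close> on the unit ball; one arbitrary atom of weight 1 then serves.
    The other case divides by \<open>snorm K u\<close>.\<close>
  proof (cases "snorm K u = 0")
    case True
    have "f z - (\<Sum>k\<in>{k0}. 1 * Re (cnj (u k) * z k)) \<le> \<epsilon>" if z: "z \<in> V" "snorm K z \<le> 1" for z
    proof -
      obtain k where k: "k \<in> Ku" "f z \<le> Re (cnj (u k) * z k) + \<epsilon> / 2 * snorm K z" using sup[OF z(1)] by blast
      have "u k = 0" "u k0 = 0" using k k0 True by (auto simp: Ku_def)
      moreover have "\<epsilon> / 2 * snorm K z \<le> \<epsilon> / 2" using z(2) \<epsilon> by simp
      ultimately have "f z \<le> \<epsilon> / 2" using k(2) by (simp del: times_divide_eq_left)
      then show ?thesis using \<open>u k0 = 0\<close> \<epsilon> by simp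
    qed
    then show ?thesis by (intro exI[of _ "{k0}"] exI[of _ "\<lambda>_. 1"]) (use k0 in simp)
  next
    case False
    then have upos: "snorm K u > 0" using snorm_nonneg[OF cu] by simp
    have "\<exists>F. finite F \<and> F \<subseteq> Ku \<and> \<not> (\<exists>z\<in>V. snorm K z \<le> 1 \<and> (\<forall>k\<in>F. f z - Re (cnj (u k) * z k) > \<epsilon>))"
    proof (rule ccontr)
      assume "\<not> ?thesis"
      then have "l1_sequence"
        by (intro separated_imp_l1_sequence[OF f cu \<epsilon> upos Ku_def _ sup]) (use k0 in auto)
      then show False using no by simp
    qed
    then obtain F where F: "finite F" "F \<subseteq> Ku"
      and nex: "\<not> (\<exists>z\<in>V. snorm K z \<le> 1 \<and> (\<forall>k\<in>F. f z - Re (cnj (u k) * z k) > \<epsilon>))" by blast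
    have "F \<noteq> {}" using nex zero snorm_scale[of "\<lambda>_. 0" 0] by auto
    define Q where "Q = {(\<lambda>k. f z - Re (cnj (u k) * z k)) | z. z \<in> V \<and> snorm K z \<le> 1}"
    have "\<exists>w. (\<forall>k\<in>F. w k \<ge> 0) \<and> sum w F = 1 \<and> (\<forall>q\<in>Q. (\<Sum>k\<in>F. w k * q k) \<le> \<epsilon>)"
    proof (rule minimax_finite[OF F(1) \<open>F \<noteq> {}\<close>])
      fix p q and t :: real assume "p \<in> Q" "q \<in> Q" and t: "0 \<le> t" "t \<le> 1"
      then obtain z w where zw: "p = (\<lambda>k. f z - Re (cnj (u k) * z k))" "q = (\<lambda>k. f w - Re (cnj (u k) * w k))"
        "z \<in> V" "w \<in> V" "snorm K z \<le> 1" "snorm K w \<le> 1" by (auto simp: Q_def)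
      define v where "v = (\<lambda>k. t *\<^sub>R z k + (1 - t) *\<^sub>R w k)"
      have v: "v \<in> V" unfolding v_def by (intro add scale zw)
      have "snorm K v \<le> \<bar>t\<bar> * snorm K z + \<bar>1 - t\<bar> * snorm K w"
        using snorm_add[OF cont[OF scale[OF zw(3)]] cont[OF scale[OF zw(4)]], of t "1 - t"]
        unfolding v_def by (simp add: snorm_scale[OF cont[OF zw(3)]] snorm_scale[OF cont[OF zw(4)]])
      also have "\<dots> \<le> 1" using convex_bound_le[OF zw(5,6), of t "1 - t"] t by simp
      finally have "snorm K v \<le> 1" .
      moreover have "f v = t * f z + (1 - t) * f w"
        unfolding v_def by (simp only: functional_add[OF f scale[OF zw(3)] scale[OF zw(4)]] functional_scale[OF f zw(3)] functional_scale[OF f zw(4)])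
      then have "(\<lambda>i. t * p i + (1 - t) * q i) = (\<lambda>k. f v - Re (cnj (u k) * v k))"
        by (simp add: zw(1,2) v_def fun_eq_iff algebra_simps)
      ultimately show "(\<lambda>i. t * p i + (1 - t) * q i) \<in> Q" unfolding Q_def using v by blast
    next
      fix q assume "q \<in> Q"
      then show "\<exists>k\<in>F. q k \<le> \<epsilon>" using nex unfolding Q_def by force
    qed
    then obtain w where w: "\<forall>k\<in>F. w k \<ge> 0" "sum w F = 1" "\<forall>q\<in>Q. (\<Sum>k\<in>F. w k * q k) \<le> \<epsilon>"
      by (elim exE conjE) (erule that)
    have "f z - (\<Sum>k\<in>F. w k * Re (cnj (u k) * z k)) \<le> \<epsilon>" if "z \<in> V" "snorm K z \<le> 1" for z
    proof -
      have "(\<lambda>k. f z - Re (cnj (u k) * z k)) \<in> Q" using that unfolding Q_def by blast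
      from bspec[OF w(3) this] have "(\<Sum>k\<in>F. w k * (f z - Re (cnj (u k) * z k))) \<le> \<epsilon>" .
      moreover have "(\<Sum>k\<in>F. w k * (f z - Re (cnj (u k) * z k))) = f z - (\<Sum>k\<in>F. w k * Re (cnj (u k) * z k))"
        using w(2) by (simp only: right_diff_distrib sum_subtractf sum_distrib_right[symmetric] mult_1)
      ultimately show ?thesis by simp
    qed
    then show ?thesis using F w by (intro exI[of _ F] exI[of _ w]) simp
  qed
  then obtain F w where F: "finite F" "F \<subseteq> Ku" "\<forall>k\<in>F. w k \<ge> 0" "sum w F = (1::real)"
    and le1: "\<forall>z\<in>V. snorm K z \<le> 1 \<longrightarrow> f z - (\<Sum>k\<in>F. w k * Re (cnj (u k) * z k)) \<le> \<epsilon>"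
    by (elim exE conjE) (erule that)
  define h where "h z = f z - (\<Sum>k\<in>F. w k * Re (cnj (u k) * z k))" for z
  have h_le1: "h z \<le> \<epsilon>" if "z \<in> V" "snorm K z \<le> 1" for z
    unfolding h_def by (rule le1[rule_format, OF that])
  have h_scale: "h (\<lambda>k. r *\<^sub>R z k) = r * h z" if "z \<in> V" for r z
    unfolding h_def functional_scale[OF f that] by (simp add: sum_distrib_left algebra_simps)
  have h_le: "h z \<le> \<epsilon> * snorm K z" if z: "z \<in> V" for z
  proof (cases "snorm K z = 0")
    \<comment> \<open>Normalising is impossible here, but all multiples of \<open>z\<close> remain
      in the unit ball, so a positive \<open>h z\<close> could be scaled beyond
      \<open>\<epsilon>\<close>.\<close>
    case True
    show ?thesis
    proof (rule ccontr)
      assume "\<not> h z \<le> \<epsilon> * snorm K z"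
      then have hz: "h z > 0" using True by simp
      define r where "r = (\<epsilon> + 1) / h z"
      have "snorm K (\<lambda>k. r *\<^sub>R z k) \<le> 1" using snorm_scale[OF cont[OF z]] True by simp
      then have "h (\<lambda>k. r *\<^sub>R z k) \<le> \<epsilon>" using h_le1[OF scale[OF z]] by blast
      then show False using hz by (simp add: h_scale[OF z] r_def)
    qed
  next
    case False
    then have p: "snorm K z > 0" using snorm_nonneg[OF cont[OF z]] by simp
    have "snorm K (\<lambda>k. (1 / snorm K z) *\<^sub>R z k) \<le> 1" using snorm_scale[OF cont[OF z]] p by simp
    then have "h (\<lambda>k. (1 / snorm K z) *\<^sub>R z k) \<le> \<epsilon>" using h_le1[OF scale[OF z]] by blast
    then show ?thesis using p by (simp add: h_scale[OF z] field_simps)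
  qed
  have "\<bar>h z\<bar> \<le> \<epsilon> * snorm K z" if z: "z \<in> V" for z
    using h_le[OF z] h_le[OF scale[OF z, of "- 1"]] h_scale[OF z, of "- 1"] snorm_scale[OF cont[OF z], of "- 1"] by auto
  moreover have "F \<subseteq> K" "\<forall>k\<in>F. w k \<ge> 0 \<and> cmod (u k) = snorm K u" using F by (auto simp: Ku_def)
  ultimately show ?thesis using u F(1,4) unfolding h_def
    by (intro exI[of _ u] exI[of _ F] exI[of _ w]) simp
qed

end

section \<open>Nuclear functionals\<close>

text \<open>The closed range returns limits of scalar-valued functions to the scalar field, and
  invariance under \<open>cnj\<close> does the same for the conjugates that occur as coefficients of
  atoms. For the real field the range is the real line.\<close>

lemma emb_exists:
  "\<exists>\<iota> :: 'k::real_or_complex \<Rightarrow> complex. (\<forall>x y. \<iota> (x + y) = \<iota> x + \<iota> y) \<and> (\<forall>x y. \<iota> (x * y) = \<iota> x * \<iota> y) \<and>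
     (\<forall>x. cmod (\<iota> x) = norm x) \<and> (\<forall>r x. \<iota> (r *\<^sub>R x) = r *\<^sub>R \<iota> x) \<and>
     closed (range \<iota>) \<and> (\<forall>x\<in>range \<iota>. cnj x \<in> range \<iota>)"
  using real_or_complex[where 'a = 'k]
proof (elim disjE exE conjE)
  fix \<phi> :: "'k \<Rightarrow> real"
  assume \<phi>: "bij \<phi>" "\<forall>x y. \<phi> (x + y) = \<phi> x + \<phi> y" "\<forall>x y. \<phi> (x * y) = \<phi> x * \<phi> y"
    "\<forall>r x. \<phi> (r *\<^sub>R x) = r *\<^sub>R \<phi> x" "\<forall>x. norm (\<phi> x) = norm x"
  have r: "range (\<lambda>x. complex_of_real (\<phi> x)) = \<real>"
    using \<phi>(1) unfolding Reals_def by (metis bij_is_surj image_image)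
  show ?thesis
    by (intro exI[of _ "\<lambda>x. complex_of_real (\<phi> x)"])
      (use \<phi> in \<open>auto simp: r closed_complex_Reals scaleR_conv_of_real complex_is_Real_iff simp flip: real_norm_def\<close>)
next
  fix \<phi> :: "'k \<Rightarrow> complex"
  assume \<phi>: "bij \<phi>" "\<forall>x y. \<phi> (x + y) = \<phi> x + \<phi> y" "\<forall>x y. \<phi> (x * y) = \<phi> x * \<phi> y"
    "\<forall>r x. \<phi> (r *\<^sub>R x) = r *\<^sub>R \<phi> x" "\<forall>x. norm (\<phi> x) = norm x"
  then have "range \<phi> = UNIV" by (simp add: bij_is_surj)
  with \<phi> show ?thesis by (intro exI[of _ \<phi>]) simp
qed

definition emb :: "'k::real_or_complex \<Rightarrow> complex" where
  "emb = (SOME \<iota>. (\<forall>x y. \<iota> (x + y) = \<iota> x + \<iota> y) \<and> (\<forall>x y. \<iota> (x * y) = \<iota> x * \<iota> y) \<and>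
     (\<forall>x. cmod (\<iota> x) = norm x) \<and> (\<forall>r x. \<iota> (r *\<^sub>R x) = r *\<^sub>R \<iota> x) \<and>
     closed (range \<iota>) \<and> (\<forall>x\<in>range \<iota>. cnj x \<in> range \<iota>))"

lemma emb_add: "emb (x + y) = emb x + emb y"
  and emb_mult: "emb (x * y) = emb x * emb y"
  and norm_emb [simp]: "cmod (emb x) = norm x"
  and emb_scaleR: "emb (r *\<^sub>R x) = r *\<^sub>R emb x"
  and closed_range_emb: "closed (range (emb :: 'k::real_or_complex \<Rightarrow> complex))"
  and cnj_emb: "cnj (emb x) \<in> range (emb :: 'k::real_or_complex \<Rightarrow> complex)"
  for x y :: "'k::real_or_complex"
  using someI_ex[OF emb_exists, where 'k1 = 'k] unfolding emb_def[symmetric] by auto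

lemma bounded_linear_emb: "bounded_linear (emb :: 'k::real_or_complex \<Rightarrow> complex)"
  by (rule bounded_linear_intro[of _ 1]) (auto simp: emb_add emb_scaleR)

lemma emb_0 [simp]: "emb 0 = 0"
  by (rule linear_0[OF bounded_linear.linear[OF bounded_linear_emb]])

lemma emb_diff: "emb (x - y) = emb x - emb y"
  by (rule linear_diff[OF bounded_linear.linear[OF bounded_linear_emb]])

lemma emb_sum: "emb (\<Sum>i\<in>I. f i) = (\<Sum>i\<in>I. emb (f i))"
  by (rule linear_sum[OF bounded_linear.linear[OF bounded_linear_emb]])

lemma inj_emb: "inj (emb :: 'k::real_or_complex \<Rightarrow> complex)"
  by (rule injI) (metis emb_diff norm_emb eq_iff_diff_eq_0 norm_eq_zero)

lemma inv_emb [simp]: "inv emb (emb x) = x"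
  by (rule inv_f_f[OF inj_emb])

lemma emb_inv: "x \<in> range (emb :: 'k \<Rightarrow> complex) \<Longrightarrow> emb (inv emb x :: 'k::real_or_complex) = x"
  by (rule f_inv_into_f)

lemma continuous_on_emb: "continuous_on S v \<Longrightarrow> continuous_on S (\<lambda>k. emb (v k))"
  by (rule bounded_linear.continuous_on[OF bounded_linear_emb])

lemma unit_rotation: "\<exists>c::'k::real_or_complex. norm c = 1 \<and> c * x = of_real (norm x)"
proof (cases "x = 0")
  case False
  then show ?thesis by (intro exI[of _ "of_real (norm x) / x"]) (simp add: norm_divide)
qed (auto intro: exI[of _ 1])

lemma emb_of_real: "emb (of_real r :: 'k::real_or_complex) = of_real r"
proof -
  have "emb (1 :: 'k) * emb (1 :: 'k) = emb (1 :: 'k)" by (simp flip: emb_mult)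
  moreover have "emb (1 :: 'k) \<noteq> 0" by (metis norm_emb norm_one norm_zero zero_neq_one)
  ultimately have "emb (1 :: 'k) = 1" by simp
  then show ?thesis using emb_scaleR[of r "1 :: 'k"] by (simp add: scaleR_conv_of_real)
qed

section \<open>Seminorms on subspaces and their Cauchy sequences\<close>

text \<open>Definiteness is left out: the completion divides by null sequences anyway.\<close>

locale seminormed = vector_space sc
  for sc :: "'k::real_or_complex \<Rightarrow> 'v::ab_group_add \<Rightarrow> 'v" +
  fixes U :: "'v set" and p :: "'v \<Rightarrow> real"
  assumes sub: "subspace U"
    and triangle: "x \<in> U \<Longrightarrow> y \<in> U \<Longrightarrow> p (x + y) \<le> p x + p y"
    and homogeneous: "x \<in> U \<Longrightarrow> p (sc c x) = norm c * p x"
begin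

lemma p_zero: "p 0 = 0"
  using homogeneous[OF subspace_0[OF sub], of 0] by simp

lemma p_minus: "x \<in> U \<Longrightarrow> p (- x) = p x"
  using homogeneous[of x "- 1"] by simp

lemma p_nonneg: "x \<in> U \<Longrightarrow> 0 \<le> p x"
  using triangle[of x "- x"] p_minus[of x] subspace_neg[OF sub, of x] p_zero by simp

lemma triangle_diff: "x \<in> U \<Longrightarrow> y \<in> U \<Longrightarrow> p (x - y) \<le> p x + p y"
  using triangle[of x "- y"] p_minus[of y] subspace_neg[OF sub, of y] by simp

lemma p_commute: "x \<in> U \<Longrightarrow> y \<in> U \<Longrightarrow> p (x - y) = p (y - x)"
  using p_minus[OF subspace_diff[OF sub, of x y]] by simp

lemma triangle3: "x \<in> U \<Longrightarrow> y \<in> U \<Longrightarrow> z \<in> U \<Longrightarrow> p (x - z) \<le> p (x - y) + p (y - z)"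
  using triangle[OF subspace_diff[OF sub] subspace_diff[OF sub], of x y y z] by simp

lemma reverse_triangle: "x \<in> U \<Longrightarrow> y \<in> U \<Longrightarrow> \<bar>p x - p y\<bar> \<le> p (x - y)"
  using triangle[OF subspace_diff[OF sub, of x y], of y] triangle[OF subspace_diff[OF sub, of y x], of x] p_commute[of x y]
  by auto

lemma p_sum: "(\<And>i. i \<in> I \<Longrightarrow> x i \<in> U) \<Longrightarrow> p (\<Sum>i\<in>I. x i) \<le> (\<Sum>i\<in>I. p (x i))"
proof (induction I rule: infinite_finite_induct)
  case (insert i I)
  then show ?case using triangle[of "x i" "\<Sum>i\<in>I. x i"] subspace_sum[OF sub, of I x] by fastforce
qed (simp_all add: p_zero)

lemma Cauchy_seqsI:
  "(\<And>n. s n \<in> U) \<Longrightarrow> (\<And>e. e > 0 \<Longrightarrow> \<exists>M. \<forall>m\<ge>M. \<forall>n\<ge>M. p (s m - s n) < e) \<Longrightarrow> s \<in> Cauchy_seqs U p"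
  by (auto simp: Cauchy_seqs_def)

lemma Cauchy_seqs_in: "s \<in> Cauchy_seqs U p \<Longrightarrow> s n \<in> U"
  by (auto simp: Cauchy_seqs_def)

lemma Cauchy_seqsD: "s \<in> Cauchy_seqs U p \<Longrightarrow> e > 0 \<Longrightarrow> \<exists>M. \<forall>m\<ge>M. \<forall>n\<ge>M. p (s m - s n) < e"
  by (auto simp: Cauchy_seqs_def)

lemma Cauchy_seqs_const: "x \<in> U \<Longrightarrow> (\<lambda>_. x) \<in> Cauchy_seqs U p"
  by (rule Cauchy_seqsI) (auto simp: p_zero)

lemma Cauchy_seqs_add:
  assumes "s \<in> Cauchy_seqs U p" "t \<in> Cauchy_seqs U p" shows "(\<lambda>n. s n + t n) \<in> Cauchy_seqs U p"
proof (rule Cauchy_seqsI)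
  fix e :: real assume "e > 0"
  then obtain M N where M: "\<forall>m\<ge>M. \<forall>n\<ge>M. p (s m - s n) < e / 2" and N: "\<forall>m\<ge>N. \<forall>n\<ge>N. p (t m - t n) < e / 2"
    using Cauchy_seqsD[OF assms(1), of "e / 2"] Cauchy_seqsD[OF assms(2), of "e / 2"] by auto
  have "p (s m + t m - (s n + t n)) < e" if "m \<ge> max M N" "n \<ge> max M N" for m n
  proof -
    have "p ((s m - s n) + (t m - t n)) \<le> p (s m - s n) + p (t m - t n)"
      by (intro triangle subspace_diff[OF sub] Cauchy_seqs_in assms)
    moreover have eq: "s m + t m - (s n + t n) = (s m - s n) + (t m - t n)" by simp
    moreover have "p (s m - s n) < e / 2" "p (t m - t n) < e / 2" using M N that by auto
    ultimately show ?thesis unfolding eq by linarith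
  qed
  then show "\<exists>M. \<forall>m\<ge>M. \<forall>n\<ge>M. p (s m + t m - (s n + t n)) < e" by blast
qed (intro subspace_add[OF sub] Cauchy_seqs_in assms)

lemma Cauchy_seqs_scale:
  assumes "s \<in> Cauchy_seqs U p" shows "(\<lambda>n. sc c (s n)) \<in> Cauchy_seqs U p"
proof (rule Cauchy_seqsI)
  fix e :: real assume "e > 0"
  have c: "norm c + 1 > 0" by (simp add: add_nonneg_pos)
  then obtain M where M: "\<forall>m\<ge>M. \<forall>n\<ge>M. p (s m - s n) < e / (norm c + 1)"
    using Cauchy_seqsD[OF assms, of "e / (norm c + 1)"] \<open>e > 0\<close> by auto
  have "p (sc c (s m) - sc c (s n)) < e" if "m \<ge> M" "n \<ge> M" for m n
  proof -
    have "p (sc c (s m) - sc c (s n)) = norm c * p (s m - s n)"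
      using homogeneous[OF subspace_diff[OF sub Cauchy_seqs_in[OF assms] Cauchy_seqs_in[OF assms]]]
      by (simp only: scale_right_diff_distrib[symmetric])
    also have "\<dots> \<le> (norm c + 1) * p (s m - s n)"
      by (intro mult_right_mono p_nonneg subspace_diff[OF sub] Cauchy_seqs_in assms) simp
    also have "\<dots> < (norm c + 1) * (e / (norm c + 1))" using M that c by (intro mult_strict_left_mono) auto
    finally show ?thesis using c by simp
  qed
  then show "\<exists>M. \<forall>m\<ge>M. \<forall>n\<ge>M. p (sc c (s m) - sc c (s n)) < e" by blast
qed (intro subspace_scale[OF sub] Cauchy_seqs_in assms)

lemma Cauchy_seqs_diff:
  assumes "s \<in> Cauchy_seqs U p" "t \<in> Cauchy_seqs U p" shows "(\<lambda>n. s n - t n) \<in> Cauchy_seqs U p"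
  using Cauchy_seqs_add[OF assms(1) Cauchy_seqs_scale[OF assms(2), of "- 1"]] by simp

lemma Cauchy_seqs_convergent:
  assumes "s \<in> Cauchy_seqs U p" shows "convergent (\<lambda>n. p (s n))"
proof (rule Cauchy_convergent, rule CauchyI)
  fix e :: real assume "e > 0"
  then obtain M where "\<forall>m\<ge>M. \<forall>n\<ge>M. p (s m - s n) < e" using Cauchy_seqsD[OF assms] by blast
  then show "\<exists>M. \<forall>m\<ge>M. \<forall>n\<ge>M. norm (p (s m) - p (s n)) < e"
    using reverse_triangle[OF Cauchy_seqs_in[OF assms] Cauchy_seqs_in[OF assms]]
    by (metis le_less_trans real_norm_def)
qed

end

section \<open>Atomic norms\<close>

definition atom_sum :: "('a \<Rightarrow> 'o \<Rightarrow> 'k::real_or_complex) \<Rightarrow> nat \<Rightarrow> (nat \<Rightarrow> 'k) \<Rightarrow> (nat \<Rightarrow> 'a) \<Rightarrow> 'o \<Rightarrow> 'k" where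
  "atom_sum \<tau> n c k = (\<Sum>j<n. tscale (c j) (\<tau> (k j)))"

text \<open>The Minkowski functional of the absolutely convex hull of the atoms. With elementary
  tensors of unit balls as atoms it is the projective norm.\<close>

definition gauge_norm :: "'a set \<Rightarrow> ('a \<Rightarrow> 'o \<Rightarrow> 'k::real_or_complex) \<Rightarrow> ('o \<Rightarrow> 'k) \<Rightarrow> real" where
  "gauge_norm K \<tau> s = Inf {(\<Sum>j<n. norm (c j)) | n c k. (\<forall>j<n. k j \<in> K) \<and> s = atom_sum \<tau> n c k}"

abbreviation tspan :: "('o \<Rightarrow> 'k::real_or_complex) set \<Rightarrow> ('o \<Rightarrow> 'k) set" where
  "tspan \<equiv> module.span tscale"

interpretation tscale: vector_space "tscale :: 'k::real_or_complex \<Rightarrow> ('o \<Rightarrow> 'k) \<Rightarrow> ('o \<Rightarrow> 'k)"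
  by (rule vector_space_tscale)

lemma fun_sum_apply: "(\<Sum>i\<in>I. f i) x = (\<Sum>i\<in>I. f i x)" for f :: "'i \<Rightarrow> 'a \<Rightarrow> 'b::comm_monoid_add"
  by (induction I rule: infinite_finite_induct) auto

lemma atom_sum_apply: "atom_sum \<tau> n c k x = (\<Sum>j<n. c j * \<tau> (k j) x)"
  by (simp add: atom_sum_def fun_sum_apply tscale_def)

lemma atom_sum_in_span: "(\<And>j. j < n \<Longrightarrow> k j \<in> K) \<Longrightarrow> atom_sum \<tau> n c k \<in> tspan (\<tau> ` K)"
  unfolding atom_sum_def by (intro tscale.span_sum tscale.span_scale tscale.span_base) auto

lemma sum_lessThan_add: "(\<Sum>j<n + m. f j) = (\<Sum>j<n. f j) + (\<Sum>j<m. f (j + n))" for n m :: nat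
  by (induction m) (simp_all add: add.commute add.left_commute add.assoc)

lemma atom_sum_add:
  "atom_sum \<tau> n c k + atom_sum \<tau> n' c' k' =
     atom_sum \<tau> (n + n') (\<lambda>j. if j < n then c j else c' (j - n)) (\<lambda>j. if j < n then k j else k' (j - n))"
  by (simp add: atom_sum_def sum_lessThan_add)

lemma span_atoms_rep:
  assumes "s \<in> tspan (\<tau> ` K)" shows "\<exists>n c k. (\<forall>j<n. k j \<in> K) \<and> s = atom_sum \<tau> n c k"
  using assms
proof (induction rule: tscale.span_induct_alt)
  case base
  show ?case by (intro exI[of _ 0]) (simp add: atom_sum_def)
next
  case (step c x y)
  then obtain a n d k where "x = \<tau> a" "a \<in> K" "\<forall>j<n. k j \<in> K" "y = atom_sum \<tau> n d k" by auto
  then show ?case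
    using atom_sum_add[of \<tau> 1 "\<lambda>_. c" "\<lambda>_. a" n d k]
    by (intro exI[of _ "1 + n"] exI[of _ "\<lambda>j. if j < 1 then c else d (j - 1)"] exI[of _ "\<lambda>j. if j < 1 then a else k (j - 1)"])
      (auto simp: atom_sum_def)
qed

lemma gauge_norm_le:
  assumes "\<And>j. j < n \<Longrightarrow> k j \<in> K" shows "gauge_norm K \<tau> (atom_sum \<tau> n c k) \<le> (\<Sum>j<n. norm (c j))"
  unfolding gauge_norm_def
proof (rule cInf_lower)
  show "(\<Sum>j<n. norm (c j)) \<in> {(\<Sum>j<m. norm (d j)) | m d l. (\<forall>j<m. l j \<in> K) \<and> atom_sum \<tau> n c k = atom_sum \<tau> m d l}"
    using assms by blast
qed (auto intro!: bdd_belowI[of _ 0] sum_nonneg)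

lemma gauge_norm_less:
  assumes "s \<in> tspan (\<tau> ` K)" "gauge_norm K \<tau> s < r"
  shows "\<exists>n c k. (\<forall>j<n. k j \<in> K) \<and> s = atom_sum \<tau> n c k \<and> (\<Sum>j<n. norm (c j)) < r"
proof -
  have "{(\<Sum>j<n. norm (c j)) | n c k. (\<forall>j<n. k j \<in> K) \<and> s = atom_sum \<tau> n c k} \<noteq> {}"
    using span_atoms_rep[OF assms(1)] by blast
  from cInf_lessD[OF this assms(2)[unfolded gauge_norm_def]] show ?thesis by blast
qed

lemma seminormed_gauge:
  fixes \<tau> :: "'a \<Rightarrow> 'o \<Rightarrow> 'k::real_or_complex"
  shows "seminormed tscale (tspan (\<tau> ` K)) (gauge_norm K \<tau>)"
proof -
  have add: "gauge_norm K \<tau> (x + y) \<le> gauge_norm K \<tau> x + gauge_norm K \<tau> y"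
    if x: "x \<in> tspan (\<tau> ` K)" and y: "y \<in> tspan (\<tau> ` K)" for x y
  proof (rule field_le_epsilon)
    fix e :: real assume "e > 0"
    then obtain n c k n' c' k' where
      1: "\<forall>j<n. k j \<in> K" "x = atom_sum \<tau> n c k" "(\<Sum>j<n. norm (c j)) < gauge_norm K \<tau> x + e / 2" and
      2: "\<forall>j<n'. k' j \<in> K" "y = atom_sum \<tau> n' c' k'" "(\<Sum>j<n'. norm (c' j)) < gauge_norm K \<tau> y + e / 2"
      using gauge_norm_less[OF x, of "gauge_norm K \<tau> x + e / 2"] gauge_norm_less[OF y, of "gauge_norm K \<tau> y + e / 2"] by auto
    let ?c = "\<lambda>j. if j < n then c j else c' (j - n)"
    let ?k = "\<lambda>j. if j < n then k j else k' (j - n)"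
    have "gauge_norm K \<tau> (x + y) \<le> (\<Sum>j<n + n'. norm (?c j))"
      unfolding 1(2) 2(2) atom_sum_add by (rule gauge_norm_le) (use 1(1) 2(1) in auto)
    also have "\<dots> = (\<Sum>j<n. norm (?c j)) + (\<Sum>j<n'. norm (?c (j + n)))"
      by (rule sum_lessThan_add)
    also have "\<dots> = (\<Sum>j<n. norm (c j)) + (\<Sum>j<n'. norm (c' j))" by simp
    finally show "gauge_norm K \<tau> (x + y) \<le> gauge_norm K \<tau> x + gauge_norm K \<tau> y + e" using 1(3) 2(3) by linarith
  qed
  have scale_le: "gauge_norm K \<tau> (tscale c x) \<le> norm c * gauge_norm K \<tau> x" if x: "x \<in> tspan (\<tau> ` K)" for c x
  proof (rule field_le_epsilon)
    fix e :: real assume "e > 0"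
    have c: "norm c + 1 > 0" by (simp add: add_nonneg_pos)
    then obtain n d k where 1: "\<forall>j<n. k j \<in> K" "x = atom_sum \<tau> n d k" "(\<Sum>j<n. norm (d j)) < gauge_norm K \<tau> x + e / (norm c + 1)"
      using gauge_norm_less[OF x, of "gauge_norm K \<tau> x + e / (norm c + 1)"] \<open>e > 0\<close> by auto
    have "tscale c x = atom_sum \<tau> n (\<lambda>j. c * d j) k" by (simp add: 1(2) fun_eq_iff atom_sum_apply tscale_def sum_distrib_left mult.assoc)
    then have "gauge_norm K \<tau> (tscale c x) \<le> (\<Sum>j<n. norm (c * d j))" using gauge_norm_le[of n k K] 1(1) by simp
    also have "\<dots> = norm c * (\<Sum>j<n. norm (d j))" by (simp add: norm_mult sum_distrib_left)
    also have "\<dots> \<le> norm c * (gauge_norm K \<tau> x + e / (norm c + 1))" using 1(3) by (intro mult_left_mono) auto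
    also have "norm c * (e / (norm c + 1)) \<le> (norm c + 1) * (e / (norm c + 1))" using \<open>e > 0\<close> c by (intro mult_right_mono) auto
    then have "norm c * (gauge_norm K \<tau> x + e / (norm c + 1)) \<le> norm c * gauge_norm K \<tau> x + e" using c by (simp add: distrib_left)
    finally show "gauge_norm K \<tau> (tscale c x) \<le> norm c * gauge_norm K \<tau> x + e" .
  qed
  have zero: "gauge_norm K \<tau> 0 \<ge> 0"
  proof -
    have "gauge_norm K \<tau> x \<ge> 0" if x: "x \<in> tspan (\<tau> ` K)" for x
    proof (rule ccontr)
      assume "\<not> ?thesis"
      then obtain n and c :: "nat \<Rightarrow> 'k" where "(\<Sum>j<n. norm (c j)) < 0" using gauge_norm_less[OF x, of 0] by auto
      then show False using sum_nonneg[of "{..<n}" "\<lambda>j. norm (c j)"] by simp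
    qed
    then show ?thesis using tscale.span_zero by blast
  qed
  show ?thesis
  proof
    show "tscale.subspace (tspan (\<tau> ` K))" by (rule tscale.subspace_span)
    show "gauge_norm K \<tau> (tscale c x) = norm c * gauge_norm K \<tau> x" if x: "x \<in> tspan (\<tau> ` K)" for c x
    proof (cases "c = 0")
      case True
      have "tscale 0 x = 0" by (simp add: tscale_def fun_eq_iff)
      then show ?thesis using True scale_le[OF x, of 0] zero by simp
    next
      case False
      have "tscale (inverse c) (tscale c x) = x" using False by (simp add: tscale_def fun_eq_iff)
      then have "gauge_norm K \<tau> x \<le> norm (inverse c) * gauge_norm K \<tau> (tscale c x)"
        using scale_le[OF tscale.span_scale[OF x, of c], of "inverse c"] by simp
      then have "norm c * gauge_norm K \<tau> x \<le> norm c * (norm (inverse c) * gauge_norm K \<tau> (tscale c x))"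
        by (rule mult_left_mono) simp
      also have "\<dots> = norm (c * inverse c) * gauge_norm K \<tau> (tscale c x)" by (simp only: norm_mult mult.assoc)
      also have "c * inverse c = 1" using False by simp
      finally have "norm c * gauge_norm K \<tau> x \<le> gauge_norm K \<tau> (tscale c x)" by simp
      then show ?thesis using scale_le[OF x, of c] by simp
    qed
  qed (rule add)
qed

definition wnorm :: "'a set \<Rightarrow> ('a \<Rightarrow> 'k::real_or_complex) \<Rightarrow> real" where
  "wnorm K v = (SUP k\<in>K. norm (v k))"

lemma wnorm_emb: "wnorm K v = snorm K (\<lambda>k. emb (v k))"
  by (simp add: wnorm_def snorm_def)

definition has_l1_sequence :: "'a set \<Rightarrow> ('a \<Rightarrow> 'k::real_or_complex) set \<Rightarrow> bool" where
  "has_l1_sequence K W \<longleftrightarrow> (\<exists>v :: nat \<Rightarrow> _. \<exists>\<delta>>0. (\<forall>i. v i \<in> W \<and> wnorm K (v i) \<le> 1) \<and>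
     (\<forall>n c. \<delta> * (\<Sum>i<n. norm (c i)) \<le> wnorm K (\<lambda>k. \<Sum>i<n. c i * v i k)))"

text \<open>The common frame for both tensor products. \<open>W\<close> is the injective side, as
  functions on \<open>K\<close>; the span of the atoms \<open>\<tau> k\<close> is the projective
  side; a tensor is paired with \<open>v\<close> by evaluating it at the form
  \<open>\<omega> v\<close>. The assumption \<open>injective\<close> says that an absolutely
  convergent atomic series which vanishes on \<open>W\<close> is null in the atomic norm; in both
  instances it comes from the approximation property.\<close>

locale duality =
  fixes K :: "'a::topological_space set" and W :: "('a \<Rightarrow> 'k::real_or_complex) set"
    and \<tau> :: "'a \<Rightarrow> 'o \<Rightarrow> 'k" and \<omega> :: "('a \<Rightarrow> 'k) \<Rightarrow> 'o"
  assumes K: "compact K" "K \<noteq> {}"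
    and W_cont: "v \<in> W \<Longrightarrow> continuous_on K v"
    and W_zero: "(\<lambda>_. 0) \<in> W"
    and W_add: "v \<in> W \<Longrightarrow> v' \<in> W \<Longrightarrow> (\<lambda>k. v k + v' k) \<in> W"
    and W_scale: "v \<in> W \<Longrightarrow> (\<lambda>k. c * v k) \<in> W"
    and pairing: "v \<in> W \<Longrightarrow> k \<in> K \<Longrightarrow> \<tau> k (\<omega> v) = v k"
    and no_l1: "\<not> has_l1_sequence K W"
    and injective: "range ks \<subseteq> K \<Longrightarrow> summable (\<lambda>i. norm (cs i)) \<Longrightarrow>
      (\<And>v. v \<in> W \<Longrightarrow> (\<lambda>i. cs i * v (ks i)) sums 0) \<Longrightarrow>
      (\<lambda>n. gauge_norm K \<tau> (atom_sum \<tau> n cs ks)) \<longlonglongrightarrow> 0"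
begin

abbreviation "U \<equiv> tspan (\<tau> ` K)"
abbreviation "q \<equiv> gauge_norm K \<tau>"

sublocale q: seminormed tscale U q
  by (rule seminormed_gauge)

definition V where "V = (\<lambda>v k. emb (v k)) ` W"

sublocale V: fun_space K V
proof
  show "compact K" "K \<noteq> {}" by (rule K)+
  show "continuous_on K z" if "z \<in> V" for z using that W_cont by (auto simp: V_def intro: continuous_on_emb)
  show "(\<lambda>_. 0) \<in> V" unfolding V_def by (rule image_eqI[OF _ W_zero]) simp
  show "(\<lambda>k. z k + w k) \<in> V" if "z \<in> V" "w \<in> V" for z w
    using that W_add by (auto simp: V_def emb_add[symmetric])
  show "(\<lambda>k. r *\<^sub>R z k) \<in> V" if "z \<in> V" for z r
  proof -
    obtain v where "v \<in> W" "z = (\<lambda>k. emb (v k))" using \<open>z \<in> V\<close> by (auto simp: V_def)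
    then show ?thesis using W_scale[of v "of_real r"]
      unfolding V_def by (intro image_eqI[of _ _ "\<lambda>k. of_real r * v k"]) (auto simp: emb_mult emb_of_real scaleR_conv_of_real)
  qed
qed

lemma no_l1_V: "\<not> V.l1_sequence"
proof
  assume "V.l1_sequence"
  then obtain z :: "nat \<Rightarrow> 'a \<Rightarrow> complex" and \<delta> where z: "\<delta> > 0" "\<forall>i. z i \<in> V \<and> snorm K (z i) \<le> 1"
    "\<forall>n c. \<delta> * (\<Sum>i<n. cmod (c i)) \<le> snorm K (\<lambda>k. \<Sum>i<n. c i * z i k)"
    unfolding V.l1_sequence_def by (elim exE conjE) (erule that)
  have "\<forall>i. \<exists>v. v \<in> W \<and> z i = (\<lambda>k. emb (v k))" using z(2) by (auto simp: V_def)
  from choice[OF this] obtain v where v: "\<And>i. v i \<in> W" "\<And>i. z i = (\<lambda>k. emb (v i k))" by blast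
  have "\<delta> * (\<Sum>i<n. norm (c i)) \<le> wnorm K (\<lambda>k. \<Sum>i<n. c i * v i k)" for n c
    using z(3)[rule_format, where n = n and c = "\<lambda>i. emb (c i)"] by (simp add: v(2) wnorm_emb emb_sum emb_mult)
  then have "has_l1_sequence K W"
    unfolding has_l1_sequence_def
    by (intro exI[of _ v] exI[of _ \<delta>]) (use z(1,2) v in \<open>simp add: wnorm_emb\<close>)
  then show False using no_l1 by simp
qed

lemma wnorm_ge: "v \<in> W \<Longrightarrow> k \<in> K \<Longrightarrow> norm (v k) \<le> wnorm K v"
  using V.snorm_ge[OF continuous_on_emb[OF W_cont], of v k] by (simp add: wnorm_emb)

lemma wnorm_nonneg: "v \<in> W \<Longrightarrow> 0 \<le> wnorm K v"
  using V.snorm_nonneg[OF continuous_on_emb[OF W_cont]] by (simp add: wnorm_emb)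

lemma atom_sum_pairing:
  "v \<in> W \<Longrightarrow> (\<And>j. j < n \<Longrightarrow> k j \<in> K) \<Longrightarrow> atom_sum \<tau> n c k (\<omega> v) = (\<Sum>j<n. c j * v (k j))"
  by (simp add: atom_sum_apply pairing)

lemma pairing_le:
  assumes "s \<in> U" "v \<in> W" shows "norm (s (\<omega> v)) \<le> q s * wnorm K v"
proof (rule field_le_epsilon)
  fix e :: real assume "e > 0"
  define d where "d = e / (wnorm K v + 1)"
  have w: "wnorm K v + 1 > 0" using wnorm_nonneg[OF assms(2)] by simp
  have d: "d > 0" using \<open>e > 0\<close> w by (simp add: d_def)
  obtain n c k where r: "\<forall>j<n. k j \<in> K" "s = atom_sum \<tau> n c k" "(\<Sum>j<n. norm (c j)) < q s + d"
    using gauge_norm_less[OF assms(1), of "q s + d"] d by auto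
  have "norm (s (\<omega> v)) = norm (\<Sum>j<n. c j * v (k j))" using r(1) unfolding r(2) by (simp add: atom_sum_pairing[OF assms(2)])
  also have "\<dots> \<le> (\<Sum>j<n. norm (c j) * wnorm K v)"
    by (rule sum_norm_le) (use r(1) wnorm_ge[OF assms(2)] in \<open>auto simp: norm_mult intro!: mult_left_mono\<close>)
  also have "\<dots> = (\<Sum>j<n. norm (c j)) * wnorm K v" by (simp add: sum_distrib_right)
  also have "\<dots> \<le> (q s + d) * wnorm K v" using r(3) wnorm_nonneg[OF assms(2)] by (intro mult_right_mono) auto
  also have "\<dots> = q s * wnorm K v + d * wnorm K v" by (simp add: distrib_right)
  also have "d * wnorm K v \<le> d * (wnorm K v + 1)" using d by (intro mult_left_mono) auto
  also have "d * (wnorm K v + 1) = e" using w by (simp add: d_def)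
  finally show "norm (s (\<omega> v)) \<le> q s * wnorm K v + e" by simp
qed

definition dual_functional :: "(('a \<Rightarrow> 'k) \<Rightarrow> 'k) \<Rightarrow> real \<Rightarrow> bool" where
  "dual_functional \<Lambda> M \<longleftrightarrow> (\<forall>v\<in>W. \<forall>w\<in>W. \<Lambda> (\<lambda>k. v k + w k) = \<Lambda> v + \<Lambda> w) \<and>
     (\<forall>c. \<forall>v\<in>W. \<Lambda> (\<lambda>k. c * v k) = c * \<Lambda> v) \<and> (\<forall>v\<in>W. norm (\<Lambda> v) \<le> M * wnorm K v)"

text \<open>The finite combination found by the approximation theorem attains its norm on the limit function
  \<open>u\<close>, which has modulus \<open>snorm K u\<close> at all atoms used.\<close>

lemma norm_attaining_approximation:
  assumes \<Lambda>: "dual_functional \<Lambda> M" and \<epsilon>: "\<epsilon> > 0" and M: "M \<ge> 0"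
  shows "\<exists>n c k. (\<forall>j<n. k j \<in> K) \<and> q (atom_sum \<tau> n c k) = (\<Sum>j<n. norm (c j)) \<and>
     (\<Sum>j<n. norm (c j)) \<le> M + \<epsilon> \<and>
     (\<forall>v\<in>W. norm (\<Lambda> v - atom_sum \<tau> n c k (\<omega> v)) \<le> \<epsilon> * wnorm K v)"
proof -
  have \<Lambda>_add: "\<Lambda> (\<lambda>k. v k + w k) = \<Lambda> v + \<Lambda> w" if "v \<in> W" "w \<in> W" for v w
    using \<Lambda> that by (simp add: dual_functional_def)
  have \<Lambda>_scale: "\<Lambda> (\<lambda>k. c * v k) = c * \<Lambda> v" if "v \<in> W" for v c
    using \<Lambda> that by (simp add: dual_functional_def)
  have \<Lambda>_le: "norm (\<Lambda> v) \<le> M * wnorm K v" if "v \<in> W" for v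
    using \<Lambda> that by (simp add: dual_functional_def)
  \<comment> \<open>The real part of \<open>\<Lambda>\<close>, carried over to the embedded
    functions; on \<open>V\<close> the inverse of \<open>emb\<close> recovers the scalar
    function.\<close>
  define f where "f z = Re (emb (\<Lambda> (\<lambda>k. inv emb (z k))))" for z :: "'a \<Rightarrow> complex"
  have f_emb: "f (\<lambda>k. emb (v k)) = Re (emb (\<Lambda> v))" for v :: "'a \<Rightarrow> 'k" by (simp add: f_def)
  have f: "V.functional f M"
    unfolding V.functional_def
  proof (intro conjI ballI allI)
    fix z w assume "z \<in> V" "w \<in> V"
    then obtain v v' where v: "v \<in> W" "v' \<in> W" "z = (\<lambda>k. emb (v k))" "w = (\<lambda>k. emb (v' k))" by (auto simp: V_def)
    have "(\<lambda>k. z k + w k) = (\<lambda>k. emb ((\<lambda>k. v k + v' k) k))" by (simp add: v emb_add)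
    then show "f (\<lambda>k. z k + w k) = f z + f w" by (simp only: f_emb v \<Lambda>_add) (simp add: emb_add)
  next
    fix r z assume "z \<in> V"
    then obtain v where v: "v \<in> W" "z = (\<lambda>k. emb (v k))" by (auto simp: V_def)
    have "(\<lambda>k. r *\<^sub>R z k) = (\<lambda>k. emb ((\<lambda>k. of_real r * v k) k))" by (simp add: v emb_mult emb_of_real scaleR_conv_of_real)
    then show "f (\<lambda>k. r *\<^sub>R z k) = r * f z" by (simp only: f_emb v \<Lambda>_scale) (simp add: emb_mult emb_of_real)
  next
    fix z assume "z \<in> V"
    then obtain v where v: "v \<in> W" "z = (\<lambda>k. emb (v k))" by (auto simp: V_def)
    have "f z \<le> cmod (emb (\<Lambda> v))" unfolding v(2) f_emb by (rule complex_Re_le_cmod)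
    then show "f z \<le> M * snorm K z" using \<Lambda>_le[OF v(1)] by (simp add: v(2) wnorm_emb)
  qed
  obtain u F w where u: "V.ulimit u" and F: "finite F" "F \<subseteq> K" and wF: "\<forall>k\<in>F. w k \<ge> 0 \<and> cmod (u k) = snorm K u"
    and w1: "sum w F = (1::real)"
    and le: "\<forall>z\<in>V. \<bar>f z - (\<Sum>k\<in>F. w k * Re (cnj (u k) * z k))\<bar> \<le> \<epsilon> * snorm K z"
    using V.finite_approximation[OF f \<epsilon> no_l1_V] by (elim exE conjE) (erule that)
  define R where "R = snorm K u"
  obtain zs where zs: "\<And>n::nat. zs n \<in> V" "(\<lambda>n. snorm K (\<lambda>k. zs n k - u k)) \<longlonglongrightarrow> 0"
    using u unfolding V.ulimit_def by blast
  have "\<forall>n. \<exists>v. v \<in> W \<and> zs n = (\<lambda>k. emb (v k))" using zs(1) by (auto simp: V_def)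
  from choice[OF this] obtain vs where vs: "\<And>n. vs n \<in> W" "\<And>n. zs n = (\<lambda>k. emb (vs n k))" by blast
  have cu: "continuous_on K u" using u by (simp add: V.ulimit_def)
  have R: "R \<ge> 0" unfolding R_def by (rule V.snorm_nonneg[OF cu])
  have point: "(\<lambda>n. zs n k) \<longlonglongrightarrow> u k" if "k \<in> K" for k
  proof (rule LIM_zero_cancel, rule Lim_null_comparison[OF always_eventually zs(2)], intro allI)
    fix n show "cmod (zs n k - u k) \<le> snorm K (\<lambda>k. zs n k - u k)"
      using V.snorm_ge[of "\<lambda>k. zs n k - u k" k] V.cont[OF zs(1)] cu that by (simp add: continuous_on_diff)
  qed
  have "(\<lambda>n. snorm K (zs n) - snorm K u) \<longlonglongrightarrow> 0"
    by (rule Lim_null_comparison[OF always_eventually zs(2)]) (use V.snorm_diff_le[OF V.cont[OF zs(1)] cu] in auto)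
  then have limR: "(\<lambda>n. snorm K (zs n)) \<longlonglongrightarrow> R" unfolding R_def by (rule LIM_zero_cancel)
  \<comment> \<open>For real scalars this says that \<open>u\<close> is real on \<open>K\<close>.
    Without it the coefficients \<open>cnj (u k)\<close> would not be scalars of the tensor
    product.\<close>
  have u_range: "u k \<in> range (emb :: 'k \<Rightarrow> complex)" if "k \<in> K" for k
    by (rule closed_sequentially[OF closed_range_emb _ point[OF that]]) (simp add: vs(2))
  define C where "C k = (of_real (w k) * inv emb (cnj (u k)) :: 'k)" for k
  have emb_C: "emb (C k) = of_real (w k) * cnj (u k)" if "k \<in> K" for k
  proof -
    have "cnj (u k) \<in> range (emb :: 'k \<Rightarrow> complex)" using u_range[OF that] cnj_emb by (metis imageE)
    then show ?thesis by (simp add: C_def emb_mult emb_of_real emb_inv)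
  qed
  have norm_C: "norm (C k) = w k * R" if "k \<in> F" for k
  proof -
    have "k \<in> K" using F that by blast
    then have "norm (C k) = cmod (of_real (w k) * cnj (u k))" using emb_C by (metis norm_emb)
    then show ?thesis using wF that by (simp add: norm_mult R_def)
  qed
  obtain h where h: "bij_betw h {0..<card F} F" using ex_bij_betw_nat_finite[OF F(1)] by blast
  define n where "n = card F"
  have hF: "h j \<in> F" if "j < n" for j using bij_betwE[OF h] that by (simp add: n_def)
  have hK: "h j \<in> K" if "j < n" for j using hF[OF that] F(2) by blast
  have reindex: "(\<Sum>j<n. g (h j)) = (\<Sum>k\<in>F. g k)" for g :: "'a \<Rightarrow> 'b::comm_monoid_add"
    using sum.reindex_bij_betw[OF h, of g] by (simp add: n_def atLeast0LessThan)
  define c where "c j = C (h j)" for j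
  have sum_c: "(\<Sum>j<n. norm (c j)) = R"
  proof -
    have "(\<Sum>j<n. norm (c j)) = (\<Sum>k\<in>F. norm (C k))" unfolding c_def by (rule reindex)
    also have "\<dots> = (\<Sum>k\<in>F. w k * R)" using norm_C by (rule sum.cong[OF refl])
    finally show ?thesis using w1 by (simp flip: sum_distrib_right)
  qed
  define t where "t = atom_sum \<tau> n c h"
  have tU: "t \<in> U" unfolding t_def by (rule atom_sum_in_span[OF hK])
  have t_emb: "emb (t (\<omega> v)) = (\<Sum>k\<in>F. of_real (w k) * (cnj (u k) * emb (v k)))" if "v \<in> W" for v
  proof -
    have "t (\<omega> v) = (\<Sum>j<n. C (h j) * v (h j))" unfolding t_def using atom_sum_pairing[OF that hK] by (simp add: c_def)
    also have "\<dots> = (\<Sum>k\<in>F. C k * v k)" by (rule reindex)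
    finally show ?thesis using F(2) by (auto simp: emb_sum emb_mult emb_C mult.assoc subset_iff intro!: sum.cong)
  qed
  have t_Re: "Re (emb (t (\<omega> v))) = (\<Sum>k\<in>F. w k * Re (cnj (u k) * emb (v k)))" if "v \<in> W" for v
    unfolding t_emb[OF that] Re_sum by (rule sum.cong[OF refl]) simp
  have t_scale: "t (\<omega> (\<lambda>k. c * v k)) = c * t (\<omega> v)" if "v \<in> W" for c v
    unfolding t_def using that W_scale by (simp add: atom_sum_pairing hK sum_distrib_left mult.left_commute)
  have close: "norm (\<Lambda> v - t (\<omega> v)) \<le> \<epsilon> * wnorm K v" if v: "v \<in> W" for v
  proof -
    \<comment> \<open>The estimate is known for real parts; rotating \<open>v\<close> by a
      unimodular scalar makes the difference real and nonnegative.\<close>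
    obtain a :: 'k where a: "norm a = 1" "a * (\<Lambda> v - t (\<omega> v)) = of_real (norm (\<Lambda> v - t (\<omega> v)))" using unit_rotation by blast
    have av: "(\<lambda>k. a * v k) \<in> W" by (rule W_scale[OF v])
    have "norm (\<Lambda> v - t (\<omega> v)) = Re (emb (a * (\<Lambda> v - t (\<omega> v))))" by (simp only: a(2) emb_of_real Re_complex_of_real)
    also have "\<dots> = Re (emb (\<Lambda> (\<lambda>k. a * v k))) - Re (emb (t (\<omega> (\<lambda>k. a * v k))))"
      unfolding \<Lambda>_scale[OF v] t_scale[OF v] by (simp only: right_diff_distrib emb_diff minus_complex.sel)
    also have "\<dots> = f (\<lambda>k. emb (a * v k)) - (\<Sum>k\<in>F. w k * Re (cnj (u k) * emb (a * v k)))"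
      unfolding t_Re[OF av] using f_emb[of "\<lambda>k. a * v k"] by simp
    also have "\<dots> \<le> \<bar>f (\<lambda>k. emb (a * v k)) - (\<Sum>k\<in>F. w k * Re (cnj (u k) * emb (a * v k)))\<bar>" by (rule abs_ge_self)
    also have "\<dots> \<le> \<epsilon> * snorm K (\<lambda>k. emb (a * v k))" by (rule le[rule_format]) (use av in \<open>auto simp: V_def\<close>)
    also have "snorm K (\<lambda>k. emb (a * v k)) = wnorm K v" unfolding wnorm_emb snorm_def by (simp add: norm_mult a(1))
    finally show ?thesis .
  qed
  \<comment> \<open>Evaluated at functions tending uniformly to \<open>u\<close>, the combination
    tends to the sum of \<open>w k * (cmod (u k))\<^sup>2\<close>, which is
    \<open>R\<^sup>2\<close>, while the bound tends to \<open>B * R\<close>. The fact is used for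
    \<open>B = q t\<close>, giving attainment, and for \<open>B = M + \<epsilon>\<close>, giving the
    cost estimate.\<close>
  have attain: "R \<le> B" if B: "\<And>v. v \<in> W \<Longrightarrow> norm (t (\<omega> v)) \<le> B * wnorm K v" "B \<ge> 0" for B
  proof (cases "R = 0")
    case False
    have "(\<lambda>n. \<Sum>k\<in>F. w k * Re (cnj (u k) * zs n k)) \<longlonglongrightarrow> (\<Sum>k\<in>F. w k * Re (cnj (u k) * u k))"
      by (intro tendsto_intros point) (use F(2) in auto)
    moreover have "(\<Sum>k\<in>F. w k * Re (cnj (u k) * zs n k)) \<le> B * snorm K (zs n)" for n
    proof -
      have "(\<Sum>k\<in>F. w k * Re (cnj (u k) * zs n k)) = Re (emb (t (\<omega> (vs n))))" unfolding t_Re[OF vs(1)] vs(2) ..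
      also have "\<dots> \<le> norm (t (\<omega> (vs n)))" using complex_Re_le_cmod[of "emb (t (\<omega> (vs n)))"] by simp
      also have "\<dots> \<le> B * wnorm K (vs n)" by (rule B(1)[OF vs(1)])
      finally show ?thesis by (simp add: wnorm_emb vs(2))
    qed
    ultimately have "(\<Sum>k\<in>F. w k * Re (cnj (u k) * u k)) \<le> B * R"
      by (intro LIMSEQ_le[OF _ tendsto_mult_left[OF limR]]) auto
    moreover have "(\<Sum>k\<in>F. w k * Re (cnj (u k) * u k)) = (\<Sum>k\<in>F. w k * R\<^sup>2)"
    proof (rule sum.cong[OF refl])
      fix k assume "k \<in> F"
      then have "(cmod (u k))\<^sup>2 = R\<^sup>2" using wF by (simp add: R_def)
      then show "w k * Re (cnj (u k) * u k) = w k * R\<^sup>2" unfolding cmod_power2 by (simp add: power2_eq_square)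
    qed
    moreover have "(\<Sum>k\<in>F. w k * R\<^sup>2) = R * R" using w1 by (simp add: power2_eq_square flip: sum_distrib_right)
    ultimately show ?thesis using False R by simp
  qed (use B in simp)
  have "q t \<le> R" unfolding t_def sum_c[symmetric] by (rule gauge_norm_le[OF hK])
  moreover have "R \<le> q t" by (rule attain[OF pairing_le[OF tU] q.p_nonneg[OF tU]])
  moreover have "R \<le> M + \<epsilon>"
  proof (rule attain)
    fix v assume v: "v \<in> W"
    have "norm (t (\<omega> v)) \<le> norm (\<Lambda> v) + norm (\<Lambda> v - t (\<omega> v))"
      using norm_triangle_ineq4[of "\<Lambda> v" "\<Lambda> v - t (\<omega> v)"] by simp
    also have "\<dots> \<le> M * wnorm K v + \<epsilon> * wnorm K v" by (rule add_mono[OF \<Lambda>_le[OF v] close[OF v]])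
    finally show "norm (t (\<omega> v)) \<le> (M + \<epsilon>) * wnorm K v" by (simp add: distrib_right)
  qed (use M \<epsilon> in simp)
  ultimately show ?thesis using hK close sum_c unfolding t_def
    by (intro exI[of _ n] exI[of _ c] exI[of _ h]) auto
qed

end

text \<open>Completeness is inherited from the closed image under \<open>emb\<close>; it makes the
  bounded maps into the scalars a Banach space.\<close>

instance real_or_complex \<subseteq> banach
proof
  fix X :: "nat \<Rightarrow> 'a::real_or_complex" assume X: "Cauchy X"
  have "Cauchy (\<lambda>n. emb (X n))" using X by (simp add: Cauchy_def dist_norm flip: emb_diff)
  then obtain l where l: "(\<lambda>n. emb (X n)) \<longlonglongrightarrow> l" using Cauchy_convergent convergentD by blast
  have "l \<in> range (emb :: 'a \<Rightarrow> complex)" by (rule closed_sequentially[OF closed_range_emb _ l]) simp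
  then obtain x where x: "l = emb (x :: 'a)" by blast
  have "X \<longlonglongrightarrow> x" using l unfolding x tendsto_dist_iff[of X] tendsto_dist_iff[of "\<lambda>n. emb (X n)"]
    by (simp add: dist_norm flip: emb_diff)
  then show "convergent X" by (rule convergentI)
qed

text \<open>Compactness of scalar balls is what Tychonoff's theorem needs for the dual
  balls.\<close>

instance real_or_complex \<subseteq> heine_borel
proof
  fix X :: "nat \<Rightarrow> 'a::real_or_complex" assume "bounded (range X)"
  then have "bounded (range (\<lambda>n. emb (X n)))" by (auto simp: bounded_iff)
  then obtain l r where l: "strict_mono (r :: nat \<Rightarrow> nat)" "((\<lambda>n. emb (X n)) \<circ> r) \<longlonglongrightarrow> l"
    using bounded_imp_convergent_subsequence by blast
  have "l \<in> range (emb :: 'a \<Rightarrow> complex)" by (rule closed_sequentially[OF closed_range_emb _ l(2)]) simp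
  then obtain x where x: "l = emb (x :: 'a)" by blast
  have "(X \<circ> r) \<longlonglongrightarrow> x"
    using l(2) unfolding x tendsto_dist_iff[of "X \<circ> r"] tendsto_dist_iff[of "(\<lambda>n. emb (X n)) \<circ> r"]
    by (simp add: dist_norm flip: emb_diff)
  then show "\<exists>l r. strict_mono (r :: nat \<Rightarrow> nat) \<and> (X \<circ> r) \<longlonglongrightarrow> l" using l(1) by blast
qed

section \<open>The projective completion as a space of functionals\<close>

context duality begin

lemma gauge_atom_le: "k \<in> K \<Longrightarrow> q (\<tau> k) \<le> 1"
  using gauge_norm_le[of 1 "\<lambda>_. k" K \<tau> "\<lambda>_. 1"] by (simp add: atom_sum_def)

text \<open>A Cauchy sequence is rewritten as one absolutely convergent series of atoms: increments
  along a fast subsequence are replaced by atomic sums of almost minimal cost, and all their atoms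
  are enumerated together. The pairing of this series with \<open>W\<close> vanishes, so
  \<open>injective\<close> applies to it.\<close>

lemma null_if_pairing_null:
  assumes s: "s \<in> Cauchy_seqs U q" and null: "\<And>v. v \<in> W \<Longrightarrow> (\<lambda>i. s i (\<omega> v)) \<longlonglongrightarrow> 0"
  shows "(\<lambda>i. q (s i)) \<longlonglongrightarrow> 0"
proof -
  note sU = q.Cauchy_seqs_in[OF s]
  have "\<forall>n. \<exists>N. \<forall>m\<ge>N. \<forall>l\<ge>N. q (s m - s l) < (1/2)^n" using q.Cauchy_seqsD[OF s] by simp
  from choice[OF this] obtain N0 where N0: "\<And>n m l. m \<ge> N0 n \<Longrightarrow> l \<ge> N0 n \<Longrightarrow> q (s m - s l) < (1/2)^n" by blast
  \<comment> \<open>Partial sums make the chosen indices monotone while keeping them above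
    \<open>N0 n\<close>.\<close>
  define \<sigma> where "\<sigma> n = (\<Sum>i\<le>n. N0 i)" for n :: nat
  have \<sigma>_ge: "\<sigma> n \<ge> N0 n" for n unfolding \<sigma>_def by (rule member_le_sum) auto
  have \<sigma>_Suc: "\<sigma> (Suc n) \<ge> \<sigma> n" for n unfolding \<sigma>_def by simp
  define d where "d n = (case n of 0 \<Rightarrow> s (\<sigma> 0) | Suc m \<Rightarrow> s (\<sigma> (Suc m)) - s (\<sigma> m))" for n
  \<comment> \<open>The 1 makes the bound strict for the initial block as well; a representation is
    available strictly above the atomic norm only.\<close>
  define b where "b n = (case n of 0 \<Rightarrow> q (s (\<sigma> 0)) + 1 | Suc m \<Rightarrow> (1/2)^m)" for n :: nat
  have d_sum: "(\<Sum>n\<le>L. d n) = s (\<sigma> L)" for L by (induction L) (simp_all add: d_def)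
  have dU: "d n \<in> U" for n by (cases n) (auto simp: d_def intro: sU tscale.span_diff)
  have d_less: "q (d n) < b n" for n
  proof (cases n)
    case (Suc m)
    have "\<sigma> (Suc m) \<ge> N0 m" using \<sigma>_ge[of m] \<sigma>_Suc[of m] by linarith
    then show ?thesis using N0[OF _ \<sigma>_ge[of m]] by (simp add: Suc d_def b_def)
  qed (simp add: d_def b_def)
  have "\<forall>n. \<exists>r. (\<forall>j<fst r. snd (snd r) j \<in> K) \<and> d n = atom_sum \<tau> (fst r) (fst (snd r)) (snd (snd r))
      \<and> (\<Sum>j<fst r. norm (fst (snd r) j)) < b n"
  proof
    fix n
    from gauge_norm_less[OF dU d_less, of n] obtain m c k where
      "(\<forall>j<m. k j \<in> K) \<and> d n = atom_sum \<tau> m c k \<and> (\<Sum>j<m. norm (c j)) < b n" by (elim exE) (erule that)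
    then show "\<exists>r. (\<forall>j<fst r. snd (snd r) j \<in> K) \<and> d n = atom_sum \<tau> (fst r) (fst (snd r)) (snd (snd r))
      \<and> (\<Sum>j<fst r. norm (fst (snd r) j)) < b n" by (intro exI[of _ "(m, c, k)"]) simp
  qed
  from choice[OF this] obtain r where r: "\<forall>n. (\<forall>j<fst (r n). snd (snd (r n)) j \<in> K) \<and>
      d n = atom_sum \<tau> (fst (r n)) (fst (snd (r n))) (snd (snd (r n))) \<and> (\<Sum>j<fst (r n). norm (fst (snd (r n)) j)) < b n" ..
  define N where "N n = fst (r n)" for n
  define c where "c n = fst (snd (r n))" for n
  define k where "k n = snd (snd (r n))" for n
  have kK: "k n j \<in> K" if "j < N n" for n j using r that by (simp add: N_def k_def)
  have d_eq: "d n = atom_sum \<tau> (N n) (c n) (k n)" for n using r by (simp add: N_def k_def c_def)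
  have c_sum: "(\<Sum>j<N n. norm (c n j)) \<le> b n" for n using r by (simp add: N_def c_def less_imp_le)
  have b0: "b n \<ge> 0" for n using order_trans[OF sum_nonneg c_sum] by simp
  obtain k0 where k0: "k0 \<in> K" using K(2) by blast
  \<comment> \<open>Block \<open>n\<close> uses the pairs \<open>(n, j)\<close> with
    \<open>j < N n\<close>. All other pairs get coefficient 0 and the dummy atom \<open>k0\<close>,
    so that \<open>prod_decode\<close> can enumerate every pair.\<close>
  define C where "C p = (if snd p < N (fst p) then c (fst p) (snd p) else 0)" for p
  define A where "A p = (if snd p < N (fst p) then k (fst p) (snd p) else k0)" for p
  define cs where "cs i = C (prod_decode i)" for i
  define ks where "ks i = A (prod_decode i)" for i
  have ks: "range ks \<subseteq> K" using kK k0 by (auto simp: ks_def A_def)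
  have block: "(\<Sum>i\<in>J. norm (cs i)) \<le> (\<Sum>n\<in>B. b n)"
    if "finite J" "finite B" "\<And>i. i \<in> J \<Longrightarrow> fst (prod_decode i) \<in> B" for J B
  proof -
    have "(\<Sum>i\<in>J. norm (cs i)) = (\<Sum>p\<in>prod_decode ` J. norm (C p))"
      unfolding cs_def by (subst sum.reindex) (auto simp: inj_on_def)
    also have "\<dots> = (\<Sum>p\<in>prod_decode ` J \<inter> Sigma B (\<lambda>n. {..<N n}). norm (C p))"
    proof (rule sum.mono_neutral_right)
      show "\<forall>p\<in>prod_decode ` J - prod_decode ` J \<inter> Sigma B (\<lambda>n. {..<N n}). norm (C p) = 0"
      proof
        fix p assume p: "p \<in> prod_decode ` J - prod_decode ` J \<inter> Sigma B (\<lambda>n. {..<N n})"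
        then have "fst p \<in> B" using that(3) by auto
        then have "\<not> snd p < N (fst p)" using p by (cases p) auto
        then show "norm (C p) = 0" by (simp add: C_def)
      qed
    qed (use that in auto)
    also have "\<dots> \<le> (\<Sum>p\<in>Sigma B (\<lambda>n. {..<N n}). norm (C p))"
      using that by (intro sum_mono2) auto
    also have "\<dots> = (\<Sum>n\<in>B. \<Sum>j<N n. norm (C (n, j)))" using that(2) by (subst sum.Sigma) auto
    also have "\<dots> = (\<Sum>n\<in>B. \<Sum>j<N n. norm (c n j))" by (auto simp: C_def intro!: sum.cong)
    also have "\<dots> \<le> (\<Sum>n\<in>B. b n)" by (intro sum_mono c_sum)
    finally show ?thesis .
  qed
  have b_tail: "(\<Sum>n\<in>{Suc L..<Suc L + m}. b n) \<le> 2 * (1/2)^L" for L m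
  proof -
    have "(\<Sum>n\<in>{Suc L..<Suc L + m}. b n) = 2 * (1/2)^L - 2 * (1/2)^(L + m)"
      by (induction m) (simp_all add: b_def)
    then show ?thesis by simp
  qed
  have fst_le: "fst (prod_decode i) \<le> i" for i
    using le_prod_encode_1[of "fst (prod_decode i)" "snd (prod_decode i)"] by simp
  have summ: "summable (\<lambda>i. norm (cs i))"
  proof (rule summableI_nonneg_bounded)
    fix m
    have "(\<Sum>i<m. norm (cs i)) \<le> (\<Sum>n\<in>{0..<Suc m}. b n)"
      by (rule block) (use fst_le in \<open>auto simp: less_Suc_eq_le intro: order_trans less_imp_le\<close>)
    also have "\<dots> = b 0 + (\<Sum>n\<in>{Suc 0..<Suc 0 + m}. b n)" by (simp add: sum.atLeast_Suc_lessThan)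
    also have "\<dots> \<le> b 0 + 2" using b_tail[of 0 m] by simp
    finally show "(\<Sum>i<m. norm (cs i)) \<le> b 0 + 2" .
  qed simp
  define T where "T m = atom_sum \<tau> m cs ks" for m
  have TU: "T m \<in> U" for m unfolding T_def by (rule atom_sum_in_span) (use ks in auto)
  have close: "\<exists>M. \<forall>m\<ge>M. q (T m - s (\<sigma> L)) \<le> 2 * (1/2)^L" for L
  proof -
    define P where "P = Sigma {..L} (\<lambda>n. {..<N n})"
    have fP: "finite P" by (simp add: P_def)
    \<comment> \<open>Larger than every code of a pair in the blocks up to \<open>L\<close>; from
      \<open>M\<close> on these blocks are complete, and what else has been enumerated belongs to
      later blocks, of total cost at most \<open>2 * (1/2)^L\<close>.\<close>
    define M where "M = Suc (\<Sum>p\<in>P. prod_encode p)"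
    have "q (T m - s (\<sigma> L)) \<le> 2 * (1/2)^L" if m: "m \<ge> M" for m
    proof -
      define g where "g p = tscale (C p) (\<tau> (A p))" for p
      have gz: "g p = 0" if "\<not> snd p < N (fst p)" for p using that by (simp add: g_def C_def tscale_def fun_eq_iff)
      define J where "J = {i. i < m \<and> fst (prod_decode i) \<le> L}"
      define J' where "J' = {i. i < m \<and> \<not> fst (prod_decode i) \<le> L}"
      have fin: "finite J" "finite J'" by (auto simp: J_def J'_def)
      have "T m = (\<Sum>i<m. g (prod_decode i))" by (simp add: T_def atom_sum_def g_def cs_def ks_def)
      also have "{..<m} = J \<union> J'" by (auto simp: J_def J'_def)
      also have "(\<Sum>i\<in>J \<union> J'. g (prod_decode i)) = (\<Sum>i\<in>J. g (prod_decode i)) + (\<Sum>i\<in>J'. g (prod_decode i))"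
        by (rule sum.union_disjoint[OF fin]) (auto simp: J_def J'_def)
      also have "(\<Sum>i\<in>J. g (prod_decode i)) = (\<Sum>p\<in>prod_decode ` J. g p)"
        by (subst sum.reindex) (auto simp: inj_on_def)
      also have "\<dots> = (\<Sum>p\<in>P. g p)"
      proof (rule sum.mono_neutral_right)
        show "P \<subseteq> prod_decode ` J"
        proof
          fix p assume p: "p \<in> P"
          have "prod_encode p < m" using member_le_sum[OF p, of prod_encode] fP m by (simp add: M_def)
          then have "prod_encode p \<in> J" using p by (auto simp: J_def P_def)
          then show "p \<in> prod_decode ` J" by (rule rev_image_eqI) simp
        qed
        show "\<forall>p\<in>prod_decode ` J - P. g p = 0"
        proof
          fix p assume p: "p \<in> prod_decode ` J - P"
          then have "fst p \<le> L" by (auto simp: J_def)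
          then have "\<not> snd p < N (fst p)" using p by (cases p) (auto simp: P_def)
          then show "g p = 0" by (rule gz)
        qed
      qed (use fin in simp)
      also have "\<dots> = (\<Sum>n\<le>L. \<Sum>j<N n. g (n, j))" unfolding P_def by (subst sum.Sigma) auto
      also have "\<dots> = (\<Sum>n\<le>L. d n)"
        by (rule sum.cong[OF refl]) (simp add: d_eq atom_sum_def g_def C_def A_def)
      finally have "T m - s (\<sigma> L) = (\<Sum>i\<in>J'. g (prod_decode i))" by (simp add: d_sum fun_eq_iff)
      moreover have "q (\<Sum>i\<in>J'. g (prod_decode i)) \<le> (\<Sum>i\<in>J'. q (g (prod_decode i)))"
      proof (rule q.p_sum)
        fix i
        have "A (prod_decode i) \<in> K" using ks by (auto simp: ks_def)
        then show "g (prod_decode i) \<in> U" unfolding g_def by (intro tscale.span_scale tscale.span_base imageI)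
      qed
      moreover have "(\<Sum>i\<in>J'. q (g (prod_decode i))) \<le> (\<Sum>i\<in>J'. norm (cs i))"
      proof (rule sum_mono)
        fix i
        have AK: "A (prod_decode i) \<in> K" using ks by (auto simp: ks_def)
        then have "q (g (prod_decode i)) = norm (cs i) * q (\<tau> (A (prod_decode i)))"
          unfolding g_def cs_def by (intro q.homogeneous tscale.span_base) simp
        then show "q (g (prod_decode i)) \<le> norm (cs i)" using gauge_atom_le[OF AK] by (simp add: mult_left_le)
      qed
      moreover have "(\<Sum>i\<in>J'. norm (cs i)) \<le> (\<Sum>n\<in>{Suc L..<Suc L + m}. b n)"
      proof (rule block)
        show "fst (prod_decode i) \<in> {Suc L..<Suc L + m}" if "i \<in> J'" for i
          using that fst_le[of i] by (simp add: J'_def)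
      qed (use fin in auto)
      ultimately show ?thesis using b_tail[of L m] by simp
    qed
    then show ?thesis by blast
  qed
  have "(\<lambda>i. cs i * v (ks i)) sums 0" if v: "v \<in> W" for v
    unfolding sums_def
  proof (rule LIMSEQ_I)
    fix e :: real assume "e > 0"
    \<comment> \<open>Chosen with \<open>e' * (2 * wnorm K v + 2) = e / 2\<close>; the added 2
      prevents division by 0.\<close>
    define e' where "e' = (e / 2) / (2 * wnorm K v + 2)"
    have wp: "2 * wnorm K v + 2 > 0" using wnorm_nonneg[OF v] by simp
    have e': "e' > 0" using \<open>e > 0\<close> wp by (simp add: e'_def)
    have "(\<lambda>L. 2 * (1/2::real)^L) \<longlonglongrightarrow> 2 * 0" by (intro tendsto_mult_left LIMSEQ_power_zero) simp
    then have ev1: "\<forall>\<^sub>F L in sequentially. 2 * (1/2::real)^L < e'" using e' by (intro order_tendstoD) auto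
    have "(\<lambda>i. norm (s i (\<omega> v))) \<longlonglongrightarrow> 0" using tendsto_norm[OF null[OF v]] by simp
    then have "\<forall>\<^sub>F i in sequentially. norm (s i (\<omega> v)) < e / 2" using \<open>e > 0\<close> by (intro order_tendstoD) auto
    then obtain I where I: "\<And>i. i \<ge> I \<Longrightarrow> norm (s i (\<omega> v)) < e / 2" unfolding eventually_sequentially by blast
    obtain L0 where L0: "\<And>L. L \<ge> L0 \<Longrightarrow> 2 * (1/2::real)^L < e'" using ev1 unfolding eventually_sequentially by blast
    define L where "L = L0"
    obtain M where M: "\<And>m. m \<ge> M \<Longrightarrow> q (T m - s (\<sigma> L)) \<le> 2 * (1/2)^L" using close by blast
    obtain I' where I': "I' \<ge> I" "I' \<ge> \<sigma> L" by (meson nle_le)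
    have sI: "q (s (\<sigma> L) - s I') \<le> 2 * (1/2)^L"
    proof -
      have "q (s (\<sigma> L) - s I') < (1/2)^L" by (rule N0[OF \<sigma>_ge order_trans[OF \<sigma>_ge I'(2)]])
      moreover have "(0::real) < (1/2)^L" by simp
      ultimately show ?thesis by linarith
    qed
    have "norm ((\<Sum>i<m. cs i * v (ks i)) - 0) < e" if m: "m \<ge> M" for m
    proof -
      have eq: "(\<Sum>i<m. cs i * v (ks i)) = T m (\<omega> v)" unfolding T_def using ks by (subst atom_sum_pairing[OF v]) auto
      have 1: "norm ((T m - s I') (\<omega> v)) \<le> q (T m - s I') * wnorm K v"
        by (rule pairing_le[OF tscale.span_diff[OF TU sU] v])
      have "q (T m - s I') \<le> q (T m - s (\<sigma> L)) + q (s (\<sigma> L) - s I')" by (rule q.triangle3[OF TU sU sU])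
      also have "\<dots> \<le> 2 * e'" using M[OF m] sI L0[of L] by (simp add: L_def)
      finally have "q (T m - s I') * wnorm K v \<le> 2 * e' * wnorm K v" by (rule mult_right_mono[OF _ wnorm_nonneg[OF v]])
      also have "\<dots> < e' * (2 * wnorm K v + 2)" using e' by (simp add: algebra_simps)
      also have "\<dots> = e / 2" using wp unfolding e'_def by (subst nonzero_eq_divide_eq[symmetric]) auto
      finally have "norm (T m (\<omega> v) - s I' (\<omega> v)) < e / 2" using 1 by simp
      moreover have "norm (T m (\<omega> v)) \<le> norm (T m (\<omega> v) - s I' (\<omega> v)) + norm (s I' (\<omega> v))"
        using norm_triangle_ineq[of "T m (\<omega> v) - s I' (\<omega> v)" "s I' (\<omega> v)"] by simp
      ultimately show ?thesis unfolding eq using I[OF I'(1)] by simp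
    qed
    then show "\<exists>no. \<forall>n\<ge>no. norm ((\<Sum>i<n. cs i * v (ks i)) - 0) < e" by blast
  qed
  from injective[OF ks summ this] have Tnull: "(\<lambda>m. q (T m)) \<longlonglongrightarrow> 0" unfolding T_def .
  show ?thesis
  proof (rule LIMSEQ_I)
    fix e :: real assume "e > 0"
    have "(\<lambda>L. 3 * (1/2::real)^L) \<longlonglongrightarrow> 3 * 0" by (intro tendsto_mult_left LIMSEQ_power_zero) simp
    then have "\<forall>\<^sub>F L in sequentially. 3 * (1/2::real)^L < e" using \<open>e > 0\<close> by (intro order_tendstoD) auto
    then obtain L where L: "3 * (1/2::real)^L < e" unfolding eventually_sequentially by blast
    obtain M where M: "\<And>m. m \<ge> M \<Longrightarrow> q (T m - s (\<sigma> L)) \<le> 2 * (1/2)^L" using close by blast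
    have sL: "q (s (\<sigma> L)) \<le> 2 * (1/2)^L"
    proof (rule LIMSEQ_le_const)
      show "(\<lambda>m. q (T m) + 2 * (1/2)^L) \<longlonglongrightarrow> 2 * (1/2)^L" using tendsto_add[OF Tnull tendsto_const] by simp
      show "\<exists>N. \<forall>n\<ge>N. q (s (\<sigma> L)) \<le> q (T n) + 2 * (1/2)^L"
      proof (intro exI[of _ M] allI impI)
        fix m assume "m \<ge> M"
        then show "q (s (\<sigma> L)) \<le> q (T m) + 2 * (1/2)^L"
          using M[of m] q.reverse_triangle[OF TU[of m] sU[of "\<sigma> L"]] by linarith
      qed
    qed
    have "norm (q (s i) - 0) < e" if "i \<ge> \<sigma> L" for i
    proof -
      have "q (s i - s (\<sigma> L)) < (1/2)^L" using N0[of L i "\<sigma> L"] \<sigma>_ge[of L] that by simp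
      then have "q (s i) < (1/2)^L + 2 * (1/2)^L" using q.reverse_triangle[OF sU[of i] sU[of "\<sigma> L"]] sL by linarith
      then show ?thesis using L q.p_nonneg[OF sU[of i]] by simp
    qed
    then show "\<exists>no. \<forall>n\<ge>no. norm (q (s n) - 0) < e" by blast
  qed
qed

lemma pairing_limit:
  assumes s: "s \<in> Cauchy_seqs U q"
  shows "\<exists>\<Lambda> M. M \<ge> 0 \<and> dual_functional \<Lambda> M \<and> (\<forall>v\<in>W. (\<lambda>i. s i (\<omega> v)) \<longlonglongrightarrow> \<Lambda> v)"
proof -
  note sU = q.Cauchy_seqs_in[OF s]
  define \<Lambda> where "\<Lambda> v = lim (\<lambda>i. s i (\<omega> v))" for v
  have lim: "(\<lambda>i. s i (\<omega> v)) \<longlonglongrightarrow> \<Lambda> v" if v: "v \<in> W" for v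
  proof -
    have "Cauchy (\<lambda>i. s i (\<omega> v))"
    proof (rule CauchyI)
      fix e :: real assume "e > 0"
      have wp: "wnorm K v + 1 > 0" using wnorm_nonneg[OF v] by simp
      then obtain M where M: "\<forall>m\<ge>M. \<forall>n\<ge>M. q (s m - s n) < e / (wnorm K v + 1)"
        using q.Cauchy_seqsD[OF s, of "e / (wnorm K v + 1)"] \<open>e > 0\<close> by auto
      have "norm (s m (\<omega> v) - s n (\<omega> v)) < e" if "m \<ge> M" "n \<ge> M" for m n
      proof -
        have "norm ((s m - s n) (\<omega> v)) \<le> q (s m - s n) * wnorm K v"
          by (rule pairing_le[OF tscale.span_diff[OF sU sU] v])
        also have "\<dots> \<le> q (s m - s n) * (wnorm K v + 1)"
          by (intro mult_left_mono q.p_nonneg tscale.span_diff sU) simp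
        also have "\<dots> < e / (wnorm K v + 1) * (wnorm K v + 1)" using M that wp by (intro mult_strict_right_mono) auto
        finally show ?thesis using wp by simp
      qed
      then show "\<exists>M. \<forall>m\<ge>M. \<forall>n\<ge>M. norm (s m (\<omega> v) - s n (\<omega> v)) < e" by blast
    qed
    then show ?thesis unfolding \<Lambda>_def using Cauchy_convergent convergent_LIMSEQ_iff by blast
  qed
  obtain M where M: "(\<lambda>i. q (s i)) \<longlonglongrightarrow> M" using q.Cauchy_seqs_convergent[OF s] convergentD by blast
  have add: "t (\<omega> (\<lambda>k. v k + w k)) = t (\<omega> v) + t (\<omega> w)" if t: "t \<in> U" and "v \<in> W" "w \<in> W" for t v w
  proof -
    obtain n c k where "\<forall>j<n. k j \<in> K" "t = atom_sum \<tau> n c k" using span_atoms_rep[OF t] by (elim exE conjE) (erule that)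
    then show ?thesis using that W_add by (simp add: atom_sum_pairing sum.distrib distrib_left)
  qed
  have scale: "t (\<omega> (\<lambda>k. c * v k)) = c * t (\<omega> v)" if t: "t \<in> U" and "v \<in> W" for t c v
  proof -
    obtain n d k where "\<forall>j<n. k j \<in> K" "t = atom_sum \<tau> n d k" using span_atoms_rep[OF t] by (elim exE conjE) (erule that)
    then show ?thesis using that W_scale by (simp add: atom_sum_pairing sum_distrib_left mult.left_commute)
  qed
  have "dual_functional \<Lambda> M"
    unfolding dual_functional_def
  proof (intro conjI ballI allI)
    fix v w assume vw: "v \<in> W" "w \<in> W"
    have "(\<lambda>i. s i (\<omega> (\<lambda>k. v k + w k))) \<longlonglongrightarrow> \<Lambda> v + \<Lambda> w"
      unfolding add[OF sU vw] by (intro tendsto_add lim vw)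
    with lim[OF W_add[OF vw]] show "\<Lambda> (\<lambda>k. v k + w k) = \<Lambda> v + \<Lambda> w" by (rule LIMSEQ_unique)
  next
    fix c v assume v: "v \<in> W"
    have "(\<lambda>i. s i (\<omega> (\<lambda>k. c * v k))) \<longlonglongrightarrow> c * \<Lambda> v"
      unfolding scale[OF sU v] by (intro tendsto_mult_left lim v)
    with lim[OF W_scale[OF v]] show "\<Lambda> (\<lambda>k. c * v k) = c * \<Lambda> v" by (rule LIMSEQ_unique)
  next
    fix v assume v: "v \<in> W"
    show "norm (\<Lambda> v) \<le> M * wnorm K v"
      by (rule LIMSEQ_le[OF tendsto_norm[OF lim[OF v]] tendsto_mult_right[OF M]]) (use pairing_le[OF sU v] in blast)
  qed
  moreover have "M \<ge> 0" by (rule LIMSEQ_le_const[OF M]) (use q.p_nonneg[OF sU] in blast)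
  ultimately show ?thesis using lim by blast
qed

text \<open>The atomic norm is asymptotically bounded by the norm of the limit functional. Applying
  the finite approximation to the successive residuals gives a Cauchy sequence \<open>t\<close> with
  the same limit functional and cost at most \<open>r\<close> plus a small amount; \<open>s\<close>
  and \<open>t\<close> differ by a sequence whose pairings vanish, hence by a null sequence.\<close>

lemma isometry:
  assumes s: "s \<in> Cauchy_seqs U q" and lim: "\<And>v. v \<in> W \<Longrightarrow> (\<lambda>i. s i (\<omega> v)) \<longlonglongrightarrow> \<Lambda> v"
    and \<Lambda>: "dual_functional \<Lambda> r" and r: "r \<ge> 0" and e: "e > 0"
  shows "\<exists>N. \<forall>i\<ge>N. q (s i) \<le> r + e"
proof -
  \<comment> \<open>The norm of the residual after \<open>n\<close> corrections. Correction
    \<open>n\<close> costs at most \<open>\<rho> n + \<rho> (Suc n)\<close>: the initial one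
    \<open>r + e / 8\<close>, all later ones together at most \<open>e / 2\<close>. At least
    \<open>e / 4\<close> remains for comparing \<open>s\<close> with \<open>t\<close>.\<close>
  define \<rho> where "\<rho> n = (if n = 0 then r else e / 4 * (1/2)^n)" for n :: nat
  have \<rho>0: "\<rho> n \<ge> 0" for n using r e by (simp add: \<rho>_def)
  have \<rho>S: "\<rho> (Suc n) > 0" for n using e by (simp add: \<rho>_def)
  define good where "good n t \<longleftrightarrow> t \<in> U \<and> dual_functional (\<lambda>v. \<Lambda> v - t (\<omega> v)) (\<rho> n)" for n t
  have step: "\<exists>t'. good (Suc n) t' \<and> q (t' - t) \<le> \<rho> n + \<rho> (Suc n)" if t: "good n t" for n t
  proof -
    have "dual_functional (\<lambda>v. \<Lambda> v - t (\<omega> v)) (\<rho> n)" using t by (simp add: good_def)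
    from norm_attaining_approximation[OF this \<rho>S[of n] \<rho>0] obtain m c k where
      k: "\<forall>j<m. k j \<in> K" and qa: "q (atom_sum \<tau> m c k) = (\<Sum>j<m. norm (c j))" "(\<Sum>j<m. norm (c j)) \<le> \<rho> n + \<rho> (Suc n)" and
      cl: "\<forall>v\<in>W. norm (\<Lambda> v - t (\<omega> v) - atom_sum \<tau> m c k (\<omega> v)) \<le> \<rho> (Suc n) * wnorm K v"
      by (elim exE conjE) (erule that)
    define w where "w = atom_sum \<tau> m c k"
    have wU: "w \<in> U" unfolding w_def by (rule atom_sum_in_span) (use k in auto)
    have "dual_functional (\<lambda>v. \<Lambda> v - (t + w) (\<omega> v)) (\<rho> (Suc n))"
    proof -
      have *: "(\<lambda>v. \<Lambda> v - (t + w) (\<omega> v)) = (\<lambda>v. (\<Lambda> v - t (\<omega> v)) - w (\<omega> v))" by (simp add: diff_diff_eq)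
      show ?thesis
        using t cl W_add W_scale k unfolding * good_def dual_functional_def
        by (simp add: w_def atom_sum_pairing sum.distrib sum_distrib_left right_diff_distrib distrib_left mult.left_commute)
    qed
    moreover have "t + w \<in> U" using t wU by (auto simp: good_def intro: tscale.span_add)
    ultimately show ?thesis using qa by (intro exI[of _ "t + w"]) (simp add: good_def w_def)
  qed
  have "\<exists>t. \<forall>n. (good n (t n) \<and> (n = 0 \<longrightarrow> t n = 0)) \<and> q (t (Suc n) - t n) \<le> \<rho> n + \<rho> (Suc n)"
  proof (rule dependent_nat_choice)
    have "good 0 0" using \<Lambda> by (simp add: good_def \<rho>_def tscale.span_zero)
    then show "\<exists>t. good 0 t \<and> (0 = 0 \<longrightarrow> t = 0)" by simp
  next
    fix t n assume "good n t \<and> (n = 0 \<longrightarrow> t = 0)"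
    then show "\<exists>t'. (good (Suc n) t' \<and> (Suc n = 0 \<longrightarrow> t' = 0)) \<and> q (t' - t) \<le> \<rho> n + \<rho> (Suc n)"
      using step[of n t] by simp
  qed
  then obtain t where t: "\<forall>n. (good n (t n) \<and> (n = 0 \<longrightarrow> t n = 0)) \<and> q (t (Suc n) - t n) \<le> \<rho> n + \<rho> (Suc n)" ..
  have tU: "t n \<in> U" and tf: "dual_functional (\<lambda>v. \<Lambda> v - t n (\<omega> v)) (\<rho> n)"
    and tstep: "q (t (Suc n) - t n) \<le> \<rho> n + \<rho> (Suc n)" and t0: "t 0 = 0" for n
    using t by (auto simp: good_def)
  have diffs: "q (t (Suc n + p) - t (Suc n)) \<le> e / 2 * ((1/2)^n - (1/2)^(n + p))" for n p
  proof (induction p)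
    case 0
    show ?case unfolding add_0_right diff_self q.p_zero by simp
  next
    case (Suc p)
    have 1: "q (t (Suc n + Suc p) - t (Suc n)) \<le> q (t (Suc (Suc n + p)) - t (Suc n + p)) + q (t (Suc n + p) - t (Suc n))"
      using q.triangle3[OF tU tU tU] by simp
    have 2: "\<rho> (Suc n + p) + \<rho> (Suc (Suc n + p)) \<le> e / 2 * ((1/2)^(n + p) - (1/2)^(n + Suc p))"
      using e by (simp add: \<rho>_def field_simps)
    have 3: "e / 2 * ((1/2)^(n + p) - (1/2)^(n + Suc p)) + e / 2 * ((1/2)^n - (1/2)^(n + p))
        = e / 2 * ((1/2)^n - (1/2)^(n + Suc p))" by (simp add: right_diff_distrib)
    show ?case using 1 2 3 tstep[of "Suc n + p"] Suc by linarith
  qed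
  have diffs': "q (t (Suc n + p) - t (Suc n)) \<le> e / 2 * (1/2)^n" for n p
  proof -
    have "e / 2 * ((1/2)^n - (1/2)^(n + p)) \<le> e / 2 * (1/2)^n" using e by (intro mult_left_mono) auto
    then show ?thesis using diffs[of n p] by linarith
  qed
  have qt: "q (t (Suc n)) \<le> r + 3 / 4 * e" for n
  proof -
    have "q (t (Suc n)) \<le> q (t (Suc n) - t 1) + q (t 1 - t 0)" using q.triangle[OF tscale.span_diff[OF tU tU] tU, of "Suc n" 1 1] t0 by simp
    moreover have "q (t (Suc n) - t 1) \<le> e / 2" using diffs'[of 0 n] by simp
    moreover have "q (t 1 - t 0) \<le> r + e / 8" using tstep[of 0] by (simp add: \<rho>_def)
    ultimately show ?thesis using e by simp
  qed
  have "(\<lambda>n. t (Suc n)) \<in> Cauchy_seqs U q"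
  proof (rule q.Cauchy_seqsI)
    fix d :: real assume "d > 0"
    have "(\<lambda>n. e / 2 * (1/2::real)^n) \<longlonglongrightarrow> e / 2 * 0" by (intro tendsto_mult_left LIMSEQ_power_zero) simp
    then have "\<forall>\<^sub>F n in sequentially. e / 2 * (1/2::real)^n < d / 2" by (rule order_tendstoD) (use \<open>d > 0\<close> in simp)
    then obtain n where n: "e / 2 * (1/2::real)^n < d / 2" unfolding eventually_sequentially by blast
    have near: "q (t (Suc m) - t (Suc n)) < d / 2" if "m \<ge> n" for m using diffs'[of n "m - n"] n that by simp
    have "q (t (Suc m) - t (Suc l)) < d" if "m \<ge> n" "l \<ge> n" for m l
      using q.triangle3[OF tU tU tU, of "Suc m" "Suc l" "Suc n"] near[OF that(1)] near[OF that(2)] q.p_commute[OF tU tU, of "Suc n" "Suc l"] by linarith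
    then show "\<exists>M. \<forall>m\<ge>M. \<forall>n\<ge>M. q (t (Suc m) - t (Suc n)) < d" by blast
  qed (rule tU)
  from q.Cauchy_seqs_diff[OF s this] have "(\<lambda>n. s n - t (Suc n)) \<in> Cauchy_seqs U q" .
  then have "(\<lambda>n. q (s n - t (Suc n))) \<longlonglongrightarrow> 0"
  proof (rule null_if_pairing_null)
    fix v assume v: "v \<in> W"
    have "(\<lambda>n. e / 4 * wnorm K v * (1/2)^Suc n) \<longlonglongrightarrow> e / 4 * wnorm K v * 0"
      by (intro tendsto_mult_left LIMSEQ_Suc LIMSEQ_power_zero) simp
    then have 0: "(\<lambda>n. e / 4 * wnorm K v * (1/2)^Suc n) \<longlonglongrightarrow> 0" by simp
    have "norm (\<Lambda> v - t (Suc n) (\<omega> v)) \<le> e / 4 * wnorm K v * (1/2)^Suc n" for n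
      using tf[of "Suc n"] v by (simp add: dual_functional_def \<rho>_def mult_ac)
    then have "(\<lambda>n. \<Lambda> v - t (Suc n) (\<omega> v)) \<longlonglongrightarrow> 0" by (intro Lim_null_comparison[OF always_eventually 0]) blast
    from tendsto_add[OF tendsto_diff[OF lim[OF v] tendsto_const[of "\<Lambda> v"]] this]
    show "(\<lambda>i. (s i - t (Suc i)) (\<omega> v)) \<longlonglongrightarrow> 0" by simp
  qed
  then have "\<forall>\<^sub>F n in sequentially. q (s n - t (Suc n)) < e / 4" using e by (intro order_tendstoD) auto
  then obtain N where N: "\<And>n. n \<ge> N \<Longrightarrow> q (s n - t (Suc n)) < e / 4" unfolding eventually_sequentially by blast
  have "q (s n) \<le> r + e" if "n \<ge> N" for n
    using q.reverse_triangle[OF q.Cauchy_seqs_in[OF s] tU, of n "Suc n"] N[OF that] qt[of n] e by linarith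
  then show ?thesis by blast
qed

text \<open>The finite combination is close to the limit functional on \<open>W\<close>; the
  isometry, applied to the difference, turns this into closeness in the atomic norm.\<close>

theorem norm_attaining_dense:
  assumes s: "s \<in> Cauchy_seqs U q" and e: "e > 0"
  shows "\<exists>n c k N. (\<forall>j<n. k j \<in> K) \<and> q (atom_sum \<tau> n c k) = (\<Sum>j<n. norm (c j)) \<and>
     (\<forall>i\<ge>N. q (s i - atom_sum \<tau> n c k) \<le> e)"
proof -
  obtain \<Lambda> M where M: "M \<ge> 0" "dual_functional \<Lambda> M" and lim: "\<And>v. v \<in> W \<Longrightarrow> (\<lambda>i. s i (\<omega> v)) \<longlonglongrightarrow> \<Lambda> v"
    using pairing_limit[OF s] by blast
  have e2: "e / 2 > 0" using e by simp
  from norm_attaining_approximation[OF M(2) e2 M(1)] obtain n c k where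
    k: "\<forall>j<n. k j \<in> K" and qa: "q (atom_sum \<tau> n c k) = (\<Sum>j<n. norm (c j))" and
    cl: "\<forall>v\<in>W. norm (\<Lambda> v - atom_sum \<tau> n c k (\<omega> v)) \<le> e / 2 * wnorm K v"
    by (elim exE conjE) (erule that)
  define w where "w = atom_sum \<tau> n c k"
  have wU: "w \<in> U" unfolding w_def by (rule atom_sum_in_span) (use k in auto)
  have "\<exists>N. \<forall>i\<ge>N. q (s i - w) \<le> e / 2 + e / 2"
  proof (rule isometry[OF q.Cauchy_seqs_diff[OF s q.Cauchy_seqs_const[OF wU]], of "\<lambda>v. \<Lambda> v - w (\<omega> v)"])
    show "(\<lambda>i. (s i - w) (\<omega> v)) \<longlonglongrightarrow> \<Lambda> v - w (\<omega> v)" if "v \<in> W" for v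
      using tendsto_diff[OF lim[OF that] tendsto_const] by simp
    show "dual_functional (\<lambda>v. \<Lambda> v - w (\<omega> v)) (e / 2)"
      using M(2) cl W_add W_scale k unfolding dual_functional_def
      by (simp add: w_def atom_sum_pairing sum.distrib sum_distrib_left right_diff_distrib distrib_left mult.left_commute)
  qed (use e in auto)
  then obtain N where "\<forall>i\<ge>N. q (s i - w) \<le> e" by auto
  then show ?thesis using k qa unfolding w_def by (intro exI[of _ n] exI[of _ c] exI[of _ k] exI[of _ N]) simp
qed

end

section \<open>Completions\<close>

context seminormed begin

abbreviation "cls s \<equiv> Cauchy_rel U p `` {s}"
abbreviation "Z \<equiv> completion sc U p"

lemma Cauchy_rel_iff:
  "(s, t) \<in> Cauchy_rel U p \<longleftrightarrow> s \<in> Cauchy_seqs U p \<and> t \<in> Cauchy_seqs U p \<and> (\<lambda>n. p (s n - t n)) \<longlonglongrightarrow> 0"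
  by (simp add: Cauchy_rel_def)

lemma equiv_Cauchy_rel: "equiv (Cauchy_seqs U p) (Cauchy_rel U p)"
proof (rule equivI)
  show "Cauchy_rel U p \<subseteq> Cauchy_seqs U p \<times> Cauchy_seqs U p" by (auto simp: Cauchy_rel_def)
  show "refl_on (Cauchy_seqs U p) (Cauchy_rel U p)"
    by (rule refl_onI) (simp add: Cauchy_rel_iff p_zero)
  show "sym (Cauchy_rel U p)"
  proof (rule symI)
    fix s t assume st: "(s, t) \<in> Cauchy_rel U p"
    then have "p (t n - s n) = p (s n - t n)" for n by (intro p_commute Cauchy_seqs_in) (auto simp: Cauchy_rel_iff)
    then show "(t, s) \<in> Cauchy_rel U p" using st by (simp add: Cauchy_rel_iff)
  qed
  show "trans (Cauchy_rel U p)"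
  proof (rule transI)
    fix s t r assume st: "(s, t) \<in> Cauchy_rel U p" and tr: "(t, r) \<in> Cauchy_rel U p"
    then have mem: "s n \<in> U" "t n \<in> U" "r n \<in> U" for n by (auto simp: Cauchy_rel_iff intro: Cauchy_seqs_in)
    have lim: "(\<lambda>n. p (s n - t n) + p (t n - r n)) \<longlonglongrightarrow> 0"
      using tendsto_add[of "\<lambda>n. p (s n - t n)" 0 _ "\<lambda>n. p (t n - r n)" 0] st tr by (simp add: Cauchy_rel_iff)
    have "(\<lambda>n. p (s n - r n)) \<longlonglongrightarrow> 0"
      by (rule tendsto_sandwich[OF always_eventually always_eventually tendsto_const lim])
        (use p_nonneg[OF subspace_diff[OF sub mem(1) mem(3)]] triangle3[OF mem] in auto)
    then show "(s, r) \<in> Cauchy_rel U p" using st tr by (simp add: Cauchy_rel_iff)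
  qed
qed

lemma cls_eq: "(s, t) \<in> Cauchy_rel U p \<Longrightarrow> cls s = cls t"
  by (rule equiv_class_eq[OF equiv_Cauchy_rel])

lemma cls_self: "s \<in> Cauchy_seqs U p \<Longrightarrow> s \<in> cls s"
  by (rule equiv_class_self[OF equiv_Cauchy_rel])

lemma carrier_completion: "carrier Z = cls ` Cauchy_seqs U p"
  by (auto simp: completion_def quotient_def)

lemma add_completion:
  assumes s: "s \<in> Cauchy_seqs U p" and t: "t \<in> Cauchy_seqs U p"
  shows "add Z (cls s) (cls t) = cls (\<lambda>n. s n + t n)"
proof -
  have "cls (\<lambda>n. s' n + t' n) = cls (\<lambda>n. s n + t n)" if s': "s' \<in> cls s" and t': "t' \<in> cls t" for s' t'
  proof (rule cls_eq)
    have mem: "s n \<in> U" "s' n \<in> U" "t n \<in> U" "t' n \<in> U" for n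
      using s' t' by (auto simp: Cauchy_rel_iff intro: Cauchy_seqs_in)
    have lim: "(\<lambda>n. p (s n - s' n) + p (t n - t' n)) \<longlonglongrightarrow> 0"
      using tendsto_add[of "\<lambda>n. p (s n - s' n)" 0 _ "\<lambda>n. p (t n - t' n)" 0] s' t' by (simp add: Cauchy_rel_iff)
    have eq: "s' n + t' n - (s n + t n) = - ((s n - s' n) + (t n - t' n))" for n by simp
    have le: "p (s' n + t' n - (s n + t n)) \<le> p (s n - s' n) + p (t n - t' n)" for n
      unfolding eq using p_minus[of "(s n - s' n) + (t n - t' n)"] triangle[of "s n - s' n" "t n - t' n"] mem
      by (simp add: subspace_diff[OF sub] subspace_add[OF sub])
    have "(\<lambda>n. p (s' n + t' n - (s n + t n))) \<longlonglongrightarrow> 0"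
      by (rule tendsto_sandwich[OF always_eventually always_eventually tendsto_const lim])
        (use le p_nonneg[OF subspace_diff[OF sub subspace_add[OF sub mem(2,4)] subspace_add[OF sub mem(1,3)]]] in auto)
    then show "((\<lambda>n. s' n + t' n), (\<lambda>n. s n + t n)) \<in> Cauchy_rel U p"
      using s t s' t' by (simp add: Cauchy_rel_iff Cauchy_seqs_add)
  qed
  moreover have "cls s \<noteq> {}" "cls t \<noteq> {}" using cls_self[OF s] cls_self[OF t] by blast+
  ultimately have "(\<Union>s'\<in>cls s. \<Union>t'\<in>cls t. cls (\<lambda>n. s' n + t' n)) = cls (\<lambda>n. s n + t n)" by simp
  then show ?thesis by (simp add: completion_def)
qed

lemma smult_completion:
  assumes s: "s \<in> Cauchy_seqs U p"
  shows "smult Z c (cls s) = cls (\<lambda>n. sc c (s n))"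
proof -
  have "cls (\<lambda>n. sc c (s' n)) = cls (\<lambda>n. sc c (s n))" if s': "s' \<in> cls s" for s'
  proof (rule cls_eq)
    have mem: "s n \<in> U" "s' n \<in> U" for n using s' by (auto simp: Cauchy_rel_iff intro: Cauchy_seqs_in)
    have eq: "p (sc c (s' n) - sc c (s n)) = norm c * p (s n - s' n)" for n
      using homogeneous[OF subspace_diff[OF sub mem(2)[of n] mem(1)[of n]], of c] p_commute[OF mem(2)[of n] mem(1)[of n]]
      by (simp only: scale_right_diff_distrib)
    have "(\<lambda>n. p (sc c (s' n) - sc c (s n))) \<longlonglongrightarrow> 0"
      unfolding eq using tendsto_mult_left[of "\<lambda>n. p (s n - s' n)" 0 _ "norm c"] s' by (simp add: Cauchy_rel_iff)
    then show "((\<lambda>n. sc c (s' n)), (\<lambda>n. sc c (s n))) \<in> Cauchy_rel U p"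
      using s s' by (simp add: Cauchy_rel_iff Cauchy_seqs_scale)
  qed
  moreover have "cls s \<noteq> {}" using cls_self[OF s] by blast
  ultimately have "(\<Union>s'\<in>cls s. cls (\<lambda>n. sc c (s' n))) = cls (\<lambda>n. sc c (s n))" by simp
  then show ?thesis by (simp add: completion_def)
qed

lemma vnorm_completion:
  assumes s: "s \<in> Cauchy_seqs U p" and r: "(\<lambda>n. p (s n)) \<longlonglongrightarrow> r"
  shows "vnorm Z (cls s) = r"
proof -
  have "(THE r. \<exists>s'\<in>cls s. (\<lambda>n. p (s' n)) \<longlonglongrightarrow> r) = r"
  proof (rule the_equality)
    show "\<exists>s'\<in>cls s. (\<lambda>n. p (s' n)) \<longlonglongrightarrow> r" using cls_self[OF s] r by blast
    fix r' assume "\<exists>s'\<in>cls s. (\<lambda>n. p (s' n)) \<longlonglongrightarrow> r'"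
    then obtain s' where s': "s' \<in> cls s" "(\<lambda>n. p (s' n)) \<longlonglongrightarrow> r'" by blast
    have mem: "s n \<in> U" "s' n \<in> U" for n using s' by (auto simp: Cauchy_rel_iff intro: Cauchy_seqs_in)
    have lim: "(\<lambda>n. p (s n - s' n)) \<longlonglongrightarrow> 0" using s' by (simp add: Cauchy_rel_iff)
    have "(\<lambda>n. p (s n) - p (s' n)) \<longlonglongrightarrow> 0"
      by (rule Lim_null_comparison[OF always_eventually lim]) (use reverse_triangle[OF mem] in auto)
    moreover have "(\<lambda>n. p (s n) - p (s' n)) \<longlonglongrightarrow> r - r'" by (intro tendsto_diff r s')
    ultimately show "r' = r" using LIMSEQ_unique by fastforce
  qed
  then show ?thesis by (simp add: completion_def)
qed

lemma vdist_completion: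
  assumes s: "s \<in> Cauchy_seqs U p" and t: "t \<in> Cauchy_seqs U p" and r: "(\<lambda>n. p (s n - t n)) \<longlonglongrightarrow> r"
  shows "vdist Z (cls s) (cls t) = r"
proof -
  have "smult Z (- 1) (cls t) = cls (\<lambda>n. sc (- 1) (t n))" by (rule smult_completion[OF t])
  then have "add Z (cls s) (smult Z (- 1) (cls t)) = cls (\<lambda>n. s n + sc (- 1) (t n))"
    using add_completion[OF s Cauchy_seqs_scale[OF t, of "- 1"]] by (simp only:)
  moreover have "vnorm Z (cls (\<lambda>n. s n + sc (- 1) (t n))) = r"
    using vnorm_completion[OF Cauchy_seqs_add[OF s Cauchy_seqs_scale[OF t]], of "- 1" r] r by simp
  ultimately show ?thesis by (simp add: vdist_def)
qed

lemma completion_embed_eq: "completion_embed U p v = cls (\<lambda>_. v)"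
  by (simp add: completion_embed_def)

lemma completion_embed_carrier: "v \<in> U \<Longrightarrow> completion_embed U p v \<in> carrier Z"
  by (simp add: completion_embed_eq carrier_completion Cauchy_seqs_const)

lemma vdist_embed: "v \<in> U \<Longrightarrow> w \<in> U \<Longrightarrow> vdist Z (completion_embed U p v) (completion_embed U p w) = p (v - w)"
  unfolding completion_embed_eq by (rule vdist_completion) (auto intro: Cauchy_seqs_const)

lemma vnorm_embed: "v \<in> U \<Longrightarrow> vnorm Z (completion_embed U p v) = p v"
  unfolding completion_embed_eq by (rule vnorm_completion) (auto intro: Cauchy_seqs_const)

text \<open>The embedding sends \<open>a\<close> to the class of the partial sums of
  \<open>a i\<close> times \<open>v i\<close>. They are Cauchy because each \<open>v i\<close> has
  seminorm at most 1, and the lower estimate for finite sums passes to the limit.\<close>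

lemma contains_l1_if_sequence:
  fixes v :: "nat \<Rightarrow> 'v"
  assumes v: "\<And>i. v i \<in> U" "\<And>i. p (v i) \<le> 1" and \<delta>: "\<delta> > 0"
    and lower: "\<And>n c. \<delta> * (\<Sum>i<n. norm (c i)) \<le> p (\<Sum>i<n. sc (c i) (v i))"
  shows "contains_copy_of_l1 Z"
proof -
  define S where "S a n = (\<Sum>i<n. sc (a i) (v i))" for a :: "nat \<Rightarrow> 'k" and n :: nat
  have SU: "S a n \<in> U" for a n unfolding S_def by (intro subspace_sum[OF sub] subspace_scale[OF sub] v)
  have block: "p (\<Sum>i\<in>I. sc (a i) (v i)) \<le> (\<Sum>i\<in>I. norm (a i))" for a :: "nat \<Rightarrow> 'k" and I
  proof -
    have "p (\<Sum>i\<in>I. sc (a i) (v i)) \<le> (\<Sum>i\<in>I. p (sc (a i) (v i)))" by (intro p_sum subspace_scale[OF sub] v)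
    also have "\<dots> \<le> (\<Sum>i\<in>I. norm (a i))" using v homogeneous by (intro sum_mono) (simp add: mult_left_le)
    finally show ?thesis .
  qed
  have diff: "p (S a m - S a n) \<le> \<bar>(\<Sum>i<m. norm (a i)) - (\<Sum>i<n. norm (a i))\<bar>" for a m n
  proof -
    have *: "p (S a m - S a n) \<le> \<bar>(\<Sum>i<m. norm (a i)) - (\<Sum>i<n. norm (a i))\<bar>" if "n \<le> m" for m n
    proof -
      have "S a m - S a n = (\<Sum>i\<in>{n..<m}. sc (a i) (v i))"
        unfolding S_def using sum_diff_nat_ivl[of 0 n m "\<lambda>i. sc (a i) (v i)"] that by (simp add: atLeast0LessThan)
      moreover have "(\<Sum>i<m. norm (a i)) - (\<Sum>i<n. norm (a i)) = (\<Sum>i\<in>{n..<m}. norm (a i))"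
        using sum_diff_nat_ivl[of 0 n m "\<lambda>i. norm (a i)"] that by (simp add: atLeast0LessThan)
      ultimately show ?thesis using block[of a "{n..<m}"] by simp
    qed
    show ?thesis using *[of n m] *[of m n] p_commute[OF SU[of a m] SU[of a n]] by (cases "n \<le> m") (auto simp: abs_minus_commute)
  qed
  have C: "S a \<in> Cauchy_seqs U p" if a: "a \<in> l1" for a
  proof (rule Cauchy_seqsI[OF SU])
    fix e :: real assume "e > 0"
    have "Cauchy (\<lambda>n. \<Sum>i<n. norm (a i))"
      using a unfolding l1_def summable_iff_convergent by (auto intro: convergent_Cauchy)
    then obtain M where "\<forall>m\<ge>M. \<forall>n\<ge>M. norm ((\<Sum>i<m. norm (a i)) - (\<Sum>i<n. norm (a i))) < e"
      using CauchyD \<open>e > 0\<close> by blast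
    then show "\<exists>M. \<forall>m\<ge>M. \<forall>n\<ge>M. p (S a m - S a n) < e" using diff by (metis le_less_trans real_norm_def)
  qed
  define T where "T a = cls (S a)" for a
  show ?thesis
    unfolding contains_copy_of_l1_def
  proof (intro exI[of _ T] conjI ballI allI)
    show "T ` l1 \<subseteq> carrier Z" using C by (auto simp: T_def carrier_completion)
    show "T (\<lambda>n. a n + b n) = add Z (T a) (T b)" if "a \<in> l1" "b \<in> l1" for a b
    proof -
      have "S (\<lambda>n. a n + b n) = (\<lambda>n. S a n + S b n)" by (simp add: S_def scale_left_distrib sum.distrib fun_eq_iff)
      then show ?thesis unfolding T_def add_completion[OF C[OF that(1)] C[OF that(2)]] by simp
    qed
    show "T (\<lambda>n. c * a n) = smult Z c (T a)" if "a \<in> l1" for c a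
    proof -
      have "S (\<lambda>n. c * a n) = (\<lambda>n. sc c (S a n))" by (simp add: S_def scale_sum_right fun_eq_iff)
      then show ?thesis unfolding T_def smult_completion[OF C[OF that]] by simp
    qed
    show "\<exists>m>0. \<exists>M. \<forall>a\<in>l1. m * l1_norm a \<le> vnorm Z (T a) \<and> vnorm Z (T a) \<le> M * l1_norm a"
    proof (rule exI[of _ \<delta>], intro conjI \<delta> exI[of _ 1] ballI)
      fix a :: "nat \<Rightarrow> 'k" assume a: "a \<in> l1"
      obtain r where r: "(\<lambda>n. p (S a n)) \<longlonglongrightarrow> r" using Cauchy_seqs_convergent[OF C[OF a]] convergentD by blast
      have l: "(\<lambda>n. \<Sum>i<n. norm (a i)) \<longlonglongrightarrow> l1_norm a"
        using a unfolding l1_def l1_norm_def by (simp add: summable_LIMSEQ)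
      have vn: "vnorm Z (T a) = r" unfolding T_def by (rule vnorm_completion[OF C[OF a] r])
      show "\<delta> * l1_norm a \<le> vnorm Z (T a)"
        unfolding vn by (rule LIMSEQ_le[OF tendsto_mult_left[OF l] r]) (use lower in \<open>auto simp: S_def\<close>)
      show "vnorm Z (T a) \<le> 1 * l1_norm a"
        unfolding vn mult_1 by (rule LIMSEQ_le[OF r l]) (use block in \<open>auto simp: S_def\<close>)
    qed
  qed
qed

end

text \<open>Finite linear combinations of point evaluations. They serve as coordinate functionals on
  finite-dimensional spaces of functions, for which boundedness and pointwise continuity are obvious.\<close>

inductive evaluation_comb :: "(('o \<Rightarrow> 'k::real_or_complex) \<Rightarrow> 'k) \<Rightarrow> bool" where
  ev_zero: "evaluation_comb (\<lambda>_. 0)"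
| ev_point: "evaluation_comb (\<lambda>w. w x)"
| ev_add: "evaluation_comb f \<Longrightarrow> evaluation_comb g \<Longrightarrow> evaluation_comb (\<lambda>w. f w + g w)"
| ev_scale: "evaluation_comb f \<Longrightarrow> evaluation_comb (\<lambda>w. c * f w)"

lemma ev_sum: "(\<And>i. i \<in> I \<Longrightarrow> evaluation_comb (f i)) \<Longrightarrow> evaluation_comb (\<lambda>w. \<Sum>i\<in>I. f i w)"
  by (induction I rule: infinite_finite_induct) (auto intro: evaluation_comb.intros)

lemma ev_diff: "evaluation_comb f \<Longrightarrow> evaluation_comb g \<Longrightarrow> evaluation_comb (\<lambda>w. f w - g w)"
  using ev_add[of f "\<lambda>w. (- 1) * g w"] ev_scale[of g "- 1"] by simp

lemma ev_plus: "evaluation_comb f \<Longrightarrow> f (w + w') = f w + f w'"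
  by (induction rule: evaluation_comb.induct) (auto simp: algebra_simps)

lemma ev_tscale: "evaluation_comb f \<Longrightarrow> f (tscale c w) = c * f w"
  by (induction rule: evaluation_comb.induct) (auto simp: algebra_simps tscale_def)

lemma ev_tendsto: "evaluation_comb f \<Longrightarrow> (\<And>x. (\<lambda>n. w n x) \<longlonglongrightarrow> 0) \<Longrightarrow> (\<lambda>n. f (w n)) \<longlonglongrightarrow> 0"
proof (induction rule: evaluation_comb.induct)
  case (ev_add f g)
  then show ?case using tendsto_add[of "\<lambda>n. f (w n)" 0 _ "\<lambda>n. g (w n)" 0] by simp
next
  case (ev_scale f c)
  then show ?case using tendsto_mult_left[of "\<lambda>n. f (w n)" 0 _ c] by simp
qed auto

lemma ev_bounded: "evaluation_comb f \<Longrightarrow> \<exists>C\<ge>0. \<forall>g :: 'x \<Rightarrow>\<^sub>L 'k. norm (f (blinfun_apply g)) \<le> C * norm g"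
  for f :: "('x::real_normed_vector \<Rightarrow> 'k::real_or_complex) \<Rightarrow> 'k"
proof (induction rule: evaluation_comb.induct)
  case ev_zero
  show ?case by (intro exI[of _ 0]) simp
next
  case (ev_point x)
  show ?case by (intro exI[of _ "norm x"]) (simp add: norm_blinfun mult.commute[of "norm x"])
next
  case (ev_add f g)
  then obtain C D where C: "C \<ge> 0" "\<forall>h :: 'x \<Rightarrow>\<^sub>L 'k. norm (f (blinfun_apply h)) \<le> C * norm h"
    and D: "D \<ge> 0" "\<forall>h :: 'x \<Rightarrow>\<^sub>L 'k. norm (g (blinfun_apply h)) \<le> D * norm h" by blast
  have "norm (f (blinfun_apply h) + g (blinfun_apply h)) \<le> (C + D) * norm h" for h :: "'x \<Rightarrow>\<^sub>L 'k"
    using norm_triangle_ineq[of "f (blinfun_apply h)" "g (blinfun_apply h)"] C(2)[rule_format, of h] D(2)[rule_format, of h]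
    by (simp add: distrib_right)
  then show ?case using C(1) D(1) by (intro exI[of _ "C + D"]) simp
next
  case (ev_scale f c)
  then obtain C where C: "C \<ge> 0" "\<forall>h :: 'x \<Rightarrow>\<^sub>L 'k. norm (f (blinfun_apply h)) \<le> C * norm h" by blast
  have "norm (c * f (blinfun_apply h)) \<le> (norm c * C) * norm h" for h :: "'x \<Rightarrow>\<^sub>L 'k"
    using mult_left_mono[OF C(2)[rule_format, of h], of "norm c"] by (simp add: norm_mult mult.assoc)
  then show ?case using C(1) by (intro exI[of _ "norm c * C"]) simp
qed

text \<open>Gaussian elimination with points as pivots: if a new vector \<open>b\<close> is not in
  the span, its residual is nonzero at some point \<open>p\<close>, and the residual of
  \<open>w\<close> at \<open>p\<close>, suitably normalised, is the coordinate along
  \<open>b\<close>. The old coordinates are then corrected; a redundant vector gets coordinate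
  0.\<close>

lemma coordinate_functionals:
  fixes B :: "('o \<Rightarrow> 'k::real_or_complex) set"
  assumes "finite B"
  shows "\<exists>l. (\<forall>b\<in>B. evaluation_comb (l b)) \<and> (\<forall>w\<in>tspan B. w = (\<Sum>b\<in>B. tscale (l b w) b))"
  using assms
proof (induction B rule: finite_induct)
  case empty
  show ?case by (simp add: tscale.span_empty)
next
  case (insert b B)
  then obtain l where l: "\<forall>x\<in>B. evaluation_comb (l x)" "\<forall>w\<in>tspan B. w = (\<Sum>x\<in>B. tscale (l x w) x)"
    by (elim exE conjE) (erule that)
  show ?case
  proof (cases "b \<in> tspan B")
    case True
    have z: "tscale 0 b = 0" by (simp add: tscale_def fun_eq_iff)
    define l' where "l' x = (if x = b then (\<lambda>_. 0) else l x)" for x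
    have "w = (\<Sum>x\<in>insert b B. tscale (l' x w) x)" if w: "w \<in> tspan (insert b B)" for w
    proof -
      have "w \<in> tspan B" using w tscale.span_redundant[OF True] by simp
      then have "w = (\<Sum>x\<in>B. tscale (l x w) x)" using l(2) by blast
      also have "\<dots> = (\<Sum>x\<in>B. tscale (l' x w) x)" by (rule sum.cong) (use insert.hyps in \<open>auto simp: l'_def\<close>)
      also have "\<dots> = (\<Sum>x\<in>insert b B. tscale (l' x w) x)" using insert.hyps by (simp add: l'_def z)
      finally show ?thesis .
    qed
    moreover have "\<forall>x\<in>insert b B. evaluation_comb (l' x)" using l(1) by (auto simp: l'_def intro: ev_zero)
    ultimately show ?thesis by (intro exI[of _ l']) simp
  next
    case False
    define r where "r w = w - (\<Sum>x\<in>B. tscale (l x w) x)" for w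
    have r_span: "r w = 0" if "w \<in> tspan B" for w using l(2) that by (simp add: r_def)
    have "r b \<noteq> 0"
    proof
      assume "r b = 0"
      then have "b = (\<Sum>x\<in>B. tscale (l x b) x)" by (simp add: r_def)
      moreover have "(\<Sum>x\<in>B. tscale (l x b) x) \<in> tspan B" by (intro tscale.span_sum tscale.span_scale tscale.span_base)
      ultimately show False using False by simp
    qed
    \<comment> \<open>The pivot point.\<close>
    then obtain p where p: "r b p \<noteq> 0" by (auto simp: fun_eq_iff)
    have r_lin: "r (tscale c w + w') = tscale c (r w) + r w'" for c w w'
    proof -
      have "l x (tscale c w + w') = c * l x w + l x w'" if "x \<in> B" for x
        using l(1) that by (simp add: ev_plus ev_tscale)
      then have "(\<Sum>x\<in>B. tscale (l x (tscale c w + w')) x) = tscale c (\<Sum>x\<in>B. tscale (l x w) x) + (\<Sum>x\<in>B. tscale (l x w') x)"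
        by (simp add: fun_eq_iff tscale_def fun_sum_apply sum_distrib_left sum.distrib[symmetric] algebra_simps)
      then show ?thesis by (simp add: r_def fun_eq_iff tscale_def algebra_simps)
    qed
    define l0 where "l0 w = inverse (r b p) * (w p - (\<Sum>x\<in>B. x p * l x w))" for w
    have l0: "l0 w = inverse (r b p) * r w p" for w
      by (simp add: l0_def r_def fun_sum_apply tscale_def mult.commute)
    define l' where "l' x = (if x = b then l0 else (\<lambda>w. l x w - l x b * l0 w))" for x
    have e0: "evaluation_comb l0"
      unfolding l0_def[abs_def] using l(1) by (intro ev_scale ev_diff ev_point ev_sum) auto
    have "\<forall>x\<in>insert b B. evaluation_comb (l' x)"
      using l(1) e0 by (auto simp: l'_def intro: ev_diff ev_scale)
    moreover have "w = (\<Sum>x\<in>insert b B. tscale (l' x w) x)" if w: "w \<in> tspan (insert b B)" for w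
    proof -
      obtain c where c: "w - tscale c b \<in> tspan B" using w unfolding tscale.span_insert by blast
      define w' where "w' = w - tscale c b"
      have w_eq: "w = tscale c b + w'" by (simp add: w'_def)
      have "r w = tscale c (r b)" unfolding w_eq r_lin using r_span c by (simp add: w'_def)
      then have l0w: "l0 w = c" using p by (simp add: l0 tscale_def)
      have "l x w' = l' x w" if "x \<in> B" for x
      proof -
        have "l x w = c * l x b + l x w'" unfolding w_eq using l(1) that by (simp add: ev_plus ev_tscale)
        then show ?thesis using that insert.hyps l0w by (auto simp: l'_def algebra_simps)
      qed
      moreover have "w' = (\<Sum>x\<in>B. tscale (l x w') x)" using l(2) c by (simp add: w'_def)
      ultimately have "w' = (\<Sum>x\<in>B. tscale (l' x w) x)" by (metis (no_types, lifting) sum.cong)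
      then have "w = tscale (l' b w) b + (\<Sum>x\<in>B. tscale (l' x w) x)" using w_eq l0w by (simp add: l'_def)
      then show ?thesis using insert.hyps by simp
    qed
    ultimately show ?thesis by (intro exI[of _ l']) simp
  qed
qed

text \<open>The basis is taken from \<open>S\<close> itself, so its members inherit whatever holds
  for \<open>S\<close>, such as lying in a space on which a seminorm is defined.\<close>

lemma coordinates_in_subset:
  fixes S :: "('o \<Rightarrow> 'k::real_or_complex) set"
  assumes "finite T" "S \<subseteq> tspan T"
  shows "\<exists>B l. finite B \<and> B \<subseteq> S \<and> (\<forall>b\<in>B. evaluation_comb (l b)) \<and> (\<forall>w\<in>tspan S. w = (\<Sum>b\<in>B. tscale (l b w) b))"
proof -
  obtain B where B: "B \<subseteq> S" "tscale.independent B" "S \<subseteq> tspan B"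
    using tscale.maximal_independent_subset[of S] by blast
  have "finite B" using tscale.independent_span_bound[OF assms(1) B(2)] B(1) assms(2) by blast
  have "tspan S \<subseteq> tspan B" using B(3) tscale.span_minimal tscale.subspace_span by blast
  from coordinate_functionals[OF \<open>finite B\<close>] obtain l where
    "\<forall>b\<in>B. evaluation_comb (l b)" "\<forall>w\<in>tspan B. w = (\<Sum>b\<in>B. tscale (l b w) b)" by (elim exE conjE) (erule that)
  then show ?thesis using B(1) \<open>finite B\<close> \<open>tspan S \<subseteq> tspan B\<close> by (intro exI[of _ B] exI[of _ l]) blast
qed

lemma (in seminormed) finite_dim_null:
  fixes c :: "'i \<Rightarrow> nat \<Rightarrow> 'k"
  assumes "finite I" "\<And>i. i \<in> I \<Longrightarrow> b i \<in> U" "\<And>i. i \<in> I \<Longrightarrow> c i \<longlonglongrightarrow> 0"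
  shows "(\<lambda>n. p (\<Sum>i\<in>I. sc (c i n) (b i))) \<longlonglongrightarrow> 0"
proof -
  have "(\<lambda>n. \<Sum>i\<in>I. norm (c i n) * p (b i)) \<longlonglongrightarrow> (\<Sum>i\<in>I. norm (0 :: 'k) * p (b i))"
    by (intro tendsto_intros assms)
  then have lim: "(\<lambda>n. \<Sum>i\<in>I. norm (c i n) * p (b i)) \<longlonglongrightarrow> 0" by simp
  have "norm (p (\<Sum>i\<in>I. sc (c i n) (b i))) \<le> (\<Sum>i\<in>I. norm (c i n) * p (b i))" for n
  proof -
    have mem: "sc (c i n) (b i) \<in> U" if "i \<in> I" for i using assms(2)[OF that] by (rule subspace_scale[OF sub])
    have "p (\<Sum>i\<in>I. sc (c i n) (b i)) \<le> (\<Sum>i\<in>I. p (sc (c i n) (b i)))" by (rule p_sum[OF mem])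
    also have "\<dots> = (\<Sum>i\<in>I. norm (c i n) * p (b i))" using assms(2) homogeneous by (intro sum.cong) auto
    finally show ?thesis using p_nonneg[OF subspace_sum[OF sub, of I "\<lambda>i. sc (c i n) (b i)"]] mem by simp
  qed
  then show ?thesis by (intro Lim_null_comparison[OF always_eventually lim]) blast
qed

text \<open>With tails \<open>r j\<close> one has
  \<open>c j / sqrt (r j) \<le> 2 * (sqrt (r j) - sqrt (r (Suc j)))\<close> for nonzero tails, which
  telescopes. The lemma moves a null factor from the coefficients of a series into its vectors,
  whose set then becomes relatively compact.\<close>

lemma summable_rescale:
  fixes c :: "nat \<Rightarrow> real"
  assumes c: "summable c" "\<And>j. c j \<ge> 0"
  shows "\<exists>\<theta>. (\<forall>j. \<theta> j > 0) \<and> \<theta> \<longlonglongrightarrow> 0 \<and> summable (\<lambda>j. c j / \<theta> j)"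
proof -
  define r where "r j = suminf c - (\<Sum>i<j. c i)" for j
  have r0: "r j \<ge> 0" for j unfolding r_def using sum_le_suminf[OF c(1), of "{..<j}"] c(2) by simp
  have rS: "r (Suc j) = r j - c j" for j by (simp add: r_def)
  have "r \<longlonglongrightarrow> suminf c - suminf c" unfolding r_def[abs_def] by (intro tendsto_intros summable_LIMSEQ c)
  then have r: "r \<longlonglongrightarrow> 0" by simp
  \<comment> \<open>The second summand only keeps \<open>\<theta> j\<close> positive when the tail
    is exhausted.\<close>
  define \<theta> where "\<theta> j = sqrt (r j) + 1 / real (Suc j)" for j
  have "(\<lambda>j. sqrt (r j) + 1 / real (Suc j)) \<longlonglongrightarrow> sqrt 0 + 0"
    by (intro tendsto_add tendsto_real_sqrt r LIMSEQ_Suc[OF lim_1_over_n])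
  then have lim: "\<theta> \<longlonglongrightarrow> 0" by (simp add: \<theta>_def[abs_def])
  have pos: "\<theta> j > 0" for j unfolding \<theta>_def by (rule add_nonneg_pos) (use r0 in auto)
  have "summable (\<lambda>j. 2 * (sqrt (r j) - sqrt (r (Suc j))))"
    by (intro summable_mult telescope_summable'[of "\<lambda>j. sqrt (r j)" "sqrt 0"] tendsto_real_sqrt r)
  moreover have "norm (c j / \<theta> j) \<le> 2 * (sqrt (r j) - sqrt (r (Suc j)))" for j
  proof -
    have le: "r (Suc j) \<le> r j" using rS c(2) by simp
    have "c j = (sqrt (r j) - sqrt (r (Suc j))) * (sqrt (r j) + sqrt (r (Suc j)))"
      using r0[of j] r0[of "Suc j"] rS[of j] by (simp add: algebra_simps)
    also have "\<dots> \<le> (sqrt (r j) - sqrt (r (Suc j))) * (2 * \<theta> j)"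
    proof (rule mult_left_mono)
      have "sqrt (r (Suc j)) \<le> sqrt (r j)" using le by simp
      moreover have "sqrt (r j) \<le> \<theta> j" by (simp add: \<theta>_def)
      ultimately show "sqrt (r j) + sqrt (r (Suc j)) \<le> 2 * \<theta> j" by linarith
    qed (use le in simp)
    finally have "c j \<le> (2 * (sqrt (r j) - sqrt (r (Suc j)))) * \<theta> j" by (simp add: algebra_simps)
    then show ?thesis using pos[of j] c(2)[of j] by (simp add: divide_le_eq)
  qed
  ultimately have "summable (\<lambda>j. c j / \<theta> j)" by (rule summable_comparison_test'[of _ 0])
  then show ?thesis using pos lim by blast
qed

section \<open>Dual spaces and operators of finite rank\<close>

lemma apply_dual_scale: "blinfun_apply (dual_scale c f) = tscale c (blinfun_apply f)"
  by (simp add: fun_eq_iff tscale_def)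

lemma apply_plus: "blinfun_apply (f + g) = blinfun_apply f + blinfun_apply g"
  by (simp add: fun_eq_iff blinfun.add_left)

lemma apply_sum: "blinfun_apply (\<Sum>i\<in>I. f i) = (\<Sum>i\<in>I. blinfun_apply (f i))"
  by (simp add: fun_eq_iff blinfun.sum_left fun_sum_apply)

interpretation dual_scale: vector_space "dual_scale :: 'k::real_or_complex \<Rightarrow> ('x::banach \<Rightarrow>\<^sub>L 'k) \<Rightarrow> _"
  by (rule vector_space_dual_scale)

lemma subspace_dual: "dual_scale.subspace (dual sX)"
  by (rule dual_scale.subspaceI) (auto simp: dual_def blinfun.add_left algebra_simps)

lemma norm_dual_scale: "norm (dual_scale c f) = norm c * norm f"
proof -
  have le: "norm (dual_scale c f) \<le> norm c * norm f" for c and f :: "'x::banach \<Rightarrow>\<^sub>L 'k::real_or_complex"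
    by (rule norm_blinfun_bound) (auto simp: norm_mult mult.assoc intro!: mult_left_mono norm_blinfun)
  show ?thesis
  proof (cases "c = 0")
    case True
    then show ?thesis using le[of 0 f] by simp
  next
    case False
    have "dual_scale (inverse c) (dual_scale c f) = f" using False by (intro blinfun_eqI) simp
    then have "norm f \<le> norm (inverse c) * norm (dual_scale c f)" using le[of "inverse c" "dual_scale c f"] by simp
    then have "norm c * norm f \<le> norm c * (norm (inverse c) * norm (dual_scale c f))" by (rule mult_left_mono) simp
    also have "\<dots> = norm (c * inverse c) * norm (dual_scale c f)" by (simp only: norm_mult mult.assoc)
    finally show ?thesis using le[of c f] False by simp
  qed
qed

lemma span_apply:
  assumes "f \<in> module.span dual_scale B" shows "blinfun_apply f \<in> tspan (blinfun_apply ` B)"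
  using assms
proof (induction rule: dual_scale.span_induct_alt)
  case base
  have "blinfun_apply 0 = (0 :: 'a \<Rightarrow> 'b)" by (simp add: fun_eq_iff)
  then show ?case by (simp only: tscale.span_zero)
next
  case (step c x y)
  then show ?case unfolding apply_plus apply_dual_scale
    by (intro tscale.span_add[OF tscale.span_scale[OF tscale.span_base[OF imageI]]])
qed

text \<open>A range inside a finite span is turned into an explicit sum with bounded linear
  coefficients. The coefficients are finite combinations of point evaluations of \<open>T x\<close>,
  which gives linearity and boundedness directly.\<close>

lemma finite_rank_coordinates:
  fixes T :: "('x::banach \<Rightarrow>\<^sub>L 'k::real_or_complex) \<Rightarrow> ('x \<Rightarrow>\<^sub>L 'k)"
  assumes T: "finite_rank_operator dual_scale (dual sX) T"
  obtains I :: "('x \<Rightarrow> 'k) set" and e \<phi> C where "finite I" "\<And>i. i \<in> I \<Longrightarrow> e i \<in> dual sX" "C \<ge> 0"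
    "\<And>x. x \<in> dual sX \<Longrightarrow> T x = (\<Sum>i\<in>I. dual_scale (\<phi> i x) (e i))"
    "\<And>i x y. i \<in> I \<Longrightarrow> x \<in> dual sX \<Longrightarrow> y \<in> dual sX \<Longrightarrow> \<phi> i (x + y) = \<phi> i x + \<phi> i y"
    "\<And>i c x. i \<in> I \<Longrightarrow> x \<in> dual sX \<Longrightarrow> \<phi> i (dual_scale c x) = c * \<phi> i x"
    "\<And>i x. i \<in> I \<Longrightarrow> x \<in> dual sX \<Longrightarrow> norm (\<phi> i x) \<le> C * norm x"
proof -
  let ?E = "dual sX"
  from T have add: "T (x + y) = T x + T y" if "x \<in> ?E" "y \<in> ?E" for x y
    using that by (simp add: finite_rank_operator_def)
  from T have scale: "T (dual_scale c x) = dual_scale c (T x)" if "x \<in> ?E" for x c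
    using that by (simp add: finite_rank_operator_def)
  from T have "\<exists>D. \<forall>x\<in>?E. norm (T x) \<le> D * norm x" unfolding finite_rank_operator_def by (elim conjE)
  then obtain D where D: "\<forall>x\<in>?E. norm (T x) \<le> D * norm x" ..
  from T have TE: "T ` ?E \<subseteq> ?E" unfolding finite_rank_operator_def by (elim conjE)
  from T have "\<exists>B. finite B \<and> T ` ?E \<subseteq> module.span dual_scale B" unfolding finite_rank_operator_def by (elim conjE)
  then obtain B0 where B0: "finite B0" "T ` ?E \<subseteq> module.span dual_scale B0" by (elim exE conjE)
  define S where "S = blinfun_apply ` (T ` ?E)"
  have "S \<subseteq> tspan (blinfun_apply ` B0)" using B0(2) span_apply unfolding S_def by blast
  from coordinates_in_subset[OF finite_imageI[OF B0(1)] this] obtain I l where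
    I: "finite I" "I \<subseteq> S" and l: "\<forall>b\<in>I. evaluation_comb (l b)" "\<forall>w\<in>tspan S. w = (\<Sum>b\<in>I. tscale (l b w) b)"
    by (elim exE conjE) (erule that)
  \<comment> \<open>The index set is the basis itself, as plain functions; \<open>Blinfun\<close>
    makes them members of the dual again.\<close>
  define e where "e i = (Blinfun i :: 'x \<Rightarrow>\<^sub>L 'k)" for i
  define \<phi> where "\<phi> i x = l i (blinfun_apply (T x))" for i x
  have e: "e i \<in> ?E" "blinfun_apply (e i) = i" if i: "i \<in> I" for i
  proof -
    obtain x where x: "x \<in> ?E" "i = blinfun_apply (T x)" using I(2) i by (auto simp: S_def)
    then have "e i = T x" by (simp add: e_def blinfun_apply_inverse)
    then show "e i \<in> ?E" "blinfun_apply (e i) = i" using TE x by auto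
  qed
  have "\<exists>C\<ge>0. \<forall>i\<in>I. \<forall>g :: 'x \<Rightarrow>\<^sub>L 'k. norm (l i (blinfun_apply g)) \<le> C * norm g"
  proof -
    have "\<forall>i\<in>I. \<exists>C. C \<ge> 0 \<and> (\<forall>g :: 'x \<Rightarrow>\<^sub>L 'k. norm (l i (blinfun_apply g)) \<le> C * norm g)"
      using l(1) ev_bounded by blast
    from bchoice[OF this] obtain C where C: "\<forall>i\<in>I. C i \<ge> 0 \<and> (\<forall>g :: 'x \<Rightarrow>\<^sub>L 'k. norm (l i (blinfun_apply g)) \<le> C i * norm g)" ..
    have "norm (l i (blinfun_apply g)) \<le> (\<Sum>i\<in>I. C i) * norm g" if i: "i \<in> I" for i and g :: "'x \<Rightarrow>\<^sub>L 'k"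
    proof -
      have "C i \<le> (\<Sum>i\<in>I. C i)" using C I(1) i by (intro member_le_sum) auto
      then have "C i * norm g \<le> (\<Sum>i\<in>I. C i) * norm g" by (intro mult_right_mono) auto
      then show ?thesis using C i by (meson order_trans)
    qed
    moreover have "(\<Sum>i\<in>I. C i) \<ge> 0" using C by (intro sum_nonneg) auto
    ultimately show ?thesis by blast
  qed
  then obtain C where C: "C \<ge> 0" "\<forall>i\<in>I. \<forall>g :: 'x \<Rightarrow>\<^sub>L 'k. norm (l i (blinfun_apply g)) \<le> C * norm g" by blast
  show thesis
  proof (rule that[of I e "C * \<bar>D\<bar>" \<phi>])
    show "finite I" by (rule I)
    show "e i \<in> ?E" if "i \<in> I" for i by (rule e[OF that])
    show "C * \<bar>D\<bar> \<ge> 0" using C(1) by simp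
    show "T x = (\<Sum>i\<in>I. dual_scale (\<phi> i x) (e i))" if "x \<in> ?E" for x
    proof -
      have "blinfun_apply (T x) \<in> tspan S" using that by (intro tscale.span_base) (simp add: S_def)
      then have "blinfun_apply (T x) = (\<Sum>i\<in>I. tscale (\<phi> i x) i)" using l(2) by (simp add: \<phi>_def)
      also have "\<dots> = blinfun_apply (\<Sum>i\<in>I. dual_scale (\<phi> i x) (e i))"
        unfolding apply_sum apply_dual_scale by (rule sum.cong) (simp_all add: e)
      finally show ?thesis by (simp add: blinfun_apply_inject)
    qed
    fix i assume i: "i \<in> I"
    show "\<phi> i (x + y) = \<phi> i x + \<phi> i y" if "x \<in> ?E" "y \<in> ?E" for x y
      using l(1) i by (simp add: \<phi>_def add[OF that] apply_plus ev_plus)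
    show "\<phi> i (dual_scale c x) = c * \<phi> i x" if "x \<in> ?E" for c x
      using l(1) i by (simp add: \<phi>_def scale[OF that] apply_dual_scale ev_tscale)
    show "norm (\<phi> i x) \<le> C * \<bar>D\<bar> * norm x" if x: "x \<in> ?E" for x
    proof -
      have "norm (\<phi> i x) \<le> C * norm (T x)" using C(2) i by (simp add: \<phi>_def)
      also have "\<dots> \<le> C * (D * norm x)" using D x C(1) by (intro mult_left_mono) auto
      also have "\<dots> \<le> C * (\<bar>D\<bar> * norm x)" using C(1) by (intro mult_left_mono mult_right_mono) auto
      finally show ?thesis by (simp add: mult.assoc)
    qed
  qed
qed

section \<open>The dual ball as a compact set of functions\<close>

text \<open>As plain functions the functionals carry the product topology of the function type,
  which is the weak-star topology; the operator type carries the norm topology instead.\<close>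

definition functional_ball :: "('k::real_or_complex \<Rightarrow> 'x::banach \<Rightarrow> 'x) \<Rightarrow> ('x \<Rightarrow> 'k) set" where
  "functional_ball sX = blinfun_apply ` dual_ball sX"

lemma functional_ball_iff:
  assumes "banach_over sX"
  shows "h \<in> functional_ball sX \<longleftrightarrow> (\<forall>x y. h (x + y) = h x + h y) \<and> (\<forall>c x. h (sX c x) = c * h x) \<and> (\<forall>x. norm (h x) \<le> norm x)"
proof
  assume "h \<in> functional_ball sX"
  then obtain f where f: "h = blinfun_apply f" "f \<in> dual sX" "norm f \<le> 1" by (auto simp: functional_ball_def dual_ball_def)
  have "norm (blinfun_apply f x) \<le> norm x" for x
    using norm_blinfun[of f x] mult_right_mono[OF f(3), of "norm x"] by simp
  then show "(\<forall>x y. h (x + y) = h x + h y) \<and> (\<forall>c x. h (sX c x) = c * h x) \<and> (\<forall>x. norm (h x) \<le> norm x)"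
    using f by (simp add: dual_def blinfun.add_right)
next
  assume h: "(\<forall>x y. h (x + y) = h x + h y) \<and> (\<forall>c x. h (sX c x) = c * h x) \<and> (\<forall>x. norm (h x) \<le> norm x)"
  have "h (r *\<^sub>R x) = r *\<^sub>R h x" for r x
    using h banach_over.scale_of_real[OF assms, of r x] by (metis scaleR_conv_of_real)
  then have bl: "bounded_linear h" using h by (intro bounded_linear_intro[of _ 1]) auto
  then have app: "blinfun_apply (Blinfun h) = h" by (rule bounded_linear_Blinfun_apply)
  have "Blinfun h \<in> dual_ball sX"
    unfolding dual_ball_def dual_def using h by (auto simp: app intro!: norm_blinfun_bound)
  then show "h \<in> functional_ball sX" unfolding functional_ball_def by (rule rev_image_eqI) (simp add: app)
qed

text \<open>The Banach-Alaoglu theorem: linearity is a family of closed conditions on a Tychonoff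
  product of scalar balls.\<close>

lemma compact_functional_ball:
  assumes "banach_over sX" shows "compact (functional_ball sX)"
proof -
  have cP: "compact (PiE UNIV (\<lambda>x :: 'b. cball (0 :: 'a) (norm x)))"
    using compactin_PiE[of "\<lambda>_. euclidean" UNIV "\<lambda>x :: 'b. cball (0 :: 'a) (norm x)"]
    by (simp add: euclidean_product_topology)
  have P: "h \<in> PiE UNIV (\<lambda>x :: 'b. cball (0 :: 'a) (norm x)) \<longleftrightarrow> (\<forall>x. norm (h x) \<le> norm x)" for h
    by (simp add: PiE_iff)
  have "functional_ball sX = PiE UNIV (\<lambda>x. cball 0 (norm x)) \<inter>
      ((\<Inter>x. \<Inter>y. {h. h (x + y) = h x + h y}) \<inter> (\<Inter>c. \<Inter>x. {h. h (sX c x) = c * h x}))"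
    by (rule set_eqI) (unfold functional_ball_iff[OF assms] Int_iff P INT_iff mem_Collect_eq, blast)
  moreover have "closed ((\<Inter>x. \<Inter>y. {h. h (x + y) = h x + h y}) \<inter> (\<Inter>c. \<Inter>x. {h :: 'b \<Rightarrow> 'a. h (sX c x) = c * h x}))"
    by (intro closed_Int closed_INT ballI closed_Collect_eq continuous_intros continuous_on_product_coordinates)
  ultimately show ?thesis using compact_Int_closed[OF cP] by simp
qed

lemma functional_ball_nonempty: "functional_ball sX \<noteq> {}"
proof -
  have "0 \<in> dual_ball sX" by (simp add: dual_ball_def dual_def)
  then show ?thesis by (auto simp: functional_ball_def)
qed

lemma wnorm_seminormed:
  fixes form :: "'a::topological_space \<Rightarrow> 'p" and Vt :: "('p \<Rightarrow> 'k::real_or_complex) set"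
  assumes K: "compact K" "K \<noteq> {}" and sub: "module.subspace tscale Vt"
    and cont: "\<And>v. v \<in> Vt \<Longrightarrow> continuous_on K (\<lambda>k. v (form k))"
  shows "seminormed tscale Vt (\<lambda>v. wnorm K (\<lambda>k. v (form k)))"
proof -
  have ge: "norm (v (form k)) \<le> wnorm K (\<lambda>k. v (form k))" if "v \<in> Vt" "k \<in> K" for v k
    using snorm_upper[OF K(1) continuous_on_emb[OF cont[OF that(1)]] that(2)] by (simp add: wnorm_emb)
  have least: "wnorm K w \<le> B" if "\<And>k. k \<in> K \<Longrightarrow> norm (w k) \<le> B" for w :: "'a \<Rightarrow> 'k" and B
    unfolding wnorm_def using that by (intro cSUP_least K)
  show ?thesis
  proof
    show "tscale.subspace Vt" by (rule sub)
    show "wnorm K (\<lambda>k. (x + y) (form k)) \<le> wnorm K (\<lambda>k. x (form k)) + wnorm K (\<lambda>k. y (form k))"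
      if "x \<in> Vt" "y \<in> Vt" for x y
      unfolding plus_fun_apply by (intro least norm_triangle_mono ge that)
    have le: "wnorm K (\<lambda>k. tscale c x (form k)) \<le> norm c * wnorm K (\<lambda>k. x (form k))" if "x \<in> Vt" for c x
      by (rule least) (use ge that in \<open>auto simp: tscale_def norm_mult intro!: mult_left_mono\<close>)
    show "wnorm K (\<lambda>k. tscale c x (form k)) = norm c * wnorm K (\<lambda>k. x (form k))" if x: "x \<in> Vt" for c x
    proof (cases "c = 0")
      case True
      have "wnorm K (\<lambda>k. 0 :: 'k) = 0" unfolding wnorm_def using K(2) by simp
      then show ?thesis using True by (simp add: tscale_def)
    next
      case False
      have "tscale (inverse c) (tscale c x) = x" using False by (simp add: tscale_def fun_eq_iff)
      then have "wnorm K (\<lambda>k. x (form k)) \<le> norm (inverse c) * wnorm K (\<lambda>k. tscale c x (form k))"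
        using le[OF tscale.subspace_scale[OF sub x, of c], of "inverse c"] by simp
      then have "norm c * wnorm K (\<lambda>k. x (form k)) \<le> norm c * (norm (inverse c) * wnorm K (\<lambda>k. tscale c x (form k)))"
        by (rule mult_left_mono) simp
      also have "\<dots> = norm (c * inverse c) * wnorm K (\<lambda>k. tscale c x (form k))" by (simp only: norm_mult mult.assoc)
      also have "c * inverse c = 1" using False by simp
      finally show ?thesis using le[OF x, of c] by simp
    qed
  qed
qed

lemma l1_sequence_imp_copy:
  fixes form :: "'a::topological_space \<Rightarrow> 'p" and Vt :: "('p \<Rightarrow> 'k::real_or_complex) set"
  assumes K: "compact K" "K \<noteq> {}" and sub: "module.subspace tscale Vt"
    and cont: "\<And>v. v \<in> Vt \<Longrightarrow> continuous_on K (\<lambda>k. v (form k))"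
    and pw: "\<And>v. p v = wnorm K (\<lambda>k. v (form k))"
    and l1: "has_l1_sequence K ((\<lambda>v k. v (form k)) ` Vt)"
  shows "contains_copy_of_l1 (completion tscale Vt p)"
proof -
  have p: "p = (\<lambda>v. wnorm K (\<lambda>k. v (form k)))" using pw by blast
  interpret seminormed tscale Vt p unfolding p by (rule wnorm_seminormed[OF K sub cont])
  obtain w :: "nat \<Rightarrow> 'a \<Rightarrow> 'k" and \<delta> where \<delta>: "\<delta> > 0" and w: "\<forall>i. w i \<in> (\<lambda>v k. v (form k)) ` Vt \<and> wnorm K (w i) \<le> 1"
    and low: "\<forall>n c. \<delta> * (\<Sum>i<n. norm (c i)) \<le> wnorm K (\<lambda>k. \<Sum>i<n. c i * w i k)"
    using l1 unfolding has_l1_sequence_def by (elim exE conjE) (erule that)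
  have "\<forall>i. \<exists>v. v \<in> Vt \<and> w i = (\<lambda>k. v (form k))" using w by blast
  from choice[OF this] obtain v where v: "\<And>i. v i \<in> Vt" "\<And>i. w i = (\<lambda>k. v i (form k))" by blast
  show ?thesis
  proof (rule contains_l1_if_sequence[OF v(1) _ \<delta>])
    show "p (v i) \<le> 1" for i using w by (simp add: pw v(2))
    show "\<delta> * (\<Sum>i<n. norm (c i)) \<le> p (\<Sum>i<n. tscale (c i) (v i))" for n c
      using low[rule_format, where n = n and c = c] by (simp add: pw v(2) fun_sum_apply tscale_def)
  qed
qed

lemma (in duality) norm_dense_completion:
  assumes NA: "NA \<subseteq> carrier (completion tscale U q)"
    and attain: "\<And>n c k. (\<And>j. j < n \<Longrightarrow> k j \<in> K) \<Longrightarrow> q (atom_sum \<tau> n c k) = (\<Sum>j<n. norm (c j)) \<Longrightarrow>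
       completion_embed U q (atom_sum \<tau> n c k) \<in> NA"
  shows "norm_dense (completion tscale U q) NA"
  unfolding norm_dense_def
proof (intro conjI NA ballI allI impI)
  fix z and e :: real assume z: "z \<in> carrier (completion tscale U q)" and e: "e > 0"
  obtain s where s: "s \<in> Cauchy_seqs U q" "z = q.cls s" using z unfolding q.carrier_completion by blast
  have "e / 2 > 0" using e by simp
  from norm_attaining_dense[OF s(1) this] obtain n c k N where
    k: "\<forall>j<n. k j \<in> K" and qa: "q (atom_sum \<tau> n c k) = (\<Sum>j<n. norm (c j))" and
    N: "\<forall>i\<ge>N. q (s i - atom_sum \<tau> n c k) \<le> e / 2" by (elim exE conjE) (erule that)
  define w where "w = atom_sum \<tau> n c k"
  have wU: "w \<in> U" unfolding w_def by (rule atom_sum_in_span) (use k in auto)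
  obtain r where r: "(\<lambda>i. q (s i - w)) \<longlonglongrightarrow> r"
    using q.Cauchy_seqs_convergent[OF q.Cauchy_seqs_diff[OF s(1) q.Cauchy_seqs_const[OF wU]]] convergentD by blast
  have "r \<le> e / 2" by (rule LIMSEQ_le_const2[OF r]) (use N in \<open>auto simp: w_def\<close>)
  moreover have "vdist (completion tscale U q) z (completion_embed U q w) = r"
    unfolding s(2) q.completion_embed_eq by (rule q.vdist_completion[OF s(1) q.Cauchy_seqs_const[OF wU] r])
  moreover have "completion_embed U q w \<in> NA" unfolding w_def by (rule attain) (use k qa in auto)
  ultimately show "\<exists>w\<in>NA. vdist (completion tscale U q) z w < e" using e by (intro bexI[of _ "completion_embed U q w"]) auto
qed

text \<open>Absolute convergence supplies a limit in norm, and the pointwise limits identify it as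
  0. This upgrades pointwise to norm convergence.\<close>

lemma blinfun_series_null:
  fixes f :: "nat \<Rightarrow> 'x::banach \<Rightarrow>\<^sub>L 'k::real_or_complex"
  assumes "summable (\<lambda>i. norm (f i))" and "\<And>x. (\<lambda>n. \<Sum>i<n. blinfun_apply (f i) x) \<longlonglongrightarrow> 0"
  shows "(\<lambda>n. \<Sum>i<n. f i) \<longlonglongrightarrow> 0"
proof -
  obtain g where g: "(\<lambda>n. \<Sum>i<n. f i) \<longlonglongrightarrow> g"
    using summable_norm_cancel[OF assms(1)] unfolding summable_iff_convergent convergent_def by blast
  have "g = 0"
  proof (rule blinfun_eqI)
    fix x
    have "(\<lambda>n. blinfun_apply (\<Sum>i<n. f i) x) \<longlonglongrightarrow> blinfun_apply g x" by (intro blinfun.tendsto g tendsto_const)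
    then show "blinfun_apply g x = blinfun_apply 0 x" using LIMSEQ_unique[OF _ assms(2)] by (simp add: blinfun.sum_left)
  qed
  then show ?thesis using g by simp
qed

text \<open>The zero functional is sent to itself, since \<open>1 / 0 = 0\<close>; the image
  therefore always lies in the dual ball.\<close>

definition normalize_dual :: "('x::banach \<Rightarrow>\<^sub>L 'k::real_or_complex) \<Rightarrow> ('x \<Rightarrow>\<^sub>L 'k)" where
  "normalize_dual x = dual_scale (of_real (1 / norm x)) x"

lemma normalize_dual:
  assumes "x \<in> dual sX"
  shows "normalize_dual x \<in> dual_ball sX" "dual_scale (of_real (norm x)) (normalize_dual x) = x"
proof -
  have "normalize_dual x \<in> dual sX" unfolding normalize_dual_def by (rule dual_scale.subspace_scale[OF subspace_dual assms])
  moreover have "norm (normalize_dual x) \<le> 1" unfolding normalize_dual_def norm_dual_scale norm_of_real by simp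
  ultimately show "normalize_dual x \<in> dual_ball sX" by (simp add: dual_ball_def)
  show "dual_scale (of_real (norm x)) (normalize_dual x) = x"
    by (cases "x = 0") (auto intro!: blinfun_eqI simp: normalize_dual_def)
qed

text \<open>Serves to identify a projective norm with an atomic norm: every representation is an
  atomic one of equal cost, and every atomic one yields a representation that is no dearer.\<close>

lemma Inf_eq_dominated:
  fixes A A' :: "real set"
  assumes "A \<subseteq> A'" and dom: "\<And>a'. a' \<in> A' \<Longrightarrow> \<exists>a\<in>A. a \<le> a'" and "\<And>a'. a' \<in> A' \<Longrightarrow> 0 \<le> a'"
  shows "Inf A = Inf A'"
proof (cases "A' = {}")
  case True
  then show ?thesis using assms(1) by simp
next
  case False
  then have ne: "A \<noteq> {}" using dom by blast
  have "bdd_below A'" using assms(3) by (auto intro!: bdd_belowI[of _ 0])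
  then have "Inf A' \<le> Inf A" using assms(1) ne by (intro cInf_superset_mono)
  moreover have "Inf A \<le> Inf A'" using assms dom False
    by (intro cInf_mono[OF False]) (auto intro!: bdd_belowI[of _ 0])
  ultimately show ?thesis by simp
qed

lemma dual_ball_dual: "x \<in> dual_ball sX \<Longrightarrow> x \<in> dual sX" by (simp add: dual_ball_def)

lemma functional_ballE:
  assumes "h \<in> functional_ball sX" shows "Blinfun h \<in> dual_ball sX" "blinfun_apply (Blinfun h) = h"
  using assms by (auto simp: functional_ball_def blinfun_apply_inverse)

section \<open>Tensor products of two spaces\<close>

locale tensor_pair =
  fixes sX :: "'k::real_or_complex \<Rightarrow> 'x::banach \<Rightarrow> 'x" and sY :: "'k \<Rightarrow> 'y::banach \<Rightarrow> 'y"
  assumes X: "banach_over sX" and Y: "banach_over sY"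
begin

definition B :: "(('x \<Rightarrow> 'k) \<times> ('y \<Rightarrow> 'k)) set" where
  "B = functional_ball sX \<times> functional_ball sY"

definition form :: "('x \<Rightarrow> 'k) \<times> ('y \<Rightarrow> 'k) \<Rightarrow> 'x \<Rightarrow> 'y \<Rightarrow> 'k" where
  "form k = (\<lambda>x y. fst k x * snd k y)"

abbreviation "Vt \<equiv> tensor_product sX UNIV sY UNIV"
abbreviation "tensor \<equiv> tens dual_scale (dual sX) dual_scale (dual sY)"

definition \<tau> :: "('x \<Rightarrow> 'k) \<times> ('y \<Rightarrow> 'k) \<Rightarrow> (('x \<Rightarrow>\<^sub>L 'k) \<Rightarrow> ('y \<Rightarrow>\<^sub>L 'k) \<Rightarrow> 'k) \<Rightarrow> 'k" where
  "\<tau> k = tensor (Blinfun (fst k)) (Blinfun (snd k))"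

lemma B_compact: "compact B" "B \<noteq> {}"
  unfolding B_def using compact_functional_ball[OF X] compact_functional_ball[OF Y]
    functional_ball_nonempty[of sX] functional_ball_nonempty[of sY] by (auto intro!: compact_Times)

lemma form_bilinear:
  assumes f: "f \<in> dual sX" and g: "g \<in> dual sY"
  shows "bilinear_form sX UNIV sY UNIV (\<lambda>x y. blinfun_apply f x * blinfun_apply g y)"
  using f g by (simp add: bilinear_form_def dual_def blinfun.add_right distrib_left distrib_right mult.left_commute mult.assoc)

lemma form_B: "k \<in> B \<Longrightarrow> bilinear_form sX UNIV sY UNIV (form k)"
  using form_bilinear by (auto simp: B_def functional_ball_def dual_ball_def form_def)

lemma Vt_linear:
  assumes v: "v \<in> Vt" and A: "bilinear_form sX UNIV sY UNIV A" and A': "bilinear_form sX UNIV sY UNIV A'"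
  shows "v (\<lambda>x y. A x y + A' x y) = v A + v A'" "v (\<lambda>x y. c * A x y) = c * v A"
proof -
  have s: "bilinear_form sX UNIV sY UNIV (\<lambda>x y. A x y + A' x y)" "bilinear_form sX UNIV sY UNIV (\<lambda>x y. c * A x y)"
    using A A' by (simp_all add: bilinear_form_def algebra_simps)
  from v have "v (\<lambda>x y. A x y + A' x y) = v A + v A' \<and> v (\<lambda>x y. c * A x y) = c * v A"
    unfolding tensor_product_def
  proof (induction rule: tscale.span_induct_alt)
    case (step d t v)
    then obtain x y where t: "t = tens sX UNIV sY UNIV x y" by blast
    show ?case using step.IH by (simp add: t tens_def tscale_def A A' s algebra_simps)
  qed simp
  then show "v (\<lambda>x y. A x y + A' x y) = v A + v A'" "v (\<lambda>x y. c * A x y) = c * v A" by auto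
qed

lemma Vt_subspace: "module.subspace tscale Vt"
  unfolding tensor_product_def by (rule tscale.subspace_span)

lemma elementary_in_Vt: "tens sX UNIV sY UNIV x y \<in> Vt"
  unfolding tensor_product_def by (rule tscale.span_base) blast

lemma Vt_continuous: "v \<in> Vt \<Longrightarrow> continuous_on B (\<lambda>k. v (form k))"
  unfolding tensor_product_def
proof (induction rule: tscale.span_induct_alt)
  case (step d t v)
  then obtain x y where t: "t = tens sX UNIV sY UNIV x y" by blast
  have c1: "continuous_on S (\<lambda>k :: ('x \<Rightarrow> 'k) \<times> ('y \<Rightarrow> 'k). fst k x)" for S
    by (rule continuous_on_compose2[OF continuous_on_product_coordinates continuous_on_fst[OF continuous_on_id]]) simp
  have c2: "continuous_on S (\<lambda>k :: ('x \<Rightarrow> 'k) \<times> ('y \<Rightarrow> 'k). snd k y)" for S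
    by (rule continuous_on_compose2[OF continuous_on_product_coordinates continuous_on_snd[OF continuous_on_id]]) simp
  have "continuous_on B (\<lambda>k. d * (fst k x * snd k y) + v (form k))"
    by (intro continuous_on_add continuous_on_mult continuous_on_const c1 c2 step.IH)
  moreover have "d * (fst k x * snd k y) + v (form k) = (tscale d t + v) (form k)" if "k \<in> B" for k
    using form_B[OF that] by (simp add: t tens_def tscale_def form_def)
  ultimately show ?case by (subst continuous_on_cong[OF refl, of _ _ "\<lambda>k. d * (fst k x * snd k y) + v (form k)"]) auto
qed simp

lemma inj_norm_eq: "inj_norm sX sY v = wnorm B (\<lambda>k. v (form k))"
proof -
  have "{norm (v (\<lambda>x y. blinfun_apply f x * blinfun_apply g y)) |f g. f \<in> dual_ball sX \<and> g \<in> dual_ball sY}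
      = (\<lambda>k. norm (v (form k))) ` B"
    by (force simp: B_def functional_ball_def form_def image_iff)
  then show ?thesis by (simp add: inj_norm_def wnorm_def)
qed

lemma
  assumes "x \<in> dual sX" "y \<in> dual sY"
  shows tensor_add_left: "x' \<in> dual sX \<Longrightarrow> tensor (x + x') y = tensor x y + tensor x' y"
    and tensor_add_right: "y' \<in> dual sY \<Longrightarrow> tensor x (y + y') = tensor x y + tensor x y'"
    and tensor_scale_left: "tensor (dual_scale c x) y = tscale c (tensor x y)"
    and tensor_scale_right: "tensor x (dual_scale c y) = tscale c (tensor x y)"
  using assms by (auto simp: fun_eq_iff tens_def bilinear_form_def tscale_def)

lemma tensor_normalize:
  assumes "x \<in> dual sX" "y \<in> dual sY"
  shows "tensor x y = tscale (of_real (norm x * norm y)) (\<tau> (blinfun_apply (normalize_dual x), blinfun_apply (normalize_dual y)))"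
proof -
  let ?x = "normalize_dual x" and ?y = "normalize_dual y"
  have m: "?x \<in> dual sX" "?y \<in> dual sY" using normalize_dual(1)[OF assms(1)] normalize_dual(1)[OF assms(2)] by (auto simp: dual_ball_def)
  have "tensor x y = tensor (dual_scale (of_real (norm x)) ?x) (dual_scale (of_real (norm y)) ?y)"
    using normalize_dual(2)[OF assms(1)] normalize_dual(2)[OF assms(2)] by simp
  also have "\<dots> = tscale (of_real (norm x)) (tscale (of_real (norm y)) (tensor ?x ?y))"
    using m by (simp add: tensor_scale_left tensor_scale_right dual_scale.subspace_scale[OF subspace_dual])
  also have "\<dots> = tscale (of_real (norm x * norm y)) (tensor ?x ?y)" by (simp add: tscale_def mult.assoc)
  finally show ?thesis by (simp add: \<tau>_def blinfun_apply_inverse)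
qed

lemma normalize_in_B:
  "x \<in> dual sX \<Longrightarrow> y \<in> dual sY \<Longrightarrow> (blinfun_apply (normalize_dual x), blinfun_apply (normalize_dual y)) \<in> B"
  by (auto simp: B_def functional_ball_def intro: normalize_dual)

lemma tensor_product_eq: "tensor_product dual_scale (dual sX) dual_scale (dual sY) = tspan (\<tau> ` B)"
  unfolding tensor_product_def
proof (rule tscale.span_eq[THEN iffD2], intro conjI subsetI)
  fix t assume "t \<in> {tensor x y |x y. x \<in> dual sX \<and> y \<in> dual sY}"
  then obtain x y where "t = tensor x y" "x \<in> dual sX" "y \<in> dual sY" by blast
  then show "t \<in> tspan (\<tau> ` B)"
    using tensor_normalize normalize_in_B by (simp add: tscale.span_scale tscale.span_base)
next
  fix t assume "t \<in> \<tau> ` B"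
  then obtain k where k: "k \<in> B" "t = tensor (Blinfun (fst k)) (Blinfun (snd k))" by (auto simp: \<tau>_def)
  have "Blinfun (fst k) \<in> dual sX" "Blinfun (snd k) \<in> dual sY"
    using k(1) dual_ball_dual[OF functional_ballE(1)[of "fst k" sX]] dual_ball_dual[OF functional_ballE(1)[of "snd k" sY]]
    by (auto simp: B_def)
  then show "t \<in> tspan {tensor x y |x y. x \<in> dual sX \<and> y \<in> dual sY}" unfolding k(2) by (intro tscale.span_base) blast
qed

text \<open>Normalising both factors moves the product of their norms into the coefficient;
  conversely the coefficient is absorbed into the left factor, and factors in the unit balls can
  only lower the cost.\<close>

lemma proj_norm_eq: "proj_norm dual_scale (dual sX) dual_scale (dual sY) = gauge_norm B \<tau>"
proof
  fix u
  show "proj_norm dual_scale (dual sX) dual_scale (dual sY) u = gauge_norm B \<tau> u"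
    unfolding proj_norm_def gauge_norm_def
  proof (rule Inf_eq_dominated)
    show "{(\<Sum>i<n. norm (x i) * norm (y i)) |n x y. (\<forall>i<n. x i \<in> dual sX \<and> y i \<in> dual sY) \<and> u = (\<Sum>i<n::nat. tensor (x i) (y i))}
      \<subseteq> {(\<Sum>j<n. norm (c j)) |n c k. (\<forall>j<n. k j \<in> B) \<and> u = atom_sum \<tau> n c k}"
    proof
      fix a assume "a \<in> {(\<Sum>i<n. norm (x i) * norm (y i)) |n x y. (\<forall>i<n. x i \<in> dual sX \<and> y i \<in> dual sY) \<and> u = (\<Sum>i<n::nat. tensor (x i) (y i))}"
      then obtain n x y where "a = (\<Sum>i<n. norm (x i) * norm (y i)) \<and> (\<forall>i<n. x i \<in> dual sX \<and> y i \<in> dual sY) \<and>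
        u = (\<Sum>i<n::nat. tensor (x i) (y i))" by (elim CollectE exE) (rule that, assumption)
      then have a: "a = (\<Sum>i<n. norm (x i) * norm (y i))" "\<forall>i<n. x i \<in> dual sX \<and> y i \<in> dual sY"
        "u = (\<Sum>i<n::nat. tensor (x i) (y i))" by simp_all
      define c where "c i = (of_real (norm (x i) * norm (y i)) :: 'k)" for i
      define k where "k i = (blinfun_apply (normalize_dual (x i)), blinfun_apply (normalize_dual (y i)))" for i
      have "a = (\<Sum>j<n. norm (c j))" unfolding a(1) c_def by (rule sum.cong) (simp_all add: norm_mult)
      moreover have "\<forall>j<n. k j \<in> B" using a(2) normalize_in_B by (simp add: k_def)
      moreover have "u = atom_sum \<tau> n c k"
        unfolding a(3) atom_sum_def c_def k_def by (rule sum.cong) (use a(2) tensor_normalize in auto)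
      ultimately show "a \<in> {(\<Sum>j<n. norm (c j)) |n c k. (\<forall>j<n. k j \<in> B) \<and> u = atom_sum \<tau> n c k}"
        by (intro CollectI exI[of _ n] exI[of _ c] exI[of _ k]) simp
    qed
  next
    fix a' assume "a' \<in> {(\<Sum>j<n. norm (c j)) |n c k. (\<forall>j<n. k j \<in> B) \<and> u = atom_sum \<tau> n c k}"
    then obtain n c k where "a' = (\<Sum>j<n. norm (c j)) \<and> (\<forall>j<n. k j \<in> B) \<and> u = atom_sum \<tau> n c k"
      by (elim CollectE exE) (rule that, assumption)
    then have a': "a' = (\<Sum>j<n. norm (c j))" "\<forall>j<n. k j \<in> B" "u = atom_sum \<tau> n c k" by simp_all
    define x where "x i = dual_scale (c i) (Blinfun (fst (k i)))" for i
    define y where "y i = Blinfun (snd (k i))" for i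
    have b: "Blinfun (fst (k i)) \<in> dual_ball sX" "y i \<in> dual_ball sY" if "i < n" for i
      using a'(2) that functional_ballE(1)[of "fst (k i)" sX] functional_ballE(1)[of "snd (k i)" sY]
      by (auto simp: B_def y_def mem_Times_iff)
    have d: "x i \<in> dual sX" "y i \<in> dual sY" if "i < n" for i
      using dual_scale.subspace_scale[OF subspace_dual dual_ball_dual[OF b(1)[OF that]], of "c i"] dual_ball_dual[OF b(2)[OF that]]
      by (simp_all add: x_def)
    have "(\<Sum>i<n. norm (x i) * norm (y i)) \<le> a'"
      unfolding a'(1)
    proof (rule sum_mono)
      fix i assume "i \<in> {..<n}"
      then have "norm (Blinfun (fst (k i))) \<le> 1" "norm (y i) \<le> 1" using b by (auto simp: dual_ball_def)
      then have "norm (c i) * norm (Blinfun (fst (k i))) * norm (y i) \<le> norm (c i) * 1 * 1"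
        by (intro mult_mono) auto
      then show "norm (x i) * norm (y i) \<le> norm (c i)" by (simp add: x_def norm_dual_scale)
    qed
    moreover have "u = (\<Sum>i<n::nat. tensor (x i) (y i))"
      unfolding a'(3) atom_sum_def
    proof (rule sum.cong[OF refl])
      fix i assume "i \<in> {..<n}"
      then show "tscale (c i) (\<tau> (k i)) = tensor (x i) (y i)"
        using b[of i] by (simp add: x_def \<tau>_def y_def tensor_scale_left dual_ball_dual)
    qed
    ultimately show "\<exists>a\<in>{(\<Sum>i<n. norm (x i) * norm (y i)) |n x y. (\<forall>i<n. x i \<in> dual sX \<and> y i \<in> dual sY) \<and> u = (\<Sum>i<n::nat. tensor (x i) (y i))}. a \<le> a'"
      using d by (intro bexI[of _ "\<Sum>i<n. norm (x i) * norm (y i)"] CollectI exI[of _ n] exI[of _ x] exI[of _ y]) simp_all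
  qed (auto intro!: sum_nonneg)
qed

text \<open>\<open>W\<close> is the injective tensor product seen as functions on the compact set \<open>B\<close>. A tensor is recovered
  from its function by choice, and \<open>\<omega>\<close> reads it as a bilinear form on the duals.\<close>

definition preimage :: "(('x \<Rightarrow> 'k) \<times> ('y \<Rightarrow> 'k) \<Rightarrow> 'k) \<Rightarrow> ('x \<Rightarrow> 'y \<Rightarrow> 'k) \<Rightarrow> 'k" where
  "preimage w = (SOME v. v \<in> Vt \<and> w = (\<lambda>k. v (form k)))"

definition W where "W = (\<lambda>v k. v (form k)) ` Vt"

definition \<omega> :: "(('x \<Rightarrow> 'k) \<times> ('y \<Rightarrow> 'k) \<Rightarrow> 'k) \<Rightarrow> ('x \<Rightarrow>\<^sub>L 'k) \<Rightarrow> ('y \<Rightarrow>\<^sub>L 'k) \<Rightarrow> 'k" where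
  "\<omega> w = (\<lambda>f g. preimage w (\<lambda>x y. blinfun_apply f x * blinfun_apply g y))"

lemma preimage:
  assumes "w \<in> W" shows "preimage w \<in> Vt" "preimage w (form k) = w k"
proof -
  have "\<exists>v. v \<in> Vt \<and> w = (\<lambda>k. v (form k))" using assms unfolding W_def by blast
  from someI_ex[OF this] show "preimage w \<in> Vt" "preimage w (form k) = w k" unfolding preimage_def[symmetric] by metis+
qed

text \<open>\<open>tens\<close> is 0 off the bilinear forms, so the content is that
  \<open>\<omega> w\<close> is bilinear on the duals. This holds since tensors are linear on bounded
  product forms.\<close>

lemma pairing:
  assumes w: "w \<in> W" and k: "k \<in> B" shows "\<tau> k (\<omega> w) = w k"
proof -
  have "bilinear_form dual_scale (dual sX) dual_scale (dual sY) (\<omega> w)"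
    unfolding bilinear_form_def
  proof (intro conjI ballI allI)
    fix f f' g assume "f \<in> dual sX" "f' \<in> dual sX" "g \<in> dual sY"
    then show "\<omega> w (f + f') g = \<omega> w f g + \<omega> w f' g"
      using Vt_linear(1)[OF preimage(1)[OF w] form_bilinear form_bilinear]
      by (simp add: \<omega>_def blinfun.add_left distrib_right)
  next
    fix f g g' assume "f \<in> dual sX" "g \<in> dual sY" "g' \<in> dual sY"
    then show "\<omega> w f (g + g') = \<omega> w f g + \<omega> w f g'"
      using Vt_linear(1)[OF preimage(1)[OF w] form_bilinear form_bilinear]
      by (simp add: \<omega>_def blinfun.add_left distrib_left)
  next
    fix c f g assume "f \<in> dual sX" "g \<in> dual sY"
    then show "\<omega> w (dual_scale c f) g = c * \<omega> w f g" "\<omega> w f (dual_scale c g) = c * \<omega> w f g"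
      using Vt_linear(2)[OF preimage(1)[OF w] form_bilinear form_bilinear, of f g f g c]
      by (simp_all add: \<omega>_def mult.assoc mult.left_commute)
  qed
  moreover have "blinfun_apply (Blinfun (fst k)) = fst k" "blinfun_apply (Blinfun (snd k)) = snd k"
    using k functional_ballE(2)[of "fst k" sX] functional_ballE(2)[of "snd k" sY] by (auto simp: B_def)
  ultimately have "\<tau> k (\<omega> w) = preimage w (form k)" by (simp add: \<tau>_def tens_def \<omega>_def form_def)
  then show ?thesis using preimage(2)[OF w] by simp
qed

sublocale q: seminormed tscale "tspan (\<tau> ` B)" "gauge_norm B \<tau>"
  by (rule seminormed_gauge)

lemma tensor_in_span: "x \<in> dual sX \<Longrightarrow> y \<in> dual sY \<Longrightarrow> tensor x y \<in> tspan (\<tau> ` B)"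
  unfolding tensor_product_eq[symmetric] tensor_product_def by (intro tscale.span_base) blast

lemma gauge_tensor_le:
  assumes "x \<in> dual sX" "y \<in> dual sY" shows "gauge_norm B \<tau> (tensor x y) \<le> norm x * norm y"
proof -
  let ?k = "(blinfun_apply (normalize_dual x), blinfun_apply (normalize_dual y))"
  have k: "?k \<in> B" by (rule normalize_in_B[OF assms])
  have "tensor x y = atom_sum \<tau> 1 (\<lambda>_. of_real (norm x * norm y)) (\<lambda>_. ?k)"
    using tensor_normalize[OF assms] by (simp add: atom_sum_def)
  then show ?thesis using gauge_norm_le[of 1 "\<lambda>_. ?k" B \<tau> "\<lambda>_. of_real (norm x * norm y)"] k by (simp add: norm_mult)
qed

lemma tscale_0: "tscale 0 t = 0"
  by (simp add: tscale_def fun_eq_iff)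

lemma tensor_zero_left: "y \<in> dual sY \<Longrightarrow> tensor 0 y = 0"
  using tensor_scale_left[OF dual_scale.subspace_0[OF subspace_dual], of y 0] unfolding dual_scale.scale_zero_left tscale_0 .

lemma tensor_zero_right: "x \<in> dual sX \<Longrightarrow> tensor x 0 = 0"
  using tensor_scale_right[OF _ dual_scale.subspace_0[OF subspace_dual], of x 0] unfolding dual_scale.scale_zero_left tscale_0 .

lemma tensor_sum_left:
  assumes "\<And>i. i \<in> I \<Longrightarrow> x i \<in> dual sX" "y \<in> dual sY" shows "tensor (\<Sum>i\<in>I. x i) y = (\<Sum>i\<in>I. tensor (x i) y)"
  using assms(1)
proof (induction I rule: infinite_finite_induct)
  case (insert i I)
  then show ?case using tensor_add_left[of "x i" y "\<Sum>i\<in>I. x i"] assms(2) dual_scale.subspace_sum[OF subspace_dual, of I x sX] by simp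
qed (simp_all only: sum.infinite sum.empty tensor_zero_left[OF assms(2)] not_False_eq_True)

lemma tensor_sum_right:
  assumes "\<And>i. i \<in> I \<Longrightarrow> y i \<in> dual sY" "x \<in> dual sX" shows "tensor x (\<Sum>i\<in>I. y i) = (\<Sum>i\<in>I. tensor x (y i))"
  using assms(1)
proof (induction I rule: infinite_finite_induct)
  case (insert i I)
  then show ?case using tensor_add_right[of x "y i" "\<Sum>i\<in>I. y i"] assms(2) dual_scale.subspace_sum[OF subspace_dual, of I y sY] by simp
qed (simp_all only: sum.infinite sum.empty tensor_zero_right[OF assms(2)] not_False_eq_True)

end

section \<open>The approximation property and two-factor series\<close>

lemma compact_insert_limit:
  fixes f :: "nat \<Rightarrow> 'a::topological_space"
  assumes "f \<longlonglongrightarrow> l" shows "compact (insert l (range f))"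
proof (rule compactI)
  fix C assume C: "\<forall>t\<in>C. open t" "insert l (range f) \<subseteq> \<Union>C"
  then obtain V where V: "V \<in> C" "l \<in> V" by blast
  then have "\<forall>\<^sub>F n in sequentially. f n \<in> V" using C(1) assms by (intro topological_tendstoD) auto
  then obtain N where N: "\<And>n. n \<ge> N \<Longrightarrow> f n \<in> V" unfolding eventually_sequentially by blast
  have "\<forall>n. \<exists>t. t \<in> C \<and> f n \<in> t" using C(2) by blast
  from choice[OF this] obtain t where t: "\<And>n. t n \<in> C" "\<And>n. f n \<in> t n" by blast
  have "f n \<in> \<Union>(insert V (t ` {..<N}))" for n using N[of n] t(2)[of n] by (cases "n < N") auto
  then have "insert l (range f) \<subseteq> \<Union>(insert V (t ` {..<N}))" using V(2) by blast
  then show "\<exists>C'\<subseteq>C. finite C' \<and> insert l (range f) \<subseteq> \<Union>C'"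
    using V(1) t(1) by (intro exI[of _ "insert V (t ` {..<N})"]) auto
qed

text \<open>A null sequence together with 0 is compact, so the approximation property supplies one
  operator for all its terms.\<close>

lemma null_sequence_in_compact:
  fixes a :: "nat \<Rightarrow> 'x::banach \<Rightarrow>\<^sub>L 'k::real_or_complex"
  assumes ap: "approximation_property dual_scale (dual sX)"
    and a: "\<And>i. a i \<in> dual sX" "a \<longlonglongrightarrow> 0" and e: "e > 0"
  shows "\<exists>T. finite_rank_operator dual_scale (dual sX) T \<and> (\<forall>i. norm (T (a i) - a i) \<le> e)"
proof -
  have "compact (insert 0 (range a))" by (rule compact_insert_limit[OF a(2)])
  moreover have "insert 0 (range a) \<subseteq> dual sX" using a(1) dual_scale.subspace_0[OF subspace_dual] by auto
  ultimately obtain T where "finite_rank_operator dual_scale (dual sX) T" "\<forall>x\<in>insert 0 (range a). norm (T x - x) \<le> e"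
    using ap e unfolding approximation_property_def by meson
  then show ?thesis by (intro exI[of _ T]) simp
qed

context tensor_pair begin

text \<open>Replace \<open>xs i\<close> by \<open>T (xs i)\<close> for an operator \<open>T\<close>
  of finite rank that is uniformly close to the identity on the sequence. The error is bounded by
  the closeness times the sum of the \<open>norm (ys i)\<close>; the rest is a finite sum of tensors
  \<open>ee j\<close> with vectors \<open>R j n\<close>, which tend to 0 in norm.\<close>

lemma tensor_series_null:
  assumes ap: "approximation_property dual_scale (dual sX)"
    and xs: "\<And>i. xs i \<in> dual sX" "xs \<longlonglongrightarrow> 0" and ys: "\<And>i. ys i \<in> dual sY" "summable (\<lambda>i. norm (ys i))"
    and null: "\<And>x y. (\<lambda>n. \<Sum>i<n. blinfun_apply (xs i) x * blinfun_apply (ys i) y) \<longlonglongrightarrow> 0"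
  shows "(\<lambda>n. gauge_norm B \<tau> (\<Sum>i<n. tensor (xs i) (ys i))) \<longlonglongrightarrow> 0"
proof (rule LIMSEQ_I)
  fix e :: real assume "e > 0"
  obtain H where H: "H > 0" "\<And>i. norm (xs i) \<le> H"
    using convergent_imp_bounded[OF xs(2)] unfolding bounded_pos by auto
  define S where "S = (\<Sum>i. norm (ys i))"
  have S0: "S \<ge> 0" unfolding S_def by (rule suminf_nonneg[OF ys(2)]) simp
  have S: "(\<Sum>i<n. norm (ys i)) \<le> S" for n unfolding S_def by (rule sum_le_suminf[OF ys(2)]) auto
  \<comment> \<open>Makes \<open>d * S < e / 2\<close>, also when \<open>S = 0\<close>.\<close>
  define d where "d = (e / 2) / (S + 1)"
  have d: "d > 0" using \<open>e > 0\<close> S0 by (simp add: d_def)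
  have dS: "d * S < e / 2"
  proof -
    have "d * S < d * (S + 1)" using d by simp
    also have "\<dots> = e / 2"
    proof -
      have "S + 1 \<noteq> 0" using S0 by simp
      then show ?thesis by (rule nonzero_eq_divide_eq[THEN iffD1, OF _ d_def])
    qed
    finally show ?thesis .
  qed
  obtain T where T: "finite_rank_operator dual_scale (dual sX) T" "\<And>i. norm (T (xs i) - xs i) \<le> d"
    using null_sequence_in_compact[OF ap xs d] by blast
  from T(1) have "T ` dual sX \<subseteq> dual sX" unfolding finite_rank_operator_def by (elim conjE)
  then have Tdual: "T (xs i) \<in> dual sX" for i using xs(1) by blast
  obtain I :: "('x \<Rightarrow> 'k) set" and ee \<phi> C where I: "finite I" "\<And>i. i \<in> I \<Longrightarrow> ee i \<in> dual sX" "C \<ge> 0"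
    and Teq: "\<And>x. x \<in> dual sX \<Longrightarrow> T x = (\<Sum>j\<in>I. dual_scale (\<phi> j x) (ee j))"
    and \<phi>_add: "\<And>j x y. j \<in> I \<Longrightarrow> x \<in> dual sX \<Longrightarrow> y \<in> dual sX \<Longrightarrow> \<phi> j (x + y) = \<phi> j x + \<phi> j y"
    and \<phi>_scale: "\<And>j c x. j \<in> I \<Longrightarrow> x \<in> dual sX \<Longrightarrow> \<phi> j (dual_scale c x) = c * \<phi> j x"
    and \<phi>_le: "\<And>j x. j \<in> I \<Longrightarrow> x \<in> dual sX \<Longrightarrow> norm (\<phi> j x) \<le> C * norm x"
    by (rule finite_rank_coordinates[OF T(1)]) (rule that)
  \<comment> \<open>Collecting the coefficients of \<open>ee j\<close> moves the whole series into
    the second factor.\<close>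
  define R where "R j n = (\<Sum>i<n. dual_scale (\<phi> j (xs i)) (ys i))" for j n
  have Rdual: "R j n \<in> dual sY" for j n unfolding R_def
    by (intro dual_scale.subspace_sum[OF subspace_dual] dual_scale.subspace_scale[OF subspace_dual] ys(1))
  have Rnull: "R j \<longlonglongrightarrow> 0" if j: "j \<in> I" for j
    unfolding R_def
  proof (rule blinfun_series_null)
    have "norm (norm (dual_scale (\<phi> j (xs i)) (ys i))) \<le> C * H * norm (ys i)" for i
    proof -
      have "norm (\<phi> j (xs i)) \<le> C * norm (xs i)" by (rule \<phi>_le[OF j xs(1)])
      also have "\<dots> \<le> C * H" using H(2) I(3) by (intro mult_left_mono) auto
      finally show ?thesis by (simp add: norm_dual_scale mult_right_mono)
    qed
    then show "summable (\<lambda>i. norm (dual_scale (\<phi> j (xs i)) (ys i)))"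
      by (intro summable_comparison_test'[OF summable_mult[OF ys(2), of "C * H"], of 0]) blast
    fix y
    \<comment> \<open>At a fixed \<open>y\<close> the series is read in the first factor, where it
      tends to 0 in norm; only then may the functional \<open>\<phi> j\<close> be applied, since it
      need not be an evaluation at a point of \<open>X\<close>.\<close>
    define G where "G n = (\<Sum>i<n. dual_scale (blinfun_apply (ys i) y) (xs i))" for n
    have Gdual: "G n \<in> dual sX" for n unfolding G_def
      by (intro dual_scale.subspace_sum[OF subspace_dual] dual_scale.subspace_scale[OF subspace_dual] xs(1))
    have "G \<longlonglongrightarrow> 0" unfolding G_def
    proof (rule blinfun_series_null)
      have "norm (norm (dual_scale (blinfun_apply (ys i) y) (xs i))) \<le> norm y * H * norm (ys i)" for i
      proof -
        have "norm (blinfun_apply (ys i) y) * norm (xs i) \<le> (norm (ys i) * norm y) * H"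
          by (intro mult_mono norm_blinfun H) auto
        then show ?thesis by (simp add: norm_dual_scale mult_ac)
      qed
      then show "summable (\<lambda>i. norm (dual_scale (blinfun_apply (ys i) y) (xs i)))"
        by (intro summable_comparison_test'[OF summable_mult[OF ys(2), of "norm y * H"], of 0]) blast
      show "(\<lambda>n. \<Sum>i<n. blinfun_apply (dual_scale (blinfun_apply (ys i) y) (xs i)) x) \<longlonglongrightarrow> 0" for x
        using null[of x y] by (simp add: mult.commute)
    qed
    then have "(\<lambda>n. C * norm (G n)) \<longlonglongrightarrow> C * norm (0 :: 'x \<Rightarrow>\<^sub>L 'k)" by (intro tendsto_intros)
    then have lim: "(\<lambda>n. C * norm (G n)) \<longlonglongrightarrow> 0" by simp
    have \<phi>G: "\<phi> j (G n) = (\<Sum>i<n. blinfun_apply (ys i) y * \<phi> j (xs i))" for n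
    proof (induction n)
      case 0
      have "\<phi> j (dual_scale 0 (xs 0)) = 0" using \<phi>_scale[OF j xs(1), of 0 0] by simp
      moreover have "dual_scale 0 (xs 0) = 0" by (rule blinfun_eqI) simp
      ultimately show ?case by (simp add: G_def)
    next
      case (Suc n)
      have "\<phi> j (G (Suc n)) = \<phi> j (G n + dual_scale (blinfun_apply (ys n) y) (xs n))" by (simp add: G_def)
      also have "\<dots> = \<phi> j (G n) + blinfun_apply (ys n) y * \<phi> j (xs n)"
        by (simp only: \<phi>_add[OF j Gdual dual_scale.subspace_scale[OF subspace_dual xs(1)]] \<phi>_scale[OF j xs(1)])
      finally show ?case using Suc by simp
    qed
    have "norm (\<phi> j (G n)) \<le> C * norm (G n)" for n by (rule \<phi>_le[OF j Gdual])
    then have "(\<lambda>n. \<phi> j (G n)) \<longlonglongrightarrow> 0" by (intro Lim_null_comparison[OF always_eventually lim]) blast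
    then show "(\<lambda>n. \<Sum>i<n. blinfun_apply (dual_scale (\<phi> j (xs i)) (ys i)) y) \<longlonglongrightarrow> 0"
      by (simp add: \<phi>G mult.commute)
  qed
  have "(\<lambda>n. \<Sum>j\<in>I. norm (ee j) * norm (R j n)) \<longlonglongrightarrow> (\<Sum>j\<in>I. norm (ee j) * norm (0 :: 'y \<Rightarrow>\<^sub>L 'k))"
    by (intro tendsto_intros Rnull)
  then have "(\<lambda>n. \<Sum>j\<in>I. norm (ee j) * norm (R j n)) \<longlonglongrightarrow> 0" by simp
  then have "\<forall>\<^sub>F n in sequentially. (\<Sum>j\<in>I. norm (ee j) * norm (R j n)) < e / 2"
    by (rule order_tendstoD) (use \<open>e > 0\<close> in simp)
  then obtain N where N: "\<And>n. n \<ge> N \<Longrightarrow> (\<Sum>j\<in>I. norm (ee j) * norm (R j n)) < e / 2"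
    unfolding eventually_sequentially by blast
  have "gauge_norm B \<tau> (\<Sum>i<n. tensor (xs i) (ys i)) < e" if n: "n \<ge> N" for n
  proof -
    have D: "xs i - T (xs i) \<in> dual sX" for i by (rule dual_scale.subspace_diff[OF subspace_dual xs(1) Tdual])
    have split: "tensor (xs i) (ys i) = tensor (xs i - T (xs i)) (ys i) + tensor (T (xs i)) (ys i)" for i
      using tensor_add_left[OF D ys(1) Tdual, of i i i] by simp
    have "(\<Sum>i<n. tensor (T (xs i)) (ys i)) = (\<Sum>i<n. \<Sum>j\<in>I. tensor (ee j) (dual_scale (\<phi> j (xs i)) (ys i)))"
    proof (rule sum.cong[OF refl])
      fix i
      have m: "dual_scale (\<phi> j (xs i)) (ee j) \<in> dual sX" if "j \<in> I" for j
        using I(2) that by (intro dual_scale.subspace_scale[OF subspace_dual]) blast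
      have "T (xs i) = (\<Sum>j\<in>I. dual_scale (\<phi> j (xs i)) (ee j))" using Teq xs(1) by blast
      then have "tensor (T (xs i)) (ys i) = (\<Sum>j\<in>I. tensor (dual_scale (\<phi> j (xs i)) (ee j)) (ys i))"
        using tensor_sum_left[OF m ys(1)] by simp
      also have "\<dots> = (\<Sum>j\<in>I. tensor (ee j) (dual_scale (\<phi> j (xs i)) (ys i)))"
        using I(2) ys(1) by (intro sum.cong[OF refl]) (simp add: tensor_scale_left tensor_scale_right)
      finally show "tensor (T (xs i)) (ys i) = (\<Sum>j\<in>I. tensor (ee j) (dual_scale (\<phi> j (xs i)) (ys i)))" .
    qed
    also have "\<dots> = (\<Sum>j\<in>I. \<Sum>i<n. tensor (ee j) (dual_scale (\<phi> j (xs i)) (ys i)))" by (rule sum.swap)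
    also have "\<dots> = (\<Sum>j\<in>I. tensor (ee j) (R j n))"
    proof (rule sum.cong[OF refl])
      fix j assume "j \<in> I"
      then have "ee j \<in> dual sX" using I(2) by blast
      then show "(\<Sum>i<n. tensor (ee j) (dual_scale (\<phi> j (xs i)) (ys i))) = tensor (ee j) (R j n)"
        unfolding R_def by (intro tensor_sum_right[symmetric] dual_scale.subspace_scale[OF subspace_dual] ys(1))
    qed
    finally have fin: "(\<Sum>i<n. tensor (T (xs i)) (ys i)) = (\<Sum>j\<in>I. tensor (ee j) (R j n))" .
    have eq: "(\<Sum>i<n. tensor (xs i) (ys i)) = (\<Sum>i<n. tensor (xs i - T (xs i)) (ys i)) + (\<Sum>j\<in>I. tensor (ee j) (R j n))"
      unfolding fin[symmetric] sum.distrib[symmetric] by (rule sum.cong[OF refl split])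
    have m1: "(\<Sum>i<n. tensor (xs i - T (xs i)) (ys i)) \<in> tspan (\<tau> ` B)" by (intro tscale.span_sum tensor_in_span D ys(1))
    have m2: "(\<Sum>j\<in>I. tensor (ee j) (R j n)) \<in> tspan (\<tau> ` B)" using I(2) Rdual by (intro tscale.span_sum tensor_in_span) auto
    have "gauge_norm B \<tau> (\<Sum>i<n. tensor (xs i - T (xs i)) (ys i)) \<le> (\<Sum>i<n. gauge_norm B \<tau> (tensor (xs i - T (xs i)) (ys i)))"
      by (rule q.p_sum) (intro tensor_in_span D ys(1))
    also have "\<dots> \<le> (\<Sum>i<n. d * norm (ys i))"
    proof (rule sum_mono)
      fix i
      have "gauge_norm B \<tau> (tensor (xs i - T (xs i)) (ys i)) \<le> norm (xs i - T (xs i)) * norm (ys i)"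
        by (rule gauge_tensor_le[OF D ys(1)])
      also have "\<dots> \<le> d * norm (ys i)" using T(2)[of i] by (intro mult_right_mono) (auto simp: norm_minus_commute)
      finally show "gauge_norm B \<tau> (tensor (xs i - T (xs i)) (ys i)) \<le> d * norm (ys i)" .
    qed
    also have "\<dots> = d * (\<Sum>i<n. norm (ys i))" by (simp add: sum_distrib_left)
    also have "\<dots> \<le> d * S" using d S by (intro mult_left_mono) auto
    finally have 1: "gauge_norm B \<tau> (\<Sum>i<n. tensor (xs i - T (xs i)) (ys i)) \<le> d * S" .
    have "gauge_norm B \<tau> (\<Sum>j\<in>I. tensor (ee j) (R j n)) \<le> (\<Sum>j\<in>I. gauge_norm B \<tau> (tensor (ee j) (R j n)))"
      using I(2) Rdual by (intro q.p_sum tensor_in_span) auto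
    also have "\<dots> \<le> (\<Sum>j\<in>I. norm (ee j) * norm (R j n))" using I(2) Rdual by (intro sum_mono gauge_tensor_le) auto
    finally have 2: "gauge_norm B \<tau> (\<Sum>j\<in>I. tensor (ee j) (R j n)) < e / 2" using N[OF n] by simp
    show ?thesis unfolding eq using q.triangle[OF m1 m2] 1 2 dS by linarith
  qed
  moreover have "gauge_norm B \<tau> (\<Sum>i<n. tensor (xs i) (ys i)) \<ge> 0" for n
    by (intro q.p_nonneg tscale.span_sum tensor_in_span xs(1) ys(1))
  ultimately show "\<exists>N. \<forall>n\<ge>N. norm (gauge_norm B \<tau> (\<Sum>i<n. tensor (xs i) (ys i)) - 0) < e" by (intro exI[of _ N]) simp
qed

text \<open>The coefficient \<open>cs i\<close> is split as \<open>\<theta> i\<close> times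
  \<open>cs i / \<theta> i\<close>, which makes the first factors a null sequence while the second
  ones stay absolutely summable. The hypothesis is used at elementary tensors.\<close>

lemma injective:
  assumes ap: "approximation_property dual_scale (dual sX)"
    and ks: "range ks \<subseteq> B" and cs: "summable (\<lambda>i. norm (cs i))"
    and null: "\<And>w. w \<in> W \<Longrightarrow> (\<lambda>i. cs i * w (ks i)) sums 0"
  shows "(\<lambda>n. gauge_norm B \<tau> (atom_sum \<tau> n cs ks)) \<longlonglongrightarrow> 0"
proof -
  obtain \<theta> where \<theta>: "\<And>j. \<theta> j > 0" "\<theta> \<longlonglongrightarrow> 0" "summable (\<lambda>j. norm (cs j) / \<theta> j)"
    using summable_rescale[OF cs] by auto
  define a where "a i = Blinfun (fst (ks i))" for i
  define b where "b i = Blinfun (snd (ks i))" for i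
  have ksB: "ks i \<in> B" for i using ks by blast
  have ab: "a i \<in> dual_ball sX" "b i \<in> dual_ball sY" "blinfun_apply (a i) = fst (ks i)" "blinfun_apply (b i) = snd (ks i)" for i
    using ksB[of i] functional_ballE[of "fst (ks i)" sX] functional_ballE[of "snd (ks i)" sY]
    by (auto simp: B_def a_def b_def mem_Times_iff)
  have abn: "norm (a i) \<le> 1" "norm (b i) \<le> 1" for i using ab by (auto simp: dual_ball_def)
  define xs where "xs i = dual_scale (of_real (\<theta> i)) (a i)" for i
  define ys where "ys i = dual_scale (cs i / of_real (\<theta> i)) (b i)" for i
  have xsd: "xs i \<in> dual sX" and ysd: "ys i \<in> dual sY" for i
    unfolding xs_def ys_def by (intro dual_scale.subspace_scale[OF subspace_dual] dual_ball_dual ab)+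
  have \<theta>ne: "(of_real (\<theta> i) :: 'k) \<noteq> 0" for i using \<theta>(1)[of i] by simp
  have "norm (xs i) \<le> \<theta> i" for i
    unfolding xs_def norm_dual_scale norm_of_real using mult_left_mono[OF abn(1), of "\<theta> i" i] \<theta>(1)[of i] by simp
  then have xs0: "xs \<longlonglongrightarrow> 0" by (intro Lim_null_comparison[OF always_eventually \<theta>(2)]) blast
  have "norm (norm (ys i)) \<le> norm (cs i) / \<theta> i" for i
  proof -
    have "norm (ys i) = (norm (cs i) / \<theta> i) * norm (b i)"
      unfolding ys_def norm_dual_scale norm_divide norm_of_real using \<theta>(1)[of i] by simp
    also have "\<dots> \<le> (norm (cs i) / \<theta> i) * 1" using abn(2) \<theta>(1)[of i] by (intro mult_left_mono) auto
    finally show ?thesis by simp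
  qed
  then have yss: "summable (\<lambda>i. norm (ys i))" by (intro summable_comparison_test'[OF \<theta>(3), of 0]) blast
  have prod: "blinfun_apply (xs i) x * blinfun_apply (ys i) y = cs i * (fst (ks i) x * snd (ks i) y)" for i x y
    using \<theta>ne[of i] by (simp add: xs_def ys_def ab)
  have "(\<lambda>n. \<Sum>i<n. blinfun_apply (xs i) x * blinfun_apply (ys i) y) \<longlonglongrightarrow> 0" for x y
  proof -
    define w where "w = (\<lambda>k. tens sX UNIV sY UNIV x y (form k))"
    have "w \<in> W" unfolding w_def W_def using elementary_in_Vt by blast
    moreover have "w (ks i) = fst (ks i) x * snd (ks i) y" for i using form_B[OF ksB[of i]] by (simp add: w_def tens_def form_def)
    ultimately show ?thesis using null[of w] unfolding sums_def prod by simp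
  qed
  from tensor_series_null[OF ap xsd xs0 ysd yss this]
  have "(\<lambda>n. gauge_norm B \<tau> (\<Sum>i<n. tensor (xs i) (ys i))) \<longlonglongrightarrow> 0" .
  moreover have "tensor (xs i) (ys i) = tscale (cs i) (\<tau> (ks i))" for i
  proof -
    have "tensor (xs i) (ys i) = tscale (of_real (\<theta> i)) (tscale (cs i / of_real (\<theta> i)) (tensor (a i) (b i)))"
      unfolding xs_def ys_def
      using tensor_scale_left[OF dual_ball_dual[OF ab(1)] ysd[unfolded ys_def]] tensor_scale_right[OF dual_ball_dual[OF ab(1)] dual_ball_dual[OF ab(2)]]
      by simp
    also have "\<dots> = tscale (cs i) (tensor (a i) (b i))" using \<theta>ne[of i] by (simp add: tscale_def fun_eq_iff)
    finally show ?thesis by (simp add: \<tau>_def a_def b_def)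
  qed
  ultimately show ?thesis by (simp add: atom_sum_def)
qed

theorem proj_norm_attaining_dense:
  assumes ap: "approximation_property dual_scale (dual sX)"
    and no: "\<not> contains_copy_of_l1 (inj_tensor sX sY)"
  shows "norm_dense (proj_tensor dual_scale (dual sX) dual_scale (dual sY))
              (proj_norm_attaining dual_scale (dual sX) dual_scale (dual sY))"
proof -
  interpret D: duality B W \<tau> \<omega>
  proof
    show "compact B" "B \<noteq> {}" by (rule B_compact)+
    show "continuous_on B v" if "v \<in> W" for v using that Vt_continuous by (auto simp: W_def)
    show "(\<lambda>_. 0) \<in> W" unfolding W_def by (rule image_eqI[OF _ tscale.subspace_0[OF Vt_subspace]]) simp
    show "(\<lambda>k. v k + v' k) \<in> W" if v: "v \<in> W" "v' \<in> W" for v v'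
    proof -
      obtain t t' where t: "t \<in> Vt" "t' \<in> Vt" "v = (\<lambda>k. t (form k))" "v' = (\<lambda>k. t' (form k))" using v by (auto simp: W_def)
      show ?thesis unfolding W_def by (rule image_eqI[OF _ tscale.subspace_add[OF Vt_subspace t(1,2)]]) (simp add: t)
    qed
    show "(\<lambda>k. c * v k) \<in> W" if v: "v \<in> W" for v c
    proof -
      obtain t where t: "t \<in> Vt" "v = (\<lambda>k. t (form k))" using v by (auto simp: W_def)
      show ?thesis unfolding W_def by (rule image_eqI[OF _ tscale.subspace_scale[OF Vt_subspace t(1)]]) (simp add: t tscale_def)
    qed
    show "\<tau> k (\<omega> v) = v k" if "v \<in> W" "k \<in> B" for v k by (rule pairing[OF that])
    show "\<not> has_l1_sequence B W"
    proof
      assume "has_l1_sequence B W"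
      then have "contains_copy_of_l1 (completion tscale Vt (inj_norm sX sY))"
        unfolding W_def by (intro l1_sequence_imp_copy[OF B_compact Vt_subspace Vt_continuous inj_norm_eq])
      then show False using no by (simp add: inj_tensor_def)
    qed
    show "(\<lambda>n. gauge_norm B \<tau> (atom_sum \<tau> n cs ks)) \<longlonglongrightarrow> 0"
      if "range ks \<subseteq> B" "summable (\<lambda>i. norm (cs i))" "\<And>v. v \<in> W \<Longrightarrow> (\<lambda>i. cs i * v (ks i)) sums 0" for cs ks
      by (rule injective[OF ap that])
  qed
  have P: "proj_tensor dual_scale (dual sX) dual_scale (dual sY) = completion tscale (tspan (\<tau> ` B)) (gauge_norm B \<tau>)"
    by (simp add: proj_tensor_def tensor_product_eq proj_norm_eq)
  show ?thesis
    unfolding P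
  proof (rule D.norm_dense_completion)
    show "proj_norm_attaining dual_scale (dual sX) dual_scale (dual sY) \<subseteq> carrier (completion tscale (tspan (\<tau> ` B)) (gauge_norm B \<tau>))"
      by (auto simp: proj_norm_attaining_def P)
  next
    fix n c k assume k: "\<And>j. j < n \<Longrightarrow> k j \<in> B"
      and qa: "gauge_norm B \<tau> (atom_sum \<tau> n c k) = (\<Sum>j<n. norm (c j))"
    define w where "w = atom_sum \<tau> n c k"
    have wU: "w \<in> tspan (\<tau> ` B)" unfolding w_def by (rule atom_sum_in_span[OF k])
    \<comment> \<open>The finite atomic sum becomes an infinite representation: scalars go into the
      first factor and zeros are appended.\<close>
    define x where "x i = (if i < n then dual_scale (c i) (Blinfun (fst (k i))) else 0)" for i
    define y where "y i = (if i < n then Blinfun (snd (k i)) else 0)" for i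
    have b: "Blinfun (fst (k i)) \<in> dual_ball sX" "Blinfun (snd (k i)) \<in> dual_ball sY" if "i < n" for i
      using k[OF that] functional_ballE(1)[of "fst (k i)" sX] functional_ballE(1)[of "snd (k i)" sY]
      by (auto simp: B_def mem_Times_iff)
    have xd: "x i \<in> dual sX" for i
      using dual_scale.subspace_scale[OF subspace_dual dual_ball_dual[OF b(1)[of i]], of "c i"] dual_scale.subspace_0[OF subspace_dual, of sX]
      by (auto simp: x_def)
    have yd: "y i \<in> dual sY" for i
      using dual_ball_dual[OF b(2)[of i]] dual_scale.subspace_0[OF subspace_dual, of sY] by (auto simp: y_def)
    have sum_le: "(\<Sum>i<m. f i) = (\<Sum>i<n. f i)" if "m \<ge> n" "\<And>i. i \<ge> n \<Longrightarrow> f i = 0" for m and f :: "nat \<Rightarrow> 'b::comm_monoid_add"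
      using that by (intro sum.mono_neutral_right) auto
    have t_eq: "tensor (x i) (y i) = tscale (c i) (\<tau> (k i))" if "i < n" for i
      using that tensor_scale_left[OF dual_ball_dual[OF b(1)[OF that]] dual_ball_dual[OF b(2)[OF that]], of "c i"]
      by (simp add: x_def y_def \<tau>_def)
    have t_0: "tensor (x i) (y i) = 0" if "i \<ge> n" for i
    proof -
      have "x i = dual_scale 0 0" using that by (intro blinfun_eqI) (simp add: x_def)
      then have "tensor (x i) (y i) = tscale 0 (tensor 0 (y i))"
        using tensor_scale_left[OF dual_scale.subspace_0[OF subspace_dual] yd] by simp
      then show ?thesis by (simp add: tscale_def fun_eq_iff)
    qed
    have w_eq: "(\<Sum>i<m. tensor (x i) (y i)) = w" if "m \<ge> n" for m
    proof -
      have "(\<Sum>i<m. tensor (x i) (y i)) = (\<Sum>i<n. tensor (x i) (y i))" by (rule sum_le[OF that t_0])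
      also have "\<dots> = w" unfolding w_def atom_sum_def by (rule sum.cong) (auto simp: t_eq)
      finally show ?thesis .
    qed
    have nle: "norm (x i) * norm (y i) \<le> norm (c i)" if "i < n" for i
    proof -
      have "norm (Blinfun (fst (k i))) \<le> 1" "norm (Blinfun (snd (k i))) \<le> 1" using b[OF that] by (auto simp: dual_ball_def)
      then have "norm (c i) * norm (Blinfun (fst (k i))) * norm (Blinfun (snd (k i))) \<le> norm (c i) * 1 * 1"
        by (intro mult_mono) auto
      then show ?thesis using that by (simp add: x_def y_def norm_dual_scale)
    qed
    \<comment> \<open>Atoms may lie inside the unit balls, but the cost of the representation is
      squeezed between the norm and the sum of the \<open>norm (c i)\<close>, which are
      equal.\<close>
    have "gauge_norm B \<tau> w \<le> (\<Sum>i<n. norm (x i) * norm (y i))"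
    proof -
      have "gauge_norm B \<tau> w \<le> (\<Sum>i<n. gauge_norm B \<tau> (tensor (x i) (y i)))"
        unfolding w_eq[OF order_refl, symmetric] by (intro q.p_sum tensor_in_span xd yd)
      also have "\<dots> \<le> (\<Sum>i<n. norm (x i) * norm (y i))" by (intro sum_mono gauge_tensor_le xd yd)
      finally show ?thesis .
    qed
    moreover have "(\<Sum>i<n. norm (x i) * norm (y i)) \<le> (\<Sum>i<n. norm (c i))" by (rule sum_mono) (use nle in auto)
    ultimately have s: "(\<Sum>i<n. norm (x i) * norm (y i)) = gauge_norm B \<tau> w" using qa by (simp add: w_def)
    have "(\<lambda>i. norm (x i) * norm (y i)) sums (\<Sum>i<n. norm (x i) * norm (y i))"
      by (rule sums_finite) (auto simp: x_def)
    then have sums: "(\<lambda>i. norm (x i) * norm (y i)) sums vnorm (completion tscale (tspan (\<tau> ` B)) (gauge_norm B \<tau>)) (completion_embed (tspan (\<tau> ` B)) (gauge_norm B \<tau>) w)"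
      unfolding s q.vnorm_embed[OF wU] .
    have "\<forall>\<^sub>F m in sequentially. vdist (completion tscale (tspan (\<tau> ` B)) (gauge_norm B \<tau>)) (completion_embed (tspan (\<tau> ` B)) (gauge_norm B \<tau>) w)
        (completion_embed (tspan (\<tau> ` B)) (gauge_norm B \<tau>) (\<Sum>i<m. tensor (x i) (y i))) = 0"
      using eventually_ge_at_top[of n]
    proof eventually_elim
      case (elim m)
      show ?case unfolding w_eq[OF elim] q.vdist_embed[OF wU wU] by (simp only: diff_self q.p_zero)
    qed
    then have lim: "(\<lambda>m. vdist (completion tscale (tspan (\<tau> ` B)) (gauge_norm B \<tau>)) (completion_embed (tspan (\<tau> ` B)) (gauge_norm B \<tau>) w)
        (completion_embed (tspan (\<tau> ` B)) (gauge_norm B \<tau>) (\<Sum>i<m. tensor (x i) (y i)))) \<longlonglongrightarrow> 0"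
      by (rule tendsto_eventually)
    show "completion_embed (tspan (\<tau> ` B)) (gauge_norm B \<tau>) (atom_sum \<tau> n c k) \<in> proj_norm_attaining dual_scale (dual sX) dual_scale (dual sY)"
      unfolding proj_norm_attaining_def P tensor_product_eq proj_norm_eq w_def[symmetric]
      using q.completion_embed_carrier[OF wU] lim sums xd yd
      by (intro CollectI conjI exI[of _ x] exI[of _ y]) auto
  qed
qed

end

section \<open>Symmetric tensor powers\<close>

lemma
  assumes "multilinear_form N sE E A" "v \<in> {..<N} \<rightarrow>\<^sub>E E" "i < N" "x \<in> E"
  shows multilinear_add: "y \<in> E \<Longrightarrow> A (v(i := x + y)) = A (v(i := x)) + A (v(i := y))"
    and multilinear_scale: "A (v(i := sE c x)) = c * A (v(i := x))"
  using assms unfolding multilinear_form_def by auto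

lemma prod_fun_upd:
  fixes g :: "nat \<Rightarrow> 'x \<Rightarrow> 'b::comm_monoid_mult"
  assumes "i < N"
  shows "(\<Prod>j<N. g j ((u(i := x)) j)) = g i x * (\<Prod>j\<in>{..<N} - {i}. g j (u j))"
  using assms by (subst prod.remove[of _ i]) auto

lemma sum_PiE_insert:
  fixes f :: "('i \<Rightarrow> 'b) \<Rightarrow> 'c::comm_monoid_add"
  assumes "m \<notin> S"
  shows "(\<Sum>\<kappa>\<in>S \<rightarrow>\<^sub>E I. \<Sum>b\<in>I. f (\<kappa>(m := b))) = (\<Sum>\<kappa>\<in>insert m S \<rightarrow>\<^sub>E I. f \<kappa>)"
proof -
  have "(\<Sum>\<kappa>\<in>insert m S \<rightarrow>\<^sub>E I. f \<kappa>) = (\<Sum>(b, \<kappa>)\<in>I \<times> (S \<rightarrow>\<^sub>E I). f (\<kappa>(m := b)))"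
    unfolding PiE_insert_eq using inj_combinator[OF assms, of "\<lambda>_. I"]
    by (subst sum.reindex) (auto intro!: sum.cong)
  also have "\<dots> = (\<Sum>b\<in>I. \<Sum>\<kappa>\<in>S \<rightarrow>\<^sub>E I. f (\<kappa>(m := b)))" by (rule sum.cartesian_product[symmetric])
  also have "\<dots> = (\<Sum>\<kappa>\<in>S \<rightarrow>\<^sub>E I. \<Sum>b\<in>I. f (\<kappa>(m := b)))" by (rule sum.swap)
  finally show ?thesis by simp
qed

lemma multilinear_slot_sum:
  fixes sX :: "'k::real_or_complex \<Rightarrow> 'x::banach \<Rightarrow> 'x"
  assumes A: "multilinear_form N dual_scale (dual sX) A" and v: "v \<in> {..<N} \<rightarrow>\<^sub>E dual sX" and i: "i < N"
    and "finite I" "\<And>b. b \<in> I \<Longrightarrow> e b \<in> dual sX"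
  shows "A (v(i := \<Sum>b\<in>I. dual_scale (\<phi> b) (e b))) = (\<Sum>b\<in>I. \<phi> b * A (v(i := e b)))"
  using assms(4,5)
proof (induction I rule: finite_induct)
  case empty
  have "A (v(i := dual_scale 0 0)) = 0 * A (v(i := 0))"
    by (rule multilinear_scale[OF A v i dual_scale.subspace_0[OF subspace_dual]])
  then show ?case by (simp only: dual_scale.scale_zero_left mult_zero_left sum.empty)
next
  case (insert b I)
  have 1: "dual_scale (\<phi> b) (e b) \<in> dual sX" using insert.prems by (intro dual_scale.subspace_scale[OF subspace_dual]) auto
  have 2: "(\<Sum>b\<in>I. dual_scale (\<phi> b) (e b)) \<in> dual sX"
    using insert.prems by (intro dual_scale.subspace_sum[OF subspace_dual] dual_scale.subspace_scale[OF subspace_dual]) auto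
  have 3: "e b \<in> dual sX" using insert.prems by simp
  have "A (v(i := \<Sum>b\<in>insert b I. dual_scale (\<phi> b) (e b))) = A (v(i := dual_scale (\<phi> b) (e b) + (\<Sum>b\<in>I. dual_scale (\<phi> b) (e b))))"
    by (simp only: sum.insert[OF insert.hyps])
  also have "\<dots> = A (v(i := dual_scale (\<phi> b) (e b))) + A (v(i := \<Sum>b\<in>I. dual_scale (\<phi> b) (e b)))"
    by (rule multilinear_add[OF A v i 1 2])
  also have "\<dots> = \<phi> b * A (v(i := e b)) + (\<Sum>b\<in>I. \<phi> b * A (v(i := e b)))"
    using insert.IH insert.prems by (simp only: multilinear_scale[OF A v i 3] insert_iff simp_thms)
  finally show ?case by (simp only: sum.insert[OF insert.hyps])
qed

text \<open>The slots are expanded one at a time: after \<open>m\<close> steps the slots below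
  \<open>m\<close> hold basis vectors and the others still hold \<open>y\<close>. The index
  \<open>\<kappa>\<close> records the choices made.\<close>

lemma multilinear_expansion:
  fixes sX :: "'k::real_or_complex \<Rightarrow> 'x::banach \<Rightarrow> 'x"
  assumes A: "multilinear_form N dual_scale (dual sX) A" and I: "finite I" "\<And>b. b \<in> I \<Longrightarrow> e b \<in> dual sX"
    and y: "y = (\<Sum>b\<in>I. dual_scale (\<phi> b) (e b))"
  shows "A (\<lambda>i\<in>{..<N}. y) = (\<Sum>\<kappa>\<in>{..<N} \<rightarrow>\<^sub>E I. (\<Prod>i<N. \<phi> (\<kappa> i)) * A (\<lambda>i\<in>{..<N}. e (\<kappa> i)))"
proof -
  have yE: "y \<in> dual sX"
    unfolding y using I by (intro dual_scale.subspace_sum[OF subspace_dual] dual_scale.subspace_scale[OF subspace_dual]) auto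
  have "A (\<lambda>i\<in>{..<N}. y) = (\<Sum>\<kappa>\<in>{..<m} \<rightarrow>\<^sub>E I. (\<Prod>i<m. \<phi> (\<kappa> i)) * A (\<lambda>i\<in>{..<N}. if i < m then e (\<kappa> i) else y))"
    if "m \<le> N" for m
    using that
  proof (induction m)
    case 0
    show ?case by (simp add: PiE_empty_domain)
  next
    case (Suc m)
    then have m: "m < N" by simp
    define f where "f \<kappa> = (\<Prod>i<Suc m. \<phi> (\<kappa> i)) * A (\<lambda>i\<in>{..<N}. if i < Suc m then e (\<kappa> i) else y)" for \<kappa>
    have step: "(\<Prod>i<m. \<phi> (\<kappa> i)) * A (\<lambda>i\<in>{..<N}. if i < m then e (\<kappa> i) else y) = (\<Sum>b\<in>I. f (\<kappa>(m := b)))"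
      if \<kappa>: "\<kappa> \<in> {..<m} \<rightarrow>\<^sub>E I" for \<kappa>
    proof -
      define v where "v = (\<lambda>i\<in>{..<N}. if i < m then e (\<kappa> i) else y)"
      have \<kappa>I: "\<kappa> i \<in> I" if "i < m" for i using PiE_mem[OF \<kappa>] that by simp
      have v: "v \<in> {..<N} \<rightarrow>\<^sub>E dual sX" unfolding v_def using I(2) \<kappa>I yE by auto
      have vm: "v = v(m := y)" using m by (auto simp: v_def fun_eq_iff)
      have "A v = A (v(m := \<Sum>b\<in>I. dual_scale (\<phi> b) (e b)))" using vm y by simp
      also have "\<dots> = (\<Sum>b\<in>I. \<phi> b * A (v(m := e b)))" by (rule multilinear_slot_sum[OF A v m I])
      finally have Av: "A v = (\<Sum>b\<in>I. \<phi> b * A (v(m := e b)))" .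
      have upd: "v(m := e b) = (\<lambda>i\<in>{..<N}. if i < Suc m then e ((\<kappa>(m := b)) i) else y)" for b
        using m by (auto simp: v_def fun_eq_iff less_Suc_eq)
      have pr: "(\<Prod>i<Suc m. \<phi> ((\<kappa>(m := b)) i)) = (\<Prod>i<m. \<phi> (\<kappa> i)) * \<phi> b" for b
        by simp
      show ?thesis unfolding v_def[symmetric] Av f_def pr upd[symmetric] by (simp add: sum_distrib_left mult.assoc)
    qed
    have "A (\<lambda>i\<in>{..<N}. y) = (\<Sum>\<kappa>\<in>{..<m} \<rightarrow>\<^sub>E I. \<Sum>b\<in>I. f (\<kappa>(m := b)))"
      unfolding Suc.IH[OF less_imp_le[OF m]] by (rule sum.cong[OF refl step])
    also have "\<dots> = (\<Sum>\<kappa>\<in>insert m {..<m} \<rightarrow>\<^sub>E I. f \<kappa>)" by (rule sum_PiE_insert) simp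
    finally show ?case unfolding f_def lessThan_Suc[symmetric] .
  qed
  from this[of N] have "A (\<lambda>i\<in>{..<N}. y) = (\<Sum>\<kappa>\<in>{..<N} \<rightarrow>\<^sub>E I. (\<Prod>i<N. \<phi> (\<kappa> i)) * A (\<lambda>i\<in>{..<N}. if i < N then e (\<kappa> i) else y))" by simp
  moreover have "(\<lambda>i\<in>{..<N}. if i < N then e (\<kappa> i) else y) = (\<lambda>i\<in>{..<N}. e (\<kappa> i))" for \<kappa> by (auto simp: fun_eq_iff)
  ultimately show ?thesis by simp
qed

locale sym_tensor =
  fixes sX :: "'k::real_or_complex \<Rightarrow> 'x::banach \<Rightarrow> 'x" and N :: nat
  assumes X: "banach_over sX"
begin

abbreviation "E \<equiv> dual sX"

definition B :: "('x \<Rightarrow> 'k) set" where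
  "B = functional_ball sX"

definition form :: "('x \<Rightarrow> 'k) \<Rightarrow> (nat \<Rightarrow> 'x) \<Rightarrow> 'k" where
  "form k = (\<lambda>u. \<Prod>i<N. k (u i))"

definition product_form :: "(nat \<Rightarrow> 'x \<Rightarrow>\<^sub>L 'k) \<Rightarrow> (nat \<Rightarrow> 'x) \<Rightarrow> 'k" where
  "product_form \<xi> = (\<lambda>u. \<Prod>i<N. blinfun_apply (\<xi> i) (u i))"

abbreviation "Vt \<equiv> sym_tensor_product N sX UNIV"
abbreviation "pow \<equiv> tens_power N dual_scale E"

definition \<tau> :: "('x \<Rightarrow> 'k) \<Rightarrow> ((nat \<Rightarrow> 'x \<Rightarrow>\<^sub>L 'k) \<Rightarrow> 'k) \<Rightarrow> 'k" where
  "\<tau> k = pow (Blinfun k)"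

lemma B_compact: "compact B" "B \<noteq> {}"
  unfolding B_def using compact_functional_ball[OF X] functional_ball_nonempty[of sX] by auto

lemma product_form_multilinear:
  assumes "\<And>i. i < N \<Longrightarrow> \<xi> i \<in> E" shows "multilinear_form N sX UNIV (product_form \<xi>)"
  unfolding multilinear_form_def product_form_def
proof (intro ballI allI impI conjI)
  fix v i assume i: "i < N"
  fix x y :: 'x
  show "(\<Prod>j<N. blinfun_apply (\<xi> j) ((v(i := x + y)) j)) =
      (\<Prod>j<N. blinfun_apply (\<xi> j) ((v(i := x)) j)) + (\<Prod>j<N. blinfun_apply (\<xi> j) ((v(i := y)) j))"
    unfolding prod_fun_upd[OF i, of "\<lambda>j. blinfun_apply (\<xi> j)"] by (simp add: blinfun.add_right distrib_right)
next
  fix v i assume i: "i < N"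
  fix c and x :: 'x
  show "(\<Prod>j<N. blinfun_apply (\<xi> j) ((v(i := sX c x)) j)) = c * (\<Prod>j<N. blinfun_apply (\<xi> j) ((v(i := x)) j))"
    unfolding prod_fun_upd[OF i, of "\<lambda>j. blinfun_apply (\<xi> j)"] using assms[OF i] by (simp add: dual_def mult.assoc)
qed

lemma form_eq: "k \<in> B \<Longrightarrow> form k = product_form (\<lambda>_. Blinfun k)"
  using functional_ballE(2)[of k sX] by (simp add: B_def form_def product_form_def)

lemma form_multilinear: "k \<in> B \<Longrightarrow> multilinear_form N sX UNIV (form k)"
  using form_eq product_form_multilinear[of "\<lambda>_. Blinfun k"] dual_ball_dual[OF functional_ballE(1)[of k sX]]
  by (simp add: B_def)

lemma Vt_linear:
  assumes v: "v \<in> Vt" and A: "multilinear_form N sX UNIV A" and A': "multilinear_form N sX UNIV A'"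
  shows "v (\<lambda>u. A u + A' u) = v A + v A'" "v (\<lambda>u. c * A u) = c * v A"
proof -
  have s: "multilinear_form N sX UNIV (\<lambda>u. A u + A' u)" "multilinear_form N sX UNIV (\<lambda>u. c * A u)"
    using A A' by (simp_all add: multilinear_form_def algebra_simps)
  from v have "v (\<lambda>u. A u + A' u) = v A + v A' \<and> v (\<lambda>u. c * A u) = c * v A"
    unfolding sym_tensor_product_def
  proof (induction rule: tscale.span_induct_alt)
    case (step d t v)
    then obtain x where t: "t = tens_power N sX UNIV x" by blast
    show ?case using step.IH by (simp add: t tens_power_def tscale_def A A' s algebra_simps)
  qed simp
  then show "v (\<lambda>u. A u + A' u) = v A + v A'" "v (\<lambda>u. c * A u) = c * v A" by auto
qed

lemma Vt_subspace: "module.subspace tscale Vt"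
  unfolding sym_tensor_product_def by (rule tscale.subspace_span)

lemma elementary_in_Vt: "tens_power N sX UNIV x \<in> Vt"
  unfolding sym_tensor_product_def by (rule tscale.span_base) blast

lemma elementary_form: "k \<in> B \<Longrightarrow> tens_power N sX UNIV x (form k) = k x ^ N"
  using form_multilinear by (simp add: tens_power_def form_def)

lemma Vt_continuous: "v \<in> Vt \<Longrightarrow> continuous_on B (\<lambda>k. v (form k))"
  unfolding sym_tensor_product_def
proof (induction rule: tscale.span_induct_alt)
  case (step d t v)
  then obtain x where t: "t = tens_power N sX UNIV x" by blast
  have c1: "continuous_on B (\<lambda>k :: 'x \<Rightarrow> 'k. k x)"
    by (rule continuous_on_subset[OF continuous_on_product_coordinates]) simp
  have "continuous_on B (\<lambda>k. d * k x ^ N + v (form k))"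
    by (intro continuous_on_add continuous_on_mult continuous_on_const continuous_on_power c1 step.IH)
  moreover have "d * k x ^ N + v (form k) = (tscale d t + v) (form k)" if "k \<in> B" for k
    using elementary_form[OF that] by (simp add: t tscale_def)
  ultimately show ?case by (subst continuous_on_cong[OF refl, of _ _ "\<lambda>k. d * k x ^ N + v (form k)"]) auto
qed simp

lemma inj_norm_eq: "sym_inj_norm N sX v = wnorm B (\<lambda>k. v (form k))"
proof -
  have "{norm (v (\<lambda>u. \<Prod>i<N. blinfun_apply f (u i))) |f. f \<in> dual_ball sX} = (\<lambda>k. norm (v (form k))) ` B"
    by (auto simp: B_def functional_ball_def form_def)
  then show ?thesis by (simp add: sym_inj_norm_def wnorm_def)
qed

text \<open>The elementary tensor of the vectors \<open>e (\<kappa> i)\<close>. It is not symmetric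
  in general, so it may lie outside the space on which the symmetric norm is defined.\<close>

definition basis_tensor :: "('i \<Rightarrow> 'x \<Rightarrow>\<^sub>L 'k) \<Rightarrow> (nat \<Rightarrow> 'i) \<Rightarrow> ((nat \<Rightarrow> 'x \<Rightarrow>\<^sub>L 'k) \<Rightarrow> 'k) \<Rightarrow> 'k" where
  "basis_tensor e \<kappa> = (\<lambda>A. if multilinear_form N dual_scale E A then A (\<lambda>i\<in>{..<N}. e (\<kappa> i)) else 0)"

lemma pow_expansion:
  assumes "finite I" "\<And>b. b \<in> I \<Longrightarrow> e b \<in> E" "y = (\<Sum>b\<in>I. dual_scale (\<phi> b) (e b))"
  shows "pow y = (\<Sum>\<kappa>\<in>{..<N} \<rightarrow>\<^sub>E I. tscale (\<Prod>i<N. \<phi> (\<kappa> i)) (basis_tensor e \<kappa>))"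
proof
  fix A
  show "pow y A = (\<Sum>\<kappa>\<in>{..<N} \<rightarrow>\<^sub>E I. tscale (\<Prod>i<N. \<phi> (\<kappa> i)) (basis_tensor e \<kappa>)) A"
    using multilinear_expansion[of N sX A I e y \<phi>] assms
    by (cases "multilinear_form N dual_scale E A") (simp_all add: tens_power_def basis_tensor_def fun_sum_apply tscale_def)
qed

text \<open>The multinomial expansion over an index set with one element.\<close>

lemma pow_scale:
  assumes x: "x \<in> E" shows "pow (dual_scale c x) = tscale (c ^ N) (pow x)"
proof -
  have P: "{..<N} \<rightarrow>\<^sub>E {()} = {\<lambda>i\<in>{..<N}. ()}" by (auto simp: PiE_iff extensional_def fun_eq_iff)
  have 1: "pow (dual_scale c x) = (\<Sum>\<kappa>\<in>{..<N} \<rightarrow>\<^sub>E {()}. tscale (\<Prod>i<N. c) (basis_tensor (\<lambda>_. x) \<kappa>))"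
    by (rule pow_expansion) (use x in auto)
  have "basis_tensor (\<lambda>_. x) \<kappa> = pow x" for \<kappa> :: "nat \<Rightarrow> unit" by (simp add: basis_tensor_def tens_power_def)
  then show ?thesis unfolding 1 P by simp
qed

lemma pow_normalize:
  assumes "x \<in> E" shows "pow x = tscale (of_real (norm x) ^ N) (\<tau> (blinfun_apply (normalize_dual x)))"
proof -
  have "pow x = pow (dual_scale (of_real (norm x)) (normalize_dual x))" using normalize_dual(2)[OF assms] by simp
  also have "\<dots> = tscale (of_real (norm x) ^ N) (pow (normalize_dual x))"
    by (rule pow_scale[OF dual_ball_dual[OF normalize_dual(1)[OF assms]]])
  finally show ?thesis by (simp add: \<tau>_def blinfun_apply_inverse)
qed

lemma normalize_in_B: "x \<in> E \<Longrightarrow> blinfun_apply (normalize_dual x) \<in> B"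
  unfolding B_def functional_ball_def by (intro imageI normalize_dual)

lemma pow_in_span: "x \<in> E \<Longrightarrow> pow x \<in> tspan (\<tau> ` B)"
  by (simp add: pow_normalize normalize_in_B tscale.span_scale tscale.span_base)

lemma sym_tensor_product_eq: "sym_tensor_product N dual_scale E = tspan (\<tau> ` B)"
  unfolding sym_tensor_product_def
proof (rule tscale.span_eq[THEN iffD2], intro conjI subsetI)
  fix t assume "t \<in> pow ` E"
  then show "t \<in> tspan (\<tau> ` B)" using pow_in_span by blast
next
  fix t assume "t \<in> \<tau> ` B"
  then obtain k where k: "k \<in> B" "t = pow (Blinfun k)" by (auto simp: \<tau>_def)
  have "Blinfun k \<in> E" using k(1) dual_ball_dual[OF functional_ballE(1)[of k sX]] by (simp add: B_def)
  then show "t \<in> tspan (pow ` E)" unfolding k(2) by (intro tscale.span_base imageI)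
qed

sublocale q: seminormed tscale "tspan (\<tau> ` B)" "gauge_norm B \<tau>"
  by (rule seminormed_gauge)

lemma gauge_pow_le:
  assumes "x \<in> E" shows "gauge_norm B \<tau> (pow x) \<le> norm x ^ N"
proof -
  let ?k = "blinfun_apply (normalize_dual x)"
  have "pow x = atom_sum \<tau> 1 (\<lambda>_. of_real (norm x) ^ N) (\<lambda>_. ?k)" using pow_normalize[OF assms] by (simp add: atom_sum_def)
  then show ?thesis using gauge_norm_le[of 1 "\<lambda>_. ?k" B \<tau> "\<lambda>_. of_real (norm x) ^ N"] normalize_in_B[OF assms] by (simp add: norm_power)
qed

lemma proj_norm_eq: "sym_proj_norm N dual_scale E = gauge_norm B \<tau>"
proof
  fix u
  show "sym_proj_norm N dual_scale E u = gauge_norm B \<tau> u"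
    unfolding sym_proj_norm_def gauge_norm_def
  proof (rule Inf_eq_dominated)
    show "{(\<Sum>j<n. norm (c j) * norm (x j) ^ N) |n c x. (\<forall>j<n. x j \<in> E) \<and> u = (\<Sum>j<n::nat. tscale (c j) (pow (x j)))}
      \<subseteq> {(\<Sum>j<n. norm (c j)) |n c k. (\<forall>j<n. k j \<in> B) \<and> u = atom_sum \<tau> n c k}"
    proof
      fix a assume "a \<in> {(\<Sum>j<n. norm (c j) * norm (x j) ^ N) |n c x. (\<forall>j<n. x j \<in> E) \<and> u = (\<Sum>j<n::nat. tscale (c j) (pow (x j)))}"
      then obtain n c x where "a = (\<Sum>j<n. norm (c j) * norm (x j) ^ N) \<and> (\<forall>j<n. x j \<in> E) \<and> u = (\<Sum>j<n::nat. tscale (c j) (pow (x j)))"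
        by (elim CollectE exE) (rule that, assumption)
      then have a: "a = (\<Sum>j<n. norm (c j) * norm (x j) ^ N)" "\<forall>j<n. x j \<in> E" "u = (\<Sum>j<n. tscale (c j) (pow (x j)))" by simp_all
      define d where "d j = c j * of_real (norm (x j)) ^ N" for j
      define k where "k j = blinfun_apply (normalize_dual (x j))" for j
      have "a = (\<Sum>j<n. norm (d j))" unfolding a(1) d_def by (rule sum.cong) (simp_all add: norm_mult norm_power)
      moreover have "\<forall>j<n. k j \<in> B" using a(2) normalize_in_B by (simp add: k_def)
      moreover have "u = atom_sum \<tau> n d k"
        unfolding a(3) atom_sum_def
      proof (rule sum.cong[OF refl])
        fix j assume "j \<in> {..<n}"
        then have "pow (x j) = tscale (of_real (norm (x j)) ^ N) (\<tau> (k j))" using a(2) pow_normalize by (simp add: k_def)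
        then show "tscale (c j) (pow (x j)) = tscale (d j) (\<tau> (k j))" by (simp add: d_def tscale_def mult.assoc)
      qed
      ultimately show "a \<in> {(\<Sum>j<n. norm (c j)) |n c k. (\<forall>j<n. k j \<in> B) \<and> u = atom_sum \<tau> n c k}"
        by (intro CollectI exI[of _ n] exI[of _ d] exI[of _ k]) simp
    qed
  next
    fix a' assume "a' \<in> {(\<Sum>j<n. norm (c j)) |n c k. (\<forall>j<n. k j \<in> B) \<and> u = atom_sum \<tau> n c k}"
    then obtain n c k where "a' = (\<Sum>j<n. norm (c j)) \<and> (\<forall>j<n. k j \<in> B) \<and> u = atom_sum \<tau> n c k"
      by (elim CollectE exE) (rule that, assumption)
    then have a': "a' = (\<Sum>j<n. norm (c j))" "\<forall>j<n. k j \<in> B" "u = atom_sum \<tau> n c k" by simp_all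
    define x where "x j = Blinfun (k j)" for j
    have b: "x j \<in> dual_ball sX" if "j < n" for j
      using a'(2) that functional_ballE(1)[of "k j" sX] by (auto simp: B_def x_def)
    have "(\<Sum>j<n. norm (c j) * norm (x j) ^ N) \<le> a'"
      unfolding a'(1)
    proof (rule sum_mono)
      fix j assume "j \<in> {..<n}"
      then have "norm (x j) ^ N \<le> 1" using b by (intro power_le_one) (auto simp: dual_ball_def)
      then show "norm (c j) * norm (x j) ^ N \<le> norm (c j)" by (simp add: mult_left_le)
    qed
    moreover have "u = (\<Sum>j<n. tscale (c j) (pow (x j)))" by (simp add: a'(3) atom_sum_def \<tau>_def x_def)
    ultimately show "\<exists>a\<in>{(\<Sum>j<n. norm (c j) * norm (x j) ^ N) |n c x. (\<forall>j<n. x j \<in> E) \<and> u = (\<Sum>j<n::nat. tscale (c j) (pow (x j)))}. a \<le> a'"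
      using dual_ball_dual[OF b]
      by (intro bexI[of _ "\<Sum>j<n. norm (c j) * norm (x j) ^ N"] CollectI exI[of _ n] exI[of _ c] exI[of _ x]) simp_all
  qed (auto intro!: sum_nonneg)
qed

definition preimage :: "(('x \<Rightarrow> 'k) \<Rightarrow> 'k) \<Rightarrow> ((nat \<Rightarrow> 'x) \<Rightarrow> 'k) \<Rightarrow> 'k" where
  "preimage w = (SOME v. v \<in> Vt \<and> w = (\<lambda>k. v (form k)))"

definition W where "W = (\<lambda>v k. v (form k)) ` Vt"

definition \<omega> :: "(('x \<Rightarrow> 'k) \<Rightarrow> 'k) \<Rightarrow> (nat \<Rightarrow> 'x \<Rightarrow>\<^sub>L 'k) \<Rightarrow> 'k" where
  "\<omega> w = (\<lambda>\<xi>. preimage w (product_form \<xi>))"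

lemma preimage:
  assumes "w \<in> W" shows "preimage w \<in> Vt" "preimage w (form k) = w k"
proof -
  have "\<exists>v. v \<in> Vt \<and> w = (\<lambda>k. v (form k))" using assms unfolding W_def by blast
  from someI_ex[OF this] have 1: "preimage w \<in> Vt" and 2: "w = (\<lambda>k. preimage w (form k))" unfolding preimage_def[symmetric] by blast+
  show "preimage w \<in> Vt" by (rule 1)
  show "preimage w (form k) = w k" using fun_cong[OF 2, of k] by simp
qed

lemma pairing:
  assumes w: "w \<in> W" and k: "k \<in> B" shows "\<tau> k (\<omega> w) = w k"
proof -
  have ml: "multilinear_form N dual_scale E (\<omega> w)"
    unfolding multilinear_form_def
  proof (intro ballI allI impI conjI)
    fix v i and f g assume v: "v \<in> {..<N} \<rightarrow>\<^sub>E E" and i: "i < N" and f: "f \<in> E" and g: "g \<in> E"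
    have m: "multilinear_form N sX UNIV (product_form (v(i := h)))" if "h \<in> E" for h
      by (rule product_form_multilinear) (use v that in auto)
    have "product_form (v(i := f + g)) = (\<lambda>u. product_form (v(i := f)) u + product_form (v(i := g)) u)"
    proof
      fix u
      have "(\<Prod>j<N. blinfun_apply ((v(i := h)) j) (u j)) = blinfun_apply h (u i) * (\<Prod>j\<in>{..<N} - {i}. blinfun_apply (v j) (u j))" for h
        using i by (subst prod.remove[of _ i]) auto
      then show "product_form (v(i := f + g)) u = product_form (v(i := f)) u + product_form (v(i := g)) u"
        by (simp only: product_form_def blinfun.add_left distrib_right)
    qed
    then show "\<omega> w (v(i := f + g)) = \<omega> w (v(i := f)) + \<omega> w (v(i := g))"
      using Vt_linear(1)[OF preimage(1)[OF w] m[OF f] m[OF g]] by (simp add: \<omega>_def)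
  next
    fix v i c and f assume v: "v \<in> {..<N} \<rightarrow>\<^sub>E E" and i: "i < N" and f: "f \<in> E"
    have m: "multilinear_form N sX UNIV (product_form (v(i := f)))"
      by (rule product_form_multilinear) (use v f in auto)
    have "product_form (v(i := dual_scale c f)) = (\<lambda>u. c * product_form (v(i := f)) u)"
    proof
      fix u
      have "(\<Prod>j<N. blinfun_apply ((v(i := h)) j) (u j)) = blinfun_apply h (u i) * (\<Prod>j\<in>{..<N} - {i}. blinfun_apply (v j) (u j))" for h
        using i by (subst prod.remove[of _ i]) auto
      then show "product_form (v(i := dual_scale c f)) u = c * product_form (v(i := f)) u"
        by (simp only: product_form_def dual_scale_apply mult.assoc)
    qed
    then show "\<omega> w (v(i := dual_scale c f)) = c * \<omega> w (v(i := f))"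
      using Vt_linear(2)[OF preimage(1)[OF w] m m] by (simp add: \<omega>_def)
  qed
  \<comment> \<open>The restricted tuple is undefined from \<open>N\<close> on, but the product only
    reads the slots below \<open>N\<close>.\<close>
  have "product_form (\<lambda>i\<in>{..<N}. Blinfun k) = form k"
    unfolding form_eq[OF k] product_form_def by (intro ext prod.cong) auto
  then have "\<tau> k (\<omega> w) = preimage w (form k)" using ml by (simp add: \<tau>_def tens_power_def \<omega>_def)
  then show ?thesis using preimage(2)[OF w] by simp
qed

end

section \<open>Polarization of vanishing power series\<close>

definition bounded_functional :: "('x::banach \<Rightarrow>\<^sub>L 'k::real_or_complex) set \<Rightarrow> (('x \<Rightarrow>\<^sub>L 'k) \<Rightarrow> 'k) \<Rightarrow> bool" where
  "bounded_functional E \<psi> \<longleftrightarrow> (\<forall>x\<in>E. \<forall>y\<in>E. \<psi> (x + y) = \<psi> x + \<psi> y) \<and>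
     (\<forall>c. \<forall>x\<in>E. \<psi> (dual_scale c x) = c * \<psi> x) \<and> (\<exists>C\<ge>0. \<forall>x\<in>E. norm (\<psi> x) \<le> C * norm x)"

lemma bounded_functionalD:
  assumes "bounded_functional E \<psi>"
  shows "x \<in> E \<Longrightarrow> y \<in> E \<Longrightarrow> \<psi> (x + y) = \<psi> x + \<psi> y" "x \<in> E \<Longrightarrow> \<psi> (dual_scale c x) = c * \<psi> x"
    "\<exists>C\<ge>0. \<forall>x\<in>E. norm (\<psi> x) \<le> C * norm x"
  using assms by (simp_all add: bounded_functional_def)

text \<open>A bounded functional on the dual space passes through partial sums that converge in
  norm. It may lie outside the image of the predual, so pointwise convergence would not
  suffice.\<close>

lemma bounded_functional_series:
  fixes sX :: "'k::real_or_complex \<Rightarrow> 'x::banach \<Rightarrow> 'x" and g :: "nat \<Rightarrow> 'k"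
  assumes \<psi>: "bounded_functional (dual sX) \<psi>" and xs: "\<And>j. xs j \<in> dual sX"
    and null: "(\<lambda>n. \<Sum>j<n. dual_scale (g j) (xs j)) \<longlonglongrightarrow> 0"
  shows "(\<lambda>j. g j * \<psi> (xs j)) sums 0"
proof -
  note add = bounded_functionalD(1)[OF \<psi>] and scale = bounded_functionalD(2)[OF \<psi>]
  obtain C where C: "C \<ge> 0" "\<And>x. x \<in> dual sX \<Longrightarrow> norm (\<psi> x) \<le> C * norm x" using bounded_functionalD(3)[OF \<psi>] by blast
  define G where "G n = (\<Sum>j<n. dual_scale (g j) (xs j))" for n
  have Gd: "G n \<in> dual sX" for n unfolding G_def
    by (intro dual_scale.subspace_sum[OF subspace_dual] dual_scale.subspace_scale[OF subspace_dual] xs)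
  have \<psi>G: "\<psi> (G n) = (\<Sum>j<n. g j * \<psi> (xs j))" for n
  proof (induction n)
    case 0
    have "\<psi> (dual_scale 0 (xs 0)) = 0" using scale[OF xs, of 0 0] by simp
    then show ?case by (simp add: G_def)
  next
    case (Suc n)
    have "\<psi> (G (Suc n)) = \<psi> (G n + dual_scale (g n) (xs n))" by (simp add: G_def)
    also have "\<dots> = \<psi> (G n) + g n * \<psi> (xs n)"
      by (simp only: add[OF Gd dual_scale.subspace_scale[OF subspace_dual xs]] scale[OF xs])
    finally show ?case using Suc by simp
  qed
  have "(\<lambda>n. C * norm (G n)) \<longlonglongrightarrow> C * norm (0 :: 'x \<Rightarrow>\<^sub>L 'k)" unfolding G_def by (intro tendsto_intros null)
  then have lim: "(\<lambda>n. C * norm (G n)) \<longlonglongrightarrow> 0" by simp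
  have "(\<lambda>n. \<psi> (G n)) \<longlonglongrightarrow> 0" by (rule Lim_null_comparison[OF always_eventually lim]) (use C(2)[OF Gd] in blast)
  then show ?thesis unfolding sums_def \<psi>G .
qed

text \<open>Polarization by differentiation: the coefficient of \<open>t\<close> in the polynomial
  \<open>t \<mapsto> \<Sum>\<^sub>j u\<^sub>j (x\<^sub>j(a) + t x\<^sub>j(b))\<^sup>p\<close> vanishes.\<close>

lemma power_series_derivative:
  fixes u :: "nat \<Rightarrow> 'k::real_or_complex" and \<alpha> \<beta> :: "nat \<Rightarrow> 'k"
  assumes u: "summable (\<lambda>j. norm (u j))" and b: "\<And>j. norm (\<alpha> j) \<le> M" "\<And>j. norm (\<beta> j) \<le> M"
    and null: "\<And>t. (\<lambda>j. u j * (\<alpha> j + t * \<beta> j) ^ Suc p) sums 0"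
  shows "(\<lambda>j. u j * (\<beta> j * \<alpha> j ^ p)) sums 0"
proof -
  have M: "M \<ge> 0" using order_trans[OF norm_ge_zero b(1)] .
  \<comment> \<open>The coefficient of \<open>t ^ r\<close> in the term with index \<open>j\<close>,
    by the binomial theorem. Interchanging the finite sum over \<open>r\<close> with the series
    leaves a polynomial in \<open>t\<close>.\<close>
  define h where "h r j = u j * (of_nat (Suc p choose r) * \<beta> j ^ r * \<alpha> j ^ (Suc p - r))" for r j
  have sm: "summable (h r)" for r
  proof -
    have "norm (h r j) \<le> real (Suc p choose r) * M ^ r * M ^ (Suc p - r) * norm (u j)" for j
    proof -
      have "norm (\<beta> j) ^ r * norm (\<alpha> j) ^ (Suc p - r) \<le> M ^ r * M ^ (Suc p - r)"
        by (intro mult_mono power_mono b) (use M in auto)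
      then have "norm (u j) * (real (Suc p choose r) * (norm (\<beta> j) ^ r * norm (\<alpha> j) ^ (Suc p - r)))
          \<le> norm (u j) * (real (Suc p choose r) * (M ^ r * M ^ (Suc p - r)))"
        by (intro mult_left_mono) auto
      then show ?thesis by (simp add: h_def norm_mult norm_power mult_ac)
    qed
    then show ?thesis by (intro summable_comparison_test'[OF summable_mult[OF u], of 0]) blast
  qed
  define c where "c r = suminf (h r)" for r
  have "(\<Sum>r\<le>Suc p. c r * t ^ r) = 0" for t
  proof -
    have "(\<lambda>j. \<Sum>r\<le>Suc p. h r j * t ^ r) sums (\<Sum>r\<le>Suc p. c r * t ^ r)"
      unfolding c_def by (intro sums_sum sums_mult2 summable_sums sm)
    moreover have "(\<Sum>r\<le>Suc p. h r j * t ^ r) = u j * (\<alpha> j + t * \<beta> j) ^ Suc p" for j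
    proof -
      have "(\<alpha> j + t * \<beta> j) ^ Suc p = (t * \<beta> j + \<alpha> j) ^ Suc p" by (simp only: add.commute)
      also have "\<dots> = (\<Sum>r\<le>Suc p. of_nat (Suc p choose r) * (t * \<beta> j) ^ r * \<alpha> j ^ (Suc p - r))" by (rule binomial_ring)
      finally have 1: "u j * (\<alpha> j + t * \<beta> j) ^ Suc p
          = (\<Sum>r\<le>Suc p. u j * (of_nat (Suc p choose r) * (t * \<beta> j) ^ r * \<alpha> j ^ (Suc p - r)))"
        by (simp only: sum_distrib_left)
      show ?thesis unfolding 1 h_def by (rule sum.cong[OF refl]) (simp only: power_mult_distrib mult_ac)
    qed
    ultimately show ?thesis using sums_unique2[OF _ null[of t]] by simp
  qed
  \<comment> \<open>A polynomial that vanishes on the whole infinite field has zero coefficients.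
    The linear one carries the factor \<open>Suc p\<close>, which is invertible.\<close>
  then have "\<forall>r\<le>Suc p. c r = 0" using polyfun_eq_0[of c "Suc p"] by blast
  then have "c 1 = 0" by simp
  then have "h 1 sums 0" using summable_sums[OF sm, of 1] by (simp add: c_def)
  then have "(\<lambda>j. inverse (of_nat (Suc p)) * h 1 j) sums (inverse (of_nat (Suc p)) * 0)" by (rule sums_mult)
  moreover have "inverse (of_nat (Suc p)) * h 1 j = u j * (\<beta> j * \<alpha> j ^ p)" for j
  proof -
    have ne: "(of_nat (Suc p) :: 'k) \<noteq> 0" by (rule of_nat_neq_0)
    have "h 1 j = of_nat (Suc p) * (u j * (\<beta> j * \<alpha> j ^ p))" by (simp add: h_def mult_ac del: of_nat_Suc)
    then show ?thesis using ne by (simp del: of_nat_Suc)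
  qed
  ultimately show ?thesis by simp
qed

text \<open>Evaluations at a point are exchanged for the functionals \<open>\<psi> i\<close> one at
  a time. Differentiating in direction \<open>a\<close> frees one slot; the series in this slot
  tends to 0 in norm in the dual space, so \<open>\<psi> m\<close> may be applied to it.\<close>

lemma polarized_series_null:
  fixes sX :: "'k::real_or_complex \<Rightarrow> 'x::banach \<Rightarrow> 'x"
  assumes X: "banach_over sX"
    and xs: "\<And>j. xs j \<in> dual sX" "\<And>j. norm (xs j) \<le> H" and d: "summable (\<lambda>j. norm (d j))"
    and null: "\<And>x. (\<lambda>j. d j * blinfun_apply (xs j) x ^ N) sums 0"
    and \<psi>: "\<And>i. i < N \<Longrightarrow> bounded_functional (dual sX) (\<psi> i)"
  shows "(\<lambda>j. d j * (\<Prod>i<N. \<psi> i (xs j))) sums 0"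
proof -
  have H: "H \<ge> 0" using order_trans[OF norm_ge_zero xs(2)] .
  have bnd: "\<exists>M\<ge>0. \<forall>j. norm (\<Prod>i<m. \<psi> i (xs j)) \<le> M" if "m \<le> N" for m
    using that
  proof (induction m)
    case 0
    show ?case by (intro exI[of _ 1]) simp
  next
    case (Suc m)
    then obtain M where M: "M \<ge> 0" "\<forall>j. norm (\<Prod>i<m. \<psi> i (xs j)) \<le> M" by auto
    have "bounded_functional (dual sX) (\<psi> m)" using \<psi> Suc.prems by simp
    then obtain C where C: "C \<ge> 0" "\<And>x. x \<in> dual sX \<Longrightarrow> norm (\<psi> m x) \<le> C * norm x" using bounded_functionalD(3) by blast
    have "norm (\<Prod>i<Suc m. \<psi> i (xs j)) \<le> M * (C * H)" for j
    proof -
      have "norm (\<psi> m (xs j)) \<le> C * H" using C(2)[OF xs(1)[of j]] mult_left_mono[OF xs(2)[of j] C(1)] by linarith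
      then have "norm (\<Prod>i<m. \<psi> i (xs j)) * norm (\<psi> m (xs j)) \<le> M * (C * H)" using M by (intro mult_mono) auto
      then show ?thesis by (simp add: norm_mult)
    qed
    then show ?case using M(1) C(1) H by (intro exI[of _ "M * (C * H)"]) simp
  qed
  \<comment> \<open>After \<open>m\<close> exchanges \<open>N - m\<close> evaluations remain. The
    statement is needed at every \<open>x\<close>, because the next derivative compares the points
    \<open>x + sX t a\<close>.\<close>
  have "m \<le> N \<Longrightarrow> (\<lambda>j. (d j * (\<Prod>i<m. \<psi> i (xs j))) * blinfun_apply (xs j) x ^ (N - m)) sums 0" for m x
  proof (induction m arbitrary: x)
    case 0
    show ?case using null[of x] by simp
  next
    case (Suc m)
    define p where "p = N - Suc m"
    have p: "N - m = Suc p" using Suc.prems by (simp add: p_def)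
    define u where "u j = d j * (\<Prod>i<m. \<psi> i (xs j))" for j
    obtain M where M: "M \<ge> 0" "\<forall>j. norm (\<Prod>i<m. \<psi> i (xs j)) \<le> M" using bnd[of m] Suc.prems by auto
    have us: "summable (\<lambda>j. norm (u j))"
    proof -
      have "norm (norm (u j)) \<le> M * norm (d j)" for j
        using mult_left_mono[OF M(2)[rule_format, of j], of "norm (d j)"] by (simp add: u_def norm_mult mult.commute)
      then show ?thesis by (intro summable_comparison_test'[OF summable_mult[OF d], of 0]) blast
    qed
    have val: "norm (blinfun_apply (xs j) y) \<le> H * norm y" for j y
      using order_trans[OF norm_blinfun mult_right_mono[OF xs(2)]] norm_ge_zero by blast
    have der: "(\<lambda>j. u j * (blinfun_apply (xs j) a * blinfun_apply (xs j) x ^ p)) sums 0" for a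
    proof (rule power_series_derivative[OF us])
      show "norm (blinfun_apply (xs j) x) \<le> H * norm x + H * norm a" for j
        using val[of j x] H by (simp add: add_increasing2)
      show "norm (blinfun_apply (xs j) a) \<le> H * norm x + H * norm a" for j
        using val[of j a] H by (simp add: add_increasing)
      fix t
      have "blinfun_apply (xs j) (x + sX t a) = blinfun_apply (xs j) x + t * blinfun_apply (xs j) a" for j
        using xs(1)[of j] by (simp add: blinfun.add_right dual_def)
      then show "(\<lambda>j. u j * (blinfun_apply (xs j) x + t * blinfun_apply (xs j) a) ^ Suc p) sums 0"
        using Suc.IH[of "x + sX t a"] Suc.prems unfolding p u_def by simp
    qed
    define g where "g j = u j * blinfun_apply (xs j) x ^ p" for j
    have "(\<lambda>n. \<Sum>j<n. dual_scale (g j) (xs j)) \<longlonglongrightarrow> 0"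
    proof (rule blinfun_series_null)
      have "norm (norm (dual_scale (g j) (xs j))) \<le> ((H * norm x) ^ p * H) * norm (u j)" for j
      proof -
        have "norm (blinfun_apply (xs j) x) ^ p * norm (xs j) \<le> (H * norm x) ^ p * H"
          by (intro mult_mono power_mono val xs(2)) (use H in auto)
        then have "norm (u j) * (norm (blinfun_apply (xs j) x) ^ p * norm (xs j)) \<le> norm (u j) * ((H * norm x) ^ p * H)"
          by (intro mult_left_mono) auto
        then show ?thesis by (simp add: norm_dual_scale g_def norm_mult norm_power mult_ac)
      qed
      then show "summable (\<lambda>j. norm (dual_scale (g j) (xs j)))"
        by (intro summable_comparison_test'[OF summable_mult[OF us], of 0]) blast
      show "(\<lambda>n. \<Sum>j<n. blinfun_apply (dual_scale (g j) (xs j)) a) \<longlonglongrightarrow> 0" for a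
        using der[of a] unfolding sums_def by (simp add: g_def mult_ac)
    qed
    from bounded_functional_series[OF \<psi>[of m] xs(1) this] Suc.prems
    have "(\<lambda>j. g j * \<psi> m (xs j)) sums 0" by simp
    then show ?case by (simp add: g_def u_def p_def mult_ac)
  qed
  \<comment> \<open>No evaluation is left, so any point will do.\<close>
  from this[of N 0] show ?thesis by simp
qed

section \<open>Series of symmetric powers and density\<close>

context sym_tensor begin

text \<open>Along the line from \<open>x\<close> to \<open>y\<close> the power is a polynomial in
  the parameter, so its value at a small parameter minus its value at 0 is a combination of its
  values at finitely many fixed nodes. The weights do not depend on \<open>x\<close> and
  \<open>y\<close> and tend to 0 with the parameter. All terms are powers of vectors, so the
  symmetric norm applies to each of them.\<close>

lemma pow_uniformly_continuous:
  assumes "R \<ge> 0" and \<delta>: "\<delta> > 0"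
  shows "\<exists>\<epsilon>>0. \<forall>x\<in>E. \<forall>y\<in>E. norm x \<le> R \<longrightarrow> norm (y - x) \<le> \<epsilon> \<longrightarrow> gauge_norm B \<tau> (pow y - pow x) \<le> \<delta>"
proof -
  \<comment> \<open>The moment curve, cut off after degree \<open>N\<close> so as to span a space of
    finite dimension.\<close>
  define pt where "pt t = (\<lambda>m::nat. if m \<le> N then t ^ m else 0)" for t :: 'k
  define S where "S = range pt"
  define unit where "unit m = (\<lambda>i::nat. if i = m then 1 else 0 :: 'k)" for m :: nat
  have "S \<subseteq> tspan (unit ` {..N})"
  proof
    fix w assume "w \<in> S"
    then obtain t where t: "w = pt t" by (auto simp: S_def)
    have weq: "w = (\<Sum>m\<le>N. tscale (t ^ m) (unit m))"
    proof
      fix i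
      have "(\<Sum>m\<le>N. t ^ m * unit m i) = (\<Sum>m\<le>N. if m = i then t ^ i else 0)" by (rule sum.cong) (auto simp: unit_def)
      also have "\<dots> = w i" by (simp add: t pt_def)
      finally show "w i = (\<Sum>m\<le>N. tscale (t ^ m) (unit m)) i" by (simp add: fun_sum_apply tscale_def)
    qed
    show "w \<in> tspan (unit ` {..N})" unfolding weq
      by (intro tscale.span_sum tscale.span_scale tscale.span_base imageI)
  qed
  from coordinates_in_subset[OF finite_imageI[OF finite_atMost] this] obtain P l where
    P: "finite P" "P \<subseteq> S" "\<forall>b\<in>P. evaluation_comb (l b)" "\<forall>w\<in>tspan S. w = (\<Sum>b\<in>P. tscale (l b w) b)"
    by (elim exE conjE) (erule that)
  \<comment> \<open>The basis was chosen on the curve itself; its parameters \<open>tt b\<close> are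
    the interpolation nodes.\<close>
  have "\<forall>b\<in>P. \<exists>t. b = pt t" using P(2) by (auto simp: S_def)
  from bchoice[OF this] obtain tt where tt: "\<And>b. b \<in> P \<Longrightarrow> b = pt (tt b)" by blast
  define tn where "tn n = (of_real (1 / real (Suc n)) :: 'k)" for n
  have tn0: "tn \<longlonglongrightarrow> 0"
    using tendsto_of_real[OF LIMSEQ_Suc[OF lim_1_over_n], where 'a = 'k] by (simp add: tn_def[abs_def])
  define \<gamma> where "\<gamma> b n = l b (pt (tn n) - pt 0)" for b n
  have \<gamma>0: "\<gamma> b \<longlonglongrightarrow> 0" if b: "b \<in> P" for b
    unfolding \<gamma>_def
  proof (rule ev_tendsto[of "l b" "\<lambda>n. pt (tn n) - pt 0"])
    show "evaluation_comb (l b)" using P(3) b by blast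
    fix m
    have "(\<lambda>n. tn n ^ m - 0 ^ m) \<longlonglongrightarrow> 0 ^ m - 0 ^ m" by (intro tendsto_intros tn0)
    then show "(\<lambda>n. (pt (tn n) - pt 0) m) \<longlonglongrightarrow> 0" by (cases "m \<le> N") (simp_all add: pt_def)
  qed
  have rep: "pt (tn n) - pt 0 = (\<Sum>b\<in>P. tscale (\<gamma> b n) b)" for n
  proof -
    have "pt (tn n) - pt 0 \<in> tspan S" by (intro tscale.span_diff tscale.span_base) (auto simp: S_def)
    then show ?thesis using P(4) unfolding \<gamma>_def by blast
  qed
  have "(\<lambda>n. \<Sum>b\<in>P. norm (\<gamma> b n) * (R + norm (tt b)) ^ N) \<longlonglongrightarrow> (\<Sum>b\<in>P. norm (0 :: 'k) * (R + norm (tt b)) ^ N)"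
    by (intro tendsto_intros \<gamma>0)
  then have "(\<lambda>n. \<Sum>b\<in>P. norm (\<gamma> b n) * (R + norm (tt b)) ^ N) \<longlonglongrightarrow> 0" by simp
  then have "\<forall>\<^sub>F n in sequentially. (\<Sum>b\<in>P. norm (\<gamma> b n) * (R + norm (tt b)) ^ N) < \<delta>" by (rule order_tendstoD) (rule \<delta>)
  then obtain n where n: "(\<Sum>b\<in>P. norm (\<gamma> b n) * (R + norm (tt b)) ^ N) < \<delta>" unfolding eventually_sequentially by blast
  have "gauge_norm B \<tau> (pow y - pow x) \<le> \<delta>"
    if x: "x \<in> E" and y: "y \<in> E" and R: "norm x \<le> R" and yx: "norm (y - x) \<le> 1 / real (Suc n)" for x y
  proof -
    \<comment> \<open>Scaled so that \<open>y = x + dual_scale (tn n) g\<close> with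
      \<open>norm g \<le> 1\<close>; the node vectors then have norm at most
      \<open>R + norm (tt b)\<close>.\<close>
    define g where "g = dual_scale (of_real (real (Suc n))) (y - x)"
    have gE: "g \<in> E" unfolding g_def by (intro dual_scale.subspace_scale[OF subspace_dual] dual_scale.subspace_diff[OF subspace_dual] x y)
    have g1: "norm g \<le> 1"
      using mult_left_mono[OF yx, of "real (Suc n)"] unfolding g_def norm_dual_scale norm_of_real by simp
    define e where "e b = (if b then g else x)" for b
    \<comment> \<open>The linear map taking \<open>pt t\<close> to the power of
      \<open>x + dual_scale t g\<close>. It groups the expansion by the number of slots that hold
      \<open>g\<close>.\<close>
    define \<Phi> where "\<Phi> w = (\<Sum>\<kappa>\<in>{..<N} \<rightarrow>\<^sub>E (UNIV :: bool set). tscale (w (card {i. i < N \<and> \<kappa> i})) (basis_tensor e \<kappa>))" for w :: "nat \<Rightarrow> 'k"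
    have pow_pt: "pow (x + dual_scale t g) = \<Phi> (pt t)" for t
    proof -
      have "pow (x + dual_scale t g) = (\<Sum>\<kappa>\<in>{..<N} \<rightarrow>\<^sub>E (UNIV :: bool set). tscale (\<Prod>i<N. if \<kappa> i then t else 1) (basis_tensor e \<kappa>))"
      proof (rule pow_expansion[where \<phi> = "\<lambda>b. if b then t else 1"])
        show "x + dual_scale t g = (\<Sum>b\<in>UNIV. dual_scale (if b then t else 1) (e b))"
          by (simp add: UNIV_bool e_def add.commute)
      qed (use x gE in \<open>auto simp: e_def\<close>)
      moreover have "(\<Prod>i<N. if \<kappa> i then t else 1) = pt t (card {i. i < N \<and> \<kappa> i})" for \<kappa> :: "nat \<Rightarrow> bool"
      proof -
        have "card {i. i < N \<and> \<kappa> i} \<le> card {..<N}" by (rule card_mono) auto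
        then have c: "card {i. i < N \<and> \<kappa> i} \<le> N" by simp
        have "(\<Prod>i<N. if \<kappa> i then t else 1) = (\<Prod>i\<in>{i. i < N \<and> \<kappa> i}. t)"
          by (rule prod.mono_neutral_cong_right) auto
        then show ?thesis using c by (simp add: pt_def)
      qed
      ultimately show ?thesis by (simp add: \<Phi>_def)
    qed
    have lin: "\<Phi> (\<Sum>b\<in>P. tscale (\<gamma> b n) b) = (\<Sum>b\<in>P. tscale (\<gamma> b n) (\<Phi> b))"
    proof
      fix A
      have "\<Phi> (\<Sum>b\<in>P. tscale (\<gamma> b n) b) A = (\<Sum>\<kappa>\<in>{..<N} \<rightarrow>\<^sub>E UNIV. \<Sum>b\<in>P. \<gamma> b n * (b (card {i. i < N \<and> \<kappa> i}) * basis_tensor e \<kappa> A))"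
        by (simp add: \<Phi>_def fun_sum_apply tscale_def sum_distrib_right mult.assoc)
      also have "\<dots> = (\<Sum>b\<in>P. \<Sum>\<kappa>\<in>{..<N} \<rightarrow>\<^sub>E UNIV. \<gamma> b n * (b (card {i. i < N \<and> \<kappa> i}) * basis_tensor e \<kappa> A))" by (rule sum.swap)
      also have "\<dots> = (\<Sum>b\<in>P. tscale (\<gamma> b n) (\<Phi> b)) A" by (simp add: \<Phi>_def fun_sum_apply tscale_def sum_distrib_left)
      finally show "\<Phi> (\<Sum>b\<in>P. tscale (\<gamma> b n) b) A = (\<Sum>b\<in>P. tscale (\<gamma> b n) (\<Phi> b)) A" .
    qed
    have dif: "\<Phi> (v - w) = \<Phi> v - \<Phi> w" for v w
      by (simp add: \<Phi>_def fun_eq_iff fun_sum_apply tscale_def left_diff_distrib sum_subtractf)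
    have "(of_real (1 / real (Suc n)) :: 'k) * of_real (real (Suc n)) = 1" by (simp flip: of_real_mult del: of_nat_Suc)
    then have "dual_scale (tn n) g = y - x" unfolding g_def tn_def by (intro blinfun_eqI) (simp only: dual_scale_apply mult.assoc[symmetric] mult_1)
    then have "pow y = \<Phi> (pt (tn n))" using pow_pt[of "tn n"] by simp
    moreover have "pow x = \<Phi> (pt 0)" using pow_pt[of 0] by simp
    ultimately have "pow y - pow x = (\<Sum>b\<in>P. tscale (\<gamma> b n) (\<Phi> b))" by (simp only: dif[symmetric] rep lin)
    also have "\<dots> = (\<Sum>b\<in>P. tscale (\<gamma> b n) (pow (x + dual_scale (tt b) g)))"
      by (rule sum.cong[OF refl]) (simp only: pow_pt tt[symmetric])
    finally have eq: "pow y - pow x = (\<Sum>b\<in>P. tscale (\<gamma> b n) (pow (x + dual_scale (tt b) g)))" .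
    have mem: "x + dual_scale (tt b) g \<in> E" for b
      by (intro dual_scale.subspace_add[OF subspace_dual] dual_scale.subspace_scale[OF subspace_dual] x gE)
    have "gauge_norm B \<tau> (pow y - pow x) \<le> (\<Sum>b\<in>P. gauge_norm B \<tau> (tscale (\<gamma> b n) (pow (x + dual_scale (tt b) g))))"
      unfolding eq by (intro q.p_sum tscale.span_scale pow_in_span mem)
    also have "\<dots> \<le> (\<Sum>b\<in>P. norm (\<gamma> b n) * (R + norm (tt b)) ^ N)"
    proof (rule sum_mono)
      fix b
      have "norm (x + dual_scale (tt b) g) \<le> R + norm (tt b)"
      proof -
        have "norm (x + dual_scale (tt b) g) \<le> norm x + norm (tt b) * norm g"
          using norm_triangle_ineq[of x "dual_scale (tt b) g"] by (simp add: norm_dual_scale)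
        also have "\<dots> \<le> R + norm (tt b) * 1" using R g1 by (intro add_mono mult_left_mono) auto
        finally show ?thesis by simp
      qed
      then have "norm (x + dual_scale (tt b) g) ^ N \<le> (R + norm (tt b)) ^ N" by (intro power_mono) auto
      then have "gauge_norm B \<tau> (pow (x + dual_scale (tt b) g)) \<le> (R + norm (tt b)) ^ N"
        using gauge_pow_le[OF mem[of b]] by linarith
      then show "gauge_norm B \<tau> (tscale (\<gamma> b n) (pow (x + dual_scale (tt b) g))) \<le> norm (\<gamma> b n) * (R + norm (tt b)) ^ N"
        unfolding q.homogeneous[OF pow_in_span[OF mem]] by (intro mult_left_mono) auto
    qed
    finally show ?thesis using n by linarith
  qed
  then show ?thesis by (intro exI[of _ "1 / real (Suc n)"]) (simp del: of_nat_Suc)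
qed

text \<open>Uniform continuity of the power controls the passage from \<open>xs j\<close> to
  \<open>T (xs j)\<close>. The approximated series runs in a space of finite dimension, where
  polarization shows that it vanishes at every form; coordinates made of evaluations turn this into
  convergence in norm.\<close>

lemma pow_series_null:
  assumes ap: "approximation_property dual_scale E"
    and xs: "\<And>j. xs j \<in> E" "xs \<longlonglongrightarrow> 0" and d: "summable (\<lambda>j. norm (d j))"
    and null: "\<And>x. (\<lambda>j. d j * blinfun_apply (xs j) x ^ N) sums 0"
  shows "(\<lambda>n. gauge_norm B \<tau> (\<Sum>j<n. tscale (d j) (pow (xs j)))) \<longlonglongrightarrow> 0"
proof (rule LIMSEQ_I)
  fix e :: real assume "e > 0"
  obtain H where H: "H > 0" "\<And>i. norm (xs i) \<le> H"
    using convergent_imp_bounded[OF xs(2)] unfolding bounded_pos by auto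
  define S where "S = (\<Sum>i. norm (d i))"
  have S0: "S \<ge> 0" unfolding S_def by (rule suminf_nonneg[OF d]) simp
  have S: "(\<Sum>i<n. norm (d i)) \<le> S" for n unfolding S_def by (rule sum_le_suminf[OF d]) auto
  define \<delta> where "\<delta> = (e / 2) / (S + 1)"
  have \<delta>: "\<delta> > 0" using \<open>e > 0\<close> S0 by (simp add: \<delta>_def)
  have \<delta>S: "\<delta> * S < e / 2"
  proof -
    have "\<delta> * S < \<delta> * (S + 1)" using \<delta> by simp
    also have "\<dots> = e / 2"
    proof -
      have "S + 1 \<noteq> 0" using S0 by simp
      then show ?thesis by (rule nonzero_eq_divide_eq[THEN iffD1, OF _ \<delta>_def])
    qed
    finally show ?thesis .
  qed
  obtain \<epsilon> where \<epsilon>: "\<epsilon> > 0" "\<forall>x\<in>E. \<forall>y\<in>E. norm x \<le> H \<longrightarrow> norm (y - x) \<le> \<epsilon> \<longrightarrow> gauge_norm B \<tau> (pow y - pow x) \<le> \<delta>"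
    using pow_uniformly_continuous[OF less_imp_le[OF H(1)] \<delta>] by blast
  obtain T where T: "finite_rank_operator dual_scale E T" "\<And>i. norm (T (xs i) - xs i) \<le> \<epsilon>"
    using null_sequence_in_compact[OF ap xs \<epsilon>(1)] by blast
  from T(1) have TE: "T ` E \<subseteq> E" unfolding finite_rank_operator_def by (elim conjE)
  then have Td: "T (xs i) \<in> E" for i using xs(1) by blast
  obtain I :: "('x \<Rightarrow> 'k) set" and ee \<phi> C where I: "finite I" "\<And>i. i \<in> I \<Longrightarrow> ee i \<in> E" "C \<ge> 0"
    and Teq: "\<And>x. x \<in> E \<Longrightarrow> T x = (\<Sum>j\<in>I. dual_scale (\<phi> j x) (ee j))"
    and \<phi>: "\<And>j x y. j \<in> I \<Longrightarrow> x \<in> E \<Longrightarrow> y \<in> E \<Longrightarrow> \<phi> j (x + y) = \<phi> j x + \<phi> j y"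
      "\<And>j c x. j \<in> I \<Longrightarrow> x \<in> E \<Longrightarrow> \<phi> j (dual_scale c x) = c * \<phi> j x"
      "\<And>j x. j \<in> I \<Longrightarrow> x \<in> E \<Longrightarrow> norm (\<phi> j x) \<le> C * norm x"
    by (rule finite_rank_coordinates[OF T(1)]) (rule that)
  have bf: "bounded_functional E (\<phi> j)" if "j \<in> I" for j
    unfolding bounded_functional_def using \<phi>[OF that] I(3) by (intro conjI ballI allI exI[of _ C]) auto
  define F where "F = {..<N} \<rightarrow>\<^sub>E I"
  have fF: "finite F" unfolding F_def using I(1) by (intro finite_PiE) auto
  have powT: "pow (T x) = (\<Sum>\<kappa>\<in>F. tscale (\<Prod>i<N. \<phi> (\<kappa> i) x) (basis_tensor ee \<kappa>))" if "x \<in> E" for x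
    unfolding F_def using pow_expansion[where \<phi> = "\<lambda>j. \<phi> j x", OF I(1,2) Teq[OF that]] by simp
  define w where "w n = (\<Sum>j<n. tscale (d j) (pow (T (xs j))))" for n
  have w_point: "(\<lambda>n. w n A) \<longlonglongrightarrow> 0" for A
  proof -
    have "w n A = (\<Sum>\<kappa>\<in>F. (\<Sum>j<n. d j * (\<Prod>i<N. \<phi> (\<kappa> i) (xs j))) * basis_tensor ee \<kappa> A)" for n
    proof -
      have "w n A = (\<Sum>j<n. \<Sum>\<kappa>\<in>F. d j * (\<Prod>i<N. \<phi> (\<kappa> i) (xs j)) * basis_tensor ee \<kappa> A)"
        by (simp add: w_def powT[OF xs(1)] fun_sum_apply tscale_def sum_distrib_left mult.assoc)
      also have "\<dots> = (\<Sum>\<kappa>\<in>F. \<Sum>j<n. d j * (\<Prod>i<N. \<phi> (\<kappa> i) (xs j)) * basis_tensor ee \<kappa> A)" by (rule sum.swap)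
      finally show ?thesis by (simp add: sum_distrib_right)
    qed
    moreover have "(\<lambda>n. \<Sum>j<n. d j * (\<Prod>i<N. \<phi> (\<kappa> i) (xs j))) \<longlonglongrightarrow> 0" if \<kappa>: "\<kappa> \<in> F" for \<kappa>
    proof -
      have "(\<lambda>j. d j * (\<Prod>i<N. (\<lambda>i. \<phi> (\<kappa> i)) i (xs j))) sums 0"
      proof (rule polarized_series_null[OF X xs(1) H(2) d null])
        show "bounded_functional E (\<phi> (\<kappa> i))" if "i < N" for i
          using \<kappa> that by (intro bf) (auto simp: F_def)
      qed
      then show ?thesis unfolding sums_def .
    qed
    then have "(\<lambda>n. \<Sum>\<kappa>\<in>F. (\<Sum>j<n. d j * (\<Prod>i<N. \<phi> (\<kappa> i) (xs j))) * basis_tensor ee \<kappa> A)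
        \<longlonglongrightarrow> (\<Sum>\<kappa>\<in>F. 0 * basis_tensor ee \<kappa> A)"
      by (intro tendsto_sum tendsto_mult_right)
    ultimately show ?thesis by simp
  qed
  \<comment> \<open>Coordinates are taken in a basis of powers, not in the basis tensors, since the
    atomic norm is available on the symmetric span only.\<close>
  define Q where "Q = (\<lambda>x. pow (T x)) ` E"
  have "Q \<subseteq> tspan (basis_tensor ee ` F)"
  proof
    fix t assume "t \<in> Q"
    then obtain x where x: "x \<in> E" "t = pow (T x)" by (auto simp: Q_def)
    show "t \<in> tspan (basis_tensor ee ` F)" unfolding x(2) powT[OF x(1)]
      by (intro tscale.span_sum tscale.span_scale tscale.span_base imageI)
  qed
  from coordinates_in_subset[OF finite_imageI[OF fF] this] obtain P l where
    P: "finite P" "P \<subseteq> Q" "\<forall>b\<in>P. evaluation_comb (l b)" "\<forall>w\<in>tspan Q. w = (\<Sum>b\<in>P. tscale (l b w) b)"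
    by (elim exE conjE) (erule that)
  have wQ: "w n \<in> tspan Q" for n unfolding w_def
    by (intro tscale.span_sum tscale.span_scale tscale.span_base) (use xs(1) in \<open>auto simp: Q_def\<close>)
  have "(\<lambda>n. gauge_norm B \<tau> (\<Sum>b\<in>P. tscale (l b (w n)) b)) \<longlonglongrightarrow> 0"
  proof (rule q.finite_dim_null[OF P(1), of "\<lambda>b. b" "\<lambda>b n. l b (w n)"])
    show "b \<in> tspan (\<tau> ` B)" if "b \<in> P" for b using P(2) that TE by (auto simp: Q_def intro: pow_in_span)
    show "(\<lambda>n. l b (w n)) \<longlonglongrightarrow> 0" if "b \<in> P" for b using P(3) that by (intro ev_tendsto[of "l b" w] w_point) blast
  qed
  moreover have "(\<Sum>b\<in>P. tscale (l b (w n)) b) = w n" for n by (rule bspec[OF P(4) wQ, symmetric])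
  ultimately have "(\<lambda>n. gauge_norm B \<tau> (w n)) \<longlonglongrightarrow> 0" by simp
  then have "\<forall>\<^sub>F n in sequentially. gauge_norm B \<tau> (w n) < e / 2" by (rule order_tendstoD) (use \<open>e > 0\<close> in simp)
  then obtain M where M: "\<And>n. n \<ge> M \<Longrightarrow> gauge_norm B \<tau> (w n) < e / 2" unfolding eventually_sequentially by blast
  have "gauge_norm B \<tau> (\<Sum>j<n. tscale (d j) (pow (xs j))) < e" if n: "n \<ge> M" for n
  proof -
    define r where "r = (\<Sum>j<n. tscale (d j) (pow (T (xs j)) - pow (xs j)))"
    have D: "pow (T (xs j)) - pow (xs j) \<in> tspan (\<tau> ` B)" for j by (intro tscale.span_diff pow_in_span Td xs(1))
    have eq: "(\<Sum>j<n. tscale (d j) (pow (xs j))) = w n - r"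
      by (simp add: w_def r_def fun_eq_iff fun_sum_apply tscale_def sum_subtractf[symmetric] right_diff_distrib)
    have m1: "w n \<in> tspan (\<tau> ` B)" unfolding w_def by (intro tscale.span_sum tscale.span_scale pow_in_span Td)
    have m2: "r \<in> tspan (\<tau> ` B)" unfolding r_def by (intro tscale.span_sum tscale.span_scale D)
    have "gauge_norm B \<tau> r \<le> (\<Sum>j<n. gauge_norm B \<tau> (tscale (d j) (pow (T (xs j)) - pow (xs j))))"
      unfolding r_def by (intro q.p_sum tscale.span_scale D)
    also have "\<dots> \<le> (\<Sum>j<n. norm (d j) * \<delta>)"
    proof (rule sum_mono)
      fix j
      have "gauge_norm B \<tau> (pow (T (xs j)) - pow (xs j)) \<le> \<delta>" by (rule \<epsilon>(2)[rule_format, OF xs(1) Td H(2) T(2)])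
      then show "gauge_norm B \<tau> (tscale (d j) (pow (T (xs j)) - pow (xs j))) \<le> norm (d j) * \<delta>"
        unfolding q.homogeneous[OF D] by (intro mult_left_mono) auto
    qed
    also have "\<dots> = \<delta> * (\<Sum>j<n. norm (d j))" by (simp add: sum_distrib_left mult.commute)
    also have "\<dots> \<le> \<delta> * S" using \<delta> S by (intro mult_left_mono) auto
    finally have "gauge_norm B \<tau> r \<le> \<delta> * S" .
    then show ?thesis unfolding eq using q.triangle_diff[OF m1 m2] M[OF n] \<delta>S by linarith
  qed
  moreover have "gauge_norm B \<tau> (\<Sum>j<n. tscale (d j) (pow (xs j))) \<ge> 0" for n
    by (intro q.p_nonneg tscale.span_sum tscale.span_scale pow_in_span xs(1))
  ultimately show "\<exists>M. \<forall>n\<ge>M. norm (gauge_norm B \<tau> (\<Sum>j<n. tscale (d j) (pow (xs j))) - 0) < e" by (intro exI[of _ M]) simp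
qed

text \<open>The null factor has to enter the vectors, where it appears to the power
  \<open>N\<close>; so \<open>xs i\<close> carries \<open>\<eta> i\<close> and the coefficient is
  divided by \<open>\<eta> i ^ N\<close>.\<close>

lemma injective:
  assumes ap: "approximation_property dual_scale E"
    and ks: "range ks \<subseteq> B" and cs: "summable (\<lambda>i. norm (cs i))"
    and null: "\<And>w. w \<in> W \<Longrightarrow> (\<lambda>i. cs i * w (ks i)) sums 0"
  shows "(\<lambda>n. gauge_norm B \<tau> (atom_sum \<tau> n cs ks)) \<longlonglongrightarrow> 0"
proof -
  \<comment> \<open>\<open>\<eta>\<close> is the \<open>N\<close>-th root of the rescaling sequence.
    For \<open>N = 0\<close> no rescaling takes place and any positive null sequence will
    do.\<close>
  have "\<exists>\<eta>. (\<forall>j. \<eta> j > 0) \<and> \<eta> \<longlonglongrightarrow> 0 \<and> summable (\<lambda>j. norm (cs j) / \<eta> j ^ N)"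
  proof (cases "N = 0")
    case True
    then show ?thesis using cs LIMSEQ_Suc[OF lim_1_over_n[where 'a = real]] by (intro exI[of _ "\<lambda>j. 1 / real (Suc j)"]) simp
  next
    case False
    obtain \<theta> where \<theta>: "\<And>j. \<theta> j > 0" "\<theta> \<longlonglongrightarrow> 0" "summable (\<lambda>j. norm (cs j) / \<theta> j)"
      using summable_rescale[OF cs] by auto
    have "(\<lambda>j. root N (\<theta> j)) \<longlonglongrightarrow> root N 0" by (intro tendsto_real_root \<theta>)
    moreover have "root N (\<theta> j) ^ N = \<theta> j" for j using \<theta>(1)[of j] False by (simp add: real_root_pow_pos2)
    ultimately show ?thesis using \<theta> False by (intro exI[of _ "\<lambda>j. root N (\<theta> j)"]) simp
  qed
  then obtain \<eta> where \<eta>: "\<And>j. \<eta> j > 0" "\<eta> \<longlonglongrightarrow> 0" "summable (\<lambda>j. norm (cs j) / \<eta> j ^ N)" by blast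
  define a where "a i = Blinfun (ks i)" for i
  have ksB: "ks i \<in> B" for i using ks by blast
  have a: "a i \<in> dual_ball sX" "blinfun_apply (a i) = ks i" for i
    using ksB[of i] functional_ballE[of "ks i" sX] by (auto simp: B_def a_def)
  have an: "norm (a i) \<le> 1" for i using a by (auto simp: dual_ball_def)
  define xs where "xs i = dual_scale (of_real (\<eta> i)) (a i)" for i
  define d where "d i = cs i / of_real (\<eta> i) ^ N" for i
  have xsd: "xs i \<in> E" for i unfolding xs_def by (intro dual_scale.subspace_scale[OF subspace_dual] dual_ball_dual a)
  have \<eta>ne: "\<eta> i \<noteq> 0" for i using \<eta>(1)[of i] by simp
  have "norm (xs i) \<le> \<eta> i" for i
    unfolding xs_def norm_dual_scale norm_of_real using mult_left_mono[OF an, of "\<eta> i" i] \<eta>(1)[of i] by simp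
  then have xs0: "xs \<longlonglongrightarrow> 0" by (intro Lim_null_comparison[OF always_eventually \<eta>(2)]) blast
  have "norm (d i) = norm (cs i) / \<eta> i ^ N" for i
    unfolding d_def norm_divide norm_power norm_of_real using \<eta>(1)[of i] by simp
  then have ds: "summable (\<lambda>i. norm (d i))" using \<eta>(3) by simp
  have "(\<lambda>j. d j * blinfun_apply (xs j) x ^ N) sums 0" for x
  proof -
    define w where "w = (\<lambda>k. tens_power N sX UNIV x (form k))"
    have "w \<in> W" unfolding w_def W_def using elementary_in_Vt by blast
    moreover have "w (ks i) = ks i x ^ N" for i unfolding w_def by (rule elementary_form[OF ksB])
    moreover have "d i * blinfun_apply (xs i) x ^ N = cs i * ks i x ^ N" for i
      using \<eta>ne[of i] by (simp add: d_def xs_def a power_mult_distrib)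
    ultimately show ?thesis using null[of w] by simp
  qed
  from pow_series_null[OF ap xsd xs0 ds this]
  have "(\<lambda>n. gauge_norm B \<tau> (\<Sum>j<n. tscale (d j) (pow (xs j)))) \<longlonglongrightarrow> 0" .
  moreover have "tscale (d i) (pow (xs i)) = tscale (cs i) (\<tau> (ks i))" for i
  proof -
    have "pow (xs i) = tscale (of_real (\<eta> i) ^ N) (pow (a i))" unfolding xs_def by (rule pow_scale[OF dual_ball_dual[OF a(1)]])
    then show ?thesis using \<eta>ne[of i] by (simp add: tscale_def fun_eq_iff \<tau>_def a_def d_def)
  qed
  ultimately show ?thesis by (simp add: atom_sum_def)
qed

theorem sym_proj_norm_attaining_dense:
  assumes ap: "approximation_property dual_scale E"
    and no: "\<not> contains_copy_of_l1 (sym_inj_tensor N sX)"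
  shows "norm_dense (sym_proj_tensor N dual_scale E) (sym_proj_norm_attaining N dual_scale E)"
proof -
  interpret D: duality B W \<tau> \<omega>
  proof
    show "compact B" "B \<noteq> {}" by (rule B_compact)+
    show "continuous_on B v" if "v \<in> W" for v using that Vt_continuous by (auto simp: W_def)
    show "(\<lambda>_. 0) \<in> W" unfolding W_def by (rule image_eqI[OF _ tscale.subspace_0[OF Vt_subspace]]) simp
    show "(\<lambda>k. v k + v' k) \<in> W" if v: "v \<in> W" "v' \<in> W" for v v'
    proof -
      obtain t t' where t: "t \<in> Vt" "t' \<in> Vt" "v = (\<lambda>k. t (form k))" "v' = (\<lambda>k. t' (form k))" using v by (auto simp: W_def)
      show ?thesis unfolding W_def by (rule image_eqI[OF _ tscale.subspace_add[OF Vt_subspace t(1,2)]]) (simp add: t)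
    qed
    show "(\<lambda>k. c * v k) \<in> W" if v: "v \<in> W" for v c
    proof -
      obtain t where t: "t \<in> Vt" "v = (\<lambda>k. t (form k))" using v by (auto simp: W_def)
      show ?thesis unfolding W_def by (rule image_eqI[OF _ tscale.subspace_scale[OF Vt_subspace t(1)]]) (simp add: t tscale_def)
    qed
    show "\<tau> k (\<omega> v) = v k" if "v \<in> W" "k \<in> B" for v k by (rule pairing[OF that])
    show "\<not> has_l1_sequence B W"
    proof
      assume "has_l1_sequence B W"
      then have "contains_copy_of_l1 (completion tscale Vt (sym_inj_norm N sX))"
        unfolding W_def by (intro l1_sequence_imp_copy[OF B_compact Vt_subspace Vt_continuous inj_norm_eq])
      then show False using no by (simp add: sym_inj_tensor_def)
    qed
    show "(\<lambda>n. gauge_norm B \<tau> (atom_sum \<tau> n cs ks)) \<longlonglongrightarrow> 0"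
      if "range ks \<subseteq> B" "summable (\<lambda>i. norm (cs i))" "\<And>v. v \<in> W \<Longrightarrow> (\<lambda>i. cs i * v (ks i)) sums 0" for cs ks
      by (rule injective[OF ap that])
  qed
  have P: "sym_proj_tensor N dual_scale E = completion tscale (tspan (\<tau> ` B)) (gauge_norm B \<tau>)"
    by (simp add: sym_proj_tensor_def sym_tensor_product_eq proj_norm_eq)
  show ?thesis
    unfolding P
  proof (rule D.norm_dense_completion)
    show "sym_proj_norm_attaining N dual_scale E \<subseteq> carrier (completion tscale (tspan (\<tau> ` B)) (gauge_norm B \<tau>))"
      by (auto simp: sym_proj_norm_attaining_def P)
  next
    fix n c k assume k: "\<And>j. j < n \<Longrightarrow> k j \<in> B"
      and qa: "gauge_norm B \<tau> (atom_sum \<tau> n c k) = (\<Sum>j<n. norm (c j))"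
    define w where "w = atom_sum \<tau> n c k"
    have wU: "w \<in> tspan (\<tau> ` B)" unfolding w_def by (rule atom_sum_in_span[OF k])
    define x where "x i = (if i < n then Blinfun (k i) else 0)" for i
    \<comment> \<open>The padding has to sit in the coefficients: for \<open>N = 0\<close> the power
      of the zero vector is not zero.\<close>
    define c' where "c' i = (if i < n then c i else 0)" for i
    have b: "Blinfun (k i) \<in> dual_ball sX" if "i < n" for i
      using k[OF that] functional_ballE(1)[of "k i" sX] by (simp add: B_def)
    have xd: "x i \<in> E" for i
      using dual_ball_dual[OF b[of i]] dual_scale.subspace_0[OF subspace_dual, of sX] by (auto simp: x_def)
    have w_eq: "(\<Sum>i<m. tscale (c' i) (pow (x i))) = w" if m: "m \<ge> n" for m
    proof -
      have "(\<Sum>i<m. tscale (c' i) (pow (x i))) = (\<Sum>i<n. tscale (c' i) (pow (x i)))"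
        by (rule sum.mono_neutral_right) (use m in \<open>auto simp: c'_def tscale_def fun_eq_iff\<close>)
      also have "\<dots> = w" unfolding w_def atom_sum_def by (rule sum.cong) (auto simp: c'_def x_def \<tau>_def)
      finally show ?thesis .
    qed
    have "gauge_norm B \<tau> w \<le> (\<Sum>i<n. norm (c' i) * norm (x i) ^ N)"
    proof -
      have "gauge_norm B \<tau> w \<le> (\<Sum>i<n. gauge_norm B \<tau> (tscale (c' i) (pow (x i))))"
        unfolding w_eq[OF order_refl, symmetric] by (intro q.p_sum tscale.span_scale pow_in_span xd)
      also have "\<dots> \<le> (\<Sum>i<n. norm (c' i) * norm (x i) ^ N)"
        unfolding q.homogeneous[OF pow_in_span[OF xd]] by (intro sum_mono mult_left_mono gauge_pow_le xd) auto
      finally show ?thesis .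
    qed
    moreover have "(\<Sum>i<n. norm (c' i) * norm (x i) ^ N) \<le> (\<Sum>i<n. norm (c i))"
    proof (rule sum_mono)
      fix i assume "i \<in> {..<n}"
      then have "norm (x i) ^ N \<le> 1" using b by (intro power_le_one) (auto simp: dual_ball_def x_def)
      then show "norm (c' i) * norm (x i) ^ N \<le> norm (c i)" by (simp add: mult_left_le c'_def)
    qed
    ultimately have s: "(\<Sum>i<n. norm (c' i) * norm (x i) ^ N) = gauge_norm B \<tau> w" using qa by (simp add: w_def)
    have "(\<lambda>i. norm (c' i) * norm (x i) ^ N) sums (\<Sum>i<n. norm (c' i) * norm (x i) ^ N)"
      by (rule sums_finite) (auto simp: c'_def)
    then have sums: "(\<lambda>i. norm (c' i) * norm (x i) ^ N) sums vnorm (completion tscale (tspan (\<tau> ` B)) (gauge_norm B \<tau>)) (completion_embed (tspan (\<tau> ` B)) (gauge_norm B \<tau>) w)"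
      unfolding s q.vnorm_embed[OF wU] .
    have "\<forall>\<^sub>F m in sequentially. vdist (completion tscale (tspan (\<tau> ` B)) (gauge_norm B \<tau>)) (completion_embed (tspan (\<tau> ` B)) (gauge_norm B \<tau>) w)
        (completion_embed (tspan (\<tau> ` B)) (gauge_norm B \<tau>) (\<Sum>i<m. tscale (c' i) (pow (x i)))) = 0"
      using eventually_ge_at_top[of n]
    proof eventually_elim
      case (elim m)
      show ?case unfolding w_eq[OF elim] q.vdist_embed[OF wU wU] by (simp only: diff_self q.p_zero)
    qed
    then have lim: "(\<lambda>m. vdist (completion tscale (tspan (\<tau> ` B)) (gauge_norm B \<tau>)) (completion_embed (tspan (\<tau> ` B)) (gauge_norm B \<tau>) w)
        (completion_embed (tspan (\<tau> ` B)) (gauge_norm B \<tau>) (\<Sum>i<m. tscale (c' i) (pow (x i))))) \<longlonglongrightarrow> 0"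
      by (rule tendsto_eventually)
    show "completion_embed (tspan (\<tau> ` B)) (gauge_norm B \<tau>) (atom_sum \<tau> n c k) \<in> sym_proj_norm_attaining N dual_scale E"
      unfolding sym_proj_norm_attaining_def P sym_tensor_product_eq proj_norm_eq w_def[symmetric]
      using q.completion_embed_carrier[OF wU] lim sums xd
      by (intro CollectI conjI exI[of _ c'] exI[of _ x]) auto
  qed
qed

end

theorem corollary2p6:
  fixes sX :: "'k::real_or_complex \<Rightarrow> 'x::banach \<Rightarrow> 'x"
    and sY :: "'k \<Rightarrow> 'y::banach \<Rightarrow> 'y"
    and N :: nat
  assumes "banach_over sX" and "banach_over sY"
    and "approximation_property dual_scale (dual sX)"
  shows "(\<not> contains_copy_of_l1 (inj_tensor sX sY) \<longrightarrow>
            norm_dense (proj_tensor dual_scale (dual sX) dual_scale (dual sY))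
              (proj_norm_attaining dual_scale (dual sX) dual_scale (dual sY)))
       \<and> (\<not> contains_copy_of_l1 (sym_inj_tensor N sX) \<longrightarrow>
            norm_dense (sym_proj_tensor N dual_scale (dual sX))
              (sym_proj_norm_attaining N dual_scale (dual sX)))"
proof (intro conjI impI)
  assume no: "\<not> contains_copy_of_l1 (inj_tensor sX sY)"
  show "norm_dense (proj_tensor dual_scale (dual sX) dual_scale (dual sY))
      (proj_norm_attaining dual_scale (dual sX) dual_scale (dual sY))"
    by (rule tensor_pair.proj_norm_attaining_dense[OF tensor_pair.intro[OF assms(1,2)] assms(3) no])
next
  assume no: "\<not> contains_copy_of_l1 (sym_inj_tensor N sX)"
  show "norm_dense (sym_proj_tensor N dual_scale (dual sX)) (sym_proj_norm_attaining N dual_scale (dual sX))"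
    by (rule sym_tensor.sym_proj_norm_attaining_dense[OF sym_tensor.intro[OF assms(1)] assms(3) no])
qed

end
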